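(* Fix $\beta>0$. With $\Lambda_0(\beta,a)$ the smallest eigenvalue of $\mathfrak{G}_{\beta,a}$ and $TW_\beta$ the general beta Tracy–Widom law, $$\frac{\eta-\Lambda_0\big(\beta,2\sqrt\eta-\tfrac{2}{\beta}\big)}{\eta^{2/3}}\Rightarrow TW_\beta$$ in distribution as $\eta\to\infty$.
   Context: For $a>-1$, $\Lambda_0(\beta,a)$ is the smallest eigenvalue of the random operator $\mathfrak{G}_{\beta,a}$: with $b$ a standard Brownian motion, $m(dx)=e^{-(a+1)x-\frac{2}{\sqrt\beta}b(x)}dx$ and $s(dx)=e^{ax+\frac{2}{\sqrt\beta}b(x)}dx$ on $[0,\infty)$, $\lambda$ is an eigenvalue iff there is $0\ne\psi\in L^2(\mathbb{R}_+,m)$ with $\psi(x)=\lambda\int_0^\infty(\int_0^{x\wedge y}s(dz))\psi(y)\,m(dy)$. (For $\eta$ large, $a=2\sqrt\eta-2/\beta>-1$.) $TW_\beta$ is the law of the top eigenvalue of the random Schrödinger operator $\frac{d^2}{dx^2}-x+\frac{2}{\sqrt\beta}b'(x)$ on $[0,\infty)$ with Dirichlet condition at $0$; equivalently, $P(TW_\beta<\mu)$ equals the probability that the diffusion $dq(x)=\frac{2}{\sqrt\beta}db(x)+(x+\mu-q^2(x))dx$ started from $+\infty$ at $x=0$ never hits $-\infty$. *)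

theory Defs
  imports "HOL-Probability.Probability"
begin

definition is_std_BM :: "'a measure \<Rightarrow> ('a \<Rightarrow> real \<Rightarrow> real) \<Rightarrow> bool" where
  "is_std_BM M b \<longleftrightarrow>
     prob_space M \<and>
     (\<forall>t\<ge>0. (\<lambda>w. b w t) \<in> borel_measurable M) \<and>
     (\<forall>w\<in>space M. b w 0 = 0 \<and> continuous_on {0..} (b w)) \<and>
     (\<forall>s t. 0 \<le> s \<and> s < t \<longrightarrow>
        distributed M lborel (\<lambda>w. b w t - b w s)
          (\<lambda>x. ennreal (normal_density 0 (sqrt (t - s)) x))) \<and>
     (\<forall>(ts::nat \<Rightarrow> real) n. 0 \<le> ts 0 \<and> (\<forall>i<n. ts i < ts (Suc i)) \<longrightarrow>
        prob_space.indep_vars M (\<lambda>_. borel)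
          (\<lambda>i w. b w (ts (Suc i)) - b w (ts i)) {..<n})"

text \<open>Speed and scale densities of the operator G_{beta,a}, for a fixed path bp.\<close>
definition m_dens :: "real \<Rightarrow> real \<Rightarrow> (real \<Rightarrow> real) \<Rightarrow> real \<Rightarrow> real" where
  "m_dens \<beta> a bp x = exp (- (a + 1) * x - (2 / sqrt \<beta>) * bp x)"

definition s_dens :: "real \<Rightarrow> real \<Rightarrow> (real \<Rightarrow> real) \<Rightarrow> real \<Rightarrow> real" where
  "s_dens \<beta> a bp x = exp (a * x + (2 / sqrt \<beta>) * bp x)"

definition scale_fun :: "real \<Rightarrow> real \<Rightarrow> (real \<Rightarrow> real) \<Rightarrow> real \<Rightarrow> real" where
  "scale_fun \<beta> a bp x = (LINT z:{0..x}|lborel. s_dens \<beta> a bp z)"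

definition is_G_eigenvalue :: "real \<Rightarrow> real \<Rightarrow> (real \<Rightarrow> real) \<Rightarrow> real \<Rightarrow> bool" where
  "is_G_eigenvalue \<beta> a bp lam \<longleftrightarrow>
     (\<exists>\<psi>::real \<Rightarrow> real.
        \<psi> \<in> borel_measurable lborel \<and>
        set_integrable lborel {0..} (\<lambda>y. (\<psi> y)\<^sup>2 * m_dens \<beta> a bp y) \<and>
        \<not> (AE y in lborel. y \<ge> 0 \<longrightarrow> \<psi> y = 0) \<and>
        (\<forall>x\<ge>0. set_integrable lborel {0..}
                   (\<lambda>y. scale_fun \<beta> a bp (min x y) * \<psi> y * m_dens \<beta> a bp y) \<and>
                 \<psi> x = lam * (LINT y:{0..}|lborel.
                   scale_fun \<beta> a bp (min x y) * \<psi> y * m_dens \<beta> a bp y)))"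

definition Lambda0 :: "real \<Rightarrow> real \<Rightarrow> (real \<Rightarrow> real) \<Rightarrow> real" where
  "Lambda0 \<beta> a bp = Inf {lam. is_G_eigenvalue \<beta> a bp lam}"

text \<open>The Riccati diffusion dq = (2/sqrt beta) db + (x + mu - q^2) dx, started from +inf at x = 0,
  never hits -inf: there is a continuous solution on (0,inf) with q(x) -> +inf as x -> 0+.\<close>
definition riccati_no_explosion :: "real \<Rightarrow> real \<Rightarrow> (real \<Rightarrow> real) \<Rightarrow> bool" where
  "riccati_no_explosion \<beta> \<mu> bp \<longleftrightarrow>
     (\<exists>q::real \<Rightarrow> real.
        continuous_on {0<..} q \<and>
        filterlim q at_top (at_right 0) \<and>
        (\<forall>x y. 0 < y \<and> y \<le> x \<longrightarrow>
           q x - q y = (2 / sqrt \<beta>) * (bp x - bp y) + (LBINT t=y..x. t + \<mu> - (q t)\<^sup>2)))"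

text \<open>P(TW_beta < mu), computed from a standard Brownian motion b on M.\<close>
definition TW_cdf_left :: "'a measure \<Rightarrow> ('a \<Rightarrow> real \<Rightarrow> real) \<Rightarrow> real \<Rightarrow> real \<Rightarrow> real" where
  "TW_cdf_left M b \<beta> \<mu> = measure M {w \<in> space M. riccati_no_explosion \<beta> \<mu> (b w)}"

end

theory Submission
  imports Defs
begin

text \<open>Sturm oscillation: \<open>\<lambda> \<le> \<Lambda>\<^sub>0\<close> holds iff the derivative of the solution of the string equation
  \<open>(f'/s)' = - \<lambda> m f\<close>, \<open>f 0 = 0\<close>, stays positive on \<open>[0,\<infinity>)\<close>; this needs the scale function of \<open>s\<close>
  to be integrable against \<open>m\<close>, which the growth of Brownian paths gives almost surely. With \<open>\<epsilon> =
  \<eta> powr (-1/6)\<close> and the Brownian scaling \<open>b \<mapsto> \<epsilon> b (\<cdot> / \<epsilon>\<^sup>2)\<close>, the logarithmic derivative of \<open>f\<close>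
  becomes, for a fixed path, a perturbation of the Riccati equation of \<open>TW\<^sub>\<beta>\<close>. If the Riccati
  solution explodes, so does the perturbed one for small \<open>\<epsilon>\<close>, by continuous dependence on compact
  intervals. If it does not explode for some \<open>\<mu>' < \<mu>\<close>, then at level \<open>\<mu>\<close> it returns to positive
  values at arbitrarily late times, after which a barrier at \<open>- max (sqrt t) (\<epsilon> t) / 4\<close> keeps the
  perturbed solution alive for all small \<open>\<epsilon>\<close>. So the event in question is squeezed between the
  events for \<open>\<mu>'\<close> and \<open>\<mu>\<close>, and continuity of the distribution function at \<open>\<mu>\<close> closes the gap.\<close>

section \<open>Calculus on the half-line\<close>

lemma integrable_on_atLeast_subinterval:
  fixes f :: "real \<Rightarrow> real"
  assumes "continuous_on {0..} f" "0 \<le> a"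
  shows "f integrable_on {a..b}"
  by (rule integrable_continuous_real, rule continuous_on_subset[OF assms(1)]) (use assms in auto)

lemma integral_diff_atLeast:
  fixes f :: "real \<Rightarrow> real"
  assumes "continuous_on {0..} f" "0 \<le> x" "x \<le> y"
  shows "integral {0..y} f - integral {0..x} f = integral {x..y} f"
  using Henstock_Kurzweil_Integration.integral_combine[of 0 x y f]
    integrable_on_atLeast_subinterval[OF assms(1), of 0 y] assms by auto

lemma continuous_on_atLeast_if_Icc:
  fixes f :: "real \<Rightarrow> 'a::topological_space"
  assumes "\<And>T. continuous_on {0..T} f"
  shows "continuous_on {0..} f"
proof -
  have "continuous (at x within {0..}) f" if "x \<ge> 0" for x
  proof -
    have "continuous (at x within {0..x+1}) f"
      using that assms[of "x+1"] by (auto simp: continuous_on_eq_continuous_within)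
    moreover have "at x within {0..x+1} = at x within {0..}"
      by (rule at_within_nhd[of x "{x-1<..<x+1}"]) auto
    ultimately show ?thesis by (simp add: continuous_within)
  qed
  then show ?thesis by (auto simp: continuous_on_eq_continuous_within)
qed

lemma continuous_on_integral_upper:
  fixes f :: "real \<Rightarrow> real"
  assumes "continuous_on {0..} f"
  shows "continuous_on {0..} (\<lambda>x. integral {0..x} f)"
  by (intro continuous_on_atLeast_if_Icc indefinite_integral_continuous_1
      integrable_on_atLeast_subinterval[OF assms]) simp

lemma DERIV_integral_interior:
  fixes f :: "real \<Rightarrow> real"
  assumes "continuous_on {a..b} f" "a < x" "x < b"
  shows "DERIV (\<lambda>u. integral {a..u} f) x :> f x"
proof -
  have "((\<lambda>u. integral {a..u} f) has_real_derivative f x) (at x within {a..b})"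
    by (rule integral_has_real_derivative[OF assms(1)]) (use assms in auto)
  moreover have "at x within {a..b} = at x" using assms by (intro at_within_interior) auto
  ultimately show ?thesis by simp
qed

lemma DERIV_integral_upper:
  fixes f :: "real \<Rightarrow> real"
  assumes "continuous_on {0..} f" "x > 0"
  shows "DERIV (\<lambda>x. integral {0..x} f) x :> f x"
  by (rule DERIV_integral_interior[where b="x + 1"], rule continuous_on_subset[OF assms(1)])
    (use assms in auto)

lemma integral_of_DERIV:
  fixes f F :: "real \<Rightarrow> real"
  assumes "continuous_on {0..} F" "\<And>x. x > 0 \<Longrightarrow> DERIV F x :> f x" "0 \<le> a" "a \<le> b"
  shows "integral {a..b} f = F b - F a"
proof -
  have "(f has_integral (F b - F a)) {a..b}"
    by (rule fundamental_theorem_of_calculus_interior)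
       (use assms in \<open>auto intro: continuous_on_subset
          simp: has_real_derivative_iff_has_vector_derivative[symmetric]\<close>)
  then show ?thesis by (rule integral_unique)
qed

lemma DERIV_nonneg_imp_le:
  fixes F F' :: "real \<Rightarrow> real"
  assumes "a \<le> b" "continuous_on {a..b} F" "\<And>x. a < x \<Longrightarrow> x < b \<Longrightarrow> DERIV F x :> F' x"
    "\<And>x. a < x \<Longrightarrow> x < b \<Longrightarrow> F' x \<ge> 0"
  shows "F a \<le> F b"
  using DERIV_nonneg_imp_increasing_open[of a b F] assms by blast

lemma DERIV_nonpos_imp_ge:
  fixes F F' :: "real \<Rightarrow> real"
  assumes "a \<le> b" "continuous_on {a..b} F" "\<And>x. a < x \<Longrightarrow> x < b \<Longrightarrow> DERIV F x :> F' x"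
    "\<And>x. a < x \<Longrightarrow> x < b \<Longrightarrow> F' x \<le> 0"
  shows "F b \<le> F a"
  using DERIV_nonpos_imp_decreasing_open[of a b F] assms by blast

lemma DERIV_pos_imp_less:
  fixes F F' :: "real \<Rightarrow> real"
  assumes "a < b" "continuous_on {a..b} F" "\<And>x. a < x \<Longrightarrow> x < b \<Longrightarrow> DERIV F x :> F' x"
    "\<And>x. a < x \<Longrightarrow> x < b \<Longrightarrow> F' x > 0"
  shows "F a < F b"
  using DERIV_pos_imp_increasing_open[of a b F] assms by blast

lemma continuous_on_atLeast_bounded_Icc:
  fixes f :: "real \<Rightarrow> real"
  assumes "continuous_on {0..} f"
  obtains K where "K > 0" "\<And>x. 0 \<le> x \<Longrightarrow> x \<le> T \<Longrightarrow> \<bar>f x\<bar> \<le> K"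
proof -
  have "bounded (f ` {0..T})"
    by (intro compact_imp_bounded compact_continuous_image continuous_on_subset[OF assms]) auto
  then obtain K where "K > 0" "\<forall>y \<in> f ` {0..T}. norm y \<le> K" using bounded_pos by blast
  then show ?thesis using that[of K] by auto
qed

lemma continuous_on_atLeast_bounded_Icc2:
  fixes f g :: "real \<Rightarrow> real"
  assumes "continuous_on {0..} f" "continuous_on {0..} g"
  obtains K where "K > 0" "\<And>x. 0 \<le> x \<Longrightarrow> x \<le> T \<Longrightarrow> \<bar>f x\<bar> \<le> K" "\<And>x. 0 \<le> x \<Longrightarrow> x \<le> T \<Longrightarrow> \<bar>g x\<bar> \<le> K"
proof -
  have "continuous_on {0..} (\<lambda>x. \<bar>f x\<bar> + \<bar>g x\<bar>)" by (intro continuous_intros assms)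
  then obtain K where K: "K > 0" "\<And>x. 0 \<le> x \<Longrightarrow> x \<le> T \<Longrightarrow> \<bar>\<bar>f x\<bar> + \<bar>g x\<bar>\<bar> \<le> K"
    by (rule continuous_on_atLeast_bounded_Icc) blast
  show ?thesis
  proof (rule that[OF K(1)])
    fix x assume "0 \<le> x" "x \<le> T"
    from K(2)[OF this] show "\<bar>f x\<bar> \<le> K" "\<bar>g x\<bar> \<le> K" by linarith+
  qed
qed

lemma first_zero:
  fixes f :: "real \<Rightarrow> real"
  assumes "continuous_on {a..b} f" "f a > 0" "f b \<le> 0" "a \<le> b"
  obtains c where "a < c" "c \<le> b" "f c = 0" "\<And>x. a \<le> x \<Longrightarrow> x < c \<Longrightarrow> f x > 0"
proof -
  let ?Z = "{x \<in> {a..b}. f x \<le> 0}"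
  define c where "c = Inf ?Z"
  have closed: "closed ?Z"
    using continuous_on_closed_Collect_le[OF assms(1), of "\<lambda>_. 0"] by (simp add: continuous_on_const)
  have "b \<in> ?Z" using assms by auto
  moreover have bdd: "bdd_below ?Z" by (rule bdd_belowI[of _ a]) auto
  ultimately have c_in: "c \<in> ?Z" unfolding c_def using closed_contains_Inf[OF _ bdd closed] by blast
  have pos: "f x > 0" if "a \<le> x" "x < c" for x
  proof (rule ccontr)
    assume "\<not> f x > 0"
    then have "x \<in> ?Z" using that c_in by auto
    then have "c \<le> x" unfolding c_def by (rule cInf_lower[OF _ bdd])
    then show False using that by simp
  qed
  have "a < c" using c_in assms(2) by (cases "a = c") auto
  moreover have "f c \<ge> 0"
  proof (rule ccontr)
    assume "\<not> f c \<ge> 0"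
    then obtain x where "a \<le> x" "x \<le> c" "f x = 0"
      using IVT2'[of f c 0 a] assms c_in \<open>a < c\<close> continuous_on_subset[OF assms(1), of "{a..c}"] by auto
    with pos[of x] \<open>\<not> f c \<ge> 0\<close> show False by (cases "x = c") auto
  qed
  ultimately show ?thesis using that[of c] pos c_in by auto
qed

lemma last_visit:
  fixes f :: "real \<Rightarrow> real"
  assumes "continuous_on {a..b} f" "f a \<ge> y" "f b < y" "a \<le> b"
  obtains c where "a \<le> c" "c < b" "f c = y" "\<And>x. c < x \<Longrightarrow> x \<le> b \<Longrightarrow> f x < y"
proof -
  have "continuous_on {- b.. - a} (\<lambda>x. y - f (- x))"
    by (intro continuous_intros continuous_on_compose2[OF assms(1)]) auto
  moreover have "y - f (- (- b)) > 0" "y - f (- (- a)) \<le> 0" "- b \<le> - a" using assms by auto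
  ultimately obtain c where c: "- b < c" "c \<le> - a" "y - f (- c) = 0"
    and below: "\<And>x. - b \<le> x \<Longrightarrow> x < c \<Longrightarrow> y - f (- x) > 0"
    using first_zero[of "-b" "-a" "\<lambda>x. y - f (- x)"] by metis
  show ?thesis
  proof (rule that[of "- c"])
    show "f x < y" if "- c < x" "x \<le> b" for x using below[of "- x"] that by auto
  qed (use c in auto)
qed

lemma gronwall:
  fixes e :: "real \<Rightarrow> real"
  assumes cont: "continuous_on {0..T} e" and "K \<ge> 0"
    and ineq: "\<And>x. 0 \<le> x \<Longrightarrow> x \<le> T \<Longrightarrow> e x \<le> c + K * integral {0..x} e"
    and "0 \<le> x" "x \<le> T"
  shows "e x \<le> c * exp (K * x)"
proof -
  let ?F = "\<lambda>x. (c + K * integral {0..x} e) * exp (- K * x)"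
  have "?F x \<le> ?F 0"
  proof (rule DERIV_nonpos_imp_ge[OF \<open>0 \<le> x\<close>])
    show "continuous_on {0..x} ?F"
      by (intro continuous_intros indefinite_integral_continuous_1 integrable_continuous_real
          continuous_on_subset[OF cont]) (use assms in auto)
    fix y assume y: "0 < y" "y < x"
    have "DERIV (\<lambda>x. integral {0..x} e) y :> e y"
      by (rule DERIV_integral_interior[OF cont]) (use y assms in auto)
    then show "DERIV ?F y :> - (K * exp (- K * y)) * (c + K * integral {0..y} e - e y)"
      by (auto intro!: derivative_eq_intros simp: algebra_simps)
    show "- (K * exp (- K * y)) * (c + K * integral {0..y} e - e y) \<le> 0"
      using \<open>K \<ge> 0\<close> ineq[of y] y assms by (intro mult_nonpos_nonneg) auto
  qed
  then have "(c + K * integral {0..x} e) * exp (- K * x) \<le> c" by simp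
  then have "c + K * integral {0..x} e \<le> c * exp (K * x)" by (simp add: exp_minus field_simps)
  then show ?thesis using ineq[of x] assms(4,5) by linarith
qed

lemma mono_bounded_tendsto_at_top:
  fixes F :: "real \<Rightarrow> real"
  assumes mono: "\<And>x y. a \<le> x \<Longrightarrow> x \<le> y \<Longrightarrow> F x \<le> F y" and bound: "\<And>x. a \<le> x \<Longrightarrow> F x \<le> K"
  obtains L where "(F \<longlongrightarrow> L) at_top" "\<And>x. a \<le> x \<Longrightarrow> F x \<le> L"
proof -
  have bdd: "bdd_above (F ` {a..})" by (rule bdd_aboveI[of _ K]) (use bound in auto)
  have up: "F x \<le> Sup (F ` {a..})" if "a \<le> x" for x
    by (rule cSup_upper[OF _ bdd]) (use that in auto)
  have "(F \<longlongrightarrow> Sup (F ` {a..})) at_top"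
  proof (rule increasing_tendsto)
    show "\<forall>\<^sub>F x in at_top. F x \<le> Sup (F ` {a..})"
      using eventually_ge_at_top[of a] by eventually_elim (rule up)
    fix y assume "y < Sup (F ` {a..})"
    then obtain x where x: "x \<ge> a" "y < F x" using less_cSup_iff[OF _ bdd, of y] by auto
    show "\<forall>\<^sub>F x in at_top. y < F x"
      using eventually_ge_at_top[of x] by eventually_elim (use x mono[of x] in force)
  qed
  then show ?thesis using that up by blast
qed

section \<open>Linear first-order systems\<close>

definition solves_system ::
  "(real \<Rightarrow> real) \<Rightarrow> (real \<Rightarrow> real) \<Rightarrow> (real \<Rightarrow> real) \<Rightarrow> (real \<Rightarrow> real) \<Rightarrow> bool" where
  "solves_system s g f h \<longleftrightarrow> continuous_on {0..} f \<and> continuous_on {0..} h \<and>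
     (\<forall>x>0. DERIV f x :> s x * h x) \<and> (\<forall>x>0. DERIV h x :> - g x * f x)"

lemma solves_systemD:
  assumes "solves_system s g f h"
  shows "continuous_on {0..} f" "continuous_on {0..} h"
    "\<And>x. x > 0 \<Longrightarrow> DERIV f x :> s x * h x" "\<And>x. x > 0 \<Longrightarrow> DERIV h x :> - g x * f x"
  using assms unfolding solves_system_def by auto

lemma solves_system_increment:
  assumes "solves_system s g f h" "0 \<le> a" "a \<le> b"
  shows "f b - f a = integral {a..b} (\<lambda>t. s t * h t)"
    "h b - h a = - integral {a..b} (\<lambda>t. g t * f t)"
  using integral_of_DERIV[OF solves_systemD(1,3)[OF assms(1)] assms(2,3)]
    integral_of_DERIV[OF solves_systemD(2,4)[OF assms(1)] assms(2,3)] by auto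

lemma solves_system_strict_increasing:
  assumes "solves_system s g f h" "0 \<le> a" "a < b" "\<And>x. a < x \<Longrightarrow> x < b \<Longrightarrow> s x * h x > 0"
  shows "f a < f b"
  by (rule DERIV_pos_imp_less[OF assms(3), where F'="\<lambda>x. s x * h x"])
    (use assms solves_systemD[OF assms(1)] in
        \<open>auto intro!: continuous_on_subset[OF solves_systemD(1)[OF assms(1)]]\<close>)

lemma solves_system_zero:
  assumes sys: "solves_system s g f h" and cont: "continuous_on {0..} s" "continuous_on {0..} g"
    and init: "f 0 = 0" "h 0 = 0" and "x \<ge> 0"
  shows "f x = 0" "h x = 0"
proof -
  note system = solves_systemD[OF sys]
  obtain K where K: "K > 0" "\<And>t. 0 \<le> t \<Longrightarrow> t \<le> x \<Longrightarrow> \<bar>s t\<bar> \<le> K" "\<And>t. 0 \<le> t \<Longrightarrow> t \<le> x \<Longrightarrow> \<bar>g t\<bar> \<le> K"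
    using continuous_on_atLeast_bounded_Icc2[OF cont] by metis
  let ?e = "\<lambda>t. \<bar>f t\<bar> + \<bar>h t\<bar>"
  have abs_integral_le: "\<bar>integral {0..y} (\<lambda>t. k t * u t)\<bar> \<le> K * integral {0..y} (\<lambda>t. \<bar>u t\<bar>)"
    if "y \<le> x" "continuous_on {0..} k" "continuous_on {0..} u" "\<And>t. 0 \<le> t \<Longrightarrow> t \<le> x \<Longrightarrow> \<bar>k t\<bar> \<le> K"
    for k u :: "real \<Rightarrow> real" and y
  proof -
    have "norm (integral {0..y} (\<lambda>t. k t * u t)) \<le> integral {0..y} (\<lambda>t. K * \<bar>u t\<bar>)"
      by (rule integral_norm_bound_integral)
        (use that in
            \<open>auto intro!: integrable_on_atLeast_subinterval continuous_intros mult_right_mono simp: abs_mult\<close>)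
    then show ?thesis by simp
  qed
  have "?e x \<le> 0 * exp (K * x)"
  proof (rule gronwall)
    show "continuous_on {0..x} ?e"
      by (rule continuous_on_subset[of "{0..}"]) (auto intro!: continuous_intros system)
    fix y assume y: "0 \<le> y" "y \<le> x"
    have "\<bar>f y\<bar> \<le> K * integral {0..y} (\<lambda>t. \<bar>h t\<bar>)"
      using abs_integral_le[OF y(2) cont(1) system(2) K(2)]
        solves_system_increment(1)[OF sys, of 0 y] y init by simp
    moreover have "\<bar>h y\<bar> \<le> K * integral {0..y} (\<lambda>t. \<bar>f t\<bar>)"
      using abs_integral_le[OF y(2) cont(2) system(1) K(3)]
        solves_system_increment(2)[OF sys, of 0 y] y init by simp
    moreover have "integral {0..y} (\<lambda>t. \<bar>f t\<bar>) + integral {0..y} (\<lambda>t. \<bar>h t\<bar>) = integral {0..y} ?e"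
      by (simp add: Henstock_Kurzweil_Integration.integral_add integrable_on_atLeast_subinterval
          continuous_intros system)
    ultimately show "?e y \<le> 0 + K * integral {0..y} ?e" by (smt (verit) distrib_left)
  qed (use K assms in auto)
  then show "f x = 0" "h x = 0" by auto
qed

primrec picard :: "(real \<Rightarrow> real) \<Rightarrow> (real \<Rightarrow> real) \<Rightarrow> nat \<Rightarrow> real \<Rightarrow> real \<times> real" where
  "picard s g 0 = (\<lambda>x. (0, 1))"
| "picard s g (Suc n) = (\<lambda>x. (integral {0..x} (\<lambda>t. s t * snd (picard s g n t)),
      1 - integral {0..x} (\<lambda>t. g t * fst (picard s g n t))))"

definition string_sol :: "(real \<Rightarrow> real) \<Rightarrow> (real \<Rightarrow> real) \<Rightarrow> real \<Rightarrow> real" where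
  "string_sol s g x = lim (\<lambda>n. fst (picard s g n x))"

definition string_slope :: "(real \<Rightarrow> real) \<Rightarrow> (real \<Rightarrow> real) \<Rightarrow> real \<Rightarrow> real" where
  "string_slope s g x = lim (\<lambda>n. snd (picard s g n x))"

lemma picard_cong:
  assumes "\<And>t. t \<ge> 0 \<Longrightarrow> s t = s' t" "\<And>t. t \<ge> 0 \<Longrightarrow> g t = g' t" "x \<ge> 0"
  shows "picard s g n x = picard s' g' n x"
  using assms(3)
proof (induction n arbitrary: x)
  case (Suc n)
  have "integral {0..x} (\<lambda>t. s t * snd (picard s g n t))
      = integral {0..x} (\<lambda>t. s' t * snd (picard s' g' n t))"
    by (rule Henstock_Kurzweil_Integration.integral_cong) (use Suc.IH assms in auto)
  moreover have "integral {0..x} (\<lambda>t. g t * fst (picard s g n t))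
      = integral {0..x} (\<lambda>t. g' t * fst (picard s' g' n t))"
    by (rule Henstock_Kurzweil_Integration.integral_cong) (use Suc.IH assms in auto)
  ultimately show ?case by simp
qed simp

lemma string_slope_cong:
  assumes "\<And>t. t \<ge> 0 \<Longrightarrow> s t = s' t" "\<And>t. t \<ge> 0 \<Longrightarrow> g t = g' t" "x \<ge> 0"
  shows "string_slope s g x = string_slope s' g' x"
  unfolding string_slope_def using picard_cong[OF assms] by simp

lemma integral_power_over_fact:
  fixes K x :: real
  assumes "x \<ge> 0"
  shows "integral {0..x} (\<lambda>t. K * ((K * t) ^ n / fact n)) = (K * x) ^ Suc n / fact (Suc n)"
proof -
  let ?F = "\<lambda>x. (K * x) ^ Suc n / fact (Suc n)"
  have "integral {0..x} (\<lambda>t. K * ((K * t) ^ n / fact n)) = ?F x - ?F 0"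
  proof (rule integral_of_DERIV)
    fix t :: real
    have "DERIV ?F t :> real (Suc n) * (K * t) ^ n * K / fact (Suc n)"
      by (rule derivative_eq_intros refl | simp)+
    moreover have "real (Suc n) * (K * t) ^ n * K / fact (Suc n) = K * ((K * t) ^ n / fact n)"
      by (simp add: fact_Suc[of n] del: of_nat_Suc fact_Suc)
    ultimately show "DERIV ?F t :> K * ((K * t) ^ n / fact n)" by (simp only:)
  qed (use assms in \<open>auto intro!: continuous_intros\<close>)
  then show ?thesis by simp
qed

lemma abs_integral_mult_diff_le:
  fixes k f f' B :: "real \<Rightarrow> real"
  assumes cont: "continuous_on {0..} k" "continuous_on {0..} f" "continuous_on {0..} f'"
    "continuous_on {0..} B"
    and k: "\<And>t. 0 \<le> t \<Longrightarrow> t \<le> x \<Longrightarrow> \<bar>k t\<bar> \<le> K"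
    and diff: "\<And>t. 0 \<le> t \<Longrightarrow> t \<le> x \<Longrightarrow> \<bar>f t - f' t\<bar> \<le> B t"
  shows "\<bar>integral {0..x} (\<lambda>t. k t * f t) - integral {0..x} (\<lambda>t. k t * f' t)\<bar>
      \<le> integral {0..x} (\<lambda>t. K * B t)"
proof -
  have "integral {0..x} (\<lambda>t. k t * f t) - integral {0..x} (\<lambda>t. k t * f' t)
      = integral {0..x} (\<lambda>t. k t * (f t - f' t))"
    by (subst Henstock_Kurzweil_Integration.integral_diff[symmetric])
      (auto intro!: integrable_on_atLeast_subinterval continuous_intros cont simp: algebra_simps)
  moreover have "norm (integral {0..x} (\<lambda>t. k t * (f t - f' t))) \<le> integral {0..x} (\<lambda>t. K * B t)"
  proof (rule integral_norm_bound_integral)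
    fix t assume t: "t \<in> {0..x}"
    then have "0 \<le> K" using k[of t] by fastforce
    then show "norm (k t * (f t - f' t)) \<le> K * B t"
      unfolding real_norm_def abs_mult using t by (intro mult_mono k diff) auto
  qed (auto intro!: integrable_on_atLeast_subinterval continuous_intros cont)
  ultimately show ?thesis by simp
qed

context
  fixes s g :: "real \<Rightarrow> real"
  assumes cont_s: "continuous_on {0..} s" and cont_g: "continuous_on {0..} g"
begin

lemma continuous_picard:
  "continuous_on {0..} (\<lambda>x. fst (picard s g n x))" "continuous_on {0..} (\<lambda>x. snd (picard s g n x))"
  by (induction n) (auto intro!: continuous_intros continuous_on_integral_upper cont_s cont_g)

lemma picard_increment_bound:
  assumes K: "\<And>t. 0 \<le> t \<Longrightarrow> t \<le> T \<Longrightarrow> \<bar>s t\<bar> \<le> K" "\<And>t. 0 \<le> t \<Longrightarrow> t \<le> T \<Longrightarrow> \<bar>g t\<bar> \<le> K"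
    and "0 \<le> x" "x \<le> T"
  shows "\<bar>fst (picard s g (Suc n) x) - fst (picard s g n x)\<bar> \<le> (K * x) ^ Suc n / fact (Suc n) \<and>
     \<bar>snd (picard s g (Suc n) x) - snd (picard s g n x)\<bar> \<le> (K * x) ^ Suc n / fact (Suc n)"
  using assms(3,4)
proof (induction n arbitrary: x)
  case 0
  have "norm (integral {0..x} s) \<le> integral {0..x} (\<lambda>_. K)"
    by (rule integral_norm_bound_integral)
      (use 0 K in \<open>auto intro!: integrable_on_atLeast_subinterval cont_s\<close>)
  moreover have "K \<ge> 0" using K(1)[of 0] 0 by force
  ultimately show ?case using 0 by (simp add: mult.commute)
next
  case (Suc n)
  have step: "\<bar>integral {0..x} (\<lambda>t. k t * f t) - integral {0..x} (\<lambda>t. k t * f' t)\<bar>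
      \<le> (K * x) ^ Suc (Suc n) / fact (Suc (Suc n))"
    if "continuous_on {0..} k" "continuous_on {0..} f" "continuous_on {0..} f'"
      "\<And>t. 0 \<le> t \<Longrightarrow> t \<le> T \<Longrightarrow> \<bar>k t\<bar> \<le> K"
      "\<And>t. 0 \<le> t \<Longrightarrow> t \<le> T \<Longrightarrow> \<bar>f t - f' t\<bar> \<le> (K * t) ^ Suc n / fact (Suc n)" for k f f' :: "real \<Rightarrow> real"
    unfolding integral_power_over_fact[OF Suc.prems(1), symmetric]
    by (rule abs_integral_mult_diff_le)
      (use that Suc.prems in \<open>auto intro!: continuous_intros simp del: power_Suc fact_Suc\<close>)
  have "\<bar>fst (picard s g (Suc (Suc n)) x) - fst (picard s g (Suc n) x)\<bar>
      \<le> (K * x) ^ Suc (Suc n) / fact (Suc (Suc n))"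
    using step[OF cont_s continuous_picard(2)[of "Suc n"] continuous_picard(2)[of n] K(1)] Suc.IH
    by (simp del: fact_Suc power_Suc)
  moreover have "\<bar>snd (picard s g (Suc (Suc n)) x) - snd (picard s g (Suc n) x)\<bar>
      \<le> (K * x) ^ Suc (Suc n) / fact (Suc (Suc n))"
    using step[OF cont_g continuous_picard(1)[of "Suc n"] continuous_picard(1)[of n] K(2)] Suc.IH
    by (simp del: fact_Suc power_Suc add: abs_minus_commute)
  ultimately show ?case by blast
qed

end

lemma uniform_limit_lim_if_increments_le:
  fixes p :: "nat \<Rightarrow> 'a \<Rightarrow> real"
  assumes "\<And>n x. x \<in> A \<Longrightarrow> \<bar>p (Suc n) x - p n x\<bar> \<le> B n" and "summable B"
  shows "uniform_limit A p (\<lambda>x. lim (\<lambda>n. p n x)) sequentially"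
proof -
  have "uniformly_convergent_on A (\<lambda>n x. \<Sum>i<n. (p (Suc i) x - p i x))"
    by (rule Weierstrass_m_test'[OF _ assms(2)]) (use assms(1) in simp)
  then obtain l where "uniform_limit A (\<lambda>n x. \<Sum>i<n. (p (Suc i) x - p i x)) l sequentially"
    by (auto simp: uniformly_convergent_on_def)
  then have "uniform_limit A (\<lambda>n x. p n x - p 0 x) l sequentially"
    using sum_lessThan_telescope[of "\<lambda>i. p i _"] by simp
  then have "uniform_limit A (\<lambda>n x. (p n x - p 0 x) + p 0 x) (\<lambda>x. l x + p 0 x) sequentially"
    by (intro uniform_limit_add uniform_limit_const)
  then have limit: "uniform_limit A p (\<lambda>x. l x + p 0 x) sequentially" by simp
  have "lim (\<lambda>n. p n x) = l x + p 0 x" if "x \<in> A" for x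
    by (rule limI) (rule tendsto_uniform_limitI[OF limit that])
  then show ?thesis using limit by (subst uniform_limit_cong'[OF refl]) auto
qed

lemma tendsto_integral_mult_uniform_limit:
  fixes k l :: "real \<Rightarrow> real"
  assumes k: "continuous_on {0..} k" and p: "\<And>n. continuous_on {0..} (p n)"
    and l: "continuous_on {0..} l"
    and limit: "uniform_limit {0..x} p l sequentially"
  shows "(\<lambda>n. integral {0..x} (\<lambda>t. k t * p n t)) \<longlonglongrightarrow> integral {0..x} (\<lambda>t. k t * l t)"
proof -
  have bounded: "bounded (f ` {0..x})" if "continuous_on {0..} f" for f :: "real \<Rightarrow> real"
    by (intro compact_imp_bounded compact_continuous_image continuous_on_subset[OF that]) auto
  have "uniform_limit {0..x} (\<lambda>n t. k t * p n t) (\<lambda>t. k t * l t) sequentially"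
    by (intro uniform_lim_mult uniform_limit_const limit bounded k l)
  then obtain I J where "\<And>n. ((\<lambda>t. k t * p n t) has_integral I n) {0..x}"
    "((\<lambda>t. k t * l t) has_integral J) {0..x}" "I \<longlonglongrightarrow> J"
    by (rule uniform_limit_integral)
      (auto intro!: continuous_intros continuous_on_subset[OF k] continuous_on_subset[OF p])
  moreover from this have "integral {0..x} (\<lambda>t. k t * l t) = J"
    "\<And>n. integral {0..x} (\<lambda>t. k t * p n t) = I n"
    using integral_unique by blast+
  ultimately show ?thesis by presburger
qed

context
  fixes s g :: "real \<Rightarrow> real"
  assumes cont_s: "continuous_on {0..} s" and cont_g: "continuous_on {0..} g"
begin

lemma picard_uniform_limit:
  "uniform_limit {0..T} (\<lambda>n x. fst (picard s g n x)) (string_sol s g) sequentially"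
  "uniform_limit {0..T} (\<lambda>n x. snd (picard s g n x)) (string_slope s g) sequentially"
proof -
  obtain K where K: "K > 0" "\<And>t. 0 \<le> t \<Longrightarrow> t \<le> T \<Longrightarrow> \<bar>s t\<bar> \<le> K" "\<And>t. 0 \<le> t \<Longrightarrow> t \<le> T \<Longrightarrow> \<bar>g t\<bar> \<le> K"
    using continuous_on_atLeast_bounded_Icc2[OF cont_s cont_g] by metis
  have summable: "summable (\<lambda>n. (K * T) ^ Suc n / fact (Suc n))"
    using summable_exp[of "K * T"] summable_Suc_iff[of "\<lambda>n. (K * T) ^ n / fact n"]
    by (simp only: divide_inverse mult.commute)
  have increment: "\<bar>fst (picard s g (Suc n) x) - fst (picard s g n x)\<bar> \<le> (K * T) ^ Suc n / fact (Suc n)"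
    "\<bar>snd (picard s g (Suc n) x) - snd (picard s g n x)\<bar> \<le> (K * T) ^ Suc n / fact (Suc n)"
    if x: "x \<in> {0..T}" for n x
  proof -
    have "(K * x) ^ Suc n / fact (Suc n) \<le> (K * T) ^ Suc n / fact (Suc n)"
      using x K(1) by (intro divide_right_mono power_mono mult_left_mono) auto
    moreover have "0 \<le> x" "x \<le> T" using x by auto
    note picard_increment_bound[OF cont_s cont_g K(2,3) this, of n]
    ultimately show "\<bar>fst (picard s g (Suc n) x) - fst (picard s g n x)\<bar>
        \<le> (K * T) ^ Suc n / fact (Suc n)"
      "\<bar>snd (picard s g (Suc n) x) - snd (picard s g n x)\<bar> \<le> (K * T) ^ Suc n / fact (Suc n)"
      by (simp_all del: power_Suc fact_Suc picard.simps)
  qed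
  show "uniform_limit {0..T} (\<lambda>n x. fst (picard s g n x)) (string_sol s g) sequentially"
    "uniform_limit {0..T} (\<lambda>n x. snd (picard s g n x)) (string_slope s g) sequentially"
    unfolding string_sol_def[abs_def] string_slope_def[abs_def]
    by (rule uniform_limit_lim_if_increments_le[OF _ summable]; rule increment; assumption)+
qed

lemma picard_tendsto:
  assumes "x \<ge> 0"
  shows "(\<lambda>n. fst (picard s g n x)) \<longlonglongrightarrow> string_sol s g x"
    "(\<lambda>n. snd (picard s g n x)) \<longlonglongrightarrow> string_slope s g x"
  using tendsto_uniform_limitI[OF picard_uniform_limit(1)[of x]]
    tendsto_uniform_limitI[OF picard_uniform_limit(2)[of x]] assms by auto

lemma continuous_string_sol: "continuous_on {0..} (string_sol s g)"
  by (intro continuous_on_atLeast_if_Icc uniform_limit_theorem[OF _ picard_uniform_limit(1)]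
      always_eventually allI
      continuous_on_subset[OF continuous_picard(1)[OF cont_s cont_g]]) auto

lemma continuous_string_slope: "continuous_on {0..} (string_slope s g)"
  by (intro continuous_on_atLeast_if_Icc uniform_limit_theorem[OF _ picard_uniform_limit(2)]
      always_eventually allI
      continuous_on_subset[OF continuous_picard(2)[OF cont_s cont_g]]) auto

lemma string_sol_integral:
  assumes "x \<ge> 0"
  shows "string_sol s g x = integral {0..x} (\<lambda>t. s t * string_slope s g t)"
    "string_slope s g x = 1 - integral {0..x} (\<lambda>t. g t * string_sol s g t)"
proof -
  note cont_picard = continuous_picard[OF cont_s cont_g]
  have "(\<lambda>n. fst (picard s g (Suc n) x)) \<longlonglongrightarrow> integral {0..x} (\<lambda>t. s t * string_slope s g t)"
    by simp (intro tendsto_integral_mult_uniform_limit cont_s cont_picard continuous_string_slope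
        picard_uniform_limit)
  with LIMSEQ_Suc[OF picard_tendsto(1)[OF assms]]
  show "string_sol s g x = integral {0..x} (\<lambda>t. s t * string_slope s g t)"
    using LIMSEQ_unique by blast
  have "(\<lambda>n. snd (picard s g (Suc n) x)) \<longlonglongrightarrow> 1 - integral {0..x} (\<lambda>t. g t * string_sol s g t)"
    by simp (intro tendsto_intros tendsto_integral_mult_uniform_limit cont_g cont_picard
        continuous_string_sol
        picard_uniform_limit)
  with LIMSEQ_Suc[OF picard_tendsto(2)[OF assms]]
  show "string_slope s g x = 1 - integral {0..x} (\<lambda>t. g t * string_sol s g t)"
    using LIMSEQ_unique by blast
qed

lemma string_sol_0 [simp]: "string_sol s g 0 = 0" and string_slope_0 [simp]: "string_slope s g 0 = 1"
  using string_sol_integral[of 0] by auto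

lemma solves_system_string_sol: "solves_system s g (string_sol s g) (string_slope s g)"
proof -
  have "DERIV (string_sol s g) x :> s x * string_slope s g x" if "x > 0" for x
    by (rule has_field_derivative_transform_within_open[OF DERIV_integral_upper[OF _ that], where
        S="{0<..}"])
      (use that in
          \<open>auto intro!: continuous_intros cont_s continuous_string_slope simp: string_sol_integral(1)\<close>)
  moreover have "DERIV (string_slope s g) x :> - g x * string_sol s g x" if "x > 0" for x
  proof -
    have "DERIV (\<lambda>x. 1 - integral {0..x} (\<lambda>t. g t * string_sol s g t)) x :> - g x * string_sol s g x"
      by (rule derivative_eq_intros DERIV_integral_upper | rule that continuous_intros cont_g
          continuous_string_sol | simp)+
    then show ?thesis
      by (rule has_field_derivative_transform_within_open[where S="{0<..}"])
        (use that in \<open>auto simp: string_sol_integral(2)\<close>)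
  qed
  ultimately show ?thesis unfolding solves_system_def
    using continuous_string_sol continuous_string_slope by auto
qed

lemma solves_system_unique:
  assumes "solves_system s g f h" "f 0 = 0" "x \<ge> 0"
  shows "f x = h 0 * string_sol s g x" "h x = h 0 * string_slope s g x"
proof -
  have "solves_system s g (\<lambda>x. f x - h 0 * string_sol s g x) (\<lambda>x. h x - h 0 * string_slope s g x)"
    unfolding solves_system_def
    using solves_systemD[OF assms(1)] solves_systemD[OF solves_system_string_sol]
    by (auto intro!: continuous_intros derivative_eq_intros simp: algebra_simps)
  from solves_system_zero[OF this cont_s cont_g _ _ assms(3)] assms(2)
  show "f x = h 0 * string_sol s g x" "h x = h 0 * string_slope s g x" by auto
qed

end

section \<open>Sturm oscillation\<close>

lemma string_sol_slope_pos_near_0: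
  assumes cont_s: "continuous_on {0..} s" and cont_g: "continuous_on {0..} g"
    and pos: "\<And>x. x \<ge> 0 \<Longrightarrow> s x > 0"
  obtains d where "d > 0" "\<And>x. 0 < x \<Longrightarrow> x \<le> d \<Longrightarrow> string_sol s g x > 0 \<and> string_slope s g x > 1/2"
proof -
  obtain d where d: "d > 0"
    "\<And>x. 0 \<le> x \<Longrightarrow> dist x 0 < d \<Longrightarrow> dist (string_slope s g x) (string_slope s g 0) < 1/2"
    using continuous_string_slope[OF cont_s cont_g] unfolding continuous_on_iff
    by (metis atLeast_iff order_refl half_gt_zero zero_less_one)
  have slope: "string_slope s g x > 1/2" if "0 \<le> x" "x < d" for x
    using d(2)[of x] that string_slope_0[OF cont_s cont_g] unfolding dist_real_def
    by (smt (verit) field_sum_of_halves)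
  show ?thesis
  proof (rule that[of "d/2"])
    fix x assume x: "0 < x" "x \<le> d/2"
    have "string_sol s g 0 < string_sol s g x"
    proof (rule solves_system_strict_increasing[OF solves_system_string_sol[OF cont_s cont_g]])
      fix y assume y: "0 < y" "y < x"
      have "s y > 0" using pos y by simp
      moreover have "string_slope s g y > 1/2" using slope[of y] y x d(1) by linarith
      ultimately show "s y * string_slope s g y > 0" by simp
    qed (use x in auto)
    then show "string_sol s g x > 0 \<and> string_slope s g x > 1/2"
      using slope[of x] x d(1) string_sol_0[OF cont_s cont_g] by auto
  qed (use d in auto)
qed

lemma string_sol_first_zero:
  assumes cont_s: "continuous_on {0..} s" and cont_g: "continuous_on {0..} g"
    and pos: "\<And>x. x \<ge> 0 \<Longrightarrow> s x > 0"
    and "b > 0" "string_sol s g b \<le> 0"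
  obtains c where "0 < c" "c \<le> b" "string_sol s g c = 0" "\<And>x. 0 < x \<Longrightarrow> x < c \<Longrightarrow> string_sol s g x > 0"
proof -
  obtain d where d: "d > 0" "\<And>x. 0 < x \<Longrightarrow> x \<le> d \<Longrightarrow> string_sol s g x > 0 \<and> string_slope s g x > 1/2"
    using string_sol_slope_pos_near_0[OF cont_s cont_g pos] by blast
  have "d \<le> b" using d(2)[of b] assms by (cases "d \<le> b") auto
  then obtain c where c: "d < c" "c \<le> b" "string_sol s g c = 0"
    "\<And>x. d \<le> x \<Longrightarrow> x < c \<Longrightarrow> string_sol s g x > 0"
    using first_zero[of d b "string_sol s g"] d assms
      continuous_on_subset[OF continuous_string_sol[OF cont_s cont_g], of "{d..b}"] by auto
  show ?thesis
  proof (rule that[of c])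
    show "string_sol s g x > 0" if "0 < x" "x < c" for x using d(2)[of x] c(4)[of x] that
      by (cases "x \<le> d") auto
  qed (use c d in auto)
qed

lemma string_sol_slope_det:
  assumes cont_s: "continuous_on {0..} s" and cont_g: "continuous_on {0..} g" and x: "x \<ge> 0"
  shows "string_slope (\<lambda>x. - g x) (\<lambda>x. - s x) x * string_slope s g x
    - string_sol (\<lambda>x. - g x) (\<lambda>x. - s x) x * string_sol s g x = 1"
proof -
  have cont_neg: "continuous_on {0..} (\<lambda>x. - s x)" "continuous_on {0..} (\<lambda>x. - g x)"
    by (intro continuous_intros cont_s cont_g)+
  note system = solves_systemD[OF solves_system_string_sol[OF cont_s cont_g]]
    and D' = solves_systemD[OF solves_system_string_sol[OF cont_neg(2,1)]]
  let ?f = "\<lambda>x. string_slope (\<lambda>x. - g x) (\<lambda>x. - s x) x * string_slope s g x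
    - string_sol (\<lambda>x. - g x) (\<lambda>x. - s x) x * string_sol s g x"
  have "?f x = ?f 0"
  proof (cases "x = 0")
    case False
    then show ?thesis using x
      by (intro DERIV_isconst_end[where f="?f" and a=0 and b=x])
        (auto intro!: continuous_intros continuous_on_subset[OF system(1)] continuous_on_subset[OF system(2)]
          continuous_on_subset[OF D'(1)] continuous_on_subset[OF D'(2)] derivative_eq_intros system D')
  qed simp
  then show ?thesis using cont_s cont_g cont_neg by simp
qed

lemma string_sol_zero_slope_neg:
  assumes cont_s: "continuous_on {0..} s" and cont_g: "continuous_on {0..} g"
    and pos: "\<And>x. x \<ge> 0 \<Longrightarrow> s x > 0"
    and "\<not> (\<forall>x>0. string_sol s g x > 0)"
  obtains c where "c > 0" "string_sol s g c = 0" "string_slope s g c < 0"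
proof -
  obtain b where "b > 0" "string_sol s g b \<le> 0" using assms(4) by force
  then obtain c where c: "0 < c" "string_sol s g c = 0" "\<And>x. 0 < x \<Longrightarrow> x < c \<Longrightarrow> string_sol s g x > 0"
    using string_sol_first_zero[OF cont_s cont_g pos] by metis
  have "string_slope s g c \<noteq> 0" using string_sol_slope_det[OF cont_s cont_g, of c] c by auto
  moreover have "\<not> string_slope s g c > 0"
  proof
    assume "string_slope s g c > 0"
    then have "s c * string_slope s g c > 0" using pos[of c] c by simp
    from DERIV_pos_inc_left[OF
        solves_systemD(3)[OF solves_system_string_sol[OF cont_s cont_g] c(1)] this]
    obtain e where e: "e > 0" "\<And>h. 0 < h \<Longrightarrow> h < e \<Longrightarrow> string_sol s g (c - h) < string_sol s g c" by auto
    define h where "h = min (e/2) (c/2)"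
    have "0 < h" "h < e" "0 < c - h" "c - h < c" using e c by (auto simp: h_def min_def)
    then show False using e(2)[of h] c(3)[of "c - h"] c(2) by force
  qed
  ultimately show ?thesis using that[of c] c by auto
qed

lemma exists_string_sol_neg:
  assumes cont_s: "continuous_on {0..} s" and cont_g: "continuous_on {0..} g"
    and pos: "\<And>x. x \<ge> 0 \<Longrightarrow> s x > 0"
    and "\<not> (\<forall>x>0. string_sol s g x > 0)"
  obtains x where "x > 0" "string_sol s g x < 0"
proof -
  obtain c where c: "c > 0" "string_sol s g c = 0" "string_slope s g c < 0"
    by (rule string_sol_zero_slope_neg[OF assms]) auto
  have "s c * string_slope s g c < 0" using c pos[of c] by (intro mult_pos_neg) auto
  from DERIV_neg_dec_right[OF
      solves_systemD(3)[OF solves_system_string_sol[OF cont_s cont_g] c(1)] this]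
  obtain e where e: "e > 0" "\<And>h. 0 < h \<Longrightarrow> h < e \<Longrightarrow> string_sol s g c > string_sol s g (c + h)" by auto
  show ?thesis using that[of "c + e/2"] e(1) e(2)[of "e/2"] c by auto
qed

lemma exists_string_slope_neg:
  assumes cont_s: "continuous_on {0..} s" and cont_g: "continuous_on {0..} g"
    and pos: "\<And>x. x \<ge> 0 \<Longrightarrow> s x > 0"
    and g_pos: "\<And>x. x \<ge> 0 \<Longrightarrow> g x > 0" and "\<not> (\<forall>x\<ge>0. string_slope s g x > 0)"
  obtains x where "x > 0" "string_slope s g x < 0"
proof -
  note system = solves_system_string_sol[OF cont_s cont_g]
  obtain b where "b \<ge> 0" "string_slope s g b \<le> 0" using assms(5) by force
  then obtain c where c: "0 < c" "string_slope s g c = 0" "\<And>x. 0 \<le> x \<Longrightarrow> x < c \<Longrightarrow> string_slope s g x > 0"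
    using first_zero[of 0 b "string_slope s g"] string_slope_0[OF cont_s cont_g]
      continuous_on_subset[OF continuous_string_slope[OF cont_s cont_g], of "{0..b}"] by auto
  have "string_sol s g 0 < string_sol s g c"
    by (rule solves_system_strict_increasing[OF system]) (use c pos in auto)
  then have "- g c * string_sol s g c < 0" using g_pos[of c] string_sol_0[OF cont_s cont_g] c by simp
  from DERIV_neg_dec_right[OF solves_systemD(4)[OF system c(1)] this]
  obtain e where e: "e > 0" "\<And>h. 0 < h \<Longrightarrow> h < e \<Longrightarrow> string_slope s g c > string_slope s g (c + h)" by auto
  show ?thesis using that[of "c + e/2"] e(1) e(2)[of "e/2"] c by auto
qed

lemma string_slope_ge_1_if_nonpos:
  assumes cont_s: "continuous_on {0..} s" and cont_g: "continuous_on {0..} g"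
    and pos: "\<And>x. x \<ge> 0 \<Longrightarrow> s x > 0"
    and g_nonpos: "\<And>x. x \<ge> 0 \<Longrightarrow> g x \<le> 0" and x: "x \<ge> 0"
  shows "string_slope s g x \<ge> 1"
proof -
  note cont_picard = continuous_picard[OF cont_s cont_g]
  have "\<forall>x\<ge>0. fst (picard s g n x) \<ge> 0 \<and> snd (picard s g n x) \<ge> 1" for n
  proof (induction n)
    case (Suc n)
    show ?case
    proof (intro allI impI conjI)
      fix x :: real assume x: "0 \<le> x"
      have "0 \<le> s t * snd (picard s g n t)" if "t \<ge> 0" for t
        using Suc pos[OF that] that by (intro mult_nonneg_nonneg) force+
      then have "0 \<le> integral {0..x} (\<lambda>t. s t * snd (picard s g n t))"
        by (intro integral_nonneg)
          (auto intro!: integrable_on_atLeast_subinterval continuous_intros cont_s cont_picard)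
      then show "fst (picard s g (Suc n) x) \<ge> 0" by simp
      have "0 \<le> integral {0..x} (\<lambda>t. - (g t * fst (picard s g n t)))"
        by (rule integral_nonneg) (use Suc g_nonpos x in \<open>auto intro!: integrable_on_atLeast_subinterval
            continuous_intros cont_g cont_picard mult_nonpos_nonneg\<close>)
      then show "snd (picard s g (Suc n) x) \<ge> 1" by simp
    qed
  qed auto
  then show ?thesis using x by (intro LIMSEQ_le_const[OF picard_tendsto(2)[OF cont_s cont_g x]]) auto
qed

definition wronskian :: "(real \<Rightarrow> real) \<Rightarrow> (real \<Rightarrow> real) \<Rightarrow> (real \<Rightarrow> real) \<Rightarrow> real \<Rightarrow> real" where
  "wronskian s g1 g2 x = string_sol s g2 x * string_slope s g1 x
      - string_sol s g1 x * string_slope s g2 x"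

context
  fixes s g1 g2 :: "real \<Rightarrow> real"
  assumes cont_s: "continuous_on {0..} s" and cont_g1: "continuous_on {0..} g1"
    and cont_g2: "continuous_on {0..} g2"
    and pos: "\<And>x. x \<ge> 0 \<Longrightarrow> s x > 0" and g_le: "\<And>x. x \<ge> 0 \<Longrightarrow> g1 x \<le> g2 x"
begin

lemma continuous_wronskian: "continuous_on {0..} (wronskian s g1 g2)"
  unfolding wronskian_def[abs_def]
  by (intro continuous_intros continuous_string_sol continuous_string_slope cont_s cont_g1 cont_g2)

lemma DERIV_wronskian:
  assumes "x > 0"
  shows "DERIV (wronskian s g1 g2) x :>
      (g2 x - g1 x) * (string_sol s g1 x * string_sol s g2 x)"
proof -
  note system1 = solves_systemD[OF solves_system_string_sol[OF cont_s cont_g1]]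
    and system2 = solves_systemD[OF solves_system_string_sol[OF cont_s cont_g2]]
  show ?thesis unfolding wronskian_def[abs_def]
    by (auto intro!: derivative_eq_intros system1 system2 assms simp: algebra_simps)
qed

lemma wronskian_mono:
  assumes "0 \<le> a" "a \<le> b" "\<And>x. a < x \<Longrightarrow> x < b \<Longrightarrow> string_sol s g1 x * string_sol s g2 x \<ge> 0"
  shows "wronskian s g1 g2 a \<le> wronskian s g1 g2 b"
  by (rule DERIV_nonneg_imp_le[OF assms(2)], rule continuous_on_subset[OF continuous_wronskian],
      use assms in simp, rule DERIV_wronskian) (use assms g_le in auto)

lemma wronskian_0: "wronskian s g1 g2 0 = 0" using cont_s cont_g1 cont_g2 by (simp add: wronskian_def)

lemma DERIV_sol_ratio:
  assumes "x > 0" "string_sol s g2 x \<noteq> 0"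
  shows "DERIV (\<lambda>x. string_sol s g1 x / string_sol s g2 x) x :>
      s x * wronskian s g1 g2 x / (string_sol s g2 x)\<^sup>2"
proof -
  note system1 = solves_systemD[OF solves_system_string_sol[OF cont_s cont_g1]]
    and system2 = solves_systemD[OF solves_system_string_sol[OF cont_s cont_g2]]
  show ?thesis
    using assms by
      (auto intro!: derivative_eq_intros system1 system2 simp: algebra_simps power2_eq_square wronskian_def)
qed

lemma sol_ratio_mono:
  assumes "0 < a" "a \<le> b" and sol_pos: "\<And>x. a \<le> x \<Longrightarrow> x \<le> b \<Longrightarrow> string_sol s g2 x > 0"
    and "\<And>x. a < x \<Longrightarrow> x < b \<Longrightarrow> wronskian s g1 g2 x \<ge> 0"
  shows "string_sol s g1 a / string_sol s g2 a \<le> string_sol s g1 b / string_sol s g2 b"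
proof (rule DERIV_nonneg_imp_le[OF \<open>a \<le> b\<close>])
  show "continuous_on {a..b} (\<lambda>x. string_sol s g1 x / string_sol s g2 x)"
    by (intro continuous_intros continuous_on_subset[OF continuous_string_sol[OF cont_s cont_g1]]
        continuous_on_subset[OF continuous_string_sol[OF cont_s cont_g2]])
      (use assms(1) sol_pos in \<open>auto simp: less_le\<close>)
  fix x assume x: "a < x" "x < b"
  then show "DERIV (\<lambda>x. string_sol s g1 x / string_sol s g2 x) x :>
      s x * wronskian s g1 g2 x / (string_sol s g2 x)\<^sup>2"
    using assms(1) sol_pos[of x] by (intro DERIV_sol_ratio) auto
  show "s x * wronskian s g1 g2 x / (string_sol s g2 x)\<^sup>2 \<ge> 0" using assms x pos[of x] by simp
qed

lemma sturm_sol_pos: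
  assumes sol2_pos: "\<And>x. 0 < x \<Longrightarrow> x \<le> X \<Longrightarrow> string_sol s g2 x > 0" and b: "0 < b" "b \<le> X"
  shows "string_sol s g1 b > 0"
proof (rule ccontr)
  assume "\<not> string_sol s g1 b > 0"
  then have "string_sol s g1 b \<le> 0" by simp
  then obtain c where c: "0 < c" "c \<le> b" "string_sol s g1 c = 0"
    and sol1_pos: "\<And>x. 0 < x \<Longrightarrow> x < c \<Longrightarrow> string_sol s g1 x > 0"
    using string_sol_first_zero[OF cont_s cont_g1 pos b(1)] by metis
  have "wronskian s g1 g2 x \<ge> 0" if "0 \<le> x" "x \<le> c" for x
  proof -
    have "0 \<le> string_sol s g1 y * string_sol s g2 y" if "0 < y" "y < x" for y
      using sol1_pos[of y] sol2_pos[of y] that \<open>x \<le> c\<close> c b by (intro mult_nonneg_nonneg) auto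
    then show ?thesis using wronskian_mono[of 0 x] wronskian_0 that by auto
  qed
  then have "string_sol s g1 (c/2) / string_sol s g2 (c/2) \<le> string_sol s g1 c / string_sol s g2 c"
    using c b by (intro sol_ratio_mono sol2_pos) auto
  moreover have "string_sol s g1 (c/2) / string_sol s g2 (c/2) > 0"
    using sol1_pos[of "c/2"] sol2_pos[of "c/2"] c b by auto
  ultimately show False using c by simp
qed

lemma wronskian_nonneg:
  assumes sol2_pos: "\<And>x. 0 < x \<Longrightarrow> x \<le> X \<Longrightarrow> string_sol s g2 x > 0" and b: "0 \<le> b" "b \<le> X"
  shows "wronskian s g1 g2 b \<ge> 0"
proof -
  have "0 \<le> string_sol s g1 y * string_sol s g2 y" if "0 < y" "y < b" for y
    using sturm_sol_pos[of X y] sol2_pos that b by (intro mult_nonneg_nonneg) (auto intro: less_imp_le)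
  then show ?thesis using wronskian_mono[of 0 b] wronskian_0 b by auto
qed

lemma wronskian_bounded_below:
  assumes sol2_pos: "\<And>x. 0 < x \<Longrightarrow> string_sol s g2 x > 0" and less: "\<And>x. x > 0 \<Longrightarrow> g1 x < g2 x"
  obtains e where "e > 0" "\<And>x. x \<ge> 1 \<Longrightarrow> wronskian s g1 g2 x \<ge> e"
proof (rule that[of "wronskian s g1 g2 1"])
  have prod_pos: "string_sol s g1 x * string_sol s g2 x > 0" if "x > 0" for x
    using sturm_sol_pos[of x x] sol2_pos that by simp
  have "wronskian s g1 g2 0 < wronskian s g1 g2 1"
    by (rule DERIV_pos_imp_less, simp, rule continuous_on_subset[OF continuous_wronskian], simp,
        rule DERIV_wronskian)
      (use less prod_pos in auto)
  then show "wronskian s g1 g2 1 > 0" using wronskian_0 by simp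
  show "wronskian s g1 g2 x \<ge> wronskian s g1 g2 1" if "x \<ge> 1" for x
    using wronskian_mono[of 1 x] that prod_pos by (simp add: less_imp_le)
qed

end

section \<open>Continuous dependence on the coefficients\<close>

lemma abs_integral_mult_perturbation_le:
  fixes k k' f f' :: "real \<Rightarrow> real"
  assumes cont: "continuous_on {0..} k" "continuous_on {0..} k'" "continuous_on {0..} f"
    "continuous_on {0..} f'"
    and k': "\<And>t. 0 \<le> t \<Longrightarrow> t \<le> y \<Longrightarrow> \<bar>k' t\<bar> \<le> K" and f: "\<And>t. 0 \<le> t \<Longrightarrow> t \<le> y \<Longrightarrow> \<bar>f t\<bar> \<le> B"
  shows "\<bar>integral {0..y} (\<lambda>t. k' t * f' t) - integral {0..y} (\<lambda>t. k t * f t)\<bar>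
    \<le> integral {0..y} (\<lambda>t. K * \<bar>f' t - f t\<bar> + B * \<bar>k' t - k t\<bar>)"
proof -
  have "integral {0..y} (\<lambda>t. k' t * f' t) - integral {0..y} (\<lambda>t. k t * f t)
      = integral {0..y} (\<lambda>t. k' t * (f' t - f t) + (k' t - k t) * f t)"
    by (subst Henstock_Kurzweil_Integration.integral_diff[symmetric])
      (auto intro!: integrable_on_atLeast_subinterval continuous_intros cont simp: algebra_simps)
  moreover have "norm (integral {0..y} (\<lambda>t. k' t * (f' t - f t) + (k' t - k t) * f t))
      \<le> integral {0..y} (\<lambda>t. K * \<bar>f' t - f t\<bar> + B * \<bar>k' t - k t\<bar>)"
  proof (rule integral_norm_bound_integral)
    fix t assume t: "t \<in> {0..y}"
    have "\<bar>k' t * (f' t - f t)\<bar> \<le> K * \<bar>f' t - f t\<bar>" using k'[of t] t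
      by (auto simp: abs_mult intro!: mult_right_mono)
    moreover have "\<bar>(k' t - k t) * f t\<bar> \<le> B * \<bar>k' t - k t\<bar>" using f[of t] t
      by (auto simp: abs_mult mult.commute intro!: mult_right_mono)
    ultimately show "norm (k' t * (f' t - f t) + (k' t - k t) * f t)
        \<le> K * \<bar>f' t - f t\<bar> + B * \<bar>k' t - k t\<bar>"
      unfolding real_norm_def by linarith
  qed (auto intro!: integrable_on_atLeast_subinterval continuous_intros cont)
  ultimately show ?thesis by simp
qed

lemma string_sol_perturbation_le:
  fixes s g s' g' :: "real \<Rightarrow> real"
  assumes cont: "continuous_on {0..} s" "continuous_on {0..} g"
    and cont': "continuous_on {0..} s'" "continuous_on {0..} g'"
    and K: "\<And>t. 0 \<le> t \<Longrightarrow> t \<le> T \<Longrightarrow> \<bar>s' t\<bar> \<le> K" "\<And>t. 0 \<le> t \<Longrightarrow> t \<le> T \<Longrightarrow> \<bar>g' t\<bar> \<le> K"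
    and B: "\<And>t. 0 \<le> t \<Longrightarrow> t \<le> T \<Longrightarrow> \<bar>string_sol s g t\<bar> \<le> B" "\<And>t. 0 \<le> t \<Longrightarrow> t \<le> T \<Longrightarrow> \<bar>string_slope s g t\<bar> \<le> B"
    and x: "0 \<le> x" "x \<le> T"
  shows "\<bar>string_sol s' g' x - string_sol s g x\<bar> + \<bar>string_slope s' g' x - string_slope s g x\<bar>
    \<le> integral {0..T} (\<lambda>t. B * (\<bar>s' t - s t\<bar> + \<bar>g' t - g t\<bar>)) * exp (K * x)"
proof -
  let ?\<Delta>sol = "\<lambda>x. \<bar>string_sol s' g' x - string_sol s g x\<bar>"
    and ?\<Delta>slope = "\<lambda>x. \<bar>string_slope s' g' x - string_slope s g x\<bar>"
    and ?\<Delta>coeff = "\<lambda>t. \<bar>s' t - s t\<bar> + \<bar>g' t - g t\<bar>"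
  note conts = cont cont' continuous_string_sol[OF cont] continuous_string_slope[OF cont]
    continuous_string_sol[OF cont'] continuous_string_slope[OF cont']
  show ?thesis
  proof (rule gronwall[where T=T and e="\<lambda>x. ?\<Delta>sol x + ?\<Delta>slope x"])
    show "continuous_on {0..T} (\<lambda>x. ?\<Delta>sol x + ?\<Delta>slope x)"
      by (rule continuous_on_subset[of "{0..}"]) (auto intro!: continuous_intros conts)
    show "K \<ge> 0" using K(1)[of 0] x by force
    fix y assume y: "0 \<le> y" "y \<le> T"
    have "?\<Delta>sol y \<le> integral {0..y} (\<lambda>t. K * ?\<Delta>slope t + B * \<bar>s' t - s t\<bar>)"
      unfolding string_sol_integral(1)[OF cont' y(1)] string_sol_integral(1)[OF cont y(1)]
      using y K B by (intro abs_integral_mult_perturbation_le conts) auto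
    moreover have "?\<Delta>slope y = \<bar>integral {0..y} (\<lambda>t. g' t * string_sol s' g' t)
        - integral {0..y} (\<lambda>t. g t * string_sol s g t)\<bar>"
      unfolding string_sol_integral(2)[OF cont' y(1)] string_sol_integral(2)[OF cont y(1)] by simp
    moreover have "\<dots> \<le> integral {0..y} (\<lambda>t. K * ?\<Delta>sol t + B * \<bar>g' t - g t\<bar>)"
      using y K B by (intro abs_integral_mult_perturbation_le conts) auto
    moreover have "integral {0..y} (\<lambda>t. K * ?\<Delta>slope t + B * \<bar>s' t - s t\<bar>)
        + integral {0..y} (\<lambda>t. K * ?\<Delta>sol t + B * \<bar>g' t - g t\<bar>)
        = integral {0..y} (\<lambda>t. B * ?\<Delta>coeff t + K * (?\<Delta>sol t + ?\<Delta>slope t))"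
      by (subst Henstock_Kurzweil_Integration.integral_add[symmetric])
        (auto intro!: integrable_on_atLeast_subinterval continuous_intros conts simp: algebra_simps)
    moreover have "\<dots> = integral {0..y} (\<lambda>t. B * ?\<Delta>coeff t)
        + K * integral {0..y} (\<lambda>t. ?\<Delta>sol t + ?\<Delta>slope t)"
      by (subst Henstock_Kurzweil_Integration.integral_add)
        (auto intro!: integrable_on_atLeast_subinterval continuous_intros conts)
    moreover have "integral {0..y} (\<lambda>t. B * ?\<Delta>coeff t) \<le> integral {0..T} (\<lambda>t. B * ?\<Delta>coeff t)"
    proof (rule integral_subset_le)
      have "B \<ge> 0" using B(1)[of 0] x by force
      then show "\<forall>t\<in>{0..T}. 0 \<le> B * ?\<Delta>coeff t" by simp
    qed (use y in \<open>auto intro!: integrable_on_atLeast_subinterval continuous_intros conts\<close>)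
    ultimately show "?\<Delta>sol y + ?\<Delta>slope y
        \<le> integral {0..T} (\<lambda>t. B * ?\<Delta>coeff t) + K * integral {0..y} (\<lambda>t. ?\<Delta>sol t + ?\<Delta>slope t)"
      by linarith
  qed (use x in auto)
qed

lemma integral_coefficient_distance_tendsto_0:
  fixes s g :: "real \<Rightarrow> real" and sn gn :: "nat \<Rightarrow> real \<Rightarrow> real"
  assumes cont: "continuous_on {0..} s" "continuous_on {0..} g"
    and contn: "\<And>n. continuous_on {0..} (sn n)" "\<And>n. continuous_on {0..} (gn n)"
    and K: "\<And>n t. 0 \<le> t \<Longrightarrow> t \<le> T \<Longrightarrow> \<bar>sn n t\<bar> \<le> K" "\<And>n t. 0 \<le> t \<Longrightarrow> t \<le> T \<Longrightarrow> \<bar>gn n t\<bar> \<le> K"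
    and lims: "\<And>t. 0 \<le> t \<Longrightarrow> t \<le> T \<Longrightarrow> (\<lambda>n. sn n t) \<longlonglongrightarrow> s t"
    and limg: "\<And>t. 0 \<le> t \<Longrightarrow> t \<le> T \<Longrightarrow> (\<lambda>n. gn n t) \<longlonglongrightarrow> g t" and "B \<ge> 0"
  shows "(\<lambda>n. integral {0..T} (\<lambda>t. B * (\<bar>sn n t - s t\<bar> + \<bar>gn n t - g t\<bar>))) \<longlonglongrightarrow> 0"
proof -
  have "(\<lambda>n. integral {0..T} (\<lambda>t. B * (\<bar>sn n t - s t\<bar> + \<bar>gn n t - g t\<bar>)))
      \<longlonglongrightarrow> integral {0..T} (\<lambda>t. 0)"
  proof (rule dominated_convergence(2))
    show "(\<lambda>t. B * (\<bar>sn n t - s t\<bar> + \<bar>gn n t - g t\<bar>)) integrable_on {0..T}" for n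
      by (intro integrable_on_atLeast_subinterval continuous_intros cont contn) auto
    show "(\<lambda>t. B * (4 * K)) integrable_on {0..T}" by (rule integrable_const_ivl)
    fix n t assume t: "t \<in> {0..T}"
    have "\<bar>s t\<bar> \<le> K" using LIMSEQ_le_const2[OF tendsto_rabs[OF lims]] K(1) t
      by (metis atLeastAtMost_iff)
    moreover have "\<bar>g t\<bar> \<le> K" using LIMSEQ_le_const2[OF tendsto_rabs[OF limg]] K(2) t
      by (metis atLeastAtMost_iff)
    ultimately have "\<bar>sn n t - s t\<bar> + \<bar>gn n t - g t\<bar> \<le> 4 * K" using K(1)[of t n] K(2)[of t n] t by auto
    then show "norm (B * (\<bar>sn n t - s t\<bar> + \<bar>gn n t - g t\<bar>)) \<le> B * (4 * K)"
      using \<open>B \<ge> 0\<close> by (simp add: mult_left_mono)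
  next
    fix t assume t: "t \<in> {0..T}"
    then have "(\<lambda>n. B * (\<bar>sn n t - s t\<bar> + \<bar>gn n t - g t\<bar>)) \<longlonglongrightarrow> B * (\<bar>s t - s t\<bar> + \<bar>g t - g t\<bar>)"
      by (intro tendsto_intros lims limg) auto
    then show "(\<lambda>n. B * (\<bar>sn n t - s t\<bar> + \<bar>gn n t - g t\<bar>)) \<longlonglongrightarrow> 0" by simp
  qed
  then show ?thesis by simp
qed

lemma string_sol_uniform_limit:
  fixes s g :: "real \<Rightarrow> real" and sn gn :: "nat \<Rightarrow> real \<Rightarrow> real"
  assumes cont: "continuous_on {0..} s" "continuous_on {0..} g"
    and contn: "\<And>n. continuous_on {0..} (sn n)" "\<And>n. continuous_on {0..} (gn n)"
    and K: "\<And>n t. 0 \<le> t \<Longrightarrow> t \<le> T \<Longrightarrow> \<bar>sn n t\<bar> \<le> K" "\<And>n t. 0 \<le> t \<Longrightarrow> t \<le> T \<Longrightarrow> \<bar>gn n t\<bar> \<le> K"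
    and lims: "\<And>t. 0 \<le> t \<Longrightarrow> t \<le> T \<Longrightarrow> (\<lambda>n. sn n t) \<longlonglongrightarrow> s t"
    and limg: "\<And>t. 0 \<le> t \<Longrightarrow> t \<le> T \<Longrightarrow> (\<lambda>n. gn n t) \<longlonglongrightarrow> g t" and T: "T \<ge> 0"
  shows "uniform_limit {0..T} (\<lambda>n. string_sol (sn n) (gn n)) (string_sol s g) sequentially"
    "uniform_limit {0..T} (\<lambda>n. string_slope (sn n) (gn n)) (string_slope s g) sequentially"
proof -
  obtain B where B: "B > 0" "\<And>t. 0 \<le> t \<Longrightarrow> t \<le> T \<Longrightarrow> \<bar>string_sol s g t\<bar> \<le> B"
      "\<And>t. 0 \<le> t \<Longrightarrow> t \<le> T \<Longrightarrow> \<bar>string_slope s g t\<bar> \<le> B"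
    using continuous_on_atLeast_bounded_Icc2[OF continuous_string_sol[OF cont]
        continuous_string_slope[OF cont]] by metis
  let ?d = "\<lambda>n. integral {0..T} (\<lambda>t. B * (\<bar>sn n t - s t\<bar> + \<bar>gn n t - g t\<bar>))"
  have "K \<ge> 0" using K(1)[of 0] T by force
  have "?d \<longlonglongrightarrow> 0"
    by (rule integral_coefficient_distance_tendsto_0[OF cont contn K lims limg]) (use B in simp_all)
  then have lim: "(\<lambda>n. ?d n * exp (K * T)) \<longlonglongrightarrow> 0" using tendsto_mult_left_zero by fastforce
  have bound: "\<bar>string_sol (sn n) (gn n) x - string_sol s g x\<bar>
      + \<bar>string_slope (sn n) (gn n) x - string_slope s g x\<bar> \<le> ?d n * exp (K * T)" if x: "x \<in> {0..T}" for n x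
  proof (rule order_trans[OF string_sol_perturbation_le[OF cont contn K B(2,3)] mult_left_mono])
    show "?d n \<ge> 0"
      by (intro integral_nonneg integrable_on_atLeast_subinterval continuous_intros cont contn)
      (use B in auto)
  qed (use x \<open>K \<ge> 0\<close> in \<open>auto intro: mult_left_mono\<close>)
  have unif: "uniform_limit {0..T} (\<lambda>n x. ?d n * exp (K * T)) (\<lambda>_. 0) sequentially"
    by (rule uniform_limitI) (use lim tendstoD in fastforce)
  have close: "dist (string_sol (sn n) (gn n) x) (string_sol s g x) \<le> dist (?d n * exp (K * T)) 0"
      "dist (string_slope (sn n) (gn n) x) (string_slope s g x) \<le> dist (?d n * exp (K * T)) 0"
    if "x \<in> {0..T}" for n x
    using bound[OF that, of n] unfolding dist_real_def by linarith+
  show "uniform_limit {0..T} (\<lambda>n. string_sol (sn n) (gn n)) (string_sol s g) sequentially"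
    by (rule metric_uniform_limit_imp_uniform_limit[OF unif]) (intro always_eventually allI ballI close)
  show "uniform_limit {0..T} (\<lambda>n. string_slope (sn n) (gn n)) (string_slope s g) sequentially"
    by (rule metric_uniform_limit_imp_uniform_limit[OF unif]) (intro always_eventually allI ballI close)
qed

section \<open>The string equation and its lowest eigenvalue\<close>

definition bounded_integral :: "(real \<Rightarrow> real) \<Rightarrow> bool" where
  "bounded_integral f \<longleftrightarrow> (\<exists>K. \<forall>x\<ge>0. integral {0..x} f \<le> K)"

lemma bounded_integral_cong:
  assumes "\<And>x. x \<ge> 0 \<Longrightarrow> f x = g x"
  shows "bounded_integral f \<longleftrightarrow> bounded_integral g"
proof -
  have "integral {0..x} f = integral {0..x} g" for x
    by (rule Henstock_Kurzweil_Integration.integral_cong) (use assms in auto)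
  then show ?thesis by (simp add: bounded_integral_def)
qed

lemma integral_mono_upper:
  fixes f :: "real \<Rightarrow> real"
  assumes "continuous_on {0..} f" "\<And>x. x \<ge> 0 \<Longrightarrow> f x \<ge> 0" "0 \<le> x" "x \<le> y"
  shows "integral {0..x} f \<le> integral {0..y} f"
  by (rule integral_subset_le) (use assms in \<open>auto intro!: integrable_on_atLeast_subinterval\<close>)

lemma bounded_integral_comparison:
  assumes cont_f: "continuous_on {0..} f" and cont_g: "continuous_on {0..} g"
    and g_nonneg: "\<And>x. x \<ge> 0 \<Longrightarrow> g x \<ge> 0"
    and c: "c \<ge> 0" and X: "X \<ge> 0" and f_le: "\<And>x. x \<ge> X \<Longrightarrow> f x \<le> c * g x" and g: "bounded_integral g"
  shows "bounded_integral f"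
proof -
  obtain K where K: "\<And>x. x \<ge> 0 \<Longrightarrow> integral {0..x} g \<le> K" using g by (auto simp: bounded_integral_def)
  obtain B where B: "B > 0" "\<And>x. 0 \<le> x \<Longrightarrow> x \<le> X \<Longrightarrow> \<bar>integral {0..x} f\<bar> \<le> B"
    using continuous_on_atLeast_bounded_Icc[OF continuous_on_integral_upper[OF cont_f]] by metis
  have "K \<ge> 0" using K[of 0] by simp
  have "integral {0..x} f \<le> B + c * K" if x: "x \<ge> 0" for x
  proof (cases "x \<le> X")
    case True
    then show ?thesis using B(2)[OF x] c \<open>K \<ge> 0\<close> by (smt (verit) mult_nonneg_nonneg)
  next
    case False
    have "integral {X..x} f \<le> integral {X..x} (\<lambda>t. c * g t)"
      by (rule integral_le)
        (use X f_le in \<open>auto intro!: integrable_on_atLeast_subinterval continuous_intros cont_f cont_g\<close>)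
    also have "\<dots> = c * (integral {0..x} g - integral {0..X} g)"
      using integral_diff_atLeast[OF cont_g X, of x] False by simp
    also have "\<dots> \<le> c * K"
      using K[OF x] integral_nonneg[OF integrable_on_atLeast_subinterval[OF cont_g, of 0 X]] g_nonneg c
      by (intro mult_left_mono) auto
    finally show ?thesis using integral_diff_atLeast[OF cont_f X, of x] False B(2)[OF X] by auto
  qed
  then show ?thesis unfolding bounded_integral_def by blast
qed

lemma bounded_integral_tendsto:
  fixes f :: "real \<Rightarrow> real"
  assumes "continuous_on {0..} f" "\<And>x. x \<ge> 0 \<Longrightarrow> f x \<ge> 0" "bounded_integral f"
  obtains L where "((\<lambda>x. integral {0..x} f) \<longlongrightarrow> L) at_top" "\<And>x. 0 \<le> x \<Longrightarrow> integral {0..x} f \<le> L"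
proof -
  obtain K where "\<And>x. 0 \<le> x \<Longrightarrow> integral {0..x} f \<le> K" using assms(3) by (auto simp: bounded_integral_def)
  with integral_mono_upper[OF assms(1,2)] show ?thesis
    by (rule mono_bounded_tendsto_at_top[of 0 "\<lambda>x. integral {0..x} f"]) (auto intro: that)
qed

lemma bounded_integral_tail_le:
  fixes f :: "real \<Rightarrow> real"
  assumes f: "continuous_on {0..} f" "\<And>x. x \<ge> 0 \<Longrightarrow> f x \<ge> 0" "bounded_integral f" and "e > 0"
  obtains X where "X \<ge> 1" "\<And>x y. X \<le> x \<Longrightarrow> x \<le> y \<Longrightarrow> integral {x..y} f \<le> e"
proof -
  obtain L where L: "((\<lambda>x. integral {0..x} f) \<longlongrightarrow> L) at_top" "\<And>x. 0 \<le> x \<Longrightarrow> integral {0..x} f \<le> L"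
    using bounded_integral_tendsto[OF f] by blast
  have "\<forall>\<^sub>F x in at_top. integral {0..x} f > L - e" using order_tendstoD(1)[OF L(1)] \<open>e > 0\<close> by simp
  then obtain X where X: "\<And>x. x \<ge> X \<Longrightarrow> integral {0..x} f > L - e"
    unfolding eventually_at_top_linorder by auto
  show ?thesis
  proof (rule that[of "max X 1"])
    fix x y assume xy: "max X 1 \<le> x" "x \<le> y"
    have "integral {x..y} f = integral {0..y} f - integral {0..x} f"
      using integral_diff_atLeast[OF f(1), of x y] xy by simp
    then show "integral {x..y} f \<le> e" using X[of x] L(2)[of y] xy by simp
  qed simp
qed

lemma integral_tendsto_if_abs_bounded:
  assumes cont: "continuous_on {0..} f" and bounded: "bounded_integral (\<lambda>x. \<bar>f x\<bar>)"
  obtains L where "((\<lambda>x. integral {0..x} f) \<longlongrightarrow> L) at_top"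
proof -
  have cont_abs: "continuous_on {0..} (\<lambda>x. \<bar>f x\<bar>)" and cont_sum: "continuous_on {0..} (\<lambda>x. \<bar>f x\<bar> + f x)"
    by (intro continuous_intros cont)+
  have sum: "integral {0..x} (\<lambda>x. \<bar>f x\<bar> + f x) = integral {0..x} (\<lambda>x. \<bar>f x\<bar>) + integral {0..x} f" for x
    by (rule Henstock_Kurzweil_Integration.integral_add)
      (auto intro!: integrable_on_atLeast_subinterval cont_abs cont)
  have bounded_sum: "bounded_integral (\<lambda>x. \<bar>f x\<bar> + f x)"
    by (rule bounded_integral_comparison[OF cont_sum cont_abs _ _ order_refl _ bounded, of 2]) auto
  have "0 \<le> \<bar>f x\<bar> + f x" for x by (simp add: abs_if)
  then obtain L1 where "((\<lambda>x. integral {0..x} (\<lambda>x. \<bar>f x\<bar> + f x)) \<longlongrightarrow> L1) at_top"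
    by (rule bounded_integral_tendsto[OF cont_sum _ bounded_sum])
  moreover obtain L2 where "((\<lambda>x. integral {0..x} (\<lambda>x. \<bar>f x\<bar>)) \<longlongrightarrow> L2) at_top"
    by (rule bounded_integral_tendsto[OF cont_abs abs_ge_zero bounded])
  ultimately have "((\<lambda>x. integral {0..x} (\<lambda>x. \<bar>f x\<bar> + f x) - integral {0..x} (\<lambda>x. \<bar>f x\<bar>))
      \<longlongrightarrow> L1 - L2) at_top"
    by (rule tendsto_diff)
  then show ?thesis using that sum by simp
qed

locale string_coefficients =
  fixes s m :: "real \<Rightarrow> real"
begin

definition scale :: "real \<Rightarrow> real" where "scale x = integral {0..x} s"

definition sol :: "real \<Rightarrow> real \<Rightarrow> real" where "sol lam = string_sol s (\<lambda>t. lam * m t)"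

definition slope :: "real \<Rightarrow> real \<Rightarrow> real" where "slope lam = string_slope s (\<lambda>t. lam * m t)"

definition slope_positive :: "real \<Rightarrow> bool" where "slope_positive lam \<longleftrightarrow> (\<forall>x\<ge>0. slope lam x > 0)"

definition trace_class :: bool where "trace_class \<longleftrightarrow> bounded_integral (\<lambda>t. scale t * m t)"

definition eigenvalue :: "real \<Rightarrow> bool" where
  "eigenvalue lam \<longleftrightarrow> lam \<noteq> 0 \<and> bounded_integral (\<lambda>t. \<bar>sol lam t\<bar> * m t) \<and>
     bounded_integral (\<lambda>t. (sol lam t)\<^sup>2 * m t) \<and> (slope lam \<longlongrightarrow> 0) at_top"

end

locale string_equation = string_coefficients +
  assumes cont_s: "continuous_on {0..} s" and cont_m: "continuous_on {0..} m"
    and s_pos: "\<And>x. x \<ge> 0 \<Longrightarrow> s x > 0" and m_pos: "\<And>x. x \<ge> 0 \<Longrightarrow> m x > 0"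
begin

lemma cont_potential: "continuous_on {0..} (\<lambda>t. lam * m t)" by (intro continuous_intros cont_m)

lemma cont_sol: "continuous_on {0..} (sol lam)"
  unfolding sol_def by (rule continuous_string_sol[OF cont_s cont_potential])

lemma cont_slope: "continuous_on {0..} (slope lam)"
  unfolding slope_def by (rule continuous_string_slope[OF cont_s cont_potential])

lemma cont_scale: "continuous_on {0..} scale"
  unfolding scale_def[abs_def] by (rule continuous_on_integral_upper[OF cont_s])

lemmas cont_facts = cont_s cont_m cont_sol cont_slope cont_scale

lemma solves_system_sol: "solves_system s (\<lambda>t. lam * m t) (sol lam) (slope lam)"
  unfolding sol_def slope_def by (rule solves_system_string_sol[OF cont_s cont_potential])

lemma sol_0 [simp]: "sol lam 0 = 0" and slope_0 [simp]: "slope lam 0 = 1"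
  and scale_0 [simp]: "scale 0 = 0"
  unfolding sol_def slope_def scale_def
  using string_sol_0[OF cont_s cont_potential] string_slope_0[OF cont_s cont_potential] by auto

lemma DERIV_scale: "x > 0 \<Longrightarrow> DERIV scale x :> s x"
  unfolding scale_def[abs_def] by (rule DERIV_integral_upper[OF cont_s])

lemma DERIV_sol: "x > 0 \<Longrightarrow> DERIV (sol lam) x :> s x * slope lam x"
  using solves_systemD(3)[OF solves_system_sol] .

lemma DERIV_slope: "x > 0 \<Longrightarrow> DERIV (slope lam) x :> - (lam * m x * sol lam x)"
  using solves_systemD(4)[OF solves_system_sol] by simp

lemma scale_strict_mono: "0 \<le> x \<Longrightarrow> x < y \<Longrightarrow> scale x < scale y"
  by (rule DERIV_pos_imp_less[where F'=s], simp, rule continuous_on_subset[OF cont_scale], simp,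
      rule DERIV_scale)
    (auto intro: s_pos)

lemma scale_mono: "0 \<le> x \<Longrightarrow> x \<le> y \<Longrightarrow> scale x \<le> scale y"
  using scale_strict_mono[of x y] by (cases "x = y") auto

lemma scale_pos: "x > 0 \<Longrightarrow> scale x > 0" using scale_strict_mono[of 0 x] by simp

lemma scale_nonneg: "x \<ge> 0 \<Longrightarrow> scale x \<ge> 0" using scale_mono[of 0 x] by simp

lemma scale_diff: "0 \<le> x \<Longrightarrow> x \<le> y \<Longrightarrow> scale y - scale x = integral {x..y} s"
  unfolding scale_def by (rule integral_diff_atLeast[OF cont_s])

lemma cont_scale_m: "continuous_on {0..} (\<lambda>t. scale t * m t)" by (intro continuous_intros cont_facts)

lemma scale_m_nonneg: "t \<ge> 0 \<Longrightarrow> scale t * m t \<ge> 0" using scale_nonneg m_pos by (simp add: less_imp_le)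

lemma sol_eq_scale_slope:
  assumes "x \<ge> 0"
  shows "sol lam x = scale x * slope lam x + lam * integral {0..x} (\<lambda>t. scale t * sol lam t * m t)"
proof -
  have "integral {0..x} (\<lambda>t. - (lam * (scale t * sol lam t * m t)))
      = (scale x * slope lam x - sol lam x) - (scale 0 * slope lam 0 - sol lam 0)"
    by (rule integral_of_DERIV)
      (use assms in
          \<open>auto intro!: continuous_intros cont_facts derivative_eq_intros DERIV_scale DERIV_sol DERIV_slope\<close>)
  then show ?thesis by simp
qed

lemma slope_diff:
  assumes "0 \<le> x" "x \<le> y"
  shows "slope lam x - slope lam y = lam * integral {x..y} (\<lambda>t. sol lam t * m t)"
  using solves_system_increment(2)[OF solves_system_sol assms, of lam] by (simp add: ac_simps)

lemma sol_diff:
  assumes "0 \<le> x" "x \<le> y"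
  shows "sol lam y - sol lam x = integral {x..y} (\<lambda>t. s t * slope lam t)"
  using solves_system_increment(1)[OF solves_system_sol assms, of lam] by simp

lemma eigenvalue_pos:
  assumes "eigenvalue lam"
  shows "lam > 0"
proof (rule ccontr)
  assume "\<not> lam > 0"
  then have "slope lam x \<ge> 1" if "x \<ge> 0" for x
    unfolding slope_def
    using string_slope_ge_1_if_nonpos[OF cont_s cont_potential s_pos _ that, of lam] m_pos
    by (simp add: mult_nonpos_nonneg less_imp_le)
  then have "\<forall>\<^sub>F x in at_top. slope lam x \<ge> 1" using eventually_ge_at_top[of 0]
    by (rule eventually_mono[rotated])
  moreover have "\<forall>\<^sub>F x in at_top. slope lam x < 1"
    using assms unfolding eigenvalue_def by (auto intro: order_tendstoD)
  ultimately have "\<forall>\<^sub>F x::real in at_top. False" by eventually_elim auto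
  then show False by simp
qed

lemma sol_slope_before_zero:
  assumes lam: "lam > 0" and pos: "\<And>x. 0 \<le> x \<Longrightarrow> x < X \<Longrightarrow> slope lam x > 0" and xy: "0 \<le> x" "x \<le> y" "y \<le> X"
  shows "slope lam y \<le> slope lam x" "sol lam x \<ge> 0" "sol lam x \<le> sol lam y" "slope lam x \<le> 1"
    "sol lam x \<le> scale x" "0 < x \<Longrightarrow> sol lam x > 0"
proof -
  have sol_mono: "sol lam a \<le> sol lam b" if "0 \<le> a" "a \<le> b" "b \<le> X" for a b
  proof (rule DERIV_nonneg_imp_le[OF that(2)])
    fix t assume t: "a < t" "t < b"
    show "DERIV (sol lam) t :> s t * slope lam t" by (rule DERIV_sol) (use t that in auto)
    have "s t > 0" "slope lam t > 0" using t that pos[of t] s_pos[of t] by auto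
    then show "s t * slope lam t \<ge> 0" by simp
  qed (use that in \<open>auto intro!: continuous_on_subset[OF cont_sol]\<close>)
  have sol_nonneg: "sol lam a \<ge> 0" if "0 \<le> a" "a \<le> X" for a using sol_mono[of 0 a] that by simp
  have slope_antimono: "slope lam b \<le> slope lam a" if "0 \<le> a" "a \<le> b" "b \<le> X" for a b
  proof (rule DERIV_nonpos_imp_ge[OF that(2)])
    fix t assume t: "a < t" "t < b"
    show "DERIV (slope lam) t :> - (lam * m t * sol lam t)" by (rule DERIV_slope) (use t that in auto)
    have "m t > 0" "sol lam t \<ge> 0" using t that sol_nonneg[of t] m_pos[of t] by auto
    then show "- (lam * m t * sol lam t) \<le> 0" using lam by simp
  qed (use that in \<open>auto intro!: continuous_on_subset[OF cont_slope]\<close>)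
  show "slope lam y \<le> slope lam x" "sol lam x \<ge> 0" "sol lam x \<le> sol lam y"
    using slope_antimono sol_mono sol_nonneg xy by auto
  show "slope lam x \<le> 1" using slope_antimono[of 0 x] xy by simp
  have "scale 0 - sol lam 0 \<le> scale x - sol lam x"
  proof (rule DERIV_nonneg_imp_le[where F="\<lambda>t. scale t - sol lam t"
        and F'="\<lambda>t. s t - s t * slope lam t"])
    fix t assume t: "0 < t" "t < x"
    show "DERIV (\<lambda>t. scale t - sol lam t) t :> s t - s t * slope lam t"
      using t by (intro derivative_intros DERIV_scale DERIV_sol)
    have "slope lam t \<le> 1" using slope_antimono[of 0 t] t xy by simp
    then show "s t - s t * slope lam t \<ge> 0" using s_pos[of t] t by (simp add: mult_left_le)
  qed (use xy in
      \<open>auto intro!: continuous_intros continuous_on_subset[OF cont_scale] continuous_on_subset[OF cont_sol]\<close>)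
  then show "sol lam x \<le> scale x" by simp
  show "sol lam x > 0" if "0 < x"
    using solves_system_strict_increasing[OF solves_system_sol, of 0 x lam] that pos s_pos xy by simp
qed

lemma slope_positiveD:
  assumes "lam > 0" "slope_positive lam" "0 \<le> x" "x \<le> y"
  shows "slope lam y \<le> slope lam x" "sol lam x \<ge> 0" "sol lam x \<le> sol lam y" "slope lam x \<le> 1"
    "sol lam x \<le> scale x" "0 < x \<Longrightarrow> sol lam x > 0"
  using sol_slope_before_zero[OF assms(1), of y x y] assms unfolding slope_positive_def by auto

lemma slope_positive_if_tail_small:
  assumes lam: "lam > 0" and X: "X \<ge> 0" and pos: "\<And>x. 0 \<le> x \<Longrightarrow> x \<le> X \<Longrightarrow> slope lam x > 0"
    and tail: "\<And>y. y \<ge> X \<Longrightarrow> lam * integral {X..y} (\<lambda>t. scale t * m t) < slope lam X"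
  shows "slope_positive lam"
  unfolding slope_positive_def
proof (rule ccontr)
  assume "\<not> (\<forall>x\<ge>0. slope lam x > 0)"
  then obtain b where b: "b \<ge> 0" "slope lam b \<le> 0" by force
  then have "X \<le> b" using pos[of b] by (cases "X \<le> b") auto
  then obtain c where c: "X < c" "c \<le> b" "slope lam c = 0" "\<And>x. X \<le> x \<Longrightarrow> x < c \<Longrightarrow> slope lam x > 0"
    using first_zero[of X b "slope lam"] b pos[of X] X continuous_on_subset[OF cont_slope,
        of "{X..b}"] by auto
  have pos_before: "slope lam x > 0" if "0 \<le> x" "x < c" for x
    using pos[of x] c(4)[of x] that by (cases "x \<le> X") auto
  have "integral {X..c} (\<lambda>t. sol lam t * m t) \<le> integral {X..c} (\<lambda>t. scale t * m t)"
  proof (rule integral_le)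
    fix t assume t: "t \<in> {X..c}"
    show "sol lam t * m t \<le> scale t * m t"
      using sol_slope_before_zero(5)[OF lam pos_before, of c t c] t X m_pos[of t]
      by (intro mult_right_mono) auto
  qed (use X in \<open>auto intro!: integrable_on_atLeast_subinterval continuous_intros cont_facts\<close>)
  then have "lam * integral {X..c} (\<lambda>t. sol lam t * m t)
      \<le> lam * integral {X..c} (\<lambda>t. scale t * m t)" using lam by simp
  then show False using slope_diff[of X c lam] c X tail[of c] by auto
qed

lemma slope_positive_antimono:
  assumes "slope_positive l2" "l1 \<le> l2" "l2 > 0"
  shows "slope_positive l1"
  unfolding slope_positive_def
proof (intro allI impI)
  fix x :: real assume x: "x \<ge> 0"
  show "slope l1 x > 0"
  proof (cases "x = 0")
    case False
    have potential_le: "l1 * m t \<le> l2 * m t" if "t \<ge> 0" for t using m_pos[OF that] assms by simp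
    have sol2_pos: "string_sol s (\<lambda>t. l2 * m t) t > 0" if "t > 0" for t
      using slope_positiveD(6)[OF assms(3,1), of t t] that by (simp add: sol_def)
    have "wronskian s (\<lambda>t. l1 * m t) (\<lambda>t. l2 * m t) x \<ge> 0"
      using wronskian_nonneg[OF cont_s cont_potential cont_potential s_pos potential_le sol2_pos,
          of x x] x by simp
    then have "sol l2 x * slope l1 x \<ge> sol l1 x * slope l2 x"
      by (simp add: wronskian_def sol_def slope_def)
    moreover have "sol l1 x > 0"
      using sturm_sol_pos[OF cont_s cont_potential cont_potential s_pos potential_le sol2_pos,
          of x x] x False
      by (simp add: sol_def)
    then have "sol l1 x * slope l2 x > 0" using assms x by (simp add: slope_positive_def)
    ultimately have "sol l2 x * slope l1 x > 0" by linarith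
    then show ?thesis using sol2_pos[of x] x False by (simp add: sol_def zero_less_mult_iff)
  qed simp
qed

lemma trace_class_tail:
  assumes trace_class "e > 0"
  obtains X where "X \<ge> 1" "\<And>x y. X \<le> x \<Longrightarrow> x \<le> y \<Longrightarrow> integral {x..y} (\<lambda>t. scale t * m t) \<le> e"
  using bounded_integral_tail_le[OF cont_scale_m scale_m_nonneg] assms
  unfolding trace_class_def by blast

context
  fixes lam
  assumes lam: "lam > 0" and slope_pos: "slope_positive lam"
begin

lemma scale_slope_le_sol:
  assumes "x \<ge> 0"
  shows "scale x * slope lam x \<le> sol lam x"
proof -
  have "0 \<le> integral {0..x} (\<lambda>t. scale t * sol lam t * m t)"
  proof (rule integral_nonneg)
    fix t assume "t \<in> {0..x}"
    then show "0 \<le> scale t * sol lam t * m t"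
      using scale_nonneg[of t] slope_positiveD(2)[OF lam slope_pos, of t x] m_pos[of t] by simp
  qed (auto intro!: integrable_on_atLeast_subinterval continuous_intros cont_facts)
  then show ?thesis using sol_eq_scale_slope[OF assms, of lam] lam by simp
qed

text \<open>The solution is concave in the scale.\<close>

lemma sol_over_scale_antimono:
  assumes "0 < x" "x \<le> y"
  shows "sol lam y / scale y \<le> sol lam x / scale x"
proof (rule DERIV_nonpos_imp_ge[OF assms(2)])
  have "scale t \<noteq> 0" if "t \<in> {x..y}" for t using scale_pos[of t] that assms by auto
  then show "continuous_on {x..y} (\<lambda>x. sol lam x / scale x)" using assms
    by (intro continuous_intros continuous_on_subset[OF cont_sol]
        continuous_on_subset[OF cont_scale]) auto
  fix t assume t: "x < t" "t < y"
  show "DERIV (\<lambda>x. sol lam x / scale x) t :>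
      (s t * slope lam t * scale t - sol lam t * s t) / (scale t * scale t)"
    by (rule DERIV_divide[OF DERIV_sol DERIV_scale]) (use t assms scale_pos[of t] in auto)
  have "s t * (scale t * slope lam t) \<le> s t * sol lam t"
    using scale_slope_le_sol[of t] s_pos[of t] t assms by simp
  then show "(s t * slope lam t * scale t - sol lam t * s t) / (scale t * scale t) \<le> 0"
    by (intro divide_nonpos_nonneg) (auto simp: algebra_simps)
qed

lemma slope_le_half_sol_over_scale:
  assumes lim: "(slope lam \<longlongrightarrow> 0) at_top" and x: "x > 0"
    and tail: "\<And>y. x \<le> y \<Longrightarrow> integral {x..y} (\<lambda>t. scale t * m t) \<le> 1 / (2 * lam)"
  shows "slope lam x \<le> sol lam x / (2 * scale x)"
proof (rule tendsto_upperbound[where F=at_top and f="\<lambda>y. slope lam x - slope lam y"])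
  show "((\<lambda>y. slope lam x - slope lam y) \<longlongrightarrow> slope lam x) at_top"
    using tendsto_diff[OF tendsto_const lim, of "slope lam x"] by simp
  let ?r = "sol lam x / scale x"
  have "?r \<ge> 0" using slope_positiveD(2)[OF lam slope_pos, of x x] scale_pos[OF x] x by simp
  show "\<forall>\<^sub>F y in at_top. slope lam x - slope lam y \<le> sol lam x / (2 * scale x)"
    using eventually_ge_at_top[of x]
  proof eventually_elim
    case (elim y)
    have "integral {x..y} (\<lambda>t. sol lam t * m t) \<le> integral {x..y} (\<lambda>t. ?r * (scale t * m t))"
    proof (rule integral_le)
      fix t assume t: "t \<in> {x..y}"
      have "sol lam t \<le> ?r * scale t"
        using sol_over_scale_antimono[of x t] t x scale_pos[of t] scale_pos[of x]
        by (simp add: field_simps)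
      then have "sol lam t * m t \<le> ?r * scale t * m t" using m_pos[of t] t x
        by (intro mult_right_mono) auto
      then show "sol lam t * m t \<le> ?r * (scale t * m t)" by (simp add: mult.assoc)
    qed (use x scale_pos[OF x] in
        \<open>auto intro!: integrable_on_atLeast_subinterval continuous_intros cont_facts\<close>)
    also have "\<dots> = ?r * integral {x..y} (\<lambda>t. scale t * m t)" by simp
    also have "\<dots> \<le> ?r * (1 / (2 * lam))" using tail[OF elim] \<open>?r \<ge> 0\<close> by (intro mult_left_mono) auto
    finally have "lam * integral {x..y} (\<lambda>t. sol lam t * m t) \<le> lam * (?r * (1 / (2 * lam)))"
      using lam by (intro mult_left_mono) auto
    also have "\<dots> = sol lam x / (2 * scale x)" using lam by (simp add: field_simps)
    finally show ?case using slope_diff[of x y lam] x elim by simp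
  qed
qed simp

lemma sol_square_over_scale_antimono:
  assumes half: "\<And>t. x \<le> t \<Longrightarrow> slope lam t \<le> sol lam t / (2 * scale t)" and "0 < x" "x \<le> y"
  shows "(sol lam y)\<^sup>2 / scale y \<le> (sol lam x)\<^sup>2 / scale x"
proof (rule DERIV_nonpos_imp_ge[OF \<open>x \<le> y\<close>])
  let ?D = "\<lambda>t.
      (2 * sol lam t * (s t * slope lam t) * scale t - (sol lam t)\<^sup>2 * s t) / (scale t * scale t)"
  have "scale t \<noteq> 0" if "t \<in> {x..y}" for t using scale_pos[of t] that assms by auto
  then show "continuous_on {x..y} (\<lambda>x. (sol lam x)\<^sup>2 / scale x)" using assms
    by (intro continuous_intros continuous_on_subset[OF cont_sol]
        continuous_on_subset[OF cont_scale]) auto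
  fix t assume t: "x < t" "t < y"
  then have "t > 0" using assms by simp
  then have "DERIV (\<lambda>x. (sol lam x)\<^sup>2) t :> 2 * sol lam t * (s t * slope lam t)"
    by (auto intro!: derivative_eq_intros DERIV_sol)
  from DERIV_divide[OF this DERIV_scale[OF \<open>t > 0\<close>]] scale_pos[OF \<open>t > 0\<close>]
  show "DERIV (\<lambda>x. (sol lam x)\<^sup>2 / scale x) t :> ?D t" by simp
  have "2 * slope lam t * scale t \<le> sol lam t" using half[of t] t scale_pos[OF \<open>t > 0\<close>]
    by (simp add: field_simps)
  then have "(s t * sol lam t) * (2 * slope lam t * scale t) \<le> (s t * sol lam t) * sol lam t"
    using s_pos[of t] slope_positiveD(2)[OF lam slope_pos, of t t] \<open>t > 0\<close>
    by (intro mult_left_mono) auto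
  then show "?D t \<le> 0" by (intro divide_nonpos_nonneg) (auto simp: algebra_simps power2_eq_square)
qed

lemma sol_square_le_scale:
  assumes trace_class and lim: "(slope lam \<longlongrightarrow> 0) at_top"
  obtains C X where "C > 0" "X \<ge> 1" "\<And>x. x \<ge> X \<Longrightarrow> (sol lam x)\<^sup>2 \<le> C * scale x"
proof -
  have "1 / (2 * lam) > 0" using lam by simp
  then obtain X where X: "X \<ge> 1"
    and tail: "\<And>x y. X \<le> x \<Longrightarrow> x \<le> y \<Longrightarrow> integral {x..y} (\<lambda>t. scale t * m t) \<le> 1 / (2 * lam)"
    using trace_class_tail[OF assms(1)] by blast
  show ?thesis
  proof (rule that[of "(sol lam X)\<^sup>2 / scale X" X])
    show "(sol lam X)\<^sup>2 / scale X > 0"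
      using slope_positiveD(6)[OF lam slope_pos, of X X] X scale_pos[of X] by simp
    fix x assume x: "x \<ge> X"
    have "slope lam t \<le> sol lam t / (2 * scale t)" if "X \<le> t" for t
      using slope_le_half_sol_over_scale[OF lim] tail that X by simp
    then have "(sol lam x)\<^sup>2 / scale x \<le> (sol lam X)\<^sup>2 / scale X"
      using X x by (intro sol_square_over_scale_antimono) auto
    then show "(sol lam x)\<^sup>2 \<le> (sol lam X)\<^sup>2 / scale X * scale x" using scale_pos[of x] x X
      by (simp add: field_simps)
  qed (rule X)
qed

context
  fixes l w
  assumes l_pos: "l > 0" and slope_pos_l: "slope_positive l" and w: "w > 0"
    and wronskian_ge: "\<And>x. x \<ge> 1 \<Longrightarrow> w \<le> sol lam x * slope l x - sol l x * slope lam x"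
begin

lemma slope_not_tendsto_0_if_scale_bounded:
  assumes B: "\<And>x. x \<ge> 0 \<Longrightarrow> scale x \<le> B"
  shows "\<not> (slope l \<longlongrightarrow> 0) at_top"
proof
  assume "(slope l \<longlongrightarrow> 0) at_top"
  have "B > 0" using B[of 1] scale_pos[of 1] by simp
  then have "\<forall>\<^sub>F x in at_top. slope l x < w / B"
    using order_tendstoD(2)[OF \<open>(slope l \<longlongrightarrow> 0) at_top\<close>] w by simp
  moreover have "\<forall>\<^sub>F x in at_top. slope l x \<ge> w / B"
    using eventually_ge_at_top[of 1]
  proof eventually_elim
    case (elim x)
    have slopes: "slope lam x > 0" "slope l x > 0" using slope_pos slope_pos_l elim
      by (auto simp: slope_positive_def)
    have "sol l x * slope lam x \<ge> 0"
      using slope_positiveD(2)[OF l_pos slope_pos_l, of x x] slopes elim by simp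
    then have "w \<le> sol lam x * slope l x" using wronskian_ge[OF elim] by simp
    also have "\<dots> \<le> B * slope l x"
      using slope_positiveD(5)[OF lam slope_pos, of x x] B[of x] elim slopes
      by (intro mult_right_mono) auto
    finally show ?case using \<open>B > 0\<close> by (simp add: field_simps)
  qed
  ultimately have "\<forall>\<^sub>F x::real in at_top. False" by eventually_elim auto
  then show False by simp
qed

lemma sol_ratio_ln_scale_antimono:
  assumes C: "C > 0" and sq: "\<And>t. t \<ge> X \<Longrightarrow> (sol l t)\<^sup>2 \<le> C * scale t" and x: "1 \<le> X" "X \<le> x"
  shows "sol lam x / sol l x + w / C * ln (scale x) \<le> sol lam X / sol l X + w / C * ln (scale X)"
proof (rule DERIV_nonpos_imp_ge[OF x(2)])
  let ?D = "\<lambda>t. (s t * slope lam t * sol l t - sol lam t * (s t * slope l t)) / (sol l t * sol l t)"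
  have pos: "sol l t > 0" "scale t > 0" if "t \<ge> X" for t
    using slope_positiveD(6)[OF l_pos slope_pos_l, of t t] scale_pos[of t] that x by auto
  show "continuous_on {X..x} (\<lambda>x. sol lam x / sol l x + w / C * ln (scale x))"
    by (intro continuous_intros continuous_on_subset[OF cont_sol] continuous_on_subset[OF cont_scale])
      (use x pos in \<open>auto simp: less_le\<close>)
  fix t assume t: "X < t" "t < x"
  then have "t > 0" "t \<ge> X" using x by auto
  note pos = pos[OF \<open>t \<ge> X\<close>]
  have "DERIV (\<lambda>x. sol lam x / sol l x) t :> ?D t"
    by (rule DERIV_divide[OF DERIV_sol DERIV_sol]) (use pos \<open>t > 0\<close> in auto)
  moreover have "DERIV (\<lambda>x. w / C * ln (scale x)) t :> w / C * (s t / scale t)"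
    using pos C by (auto intro!: derivative_eq_intros DERIV_scale \<open>t > 0\<close> simp: field_simps)
  ultimately show "DERIV (\<lambda>x. sol lam x / sol l x + w / C * ln (scale x)) t :>
      ?D t + w / C * (s t / scale t)"
    by (rule DERIV_add)
  have "?D t = - (s t * (sol lam t * slope l t - sol l t * slope lam t)) / (sol l t)\<^sup>2"
    by (simp add: algebra_simps power2_eq_square)
  also have "\<dots> \<le> - (s t * w) / (sol l t)\<^sup>2"
    using wronskian_ge[of t] t x s_pos[of t] \<open>t > 0\<close> by (intro divide_right_mono) auto
  also have "\<dots> \<le> - (s t * w) / (C * scale t)"
    using divide_left_mono[OF sq[OF \<open>t \<ge> X\<close>], of "s t * w"] s_pos[of t] \<open>t > 0\<close> w pos C by simp
  finally show "?D t + w / C * (s t / scale t) \<le> 0" by (simp add: mult.commute)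
qed

lemma scale_bounded_if_sol_square_le_scale:
  assumes C: "C > 0" and sq: "\<And>t. t \<ge> X \<Longrightarrow> (sol l t)\<^sup>2 \<le> C * scale t" and X: "1 \<le> X"
  obtains B where "\<And>x. x \<ge> 0 \<Longrightarrow> scale x \<le> B"
proof -
  let ?F = "sol lam X / sol l X + w / C * ln (scale X)"
  have late: "scale x \<le> exp (?F * C / w)" if x: "x \<ge> X" for x
  proof -
    have "sol lam x / sol l x \<ge> 0"
      using slope_positiveD(2)[OF lam slope_pos, of x x] slope_positiveD(2)[OF l_pos slope_pos_l,
          of x x] x X by simp
    then have "w / C * ln (scale x) \<le> ?F" using sol_ratio_ln_scale_antimono[OF C sq X x] by linarith
    then have "(w / C * ln (scale x)) * (C / w) \<le> ?F * (C / w)" using w C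
      by (intro mult_right_mono) auto
    then have "ln (scale x) \<le> ?F * C / w" using w C by simp
    then have "exp (ln (scale x)) \<le> exp (?F * C / w)" by (simp only: exp_le_cancel_iff)
    then show ?thesis using scale_pos[of x] x X by simp
  qed
  have "scale x \<le> exp (?F * C / w)" if "x \<ge> 0" for x
    using late[of "max x X"] scale_mono[of x "max x X"] that by simp
  then show ?thesis by (rule that)
qed

end

end

lemma no_eigenvalue_below:
  assumes trace_class and pos: "slope_positive lam" and eigen: "eigenvalue l"
  shows "lam \<le> l"
proof (rule ccontr)
  assume "\<not> lam \<le> l"
  then have less: "l < lam" by simp
  have l: "l > 0" by (rule eigenvalue_pos[OF eigen])
  have lam: "lam > 0" using l less by simp
  have pos_l: "slope_positive l" using slope_positive_antimono[OF pos _ lam] less by simp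
  have lim: "(slope l \<longlongrightarrow> 0) at_top" using eigen by (simp add: eigenvalue_def)
  have potential_less: "l * m t < lam * m t" if "t \<ge> 0" for t using m_pos[OF that] less by simp
  have "string_sol s (\<lambda>t. lam * m t) t > 0" if "t > 0" for t
    using slope_positiveD(6)[OF lam pos, of t t] that by (simp add: sol_def)
  then obtain w where "w > 0" "\<And>x. x \<ge> 1 \<Longrightarrow> wronskian s (\<lambda>t. l * m t) (\<lambda>t. lam * m t) x \<ge> w"
    using wronskian_bounded_below[OF cont_s cont_potential cont_potential s_pos
        less_imp_le[OF potential_less]]
      potential_less by (metis less_imp_le)
  then have w: "w > 0" "\<And>x. x \<ge> 1 \<Longrightarrow> w \<le> sol lam x * slope l x - sol l x * slope lam x"
    by (simp_all add: wronskian_def sol_def slope_def)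
  obtain C X where "C > 0" "X \<ge> 1" "\<And>x. x \<ge> X \<Longrightarrow> (sol l x)\<^sup>2 \<le> C * scale x"
    using sol_square_le_scale[OF l pos_l \<open>trace_class\<close> lim] by blast
  then obtain B where "\<And>x. x \<ge> 0 \<Longrightarrow> scale x \<le> B"
    using scale_bounded_if_sol_square_le_scale[OF lam pos l pos_l w] by metis
  then show False using slope_not_tendsto_0_if_scale_bounded[OF lam pos l pos_l w] lim by blast
qed

lemma sol_slope_uniform_limit:
  assumes "l \<longlonglongrightarrow> lam" "X \<ge> 0"
  shows "uniform_limit {0..X} (\<lambda>n. sol (l n)) (sol lam) sequentially"
    "uniform_limit {0..X} (\<lambda>n. slope (l n)) (slope lam) sequentially"
proof -
  obtain B where B: "B > 0" "\<And>n. norm (l n) \<le> B"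
    using convergent_imp_Bseq[OF convergentI[OF assms(1)]] by (auto simp: Bseq_def)
  obtain K where K: "K > 0" "\<And>t. 0 \<le> t \<Longrightarrow> t \<le> X \<Longrightarrow> \<bar>s t\<bar> \<le> K" "\<And>t. 0 \<le> t \<Longrightarrow> t \<le> X \<Longrightarrow> \<bar>m t\<bar> \<le> K"
    using continuous_on_atLeast_bounded_Icc2[OF cont_s cont_m] by metis
  have bounds: "\<bar>s t\<bar> \<le> K + B * K" "\<bar>l n * m t\<bar> \<le> K + B * K" if "0 \<le> t" "t \<le> X" for n t
  proof -
    have "B * K > 0" using B K by simp
    then show "\<bar>s t\<bar> \<le> K + B * K" using K(2)[OF that] by linarith
    have "\<bar>l n\<bar> * \<bar>m t\<bar> \<le> B * K" using B(2)[of n] K(3)[OF that] B(1) by (intro mult_mono) auto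
    then show "\<bar>l n * m t\<bar> \<le> K + B * K" using K(1) by (simp add: abs_mult)
  qed
  have "(\<lambda>n. l n * m t) \<longlonglongrightarrow> lam * m t" for t by (intro tendsto_intros assms)
  note limits = string_sol_uniform_limit[OF cont_s cont_potential[of lam] cont_s
      cont_potential[of "l _"]
      bounds tendsto_const this assms(2)]
  show "uniform_limit {0..X} (\<lambda>n. sol (l n)) (sol lam) sequentially"
    "uniform_limit {0..X} (\<lambda>n. slope (l n)) (slope lam) sequentially"
    unfolding sol_def slope_def using limits by simp_all
qed

lemma exists_slope_positive:
  assumes trace_class
  obtains l where "l > 0" "slope_positive l"
proof -
  obtain K where K: "\<And>x. x \<ge> 0 \<Longrightarrow> integral {0..x} (\<lambda>t. scale t * m t) \<le> K"
    using assms by (auto simp: trace_class_def bounded_integral_def)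
  have "K \<ge> 0" using K[of 0] by simp
  define l where "l = 1 / (2 * (K + 1))"
  have "l > 0" using \<open>K \<ge> 0\<close> by (simp add: l_def)
  moreover have "slope_positive l"
  proof (rule slope_positive_if_tail_small[OF \<open>l > 0\<close>, of 0])
    fix y :: real assume "y \<ge> 0"
    then have "l * integral {0..y} (\<lambda>t. scale t * m t) \<le> l * K" using K \<open>l > 0\<close> by simp
    also have "\<dots> < 1" using \<open>K \<ge> 0\<close> by (simp add: l_def field_simps)
    finally show "l * integral {0..y} (\<lambda>t. scale t * m t) < slope l 0" by simp
  qed auto
  ultimately show ?thesis by (rule that)
qed

lemma slope_positive_left_closed:
  assumes "L > 0" and below: "\<And>l. l < L \<Longrightarrow> slope_positive l"
  shows "slope_positive L"
proof (rule ccontr)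
  assume "\<not> slope_positive L"
  then obtain x where x: "x > 0" "slope L x < 0"
    unfolding slope_positive_def slope_def
    using exists_string_slope_neg[OF cont_s cont_potential s_pos, of L] m_pos \<open>L > 0\<close>
    by (metis mult_pos_pos)
  have "(\<lambda>n. L - 1 / real (Suc n)) \<longlonglongrightarrow> L - 0"
    using LIMSEQ_inverse_real_of_nat by (intro tendsto_diff tendsto_const) (simp add: inverse_eq_divide)
  then have "(\<lambda>n. slope (L - 1 / real (Suc n)) x) \<longlonglongrightarrow> slope L x"
    using tendsto_uniform_limitI[OF sol_slope_uniform_limit(2)[of _ L x]] x by simp
  from order_tendstoD(2)[OF this x(2)] obtain n where "slope (L - 1 / real (Suc n)) x < 0"
    by (auto simp: eventually_sequentially)
  moreover have "slope_positive (L - 1 / real (Suc n))" by (rule below) simp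
  ultimately show False using x(1) unfolding slope_positive_def by (metis less_imp_le less_asym)
qed

lemma slope_positive_right_open:
  assumes trace_class and "L > 0" and u: "u > 0" and slope_ge: "\<And>x. x \<ge> 0 \<Longrightarrow> u \<le> slope L x"
  obtains l where "l > L" "slope_positive l"
proof -
  define e where "e = u / (4 * (L + 1))"
  have e: "e > 0" using u \<open>L > 0\<close> by (simp add: e_def)
  obtain X where X: "X \<ge> 1" "\<And>x y. X \<le> x \<Longrightarrow> x \<le> y \<Longrightarrow> integral {x..y} (\<lambda>t. scale t * m t) \<le> e"
    using trace_class_tail[OF assms(1) e] by blast
  have "(\<lambda>n. L + 1 / real (Suc n)) \<longlonglongrightarrow> L + 0"
    using LIMSEQ_inverse_real_of_nat by (intro tendsto_add tendsto_const) (simp add: inverse_eq_divide)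
  then have "\<forall>\<^sub>F n in sequentially. \<forall>x\<in>{0..X}. dist (slope (L + 1 / real (Suc n)) x) (slope L x) < u / 2"
    using uniform_limitD[OF sol_slope_uniform_limit(2)[of _ L X], of _ "u / 2"] X u by simp
  then obtain n where n: "\<And>x. x \<in> {0..X} \<Longrightarrow> dist (slope (L + 1 / real (Suc n)) x) (slope L x) < u / 2"
    unfolding eventually_sequentially by blast
  define l where "l = L + 1 / real (Suc n)"
  have l: "l > L" "l \<le> L + 1" by (auto simp: l_def)
  have slope_l: "slope l x > u / 2" if "0 \<le> x" "x \<le> X" for x
    using n[of x] slope_ge[OF that(1)] that unfolding l_def dist_real_def
    by (smt (verit) field_sum_of_halves atLeastAtMost_iff)
  have "slope_positive l"
  proof (rule slope_positive_if_tail_small[of l X])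
    fix y assume y: "y \<ge> X"
    have "0 \<le> integral {X..y} (\<lambda>t. scale t * m t)"
      using X by (intro integral_nonneg integrable_on_atLeast_subinterval cont_scale_m
          scale_m_nonneg) auto
    then have "l * integral {X..y} (\<lambda>t. scale t * m t) \<le> (L + 1) * e"
      using X(2)[of X y] y l \<open>L > 0\<close> e by (intro mult_mono) auto
    also have "\<dots> = u / 4" using \<open>L > 0\<close> by (simp add: e_def field_simps)
    also have "\<dots> < slope l X" using slope_l[of X] X u by simp
    finally show "l * integral {X..y} (\<lambda>t. scale t * m t) < slope l X" .
  next
    fix x assume "0 \<le> x" "x \<le> X"
    then show "slope l x > 0" using slope_l[of x] u by simp
  qed (use l \<open>L > 0\<close> X in auto)
  with l(1) show ?thesis by (rule that)
qed

lemma slope_tendsto_if_slope_positive: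
  assumes "lam > 0" "slope_positive lam"
  obtains u where "(slope lam \<longlongrightarrow> u) at_top" "u \<ge> 0" "\<And>x. x \<ge> 0 \<Longrightarrow> u \<le> slope lam x"
proof -
  have pos: "slope lam x > 0" if "x \<ge> 0" for x using assms(2) that by (simp add: slope_positive_def)
  obtain nu where nu: "((\<lambda>x. - slope lam x) \<longlongrightarrow> nu) at_top" "\<And>x. 0 \<le> x \<Longrightarrow> - slope lam x \<le> nu"
    by (rule mono_bounded_tendsto_at_top[of 0 "\<lambda>x. - slope lam x" 0])
      (use slope_positiveD(1)[OF assms] pos in \<open>auto simp: less_imp_le\<close>)
  have lim: "(slope lam \<longlongrightarrow> - nu) at_top" using tendsto_minus[OF nu(1)] by simp
  show ?thesis
  proof (rule that[OF lim])
    show "- nu \<ge> 0"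
      by (rule tendsto_lowerbound[OF lim])
        (auto intro!: eventually_mono[OF eventually_ge_at_top[of 0]] less_imp_le[OF pos])
    show "- nu \<le> slope lam x" if "x \<ge> 0" for x using nu(2)[OF that] by simp
  qed
qed

lemma eigenvalue_if_slope_tendsto_0:
  assumes trace_class and lam: "lam > 0" and pos: "slope_positive lam" and lim: "(slope lam \<longlongrightarrow> 0) at_top"
  shows "eigenvalue lam"
proof -
  note facts = slope_positiveD[OF lam pos]
  have "bounded_integral (\<lambda>t. \<bar>sol lam t\<bar> * m t)"
    unfolding bounded_integral_def
  proof (intro exI allI impI)
    fix x :: real assume x: "x \<ge> 0"
    have "integral {0..x} (\<lambda>t. \<bar>sol lam t\<bar> * m t) = integral {0..x} (\<lambda>t. sol lam t * m t)"
      by (rule Henstock_Kurzweil_Integration.integral_cong) (use facts(2) in auto)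
    also have "\<dots> = (1 - slope lam x) / lam" using slope_diff[of 0 x lam] x lam by simp
    also have "\<dots> \<le> 1 / lam" using pos x lam
      by (intro divide_right_mono) (auto simp: slope_positive_def less_imp_le)
    finally show "integral {0..x} (\<lambda>t. \<bar>sol lam t\<bar> * m t) \<le> 1 / lam" .
  qed
  moreover obtain C X where CX: "C > 0" "X \<ge> 1" "\<And>x. x \<ge> X \<Longrightarrow> (sol lam x)\<^sup>2 \<le> C * scale x"
    using sol_square_le_scale[OF lam pos assms(1) lim] by blast
  have "bounded_integral (\<lambda>t. (sol lam t)\<^sup>2 * m t)"
  proof (rule bounded_integral_comparison[where g="\<lambda>t. scale t * m t" and c=C and X=X])
    show "(sol lam x)\<^sup>2 * m x \<le> C * (scale x * m x)" if "x \<ge> X" for x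
      using mult_right_mono[OF CX(3)[OF that], of "m x"] m_pos[of x] that CX(2)
      by (simp add: mult.assoc)
    show "bounded_integral (\<lambda>t. scale t * m t)" using assms(1) by (simp add: trace_class_def)
  qed (use CX in \<open>auto intro!: continuous_intros cont_facts scale_m_nonneg\<close>)
  ultimately show ?thesis using lim lam by (simp add: eigenvalue_def)
qed

text \<open>The supremum of the parameters with positive slope is an eigenvalue: if its slope had a
  positive limit, the parameter could be increased.\<close>

lemma exists_eigenvalue_below:
  assumes trace_class and lam: "lam > 0" and not_pos: "\<not> slope_positive lam"
  obtains l where "eigenvalue l" "l < lam"
proof -
  define A where "A = {l. l > 0 \<and> slope_positive l}"
  obtain l0 where l0: "l0 \<in> A" using exists_slope_positive[OF \<open>trace_class\<close>] unfolding A_def by blast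
  have A_less: "l < lam" if "l \<in> A" for l
    using slope_positive_antimono[of l lam] that not_pos by (force simp: A_def)
  have bdd: "bdd_above A" by (rule bdd_aboveI[of _ lam]) (use A_less in force)
  define L where "L = Sup A"
  have upper: "l \<le> L" if "l \<in> A" for l unfolding L_def by (rule cSup_upper[OF that bdd])
  have L_pos: "L > 0" using upper[OF l0] l0 by (auto simp: A_def)
  have "slope_positive l" if "l < L" for l
  proof -
    have "\<exists>a\<in>A. l < a" using that less_cSup_iff[OF _ bdd, of l] l0 unfolding L_def by blast
    then obtain a where "a \<in> A" "l < a" by blast
    then show ?thesis using slope_positive_antimono[of a l] by (auto simp: A_def)
  qed
  then have pos_L: "slope_positive L" by (rule slope_positive_left_closed[OF L_pos])
  then obtain u where u: "(slope L \<longlongrightarrow> u) at_top" "u \<ge> 0" "\<And>x. x \<ge> 0 \<Longrightarrow> u \<le> slope L x"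
    using slope_tendsto_if_slope_positive[OF L_pos] by blast
  have "\<not> u > 0"
  proof
    assume "u > 0"
    then obtain l where "l > L" "slope_positive l"
      using slope_positive_right_open[OF \<open>trace_class\<close> L_pos] u(3) by blast
    then show False using upper[of l] L_pos by (auto simp: A_def)
  qed
  then have "eigenvalue L" using eigenvalue_if_slope_tendsto_0[OF \<open>trace_class\<close> L_pos pos_L] u by simp
  moreover have "L < lam" using A_less pos_L L_pos by (simp add: A_def)
  ultimately show ?thesis by (rule that)
qed

lemma exists_not_slope_positive:
  obtains lam where "lam > 0" "\<not> slope_positive lam"
proof -
  define d where "d = integral {1..2} m"
  have "integral {0..1} m < integral {0..2} m"
    by (rule DERIV_pos_imp_less[where F'=m], simp,
        rule continuous_on_subset[OF continuous_on_integral_upper[OF cont_m]],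
        simp, rule DERIV_integral_upper[OF cont_m]) (auto intro: m_pos)
  then have d: "d > 0" using integral_diff_atLeast[OF cont_m, of 1 2] by (simp add: d_def)
  define lam where "lam = 1 / (scale 1 * d)"
  have lam: "lam > 0" using d scale_pos[of 1] by (simp add: lam_def)
  have "\<not> slope_positive lam"
  proof
    assume pos: "slope_positive lam"
    have "integral {1..2} (\<lambda>t. sol lam 1 * m t) \<le> integral {1..2} (\<lambda>t. sol lam t * m t)"
    proof (rule integral_le)
      fix t :: real assume "t \<in> {1..2}"
      then show "sol lam 1 * m t \<le> sol lam t * m t"
        using slope_positiveD(3)[OF lam pos, of 1 t] m_pos[of t] by (intro mult_right_mono) auto
    qed (auto intro!: integrable_on_atLeast_subinterval continuous_intros cont_facts)
    then have "lam * (sol lam 1 * d) \<le> slope lam 1 - slope lam 2"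
      using slope_diff[of 1 2 lam] lam by (simp add: d_def)
    moreover have "lam * (sol lam 1 * d) \<ge> lam * (scale 1 * slope lam 1 * d)"
      using scale_slope_le_sol[OF lam pos, of 1] lam d by simp
    moreover have "lam * (scale 1 * slope lam 1 * d) = slope lam 1" using scale_pos[of 1] d
      by (simp add: lam_def)
    moreover have "slope lam 2 > 0" using pos by (simp add: slope_positive_def)
    ultimately show False by linarith
  qed
  then show ?thesis using that lam by blast
qed

lemma exists_eigenvalue:
  assumes trace_class
  obtains l where "eigenvalue l"
proof -
  obtain lam where "lam > 0" "\<not> slope_positive lam" by (rule exists_not_slope_positive)
  then show ?thesis using exists_eigenvalue_below[OF assms] that by blast
qed

theorem slope_positive_iff_le_eigenvalues:
  assumes trace_class and lam: "lam > 0"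
  shows "slope_positive lam \<longleftrightarrow> (\<forall>l. eigenvalue l \<longrightarrow> lam \<le> l)"
proof
  assume "slope_positive lam"
  then show "\<forall>l. eigenvalue l \<longrightarrow> lam \<le> l" using no_eigenvalue_below[OF assms(1)] by blast
next
  assume lower: "\<forall>l. eigenvalue l \<longrightarrow> lam \<le> l"
  show "slope_positive lam"
  proof (rule ccontr)
    assume "\<not> slope_positive lam"
    then obtain l where "eigenvalue l" "l < lam" by (rule exists_eigenvalue_below[OF assms])
    then show False using lower by auto
  qed
qed

end

section \<open>Strings that are not of trace class\<close>

text \<open>On paths where \<open>scale m\<close> is not integrable only measurability of the eigenvalue set is
  needed, so the boundary condition \<open>slope lam \<longlonglongrightarrow> 0\<close> is reduced to conditions with countable
  quantifiers.\<close>

context string_coefficients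
begin

definition scale_unbounded :: bool where
  "scale_unbounded \<longleftrightarrow> (\<forall>B::nat. \<exists>n::nat. scale (real n) > real B)"

definition scale_tail :: "real \<Rightarrow> real" where
  "scale_tail x = lim (\<lambda>n. scale (real n)) - scale x"

end

context string_equation
begin

lemma cont_scale_tail: "continuous_on {0..} scale_tail"
  unfolding scale_tail_def[abs_def] by (intro continuous_intros cont_scale)

lemma cont_abs_sol_m: "continuous_on {0..} (\<lambda>t. \<bar>sol lam t\<bar> * m t)"
  by (intro continuous_intros cont_facts)

lemma slope_eq_one_minus_integral: "x \<ge> 0 \<Longrightarrow> slope lam x = 1 - lam * integral {0..x} (\<lambda>t. sol lam t * m t)"
  using slope_diff[of 0 x lam] by simp

lemma bounded_integral_if_le_sol:
  assumes sol_m: "bounded_integral (\<lambda>t. \<bar>sol lam t\<bar> * m t)" and "continuous_on {0..} f" "c \<ge> 0" "X \<ge> 0"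
    and le: "\<And>x. x \<ge> X \<Longrightarrow> f x \<le> c * \<bar>sol lam x\<bar>"
  shows "bounded_integral (\<lambda>t. f t * m t)"
proof (rule bounded_integral_comparison[OF _ cont_abs_sol_m _ \<open>c \<ge> 0\<close> \<open>X \<ge> 0\<close> _ sol_m])
  show "f x * m x \<le> c * (\<bar>sol lam x\<bar> * m x)" if "x \<ge> X" for x
    using mult_right_mono[OF le[OF that], of "m x"] m_pos[of x] that \<open>X \<ge> 0\<close> by (simp add: mult.assoc)
qed (use assms(2) m_pos in \<open>auto intro!: continuous_intros cont_m simp: less_imp_le\<close>)

lemma slope_converges:
  assumes "bounded_integral (\<lambda>t. \<bar>sol lam t\<bar> * m t)"
  obtains L where "(slope lam \<longlongrightarrow> L) at_top"
proof -
  have "bounded_integral (\<lambda>t. \<bar>sol lam t * m t\<bar>)"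
    using assms bounded_integral_cong[of "\<lambda>t. \<bar>sol lam t\<bar> * m t" "\<lambda>t. \<bar>sol lam t * m t\<bar>"] m_pos
    by (simp add: abs_mult less_imp_le)
  then obtain L where "((\<lambda>x. integral {0..x} (\<lambda>t. sol lam t * m t)) \<longlongrightarrow> L) at_top"
    using integral_tendsto_if_abs_bounded[of "\<lambda>t. sol lam t * m t"]
    by (auto intro!: continuous_intros cont_facts)
  then have "((\<lambda>x. 1 - lam * integral {0..x} (\<lambda>t. sol lam t * m t)) \<longlongrightarrow> 1 - lam * L) at_top"
    by (intro tendsto_intros)
  moreover have "\<forall>\<^sub>F x in at_top. 1 - lam * integral {0..x} (\<lambda>t. sol lam t * m t) = slope lam x"
    using eventually_ge_at_top[of 0] by eventually_elim (simp add: slope_eq_one_minus_integral)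
  ultimately have "(slope lam \<longlongrightarrow> 1 - lam * L) at_top" by (rule Lim_transform_eventually)
  then show ?thesis using that by blast
qed

lemma slope_bounded:
  assumes "bounded_integral (\<lambda>t. \<bar>sol lam t\<bar> * m t)"
  obtains B where "B \<ge> 0" "\<And>x. x \<ge> 0 \<Longrightarrow> \<bar>slope lam x\<bar> \<le> B"
proof -
  obtain K where K: "\<And>x. x \<ge> 0 \<Longrightarrow> integral {0..x} (\<lambda>t. \<bar>sol lam t\<bar> * m t) \<le> K"
    using assms by (auto simp: bounded_integral_def)
  have bound: "\<bar>slope lam x\<bar> \<le> 1 + \<bar>lam\<bar> * K" if "x \<ge> 0" for x
  proof -
    have "norm (integral {0..x} (\<lambda>t. sol lam t * m t)) \<le> integral {0..x} (\<lambda>t. \<bar>sol lam t\<bar> * m t)"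
      by (rule integral_norm_bound_integral)
        (use m_pos in \<open>auto intro!: integrable_on_atLeast_subinterval continuous_intros cont_facts
          simp: abs_mult less_imp_le\<close>)
    then have "\<bar>lam\<bar> * \<bar>integral {0..x} (\<lambda>t. sol lam t * m t)\<bar> \<le> \<bar>lam\<bar> * K"
      using K[OF that] by (intro mult_left_mono) auto
    then have "\<bar>lam * integral {0..x} (\<lambda>t. sol lam t * m t)\<bar> \<le> \<bar>lam\<bar> * K" by (simp add: abs_mult)
    then show ?thesis using slope_eq_one_minus_integral[OF that, of lam] by linarith
  qed
  moreover have "0 \<le> 1 + \<bar>lam\<bar> * K" using bound[of 0] by simp
  ultimately show ?thesis using that by blast
qed

lemma sol_increment_lower:
  assumes lim: "(slope lam \<longlongrightarrow> L) at_top" and L: "L \<noteq> 0"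
  obtains X where "X \<ge> 0"
    "\<And>x y. X \<le> x \<Longrightarrow> x \<le> y \<Longrightarrow> \<bar>sol lam y - sol lam x\<bar> \<ge> \<bar>L\<bar> / 2 * (scale y - scale x)"
proof -
  have "((\<lambda>x. slope lam x * sgn L) \<longlongrightarrow> L * sgn L) at_top" by (intro tendsto_intros lim)
  moreover have "L * sgn L > \<bar>L\<bar> / 2" using L by (auto simp: sgn_if)
  ultimately have "\<forall>\<^sub>F x in at_top. slope lam x * sgn L > \<bar>L\<bar> / 2" by (rule order_tendstoD)
  then obtain X where X: "\<And>x. x \<ge> X \<Longrightarrow> slope lam x * sgn L > \<bar>L\<bar> / 2"
    unfolding eventually_at_top_linorder by auto
  show ?thesis
  proof (rule that[of "max X 0"])
    fix x y assume xy: "max X 0 \<le> x" "x \<le> y"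
    have "\<bar>L\<bar> / 2 * (scale y - scale x) = integral {x..y} (\<lambda>t. \<bar>L\<bar> / 2 * s t)"
      using scale_diff[of x y] xy by simp
    also have "\<dots> \<le> integral {x..y} (\<lambda>t. sgn L * (s t * slope lam t))"
    proof (rule integral_le)
      fix t assume t: "t \<in> {x..y}"
      have "s t * (\<bar>L\<bar> / 2) \<le> s t * (slope lam t * sgn L)"
        using X[of t] s_pos[of t] t xy by (intro mult_left_mono) auto
      then show "\<bar>L\<bar> / 2 * s t \<le> sgn L * (s t * slope lam t)" by (simp add: ac_simps)
    qed (use xy in \<open>auto intro!: integrable_on_atLeast_subinterval continuous_intros cont_facts\<close>)
    also have "\<dots> = sgn L * (sol lam y - sol lam x)" using sol_diff[of x y lam] xy by simp
    also have "\<dots> \<le> \<bar>sol lam y - sol lam x\<bar>" by (auto simp: sgn_if)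
    finally show "\<bar>sol lam y - sol lam x\<bar> \<ge> \<bar>L\<bar> / 2 * (scale y - scale x)" .
  qed simp
qed

lemma scale_le_sol_if_scale_unbounded:
  assumes lim: "(slope lam \<longlongrightarrow> L) at_top" and L: "L \<noteq> 0" and scale_unbounded
  obtains X where "X \<ge> 0" "\<And>x. x \<ge> X \<Longrightarrow> scale x \<le> 4 / \<bar>L\<bar> * \<bar>sol lam x\<bar>"
proof -
  obtain X where X: "X \<ge> 0"
    "\<And>x y. X \<le> x \<Longrightarrow> x \<le> y \<Longrightarrow> \<bar>sol lam y - sol lam x\<bar> \<ge> \<bar>L\<bar> / 2 * (scale y - scale x)"
    by (rule sol_increment_lower[OF lim L]) auto
  define c where "c = (\<bar>sol lam X\<bar> + \<bar>L\<bar> / 2 * scale X) / (\<bar>L\<bar> / 4)"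
  obtain n where n: "scale (real n) > real (nat \<lceil>c\<rceil>)" using \<open>scale_unbounded\<close>
    by (auto simp: scale_unbounded_def)
  show ?thesis
  proof (rule that[of "max X (real n)"])
    fix x assume x: "x \<ge> max X (real n)"
    have "scale x \<ge> scale (real n)" using x by (intro scale_mono) auto
    then have "scale x \<ge> c" using n by linarith
    then have "(\<bar>L\<bar> / 4) * c \<le> \<bar>L\<bar> / 4 * scale x" by (intro mult_left_mono) auto
    then have "\<bar>sol lam X\<bar> + \<bar>L\<bar> / 2 * scale X \<le> \<bar>L\<bar> / 4 * scale x" using L by (simp add: c_def)
    moreover have "\<bar>L\<bar> / 2 * scale x - \<bar>L\<bar> / 2 * scale X \<le> \<bar>sol lam x - sol lam X\<bar>"
      using X(2)[of X x] x by (simp add: right_diff_distrib)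
    ultimately have "\<bar>L\<bar> / 4 * scale x \<le> \<bar>sol lam x\<bar>" by linarith
    then show "scale x \<le> 4 / \<bar>L\<bar> * \<bar>sol lam x\<bar>" using L by (simp add: field_simps)
  qed (use X in simp)
qed

lemma slope_tendsto_0_if_scale_unbounded:
  assumes "\<not> trace_class" scale_unbounded and sol_m: "bounded_integral (\<lambda>t. \<bar>sol lam t\<bar> * m t)"
  shows "(slope lam \<longlongrightarrow> 0) at_top"
proof -
  obtain L where L: "(slope lam \<longlongrightarrow> L) at_top" by (rule slope_converges[OF sol_m])
  have "L = 0"
  proof (rule ccontr)
    assume "L \<noteq> 0"
    then obtain X where X: "X \<ge> 0" "\<And>x. x \<ge> X \<Longrightarrow> scale x \<le> 4 / \<bar>L\<bar> * \<bar>sol lam x\<bar>"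
      using scale_le_sol_if_scale_unbounded[OF L _ \<open>scale_unbounded\<close>] by blast
    have trace_class unfolding trace_class_def
      by (rule bounded_integral_if_le_sol[OF sol_m cont_scale _ X]) simp_all
    then show False using \<open>\<not> trace_class\<close> by simp
  qed
  then show ?thesis using L by simp
qed

lemma scale_bounded:
  assumes "\<not> scale_unbounded"
  obtains B where "B > 0" "\<And>x. x \<ge> 0 \<Longrightarrow> scale x \<le> B"
proof -
  obtain B :: nat where B: "\<And>n::nat. scale (real n) \<le> real B"
    using assms unfolding scale_unbounded_def by (meson not_less)
  have bound: "scale x \<le> real B" if "x \<ge> 0" for x
    using scale_mono[of x "real (nat \<lceil>x\<rceil>)"] B[of "nat \<lceil>x\<rceil>"] that by linarith
  moreover have "real B > 0" using scale_pos[of 1] bound[of 1] by simp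
  ultimately show ?thesis using that by blast
qed

lemma scale_converges:
  assumes "\<not> scale_unbounded"
  shows "(scale \<longlongrightarrow> lim (\<lambda>n. scale (real n))) at_top" "x \<ge> 0 \<Longrightarrow> scale_tail x \<ge> 0"
proof -
  obtain B where B: "\<And>x. x \<ge> 0 \<Longrightarrow> scale x \<le> B" by (rule scale_bounded[OF assms]) auto
  obtain L where L: "(scale \<longlongrightarrow> L) at_top" "\<And>x. 0 \<le> x \<Longrightarrow> scale x \<le> L"
    by (rule mono_bounded_tendsto_at_top[of 0 scale B]) (use scale_mono B in auto)
  have "lim (\<lambda>n. scale (real n)) = L"
    by (rule limI) (rule filterlim_compose[OF L(1) filterlim_real_sequentially])
  then show "(scale \<longlongrightarrow> lim (\<lambda>n. scale (real n))) at_top" "x \<ge> 0 \<Longrightarrow> scale_tail x \<ge> 0"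
    using L by (simp_all add: scale_tail_def)
qed

context
  assumes not_trace_class: "\<not> trace_class" and bounded: "\<not> scale_unbounded"
begin

lemma not_bounded_integral_m: "\<not> bounded_integral m"
proof
  assume m: "bounded_integral m"
  obtain B where B: "B > 0" "\<And>x. x \<ge> 0 \<Longrightarrow> scale x \<le> B" by (rule scale_bounded[OF bounded]) auto
  have trace_class unfolding trace_class_def
    by (rule bounded_integral_comparison[where g=m and X=0 and c=B])
      (use B m m_pos in \<open>auto intro!: cont_scale_m cont_m mult_right_mono simp: less_imp_le\<close>)
  then show False using not_trace_class by simp
qed

lemma sol_converges:
  assumes sol_m: "bounded_integral (\<lambda>t. \<bar>sol lam t\<bar> * m t)"
  obtains p where "(sol lam \<longlongrightarrow> p) at_top"
proof -
  obtain B where "\<And>x. x \<ge> 0 \<Longrightarrow> scale x \<le> B" by (rule scale_bounded[OF bounded]) auto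
  then have "bounded_integral s" unfolding bounded_integral_def by (auto simp: scale_def[symmetric])
  obtain K where K: "K \<ge> 0" "\<And>x. x \<ge> 0 \<Longrightarrow> \<bar>slope lam x\<bar> \<le> K" by (rule slope_bounded[OF sol_m]) auto
  have "bounded_integral (\<lambda>t. \<bar>s t * slope lam t\<bar>)"
  proof (rule bounded_integral_comparison[where g=s and X=0 and c=K])
    fix x :: real assume x: "0 \<le> x"
    show "\<bar>s x * slope lam x\<bar> \<le> K * s x"
      using K(2)[OF x] s_pos[OF x] by (simp add: abs_mult mult.commute mult_left_mono)
  qed (use s_pos K \<open>bounded_integral s\<close> in
      \<open>auto intro!: continuous_intros cont_facts simp: less_imp_le\<close>)
  then obtain p where p: "((\<lambda>x. integral {0..x} (\<lambda>t. s t * slope lam t)) \<longlongrightarrow> p) at_top"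
    using integral_tendsto_if_abs_bounded[of "\<lambda>t. s t * slope lam t"]
    by (auto intro!: continuous_intros cont_facts)
  have "(sol lam \<longlongrightarrow> p) at_top"
    by (rule Lim_transform_eventually[OF p])
      (use sol_diff[of 0 _ lam] in \<open>auto intro!: eventually_mono[OF eventually_ge_at_top[of 0]]\<close>)
  then show ?thesis by (rule that)
qed

lemma sol_tendsto_0:
  assumes sol_m: "bounded_integral (\<lambda>t. \<bar>sol lam t\<bar> * m t)"
  shows "(sol lam \<longlongrightarrow> 0) at_top"
proof -
  obtain p where p: "(sol lam \<longlongrightarrow> p) at_top" by (rule sol_converges[OF sol_m])
  have "p = 0"
  proof (rule ccontr)
    assume "p \<noteq> 0"
    then have "\<forall>\<^sub>F x in at_top. \<bar>sol lam x\<bar> > \<bar>p\<bar> / 2"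
      using order_tendstoD(1)[OF tendsto_rabs[OF p], of "\<bar>p\<bar> / 2"] by simp
    then obtain X where X: "\<And>x. x \<ge> X \<Longrightarrow> \<bar>sol lam x\<bar> > \<bar>p\<bar> / 2"
      unfolding eventually_at_top_linorder by auto
    have "bounded_integral (\<lambda>t. 1 * m t)"
      by (rule bounded_integral_if_le_sol[OF sol_m, where c="2 / \<bar>p\<bar>" and X="max X 0"])
        (use X \<open>p \<noteq> 0\<close> in \<open>auto simp: field_simps intro: less_imp_le\<close>)
    then show False using not_bounded_integral_m by simp
  qed
  then show ?thesis using p by simp
qed

lemma slope_tendsto_0_if_scale_tail:
  assumes sol_m: "bounded_integral (\<lambda>t. \<bar>sol lam t\<bar> * m t)"
    and tail: "\<not> bounded_integral (\<lambda>t. scale_tail t * m t)"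
  shows "(slope lam \<longlongrightarrow> 0) at_top"
proof -
  obtain L where L: "(slope lam \<longlongrightarrow> L) at_top" by (rule slope_converges[OF sol_m])
  have "L = 0"
  proof (rule ccontr)
    assume "L \<noteq> 0"
    obtain X where X: "X \<ge> 0"
      "\<And>x y. X \<le> x \<Longrightarrow> x \<le> y \<Longrightarrow> \<bar>sol lam y - sol lam x\<bar> \<ge> \<bar>L\<bar> / 2 * (scale y - scale x)"
      by (rule sol_increment_lower[OF L \<open>L \<noteq> 0\<close>]) auto
    have tail_le: "scale_tail x \<le> 2 / \<bar>L\<bar> * \<bar>sol lam x\<bar>" if "x \<ge> X" for x
    proof -
      have "((\<lambda>y. \<bar>sol lam y - sol lam x\<bar>) \<longlongrightarrow> \<bar>0 - sol lam x\<bar>) at_top"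
        by (intro tendsto_intros sol_tendsto_0[OF sol_m])
      moreover have "((\<lambda>y. \<bar>L\<bar> / 2 * (scale y - scale x))
          \<longlongrightarrow> \<bar>L\<bar> / 2 * (lim (\<lambda>n. scale (real n)) - scale x)) at_top"
        by (intro tendsto_intros scale_converges[OF bounded])
      ultimately have "\<bar>L\<bar> / 2 * (lim (\<lambda>n. scale (real n)) - scale x) \<le> \<bar>0 - sol lam x\<bar>"
        by (rule tendsto_le[rotated])
          (use X(2)[OF that] in \<open>auto intro!: eventually_mono[OF eventually_ge_at_top[of x]]\<close>)
      then show ?thesis using \<open>L \<noteq> 0\<close> by (simp add: scale_tail_def field_simps)
    qed
    have "bounded_integral (\<lambda>t. scale_tail t * m t)"
      by (rule bounded_integral_if_le_sol[OF sol_m cont_scale_tail _ X(1) tail_le]) simp_all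
    then show False using tail by simp
  qed
  then show ?thesis using L by simp
qed

lemma abs_sol_le_scale_tail:
  assumes sol_m: "bounded_integral (\<lambda>t. \<bar>sol lam t\<bar> * m t)" and "0 \<le> x"
    and M: "\<And>t. t \<ge> x \<Longrightarrow> \<bar>slope lam t\<bar> \<le> M"
  shows "\<bar>sol lam x\<bar> \<le> M * scale_tail x"
proof -
  have "\<forall>\<^sub>F y in at_top. \<bar>sol lam y - sol lam x\<bar> \<le> M * (scale y - scale x)"
    using eventually_ge_at_top[of x]
  proof eventually_elim
    case (elim y)
    have "norm (integral {x..y} (\<lambda>t. s t * slope lam t)) \<le> integral {x..y} (\<lambda>t. M * s t)"
    proof (rule integral_norm_bound_integral)
      fix t assume t: "t \<in> {x..y}"
      show "norm (s t * slope lam t) \<le> M * s t"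
        using M[of t] s_pos[of t] t \<open>0 \<le> x\<close> by (simp add: abs_mult mult.commute mult_left_mono)
    qed (use \<open>0 \<le> x\<close> in \<open>auto intro!: integrable_on_atLeast_subinterval continuous_intros cont_facts\<close>)
    then show ?case using sol_diff[of x y lam] scale_diff[of x y] \<open>0 \<le> x\<close> elim by simp
  qed
  moreover have "((\<lambda>y. \<bar>sol lam y - sol lam x\<bar>) \<longlongrightarrow> \<bar>0 - sol lam x\<bar>) at_top"
    by (intro tendsto_intros sol_tendsto_0[OF sol_m])
  moreover have "((\<lambda>y. M * (scale y - scale x)) \<longlongrightarrow> M * (lim (\<lambda>n. scale (real n)) - scale x)) at_top"
    by (intro tendsto_intros scale_converges[OF bounded])
  ultimately have "\<bar>0 - sol lam x\<bar> \<le> M * (lim (\<lambda>n. scale (real n)) - scale x)"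
    by (intro tendsto_le[OF trivial_limit_at_top_linorder])
  then show ?thesis by (simp add: scale_tail_def)
qed

lemma abs_slope_le_half:
  assumes lam: "lam > 0" and lim: "(slope lam \<longlongrightarrow> 0) at_top" and x: "0 \<le> x" and "M \<ge> 0"
    and sol_le: "\<And>t. t \<ge> x \<Longrightarrow> \<bar>sol lam t\<bar> \<le> M * scale_tail t"
    and tail: "\<And>y. x \<le> y \<Longrightarrow> integral {x..y} (\<lambda>t. scale_tail t * m t) \<le> 1 / (2 * lam)"
  shows "\<bar>slope lam x\<bar> \<le> M / 2"
proof (rule tendsto_upperbound[where F=at_top and f="\<lambda>y. \<bar>slope lam x - slope lam y\<bar>"])
  have "((\<lambda>y. \<bar>slope lam x - slope lam y\<bar>) \<longlongrightarrow> \<bar>slope lam x - 0\<bar>) at_top" by (intro tendsto_intros lim)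
  then show "((\<lambda>y. \<bar>slope lam x - slope lam y\<bar>) \<longlongrightarrow> \<bar>slope lam x\<bar>) at_top" by simp
  show "\<forall>\<^sub>F y in at_top. \<bar>slope lam x - slope lam y\<bar> \<le> M / 2"
    using eventually_ge_at_top[of x]
  proof eventually_elim
    case (elim y)
    have "norm (integral {x..y} (\<lambda>t. sol lam t * m t)) \<le> integral {x..y} (\<lambda>t. M * (scale_tail t * m t))"
    proof (rule integral_norm_bound_integral)
      fix t assume t: "t \<in> {x..y}"
      show "norm (sol lam t * m t) \<le> M * (scale_tail t * m t)"
        using mult_right_mono[OF sol_le[of t], of "m t"] m_pos[of t] t x
        by (simp add: abs_mult mult.assoc)
    qed (use x in
        \<open>auto intro!: integrable_on_atLeast_subinterval continuous_intros cont_facts cont_scale_tail\<close>)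
    also have "\<dots> \<le> M * (1 / (2 * lam))" using mult_left_mono[OF tail[OF elim] \<open>M \<ge> 0\<close>] by simp
    finally have "lam * \<bar>integral {x..y} (\<lambda>t. sol lam t * m t)\<bar> \<le> M / 2" using lam
      by (simp add: field_simps)
    then show ?case using slope_diff[of x y lam] x elim lam by (simp add: abs_mult)
  qed
qed simp

text \<open>On a late half-line the supremum of \<open>\<bar>slope lam\<bar>\<close> is at most half of itself.\<close>

lemma no_eigenvalue_if_scale_tail:
  assumes tail: "bounded_integral (\<lambda>t. scale_tail t * m t)"
  shows "\<not> eigenvalue lam"
proof
  assume eigen: "eigenvalue lam"
  have sol_m: "bounded_integral (\<lambda>t. \<bar>sol lam t\<bar> * m t)" and lim: "(slope lam \<longlongrightarrow> 0) at_top"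
    using eigen by (auto simp: eigenvalue_def)
  have lam: "lam > 0" by (rule eigenvalue_pos[OF eigen])
  have "continuous_on {0..} (\<lambda>t. scale_tail t * m t)"
    by (intro continuous_intros cont_scale_tail cont_m)
  moreover have "scale_tail t * m t \<ge> 0" if "t \<ge> 0" for t
    using scale_converges(2)[OF bounded that] m_pos[OF that] by simp
  ultimately obtain X where X: "X \<ge> 1"
    and small: "\<And>x y. X \<le> x \<Longrightarrow> x \<le> y \<Longrightarrow> integral {x..y} (\<lambda>t. scale_tail t * m t) \<le> 1 / (2 * lam)"
    using bounded_integral_tail_le[of "\<lambda>t. scale_tail t * m t" "1 / (2 * lam)"] tail lam by auto
  define M where "M = Sup ((\<lambda>x. \<bar>slope lam x\<bar>) ` {X..})"
  obtain B where B: "\<And>x. x \<ge> 0 \<Longrightarrow> \<bar>slope lam x\<bar> \<le> B" by (rule slope_bounded[OF sol_m]) auto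
  have bdd: "bdd_above ((\<lambda>x. \<bar>slope lam x\<bar>) ` {X..})" by (rule bdd_aboveI[of _ B]) (use B X in auto)
  have slope_le: "\<bar>slope lam x\<bar> \<le> M" if "x \<ge> X" for x
    unfolding M_def by (rule cSup_upper[OF _ bdd]) (use that in auto)
  then have "M \<ge> 0" using order_trans[OF abs_ge_zero slope_le[OF order_refl]] by simp
  have sol_le: "\<bar>sol lam x\<bar> \<le> M * scale_tail x" if "x \<ge> X" for x
    by (rule abs_sol_le_scale_tail[OF sol_m]) (use that X slope_le in auto)
  have "\<bar>slope lam x\<bar> \<le> M / 2" if "x \<ge> X" for x
    by (rule abs_slope_le_half[OF lam lim _ \<open>M \<ge> 0\<close>]) (use that X sol_le small in auto)
  then have "M \<le> M / 2" unfolding M_def[symmetric] by (subst M_def, intro cSup_least) auto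
  then have "M = 0" using \<open>M \<ge> 0\<close> by simp
  then have "slope lam X = 0" "sol lam X = 0" using slope_le[of X] sol_le[of X] by auto
  then show False using string_sol_slope_det[OF cont_s cont_potential[of lam], of X] X
    by (simp add: sol_def slope_def)
qed

end

theorem eigenvalue_iff_not_trace_class:
  assumes "\<not> trace_class"
  shows "eigenvalue lam \<longleftrightarrow> (scale_unbounded \<or> \<not> bounded_integral (\<lambda>t. scale_tail t * m t)) \<and> lam > 0 \<and>
    bounded_integral (\<lambda>t. \<bar>sol lam t\<bar> * m t)
        \<and> bounded_integral (\<lambda>t. (sol lam t)\<^sup>2 * m t)" (is "_ \<longleftrightarrow> ?cond")
proof
  assume eigen: "eigenvalue lam"
  then have "scale_unbounded \<or> \<not> bounded_integral (\<lambda>t. scale_tail t * m t)"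
    using no_eigenvalue_if_scale_tail[OF assms, of lam] by blast
  then show ?cond using eigen eigenvalue_pos[OF eigen] unfolding eigenvalue_def by blast
next
  assume cond: ?cond
  then have "(slope lam \<longlongrightarrow> 0) at_top"
    using slope_tendsto_0_if_scale_unbounded[OF assms] slope_tendsto_0_if_scale_tail[OF assms] by blast
  then show "eigenvalue lam" using cond unfolding eigenvalue_def by auto
qed

end

section \<open>The eigenvalue problem as an integral equation\<close>

lemma set_integral_Icc_eq_integral:
  fixes f :: "real \<Rightarrow> real"
  assumes "continuous_on {0..} f" "0 \<le> a"
  shows "set_integrable lborel {a..b} f" "(LINT y:{a..b}|lborel. f y) = integral {a..b} f"
proof -
  show integrable: "set_integrable lborel {a..b} f"
    by (rule borel_integrable_atLeastAtMost', rule continuous_on_subset[OF assms(1)])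
      (use assms in auto)
  show "(LINT y:{a..b}|lborel. f y) = integral {a..b} f"
    by (rule set_borel_integral_eq_integral(2)[OF integrable])
qed

lemma set_borel_measurable_atLeast:
  fixes f :: "real \<Rightarrow> real"
  assumes "continuous_on {0..} f"
  shows "set_borel_measurable lborel {0..} f"
  unfolding set_borel_measurable_def using borel_measurable_continuous_on_indicator[OF _ assms] by simp

lemma set_integrable_iff_bounded_integral:
  fixes f :: "real \<Rightarrow> real"
  assumes cont: "continuous_on {0..} f" and nonneg: "\<And>x. x \<ge> 0 \<Longrightarrow> f x \<ge> 0"
  shows "set_integrable lborel {0..} f \<longleftrightarrow> bounded_integral f"
proof
  assume integrable: "set_integrable lborel {0..} f"
  have "integral {0..x} f \<le> (LINT y:{0..}|lborel. f y)" if "x \<ge> 0" for x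
  proof -
    have "(LINT y:{0..x}|lborel. f y) \<le> (LINT y:{0..}|lborel. f y)"
      unfolding set_lebesgue_integral_def
      by (rule integral_mono) (use nonneg integrable set_integral_Icc_eq_integral(1)[OF cont, of 0 x]
          in \<open>auto simp: set_integrable_def indicator_def\<close>)
    then show ?thesis using set_integral_Icc_eq_integral[OF cont, of 0 x] by simp
  qed
  then show "bounded_integral f" unfolding bounded_integral_def by blast
next
  assume "bounded_integral f"
  then obtain L where L: "((\<lambda>x. integral {0..x} f) \<longlongrightarrow> L) at_top"
    using bounded_integral_tendsto[OF cont nonneg] by blast
  let ?f = "\<lambda>x. indicator {0..} x *\<^sub>R f x"
  have cut: "?f x * indicator {..y} x = indicator {0..y} x *\<^sub>R f x" for x y by (auto simp: indicator_def)
  show "set_integrable lborel {0..} f"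
    unfolding set_integrable_def
  proof (rule integrable_monotone_convergence_at_top)
    show "AE x in lborel. 0 \<le> ?f x" using nonneg by (auto simp: indicator_def)
    show "?f \<in> borel_measurable borel"
      using set_borel_measurable_atLeast[OF cont] by (simp add: set_borel_measurable_def)
    show "integrable lborel (\<lambda>x. ?f x * indicator {..y} x)" for y
      unfolding cut using set_integral_Icc_eq_integral(1)[OF cont, of 0 y]
      by (simp add: set_integrable_def)
    show "((\<lambda>y. LINT x|lborel. ?f x * indicator {..y} x) \<longlongrightarrow> L) at_top"
      unfolding cut using L set_integral_Icc_eq_integral(2)[OF cont, of 0]
      by (simp add: set_lebesgue_integral_def)
  qed simp
qed

lemma integral_tendsto_set_integral:
  fixes f :: "real \<Rightarrow> real"
  assumes "continuous_on {0..} f" "set_integrable lborel {0..} f"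
  shows "((\<lambda>b. integral {0..b} f) \<longlongrightarrow> (LINT y:{0..}|lborel. f y)) at_top"
proof -
  have "((\<lambda>b. LINT y:{0..b}|lborel. f y) \<longlongrightarrow> (LINT y:{0..}|lborel. f y)) at_top"
    by (rule tendsto_set_lebesgue_integral_at_top) (use assms in auto)
  then show ?thesis using set_integral_Icc_eq_integral(2)[OF assms(1)] by simp
qed

definition (in string_coefficients) integral_eigenvalue :: "real \<Rightarrow> bool" where
  "integral_eigenvalue lam \<longleftrightarrow> (\<exists>\<psi>::real \<Rightarrow> real. \<psi> \<in> borel_measurable lborel \<and>
     set_integrable lborel {0..} (\<lambda>y. (\<psi> y)\<^sup>2 * m y) \<and> \<not> (AE y in lborel. y \<ge> 0 \<longrightarrow> \<psi> y = 0) \<and>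
     (\<forall>x\<ge>0. set_integrable lborel {0..} (\<lambda>y. scale (min x y) * \<psi> y * m y) \<and>
             \<psi> x = lam * (LINT y:{0..}|lborel. scale (min x y) * \<psi> y * m y)))"

context string_equation
begin

lemma set_integrable_scale_min:
  assumes f: "set_integrable lborel {0..} f" and x: "x \<ge> 0"
  shows "set_integrable lborel {0..} (\<lambda>y. scale (min x y) * f y)"
proof (rule set_integrable_bound)
  show "set_integrable lborel {0..} (\<lambda>y. scale x * f y)" using f by simp
  have "continuous_on {0..} (\<lambda>y. scale (min x y))"
    by (rule continuous_on_compose2[OF cont_scale]) (use x in \<open>auto intro!: continuous_intros\<close>)
  then have "(\<lambda>y. (indicator {0..} y *\<^sub>R scale (min x y)) * (indicator {0..} y *\<^sub>R f y))
      \<in> borel_measurable lborel"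
    using set_borel_measurable_atLeast f
    by (intro borel_measurable_times) (auto simp: set_borel_measurable_def set_integrable_def)
  moreover have "(\<lambda>y. (indicator {0..} y *\<^sub>R scale (min x y)) * (indicator {0..} y *\<^sub>R f y))
      = (\<lambda>y. indicator {0..} y *\<^sub>R (scale (min x y) * f y))"
    by (auto simp: indicator_def)
  ultimately show "set_borel_measurable lborel {0..} (\<lambda>y. scale (min x y) * f y)"
    by (simp add: set_borel_measurable_def)
  have "norm (scale (min x y) * f y) \<le> norm (scale x * f y)" if "y \<in> {0..}" for y
  proof -
    have "0 \<le> scale (min x y)" "scale (min x y) \<le> scale x"
      using scale_nonneg[of "min x y"] scale_mono[of "min x y" x] x that by auto
    then show ?thesis by (simp add: abs_mult mult_right_mono)
  qed
  then show "AE y in lborel. y \<in> {0..} \<longrightarrow> norm (scale (min x y) * f y) \<le> norm (scale x * f y)" by blast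
qed

lemma set_integral_scale_min:
  assumes f: "set_integrable lborel {0..} f" and x: "x \<ge> 0"
  shows "(\<lambda>y. scale y * f y) integrable_on {0..x}" "f integrable_on {0..x}"
    "(LINT y:{0..}|lborel. scale (min x y) * f y)
      = integral {0..x} (\<lambda>y. scale y * f y) + scale x
          * ((LINT y:{0..}|lborel. f y) - integral {0..x} f)"
proof -
  note kernel = set_integrable_scale_min[OF f x]
  have split_set: "{0..} = {0..x} \<union> {x<..}" using x by auto
  have sub: "set_integrable lborel {0..x} h" "set_integrable lborel {x<..} h"
    if "set_integrable lborel {0..} h" for h :: "real \<Rightarrow> real"
    by (rule set_integrable_subset[OF that]; use x in auto)+
  have split: "(LINT y:{0..}|lborel. h y) = (LINT y:{0..x}|lborel. h y) + (LINT y:{x<..}|lborel. h y)"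
    if "set_integrable lborel {0..} h" for h :: "real \<Rightarrow> real"
    unfolding split_set by (rule set_integral_Un) (use sub[OF that] in auto)
  have "set_integrable lborel {0..x} (\<lambda>y. scale (min x y) * f y)
      = set_integrable lborel {0..x} (\<lambda>y. scale y * f y)"
    by (rule set_integrable_cong) auto
  then have scale_f: "set_integrable lborel {0..x} (\<lambda>y. scale y * f y)" using sub(1)[OF kernel] by simp
  show "(\<lambda>y. scale y * f y) integrable_on {0..x}" "f integrable_on {0..x}"
    using set_borel_integral_eq_integral(1)[OF scale_f]
        set_borel_integral_eq_integral(1)[OF sub(1)[OF f]] by auto
  have "(LINT y:{0..x}|lborel. scale (min x y) * f y) = (LINT y:{0..x}|lborel. scale y * f y)"
    by (rule set_lebesgue_integral_cong) auto
  moreover have "(LINT y:{x<..}|lborel. scale (min x y) * f y) = (LINT y:{x<..}|lborel. scale x * f y)"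
    by (rule set_lebesgue_integral_cong) auto
  ultimately show "(LINT y:{0..}|lborel. scale (min x y) * f y)
      = integral {0..x} (\<lambda>y. scale y * f y) + scale x
          * ((LINT y:{0..}|lborel. f y) - integral {0..x} f)"
    using split[OF kernel] split[OF f] set_borel_integral_eq_integral(2)[OF scale_f]
      set_borel_integral_eq_integral(2)[OF sub(1)[OF f]] by simp
qed

lemma set_integrable_if_square_integrable_Icc:
  assumes meas: "\<psi> \<in> borel_measurable lborel" and sq: "set_integrable lborel {0..} (\<lambda>y. (\<psi> y)\<^sup>2 * m y)"
  shows "set_integrable lborel {0..b} (\<lambda>y. \<psi> y * m y)"
proof (rule set_integrable_bound[where f="\<lambda>y. m y + (\<psi> y)\<^sup>2 * m y"])
  have "set_integrable lborel {0..b} (\<lambda>y. (\<psi> y)\<^sup>2 * m y)" by (rule set_integrable_subset[OF sq]) auto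
  then show "set_integrable lborel {0..b} (\<lambda>y. m y + (\<psi> y)\<^sup>2 * m y)"
    using set_integral_Icc_eq_integral(1)[OF cont_m, of 0 b] by (intro set_integral_add) auto
  have "(\<lambda>y. indicator {0..} y *\<^sub>R m y) \<in> borel_measurable lborel"
    using set_borel_measurable_atLeast[OF cont_m] by (simp add: set_borel_measurable_def)
  then have "(\<lambda>y. indicator {0..b} y *\<^sub>R (\<psi> y * (indicator {0..} y *\<^sub>R m y))) \<in> borel_measurable lborel"
    using meas by measurable
  moreover have "(\<lambda>y. indicator {0..b} y *\<^sub>R (\<psi> y * (indicator {0..} y *\<^sub>R m y)))
      = (\<lambda>y. indicator {0..b} y *\<^sub>R (\<psi> y * m y))"
    by (auto simp: indicator_def)
  ultimately show "set_borel_measurable lborel {0..b} (\<lambda>y. \<psi> y * m y)"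
    by (simp add: set_borel_measurable_def)
  have "\<bar>\<psi> y\<bar> * m y \<le> (1 + (\<psi> y)\<^sup>2) * m y" if "y \<ge> 0" for y
  proof (rule mult_right_mono)
    have "0 \<le> (\<bar>\<psi> y\<bar> - 1/2)\<^sup>2" by simp
    then show "\<bar>\<psi> y\<bar> \<le> 1 + (\<psi> y)\<^sup>2" by (simp add: power2_eq_square algebra_simps)
  qed (use m_pos[OF that] in simp)
  then show "AE y in lborel. y \<in> {0..b} \<longrightarrow> norm (\<psi> y * m y) \<le> norm (m y + (\<psi> y)\<^sup>2 * m y)"
    using m_pos by (intro AE_I2)
      (auto simp: abs_mult distrib_right less_imp_le intro!: order_trans[OF _ abs_ge_self])
qed

lemma set_integrable_eigenfunction:
  assumes meas: "\<psi> \<in> borel_measurable lborel" and sq: "set_integrable lborel {0..} (\<lambda>y. (\<psi> y)\<^sup>2 * m y)"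
    and kernel: "set_integrable lborel {0..} (\<lambda>y. scale (min 1 y) * \<psi> y * m y)"
  shows "set_integrable lborel {0..} (\<lambda>y. \<psi> y * m y)"
proof -
  have "set_integrable lborel {1..} (\<lambda>y. scale (min 1 y) * \<psi> y * m y)"
    by (rule set_integrable_subset[OF kernel]) auto
  moreover have "set_integrable lborel {1..} (\<lambda>y. scale (min 1 y) * \<psi> y * m y)
      = set_integrable lborel {1..} (\<lambda>y. scale 1 * (\<psi> y * m y))"
    by (rule set_integrable_cong) auto
  ultimately have "set_integrable lborel {1..} (\<lambda>y. \<psi> y * m y)" using scale_pos[of 1] by simp
  then have "set_integrable lborel ({0..1} \<union> {1..}) (\<lambda>y. \<psi> y * m y)"
    by (rule set_integrable_Un[OF set_integrable_if_square_integrable_Icc[OF meas sq]]) auto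
  moreover have "{0..1} \<union> {1..} = {0::real..}" by auto
  ultimately show ?thesis by simp
qed

lemma solves_system_if_integral_equation:
  assumes f: "set_integrable lborel {0..} (\<lambda>y. \<psi> y * m y)"
    and eq: "\<And>x. x \<ge> 0 \<Longrightarrow> \<psi> x = lam * (LINT y:{0..}|lborel. scale (min x y) * \<psi> y * m y)"
    and H: "\<And>x. H x = lam * ((LINT y:{0..}|lborel. \<psi> y * m y) - integral {0..x} (\<lambda>y. \<psi> y * m y))"
  shows "solves_system s (\<lambda>t. lam * m t) \<psi> H" "\<psi> 0 = 0"
proof -
  let ?f = "\<lambda>y. \<psi> y * m y"
  let ?F = "\<lambda>x. integral {0..x} ?f" and ?G = "\<lambda>x. integral {0..x} (\<lambda>y. scale y * ?f y)"
  have \<psi>_eq: "\<psi> x = lam * ?G x + scale x * H x" if "x \<ge> 0" for x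
    using eq[OF that] set_integral_scale_min(3)[OF f that] H[of x]
    by (simp add: mult.assoc distrib_left)
  then show "\<psi> 0 = 0" using scale_0 by simp
  have integrable: "?f integrable_on {0..T} \<and> (\<lambda>y. scale y * ?f y) integrable_on {0..T}" for T
  proof (cases "T \<ge> 0")
    case True
    then show ?thesis using set_integral_scale_min(1,2)[OF f] by blast
  next
    case False
    then have "{0..T} = {}" by simp
    then show ?thesis using integrable_on_empty by metis
  qed
  have cont_F: "continuous_on {0..} ?F" and cont_G: "continuous_on {0..} ?G"
    using integrable by (auto intro!: continuous_on_atLeast_if_Icc indefinite_integral_continuous_1)
  have cont_H: "continuous_on {0..} H" unfolding H[abs_def] by (intro continuous_intros cont_F)
  have "continuous_on {0..} (\<lambda>x. lam * ?G x + scale x * H x)"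
    by (intro continuous_intros cont_H cont_G cont_scale)
  then have cont_\<psi>: "continuous_on {0..} \<psi>" by (subst continuous_on_cong[OF refl]) (auto simp: \<psi>_eq)
  show "solves_system s (\<lambda>t. lam * m t) \<psi> H"
    unfolding solves_system_def
  proof (intro conjI allI impI cont_\<psi> cont_H)
    fix x :: real assume x: "x > 0"
    have "DERIV ?F x :> ?f x"
      by (rule DERIV_integral_upper[OF _ x]) (intro continuous_intros cont_\<psi> cont_m)
    then show DERIV_H: "DERIV H x :> - (lam * m x) * \<psi> x"
      unfolding H[abs_def] by (auto intro!: derivative_eq_intros simp: algebra_simps)
    have "DERIV ?G x :> scale x * ?f x"
      by (rule DERIV_integral_upper[OF _ x]) (intro continuous_intros cont_scale cont_\<psi> cont_m)
    then have "DERIV (\<lambda>x. lam * ?G x + scale x * H x) x :> s x * H x"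
      by (auto intro!: derivative_eq_intros DERIV_scale DERIV_H x simp: algebra_simps)
    then show "DERIV \<psi> x :> s x * H x"
      by (rule has_field_derivative_transform_within_open[where S="{0<..}"]) (use x \<psi>_eq in auto)
  qed
qed

lemma eigenvalue_if_proportional:
  assumes c: "c \<noteq> 0" and \<psi>: "\<And>x. x \<ge> 0 \<Longrightarrow> \<psi> x = c * sol lam x" and "lam \<noteq> 0"
    and f: "set_integrable lborel {0..} (\<lambda>y. \<psi> y * m y)"
      and sq: "set_integrable lborel {0..} (\<lambda>y. (\<psi> y)\<^sup>2 * m y)"
    and lim: "((\<lambda>x. c * slope lam x) \<longlongrightarrow> 0) at_top"
  shows "eigenvalue lam"
  unfolding eigenvalue_def
proof (intro conjI)
  have "set_integrable lborel {0..} (\<lambda>y. (1 / \<bar>c\<bar>) * \<bar>\<psi> y * m y\<bar>)"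
    using set_integrable_abs[OF f] by simp
  also have "?this \<longleftrightarrow> set_integrable lborel {0..} (\<lambda>t. \<bar>sol lam t\<bar> * m t)"
    by (rule set_integrable_cong) (use \<psi> c m_pos in \<open>auto simp: abs_mult less_imp_le\<close>)
  finally show "bounded_integral (\<lambda>t. \<bar>sol lam t\<bar> * m t)"
    by (subst set_integrable_iff_bounded_integral[symmetric])
      (use m_pos in \<open>auto intro!: cont_abs_sol_m simp: less_imp_le\<close>)
  have "set_integrable lborel {0..} (\<lambda>y. (1 / c\<^sup>2) * ((\<psi> y)\<^sup>2 * m y))" using sq by simp
  also have "?this \<longleftrightarrow> set_integrable lborel {0..} (\<lambda>t. (sol lam t)\<^sup>2 * m t)"
    by (rule set_integrable_cong) (use \<psi> c in \<open>auto simp: power_mult_distrib\<close>)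
  finally show "bounded_integral (\<lambda>t. (sol lam t)\<^sup>2 * m t)"
    by (subst set_integrable_iff_bounded_integral[symmetric])
      (use m_pos in \<open>auto intro!: continuous_intros cont_facts simp: less_imp_le\<close>)
  have "((\<lambda>x. (1 / c) * (c * slope lam x)) \<longlongrightarrow> (1 / c) * 0) at_top" by (intro tendsto_intros lim)
  then show "(slope lam \<longlongrightarrow> 0) at_top" using c by simp
qed (rule \<open>lam \<noteq> 0\<close>)

lemma integral_eigenvalue_imp_eigenvalue:
  assumes "integral_eigenvalue lam"
  shows "eigenvalue lam"
proof -
  obtain \<psi> where meas: "\<psi> \<in> borel_measurable lborel"
    and sq: "set_integrable lborel {0..} (\<lambda>y. (\<psi> y)\<^sup>2 * m y)"
    and nonzero: "\<not> (AE y in lborel. y \<ge> 0 \<longrightarrow> \<psi> y = 0)"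
    and kernel: "\<And>x. x \<ge> 0 \<Longrightarrow> set_integrable lborel {0..} (\<lambda>y. scale (min x y) * \<psi> y * m y)"
    and eq: "\<And>x. x \<ge> 0 \<Longrightarrow> \<psi> x = lam * (LINT y:{0..}|lborel. scale (min x y) * \<psi> y * m y)"
    using assms unfolding integral_eigenvalue_def by auto
  have "\<exists>x\<ge>0. \<psi> x \<noteq> 0" using nonzero by (auto intro!: AE_I2)
  then obtain x where x: "x \<ge> 0" "\<psi> x \<noteq> 0" by blast
  have f: "set_integrable lborel {0..} (\<lambda>y. \<psi> y * m y)"
    by (rule set_integrable_eigenfunction[OF meas sq kernel]) simp
  define H where "H x = lam * ((LINT y:{0..}|lborel. \<psi> y * m y) - integral {0..x} (\<lambda>y. \<psi> y * m y))"
    for x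
  have sys: "solves_system s (\<lambda>t. lam * m t) \<psi> H" "\<psi> 0 = 0"
    using solves_system_if_integral_equation[OF f eq H_def] by blast+
  note unique = solves_system_unique[OF cont_s cont_potential sys, folded sol_def slope_def]
  show ?thesis
  proof (rule eigenvalue_if_proportional[OF _ unique(1) _ f sq])
    show "H 0 \<noteq> 0" using x unique(1)[OF x(1)] by auto
    show "lam \<noteq> 0" using eq[OF x(1)] x(2) by (metis mult_zero_left)
    have "continuous_on {0..} (\<lambda>y. \<psi> y * m y)"
      by (intro continuous_intros solves_systemD(1)[OF sys(1)] cont_m)
    from integral_tendsto_set_integral[OF this f]
    have "(H \<longlongrightarrow> lam * ((LINT y:{0..}|lborel. \<psi> y * m y) - (LINT y:{0..}|lborel. \<psi> y * m y))) at_top"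
      unfolding H_def[abs_def] by (intro tendsto_intros)
    then have "(H \<longlongrightarrow> 0) at_top" by simp
    moreover have "\<forall>\<^sub>F x in at_top. H x = H 0 * slope lam x"
      using eventually_ge_at_top[of 0] by (rule eventually_mono) (rule unique(2))
    ultimately show "((\<lambda>x. H 0 * slope lam x) \<longlongrightarrow> 0) at_top" by (rule Lim_transform_eventually)
  qed
qed

lemma eigenvalue_set_integral:
  assumes "eigenvalue lam"
  shows "set_integrable lborel {0..} (\<lambda>y. sol lam y * m y)"
    "x \<ge> 0 \<Longrightarrow> lam * ((LINT y:{0..}|lborel. sol lam y * m y) - integral {0..x} (\<lambda>y. sol lam y * m y))
        = slope lam x"
proof -
  let ?f = "\<lambda>y. sol lam y * m y"
  have cont: "continuous_on {0..} ?f" by (intro continuous_intros cont_facts)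
  show f: "set_integrable lborel {0..} ?f"
  proof (rule set_integrable_bound[where f="\<lambda>t. \<bar>sol lam t\<bar> * m t"])
    show "set_integrable lborel {0..} (\<lambda>t. \<bar>sol lam t\<bar> * m t)"
      using assms by (subst set_integrable_iff_bounded_integral)
        (use m_pos in \<open>auto intro!: cont_abs_sol_m simp: eigenvalue_def less_imp_le\<close>)
  qed (auto intro!: set_borel_measurable_atLeast cont simp: abs_mult)
  have "((\<lambda>b. 1 - lam * integral {0..b} ?f) \<longlongrightarrow> 1 - lam * (LINT y:{0..}|lborel. ?f y)) at_top"
    by (intro tendsto_intros integral_tendsto_set_integral cont f)
  then have "(slope lam \<longlongrightarrow> 1 - lam * (LINT y:{0..}|lborel. ?f y)) at_top"
    by (rule Lim_transform_eventually[OF _ eventually_mono[OF eventually_ge_at_top[of 0]]])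
      (simp add: slope_eq_one_minus_integral)
  moreover have "(slope lam \<longlongrightarrow> 0) at_top" using assms by (simp add: eigenvalue_def)
  ultimately have "1 - lam * (LINT y:{0..}|lborel. ?f y) = 0"
    using tendsto_unique trivial_limit_at_top_linorder by blast
  then show "lam * ((LINT y:{0..}|lborel. ?f y) - integral {0..x} ?f) = slope lam x" if "x \<ge> 0"
    using slope_eq_one_minus_integral[OF that, of lam] by (simp add: right_diff_distrib)
qed

lemma sol_not_AE_zero: "\<not> (AE y in lborel. 0 \<le> y \<longrightarrow> indicator {0..} y *\<^sub>R sol lam y = 0)"
proof
  assume zero: "AE y in lborel. 0 \<le> y \<longrightarrow> indicator {0..} y *\<^sub>R sol lam y = 0"
  obtain d where d: "d > 0" "\<And>x. 0 < x \<Longrightarrow> x \<le> d \<Longrightarrow> sol lam x > 0"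
    using string_sol_slope_pos_near_0[OF cont_s cont_potential s_pos, of lam] unfolding sol_def by metis
  have "AE y in lborel. y \<notin> {0<..d}" using zero by eventually_elim (use d(2) in force)
  then have "emeasure lborel {0<..d} = 0" by (subst (asm) AE_iff_measurable[of "{0<..d}"]) auto
  then show False using d(1) by simp
qed

lemma eigenvalue_imp_integral_eigenvalue:
  assumes eigen: "eigenvalue lam"
  shows "integral_eigenvalue lam"
proof -
  let ?\<psi> = "\<lambda>x. indicator {0..} x *\<^sub>R sol lam x" and ?f = "\<lambda>y. sol lam y * m y"
  have f: "set_integrable lborel {0..} ?f" by (rule eigenvalue_set_integral(1)[OF eigen])
  have cong: "set_integrable lborel {0..} (\<lambda>y. scale (min x y) * ?\<psi> y * m y)
      = set_integrable lborel {0..} (\<lambda>y. scale (min x y) * ?f y)"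
    "(LINT y:{0..}|lborel. scale (min x y) * ?\<psi> y * m y)
        = (LINT y:{0..}|lborel. scale (min x y) * ?f y)" for x
    by (rule set_integrable_cong set_lebesgue_integral_cong; simp)+
  show ?thesis
    unfolding integral_eigenvalue_def
  proof (intro exI[of _ ?\<psi>] conjI allI impI sol_not_AE_zero)
    show "?\<psi> \<in> borel_measurable lborel"
      using set_borel_measurable_atLeast[OF cont_sol] by (simp add: set_borel_measurable_def)
    have "set_integrable lborel {0..} (\<lambda>y. (?\<psi> y)\<^sup>2 * m y)
        = set_integrable lborel {0..} (\<lambda>y. (sol lam y)\<^sup>2 * m y)"
      by (rule set_integrable_cong) auto
    also have \<dots>
      using eigen by (subst set_integrable_iff_bounded_integral)
        (use m_pos in \<open>auto intro!: continuous_intros cont_facts simp: eigenvalue_def less_imp_le\<close>)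
    finally show "set_integrable lborel {0..} (\<lambda>y. (?\<psi> y)\<^sup>2 * m y)" by simp
    fix x :: real assume x: "0 \<le> x"
    show "set_integrable lborel {0..} (\<lambda>y. scale (min x y) * ?\<psi> y * m y)"
      unfolding cong by (rule set_integrable_scale_min[OF f x])
    have "lam * (LINT y:{0..}|lborel. scale (min x y) * ?f y)
        = lam * integral {0..x} (\<lambda>y. scale y * ?f y) + scale x
            * (lam * ((LINT y:{0..}|lborel. ?f y) - integral {0..x} ?f))"
      unfolding set_integral_scale_min(3)[OF f x] by (simp add: algebra_simps)
    also have "\<dots> = sol lam x"
      unfolding eigenvalue_set_integral(2)[OF eigen x] using sol_eq_scale_slope[OF x, of lam]
      by (simp add: mult.assoc)
    finally show "?\<psi> x = lam * (LINT y:{0..}|lborel. scale (min x y) * ?\<psi> y * m y)" unfolding cong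
      using x by simp
  qed
qed

lemma integral_eigenvalue_iff: "integral_eigenvalue lam \<longleftrightarrow> eigenvalue lam"
  using integral_eigenvalue_imp_eigenvalue eigenvalue_imp_integral_eigenvalue by blast

end

lemma continuous_dens:
  assumes "continuous_on {0..} bp"
  shows "continuous_on {0..} (s_dens \<beta> a bp)" "continuous_on {0..} (m_dens \<beta> a bp)"
  unfolding s_dens_def[abs_def] m_dens_def[abs_def] by (intro continuous_intros assms)+

lemma string_equation_dens: "continuous_on {0..} bp \<Longrightarrow> string_equation (s_dens \<beta> a bp) (m_dens \<beta> a bp)"
  using continuous_dens[of bp] by unfold_locales (auto, auto simp: s_dens_def m_dens_def)

lemma is_G_eigenvalue_iff:
  assumes cont: "continuous_on {0..} bp"
  shows "is_G_eigenvalue \<beta> a bp lam \<longleftrightarrow> string_coefficients.eigenvalue (s_dens \<beta> a bp)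
      (m_dens \<beta> a bp) lam"
proof -
  interpret string_equation "s_dens \<beta> a bp" "m_dens \<beta> a bp" by (rule string_equation_dens[OF cont])
  have scale: "scale_fun \<beta> a bp x = scale x" for x
    unfolding scale_fun_def scale_def by (rule set_integral_Icc_eq_integral(2)[OF cont_s]) simp
  show ?thesis
    unfolding is_G_eigenvalue_def scale integral_eigenvalue_iff[symmetric] integral_eigenvalue_def ..
qed

section \<open>Measurability of the lowest eigenvalue\<close>

definition cont_process :: "'a measure \<Rightarrow> ('a \<Rightarrow> real \<Rightarrow> real) \<Rightarrow> bool" where
  "cont_process M X \<longleftrightarrow>
     (\<forall>t\<ge>0. (\<lambda>w. X w t) \<in> borel_measurable M) \<and> (\<forall>w\<in>space M. continuous_on {0..} (X w))"

lemma cont_processD: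
  "cont_process M X \<Longrightarrow> t \<ge> 0 \<Longrightarrow> (\<lambda>w. X w t) \<in> borel_measurable M"
  "cont_process M X \<Longrightarrow> w \<in> space M \<Longrightarrow> continuous_on {0..} (X w)"
  by (auto simp: cont_process_def)

lemma cont_process_const: "continuous_on {0..} f \<Longrightarrow> cont_process M (\<lambda>w. f)"
  by (auto simp: cont_process_def)

lemma cont_process_rv: "f \<in> borel_measurable M \<Longrightarrow> cont_process M (\<lambda>w t. f w)"
  unfolding cont_process_def by auto

lemma cont_process_add: "cont_process M X \<Longrightarrow> cont_process M Y \<Longrightarrow> cont_process M (\<lambda>w t. X w t + Y w t)"
  unfolding cont_process_def by (auto intro!: continuous_intros borel_measurable_add)

lemma cont_process_diff: "cont_process M X \<Longrightarrow> cont_process M Y \<Longrightarrow> cont_process M (\<lambda>w t. X w t - Y w t)"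
  unfolding cont_process_def by (auto intro!: continuous_intros borel_measurable_diff)

lemma cont_process_mult: "cont_process M X \<Longrightarrow> cont_process M Y \<Longrightarrow> cont_process M (\<lambda>w t. X w t * Y w t)"
  unfolding cont_process_def by (auto intro!: continuous_intros borel_measurable_times)

lemma cont_process_uminus: "cont_process M X \<Longrightarrow> cont_process M (\<lambda>w t. - X w t)"
  unfolding cont_process_def by (auto intro!: continuous_intros borel_measurable_uminus)

lemma cont_process_abs: "cont_process M X \<Longrightarrow> cont_process M (\<lambda>w t. \<bar>X w t\<bar>)"
  unfolding cont_process_def by (auto intro!: continuous_intros borel_measurable_abs)

lemma cont_process_power: "cont_process M X \<Longrightarrow> cont_process M (\<lambda>w t. X w t ^ n)"
  unfolding cont_process_def by (auto intro!: continuous_intros borel_measurable_power)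

lemma cont_process_exp: "cont_process M X \<Longrightarrow> cont_process M (\<lambda>w t. exp (X w t))"
  unfolding cont_process_def by (auto intro!: continuous_intros)

lemma floor_mult_div_tendsto:
  fixes c :: "nat \<Rightarrow> real"
  assumes "filterlim c at_top sequentially"
  shows "(\<lambda>n. of_int \<lfloor>c n * x\<rfloor> / c n) \<longlonglongrightarrow> x"
proof (rule tendsto_sandwich)
  have "(\<lambda>n. x - inverse (c n)) \<longlonglongrightarrow> x - 0"
    by (intro tendsto_intros tendsto_inverse_0_at_top assms)
  then show "(\<lambda>n. x - inverse (c n)) \<longlonglongrightarrow> x" by simp
  have pos: "\<forall>\<^sub>F n in sequentially. c n > 0" using assms by (simp add: filterlim_at_top_dense)
  then show "\<forall>\<^sub>F n in sequentially. x - inverse (c n) \<le> of_int \<lfloor>c n * x\<rfloor> / c n"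
  proof eventually_elim
    case (elim n)
    have "c n * x - 1 \<le> of_int \<lfloor>c n * x\<rfloor>" by linarith
    then have "(c n * x - 1) / c n \<le> of_int \<lfloor>c n * x\<rfloor> / c n" using elim
      by (intro divide_right_mono) auto
    then show ?case using elim by (simp add: field_simps)
  qed
  show "\<forall>\<^sub>F n in sequentially. of_int \<lfloor>c n * x\<rfloor> / c n \<le> x"
    using pos by eventually_elim (simp add: pos_divide_le_eq mult.commute)
qed simp

lemma cont_process_jointly_measurable:
  assumes X: "cont_process M X"
  shows "(\<lambda>p. X (fst p) (max 0 (snd p))) \<in> borel_measurable (M \<Otimes>\<^sub>M lborel)"
proof (rule borel_measurable_LIMSEQ_real)
  fix i :: nat
  have floor: "(\<lambda>p. \<lfloor>real i * snd p\<rfloor>) \<in> measurable (M \<Otimes>\<^sub>M lborel) (count_space UNIV)"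
    by measurable
  show "(\<lambda>p. X (fst p) (max 0 (of_int \<lfloor>real i * snd p\<rfloor> / real i))) \<in> borel_measurable (M \<Otimes>\<^sub>M lborel)"
  proof (rule measurable_compose_countable[OF _ floor])
    fix k :: int
    have "(\<lambda>w. X w (max 0 (of_int k / real i))) \<in> borel_measurable M"
      by (rule cont_processD(1)[OF X]) simp
    then show "(\<lambda>p. X (fst p) (max 0 (of_int k / real i))) \<in> borel_measurable (M \<Otimes>\<^sub>M lborel)"
      by (rule measurable_compose[OF measurable_fst])
  qed
next
  fix p :: "'a \<times> real" assume "p \<in> space (M \<Otimes>\<^sub>M lborel)"
  then have w: "fst p \<in> space M" by (auto simp: space_pair_measure)
  have "continuous_on UNIV (\<lambda>t. X (fst p) (max 0 t))"
    by (rule continuous_on_compose2[OF cont_processD(2)[OF X w]]) (auto intro!: continuous_intros)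
  then have "isCont (\<lambda>t. X (fst p) (max 0 t)) (snd p)" by (simp add: continuous_on_eq_continuous_at)
  from isCont_tendsto_compose[OF this floor_mult_div_tendsto[OF filterlim_real_sequentially]]
  show "(\<lambda>i. X (fst p) (max 0 (of_int \<lfloor>real i * snd p\<rfloor> / real i))) \<longlonglongrightarrow> X (fst p) (max 0 (snd p))" .
qed

lemma cont_process_integral:
  assumes X: "cont_process M X"
  shows "cont_process M (\<lambda>w x. integral {0..x} (X w))"
  unfolding cont_process_def
proof (intro conjI allI impI ballI)
  fix x :: real assume x: "0 \<le> x"
  have "(\<lambda>(w,t). indicator {0..x} t * X w (max 0 t)) \<in> borel_measurable (M \<Otimes>\<^sub>M lborel)"
    using cont_process_jointly_measurable[OF X] unfolding case_prod_beta by measurable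
  then have "(\<lambda>w. LINT t|lborel. indicator {0..x} t * X w (max 0 t)) \<in> borel_measurable M"
    by (rule lborel.borel_measurable_lebesgue_integral)
  also have "?this \<longleftrightarrow> (\<lambda>w. integral {0..x} (X w)) \<in> borel_measurable M"
  proof (rule measurable_cong)
    fix w assume w: "w \<in> space M"
    have "(LINT t|lborel. indicator {0..x} t * X w (max 0 t)) = (LINT t:{0..x}|lborel. X w t)"
      unfolding set_lebesgue_integral_def
      by (rule Bochner_Integration.integral_cong) (auto simp: indicator_def)
    also have "\<dots> = integral {0..x} (X w)"
      by (rule set_integral_Icc_eq_integral(2)[OF cont_processD(2)[OF X w]]) simp
    finally show "(LINT t|lborel. indicator {0..x} t * X w (max 0 t)) = integral {0..x} (X w)" .
  qed
  finally show "(\<lambda>w. integral {0..x} (X w)) \<in> borel_measurable M" .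
next
  fix w assume "w \<in> space M"
  then show "continuous_on {0..} (\<lambda>x. integral {0..x} (X w))"
    by (rule continuous_on_integral_upper[OF cont_processD(2)[OF X]])
qed

lemma cont_process_string_sol:
  assumes s: "cont_process M s" and g: "cont_process M g"
  shows "cont_process M (\<lambda>w. string_sol (s w) (g w))" "cont_process M (\<lambda>w. string_slope (s w) (g w))"
proof -
  have picard: "cont_process M (\<lambda>w x. fst (picard (s w) (g w) n x))
      \<and> cont_process M (\<lambda>w x. snd (picard (s w) (g w) n x))" for n
  proof (induction n)
    case 0
    show ?case by (auto intro!: cont_process_const)
  next
    case (Suc n)
    then have "cont_process M (\<lambda>w x. integral {0..x} (\<lambda>t. s w t * snd (picard (s w) (g w) n t)))"
      "cont_process M (\<lambda>w x. integral {0..x} (\<lambda>t. g w t * fst (picard (s w) (g w) n t)))"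
      by (auto intro!: cont_process_integral cont_process_mult s g)
    then show ?case using cont_process_diff[OF cont_process_const[of "\<lambda>_. 1"]] by simp
  qed
  have "(\<lambda>w. string_sol (s w) (g w) t) \<in> borel_measurable M" if "t \<ge> 0" for t
    by (rule borel_measurable_LIMSEQ_real[where u="\<lambda>n w. fst (picard (s w) (g w) n t)"])
      (use picard that s g in \<open>auto intro!: picard_tendsto cont_processD(2)
        cont_processD(1)[of M "\<lambda>w x. fst (picard (s w) (g w) _ x)"]\<close>)
  then show "cont_process M (\<lambda>w. string_sol (s w) (g w))"
    unfolding cont_process_def[of _ "\<lambda>w. string_sol (s w) (g w)"]
    using continuous_string_sol[OF cont_processD(2)[OF s] cont_processD(2)[OF g]] by blast
  have "(\<lambda>w. string_slope (s w) (g w) t) \<in> borel_measurable M" if "t \<ge> 0" for t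
    by (rule borel_measurable_LIMSEQ_real[where u="\<lambda>n w. snd (picard (s w) (g w) n t)"])
      (use picard that s g in \<open>auto intro!: picard_tendsto cont_processD(2)
        cont_processD(1)[of M "\<lambda>w x. snd (picard (s w) (g w) _ x)"]\<close>)
  then show "cont_process M (\<lambda>w. string_slope (s w) (g w))"
    unfolding cont_process_def[of _ "\<lambda>w. string_slope (s w) (g w)"]
    using continuous_string_slope[OF cont_processD(2)[OF s] cont_processD(2)[OF g]] by blast
qed

lemma continuous_le_iff_rat:
  fixes f :: "real \<Rightarrow> real"
  assumes "continuous_on {a..b} f" "a < b"
  shows "(\<forall>x\<in>{a..b}. f x \<le> K) \<longleftrightarrow> (\<forall>q::rat. of_rat q \<in> {a..b} \<longrightarrow> f (of_rat q) \<le> K)"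
proof (intro iffI ballI)
  fix x assume rat_le: "\<forall>q::rat. of_rat q \<in> {a..b} \<longrightarrow> f (of_rat q) \<le> K" and x: "x \<in> {a..b}"
  show "f x \<le> K"
  proof (rule ccontr)
    assume "\<not> f x \<le> K"
    then obtain d where d: "d > 0" "\<And>y. y \<in> {a..b} \<Longrightarrow> dist y x < d \<Longrightarrow> dist (f y) (f x) < f x - K"
      using x assms(1) unfolding continuous_on_iff by (metis diff_gt_0_iff_gt not_le)
    have "max a (x - d) < min b (x + d)" using x d(1) assms by auto
    then obtain q where "max a (x - d) < of_rat q" "of_rat q < min b (x + d)"
      using of_rat_dense by blast
    then have "of_rat q \<in> {a..b}" "dist (of_rat q) x < d" by (auto simp: dist_real_def)
    then have "f (of_rat q) \<le> K" "dist (f (of_rat q)) (f x) < f x - K" using rat_le d(2) by auto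
    then show False by (auto simp: dist_real_def)
  qed
qed auto

lemma pred_Icc_le:
  assumes X: "cont_process M X" and ab: "0 \<le> a" "a < b"
  shows "Measurable.pred M (\<lambda>w. \<forall>x\<in>{a..b}. X w x \<le> K)"
proof -
  have eq: "(\<forall>x\<in>{a..b}. X w x \<le> K) \<longleftrightarrow> (\<forall>q::rat. of_rat q \<in> {a..b} \<longrightarrow> X w (max 0 (of_rat q)) \<le> K)"
    if w: "w \<in> space M" for w
  proof -
    have "continuous_on {a..b} (X w)"
      by (rule continuous_on_subset[OF cont_processD(2)[OF X w]]) (use ab in auto)
    moreover have "max 0 (of_rat q :: real) = of_rat q" if "of_rat q \<in> {a..b}" for q
      using that ab by auto
    ultimately show ?thesis using continuous_le_iff_rat[of a b "X w" K] ab by auto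
  qed
  have "(\<lambda>w. X w (max 0 (of_rat q))) \<in> borel_measurable M" for q :: rat
    by (rule cont_processD(1)[OF X]) simp
  then have "Measurable.pred M (\<lambda>w. \<forall>q::rat. of_rat q \<in> {a..b} \<longrightarrow> X w (max 0 (of_rat q)) \<le> K)"
    by measurable
  then show ?thesis by (subst measurable_cong[OF eq])
qed

lemma all_pos_iff_bounded_below_on_Icc:
  fixes f :: "real \<Rightarrow> real"
  assumes cont: "continuous_on {0<..} f"
  shows "(\<forall>x>0. f x > 0) \<longleftrightarrow>
    (\<forall>n::nat. \<exists>k::nat. \<forall>x\<in>{1 / real (Suc n)..real (Suc (Suc n))}. - f x \<le> - (1 / real (Suc k)))"
    (is "?pos \<longleftrightarrow> (\<forall>n. \<exists>k. ?bound n k)")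
proof (intro iffI allI impI)
  fix n assume ?pos
  let ?I = "{1 / real (Suc n)..real (Suc (Suc n))}"
  have I_pos: "x > 0" if "x \<in> ?I" for x
    using that less_le_trans[of 0 "1 / real (Suc n)" x] by simp
  have "1 / real (Suc n) \<le> 1" by simp
  then have "?I \<noteq> {}" by (simp only: atLeastatMost_empty_iff)
  moreover have "continuous_on ?I f" by (rule continuous_on_subset[OF cont]) (use I_pos in auto)
  ultimately obtain x where x: "x \<in> ?I" "\<And>y. y \<in> ?I \<Longrightarrow> f x \<le> f y"
    using continuous_attains_inf[of ?I f] by auto
  then have "f x > 0" using \<open>?pos\<close> I_pos by blast
  then obtain k where "inverse (real (Suc k)) < f x" using reals_Archimedean by blast
  then have "?bound n k" using x(2) by (force simp: inverse_eq_divide)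
  then show "\<exists>k. ?bound n k" by blast
next
  fix x :: real assume bound: "\<forall>n. \<exists>k. ?bound n k" and x: "x > 0"
  obtain n1 where n1: "inverse (real (Suc n1)) < x" using reals_Archimedean[OF x] by blast
  obtain n2 :: nat where n2: "x < real n2" using reals_Archimedean2 by blast
  define n where "n = max n1 n2"
  have "1 / real (Suc n) \<le> 1 / real (Suc n1)" by (rule divide_left_mono) (auto simp: n_def)
  then have "x \<in> {1 / real (Suc n)..real (Suc (Suc n))}" using n1 n2
    by (auto simp: n_def inverse_eq_divide)
  moreover obtain k where "?bound n k" using bound by blast
  ultimately have "1 / real (Suc k) \<le> f x" by auto
  then show "f x > 0" using less_le_trans[of 0 "1 / real (Suc k)" "f x"] by simp
qed

lemma pred_all_pos:
  assumes X: "cont_process M X"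
  shows "Measurable.pred M (\<lambda>w. \<forall>x>0. X w x > 0)"
proof -
  let ?P = "\<lambda>w. \<forall>n::nat. \<exists>k::nat. \<forall>x\<in>{1 / real (Suc n)..real (Suc (Suc n))}. - X w x
      \<le> - (1 / real (Suc k))"
  have "1 / real (Suc n) < real (Suc (Suc n))" for n by (rule le_less_trans[of _ 1]) auto
  then have "Measurable.pred M ?P"
    by (intro pred_intros_countable pred_Icc_le[OF cont_process_uminus[OF X]]) auto
  moreover have "(\<forall>x>0. X w x > 0) \<longleftrightarrow> ?P w" if "w \<in> space M" for w
    by (rule all_pos_iff_bounded_below_on_Icc,
        rule continuous_on_subset[OF cont_processD(2)[OF X that]]) auto
  ultimately show ?thesis by (subst measurable_cong)
qed

lemma bounded_integral_iff_nat:
  "bounded_integral f \<longleftrightarrow> (\<exists>K::nat. \<forall>n::nat. \<forall>x\<in>{0..real (Suc n)}. integral {0..x} f \<le> real K)"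
proof
  assume "bounded_integral f"
  then obtain K where K: "\<And>x. x \<ge> 0 \<Longrightarrow> integral {0..x} f \<le> K" by (auto simp: bounded_integral_def)
  obtain k :: nat where "K < real k" using reals_Archimedean2 by blast
  then have "\<forall>n::nat. \<forall>x\<in>{0..real (Suc n)}. integral {0..x} f \<le> real k" using K by force
  then show "\<exists>K::nat. \<forall>n::nat. \<forall>x\<in>{0..real (Suc n)}. integral {0..x} f \<le> real K" by blast
next
  assume "\<exists>K::nat. \<forall>n::nat. \<forall>x\<in>{0..real (Suc n)}. integral {0..x} f \<le> real K"
  then obtain K :: nat where K: "\<And>n x. x \<in> {0..real (Suc n)} \<Longrightarrow> integral {0..x} f \<le> real K" by blast
  have "integral {0..x} f \<le> real K" if "x \<ge> 0" for x
  proof -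
    obtain n :: nat where "x < real n" using reals_Archimedean2 by blast
    then show ?thesis using K[of x n] that by simp
  qed
  then show "bounded_integral f" unfolding bounded_integral_def by blast
qed

lemma pred_bounded_integral:
  assumes X: "cont_process M X"
  shows "Measurable.pred M (\<lambda>w. bounded_integral (X w))"
  unfolding bounded_integral_iff_nat
  by (intro pred_intros_countable pred_Icc_le[OF cont_process_integral[OF X]]) auto

lemma bounded_integral_nonneg_iff_nat:
  assumes cont: "continuous_on {0..} f" and nonneg: "\<And>x. x \<ge> 0 \<Longrightarrow> f x \<ge> 0"
  shows "bounded_integral f \<longleftrightarrow> (\<exists>K::nat. \<forall>k::nat. integral {0..real k} f \<le> real K)"
proof
  assume "bounded_integral f"
  then obtain K where K: "\<And>x. x \<ge> 0 \<Longrightarrow> integral {0..x} f \<le> K" by (auto simp: bounded_integral_def)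
  obtain k :: nat where "K < real k" using reals_Archimedean2 by blast
  then have "integral {0..real j} f \<le> real k" for j using K[of "real j"] by simp
  then show "\<exists>K::nat. \<forall>k::nat. integral {0..real k} f \<le> real K" by blast
next
  assume "\<exists>K::nat. \<forall>k::nat. integral {0..real k} f \<le> real K"
  then obtain K :: nat where K: "\<And>k. integral {0..real k} f \<le> real K" by blast
  have "integral {0..x} f \<le> real K" if "x \<ge> 0" for x
  proof -
    obtain k :: nat where "x < real k" using reals_Archimedean2 by blast
    then have "integral {0..x} f \<le> integral {0..real k} f" using that
      by (intro integral_mono_upper cont nonneg) auto
    then show ?thesis using K[of k] by simp
  qed
  then show "bounded_integral f" unfolding bounded_integral_def by blast
qed

lemma bounded_integral_add_iff:
  fixes f g :: "real \<Rightarrow> real"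
  assumes cont: "continuous_on {0..} f" "continuous_on {0..} g"
    and nonneg: "\<And>x. x \<ge> 0 \<Longrightarrow> f x \<ge> 0" "\<And>x. x \<ge> 0 \<Longrightarrow> g x \<ge> 0"
  shows "bounded_integral (\<lambda>x. f x + g x) \<longleftrightarrow> bounded_integral f \<and> bounded_integral g"
proof
  assume sum: "bounded_integral (\<lambda>x. f x + g x)"
  have "continuous_on {0..} (\<lambda>x. f x + g x)" by (intro continuous_intros cont)
  then show "bounded_integral f \<and> bounded_integral g"
    using bounded_integral_comparison[OF cont(1) _ _ _ order_refl _ sum, of 1]
      bounded_integral_comparison[OF cont(2) _ _ _ order_refl _ sum, of 1] nonneg by simp
next
  assume "bounded_integral f \<and> bounded_integral g"
  then obtain K1 K2 where K: "\<And>x. x \<ge> 0 \<Longrightarrow> integral {0..x} f \<le> K1" "\<And>x. x \<ge> 0 \<Longrightarrow> integral {0..x} g \<le> K2"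
    by (auto simp: bounded_integral_def)
  have "integral {0..x} (\<lambda>x. f x + g x) = integral {0..x} f + integral {0..x} g" for x
    by (rule Henstock_Kurzweil_Integration.integral_add)
      (auto intro!: integrable_on_atLeast_subinterval cont)
  then have "integral {0..x} (\<lambda>x. f x + g x) \<le> K1 + K2" if "x \<ge> 0" for x using K[OF that] by simp
  then show "bounded_integral (\<lambda>x. f x + g x)" unfolding bounded_integral_def by blast
qed

lemma rat_sequence_in_Icc_tendsto:
  fixes c d l :: real
  assumes "c < d" "l \<in> {c..d}"
  obtains q :: "nat \<Rightarrow> rat" where "\<And>k. of_rat (q k) \<in> {c..d}" "(\<lambda>k. of_rat (q k)) \<longlonglongrightarrow> l"
proof -
  have "\<exists>q::rat. of_rat q \<in> {c..d} \<and> \<bar>of_rat q - l\<bar> < 1 / real (Suc k)" for k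
  proof -
    define e where "e = 1 / real (Suc k)"
    have "e > 0" by (simp add: e_def)
    then have "max c (l - e) < min d (l + e)" using assms by auto
    then obtain q where "max c (l - e) < of_rat q" "of_rat q < min d (l + e)"
      using of_rat_dense by blast
    then show ?thesis unfolding e_def[symmetric] by (intro exI[of _ q]) (auto simp: abs_less_iff)
  qed
  then obtain q :: "nat \<Rightarrow> rat"
    where q: "\<And>k. of_rat (q k) \<in> {c..d}" "\<And>k. \<bar>of_rat (q k) - l\<bar> < 1 / real (Suc k)" by metis
  have "(\<lambda>k. of_rat (q k) - l) \<longlonglongrightarrow> 0"
    by (rule Lim_null_comparison[OF _ LIMSEQ_inverse_real_of_nat])
      (use q(2) in \<open>auto simp: inverse_eq_divide less_imp_le\<close>)
  then have "(\<lambda>k. of_rat (q k)) \<longlonglongrightarrow> l" by (simp add: LIM_zero_iff)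
  with q(1) show ?thesis by (rule that)
qed

text \<open>An existential quantifier over an uncountable compact interval is replaced by rational
  approximations at every level \<open>n\<close>; compactness of the interval and monotonicity in \<open>n\<close> recover a
  common witness.\<close>

lemma ex_Icc_all_le_iff_rat:
  fixes f :: "nat \<Rightarrow> real \<Rightarrow> real"
  assumes "c < d" and cont: "\<And>n l l'. l \<longlonglongrightarrow> l' \<Longrightarrow> (\<lambda>k. f n (l k)) \<longlonglongrightarrow> f n l'"
    and mono: "\<And>n n' l. n \<le> n' \<Longrightarrow> f n l \<le> f n' l"
  shows "(\<exists>l\<in>{c..d}. \<forall>n. f n l \<le> K) \<longleftrightarrow>
      (\<forall>n. \<exists>q::rat. of_rat q \<in> {c..d} \<and> f n (of_rat q) < K + 1 / real (Suc n))"
proof (intro iffI allI)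
  fix n assume "\<exists>l\<in>{c..d}. \<forall>n. f n l \<le> K"
  then obtain l where l: "l \<in> {c..d}" "f n l \<le> K" by blast
  obtain q :: "nat \<Rightarrow> rat" where q: "\<And>k. of_rat (q k) \<in> {c..d}" "(\<lambda>k. of_rat (q k)) \<longlonglongrightarrow> l"
    using rat_sequence_in_Icc_tendsto[OF \<open>c < d\<close> l(1)] by blast
  have "f n l < K + 1 / real (Suc n)" using l(2) le_less_trans[of _ K "K + 1 / real (Suc n)"] by simp
  from order_tendstoD(2)[OF cont[OF q(2)] this] obtain k where "f n (of_rat (q k))
      < K + 1 / real (Suc n)"
    unfolding eventually_sequentially by blast
  then show "\<exists>q::rat. of_rat q \<in> {c..d} \<and> f n (of_rat q) < K + 1 / real (Suc n)" using q(1) by blast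
next
  assume "\<forall>n. \<exists>q::rat. of_rat q \<in> {c..d} \<and> f n (of_rat q) < K + 1 / real (Suc n)"
  then obtain q :: "nat \<Rightarrow> rat"
    where q: "\<And>n. of_rat (q n) \<in> {c..d}" "\<And>n. f n (of_rat (q n)) < K + 1 / real (Suc n)" by metis
  have "compact {c..d}" by simp
  then obtain l r where l: "l \<in> {c..d}" "strict_mono (r :: nat \<Rightarrow> nat)" "((\<lambda>n. of_rat (q n)) \<circ> r) \<longlonglongrightarrow> l"
    using q(1) unfolding compact_def by (metis (no_types, lifting))
  have "f n l \<le> K" for n
  proof (rule LIMSEQ_le)
    show "(\<lambda>k. f n (((\<lambda>n. of_rat (q n)) \<circ> r) k)) \<longlonglongrightarrow> f n l" by (rule cont[OF l(3)])
    have "(\<lambda>k. 1 / real (Suc (r k))) \<longlonglongrightarrow> 0"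
      using LIMSEQ_subseq_LIMSEQ[OF LIMSEQ_inverse_real_of_nat l(2)]
      by (simp add: o_def inverse_eq_divide)
    then have "(\<lambda>k. K + 1 / real (Suc (r k))) \<longlonglongrightarrow> K + 0" by (intro tendsto_intros)
    then show "(\<lambda>k. K + 1 / real (Suc (r k))) \<longlonglongrightarrow> K" by simp
    have "f n (of_rat (q (r k))) \<le> K + 1 / real (Suc (r k))" if "k \<ge> n" for k
    proof -
      have "n \<le> r k" using seq_suble[OF l(2), of k] that by simp
      then show ?thesis using mono[of n "r k" "of_rat (q (r k))"] q(2)[of "r k"] by linarith
    qed
    then show "\<exists>N. \<forall>k\<ge>N. f n (((\<lambda>n. of_rat (q n)) \<circ> r) k) \<le> K + 1 / real (Suc (r k))" by auto
  qed
  then show "\<exists>l\<in>{c..d}. \<forall>n. f n l \<le> K" using l(1) by blast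
qed

lemma pred_ex_Icc_all_le:
  fixes f :: "'a \<Rightarrow> nat \<Rightarrow> real \<Rightarrow> real"
  assumes meas: "\<And>n l. (\<lambda>w. f w n l) \<in> borel_measurable M" and "c < d"
    and cont: "\<And>w n l l'. w \<in> space M \<Longrightarrow> l \<longlonglongrightarrow> l' \<Longrightarrow> (\<lambda>k. f w n (l k)) \<longlonglongrightarrow> f w n l'"
    and mono: "\<And>w n n' l. w \<in> space M \<Longrightarrow> n \<le> n' \<Longrightarrow> f w n l \<le> f w n' l"
  shows "Measurable.pred M (\<lambda>w. \<exists>l\<in>{c..d}. \<forall>n. f w n l \<le> K)"
proof -
  have "Measurable.pred M (\<lambda>w. \<forall>n. \<exists>q::rat. of_rat q \<in> {c..d} \<and> f w n (of_rat q)
      < K + 1 / real (Suc n))"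
    using meas by measurable
  then show ?thesis
    by (subst measurable_cong[OF ex_Icc_all_le_iff_rat[OF \<open>c < d\<close> cont mono]])
qed

definition (in string_coefficients) sol_mass :: "nat \<Rightarrow> real \<Rightarrow> real" where
  "sol_mass k l = integral {0..real k} (\<lambda>t. (\<bar>sol l t\<bar> + (sol l t)\<^sup>2) * m t)"

context string_equation
begin

lemma cont_sol_mass_density: "continuous_on {0..} (\<lambda>t. (\<bar>sol l t\<bar> + (sol l t)\<^sup>2) * m t)"
  by (intro continuous_intros cont_facts)

lemma sol_mass_mono: "k \<le> k' \<Longrightarrow> sol_mass k l \<le> sol_mass k' l"
  unfolding sol_mass_def
  by (rule integral_mono_upper[OF cont_sol_mass_density]) (use m_pos in \<open>auto simp: less_imp_le\<close>)

lemma sol_mass_tendsto: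
  assumes "l \<longlonglongrightarrow> lam"
  shows "(\<lambda>n. sol_mass k (l n)) \<longlonglongrightarrow> sol_mass k lam"
proof -
  let ?X = "real k"
  note unif = sol_slope_uniform_limit(1)[OF assms, of ?X, simplified]
  obtain B where B: "B > 0" "\<And>x. 0 \<le> x \<Longrightarrow> x \<le> ?X \<Longrightarrow> \<bar>sol lam x\<bar> \<le> B"
    by (rule continuous_on_atLeast_bounded_Icc[OF cont_sol]) auto
  have "\<forall>\<^sub>F n in sequentially. \<forall>x\<in>{0..?X}. dist (sol (l n) x) (sol lam x) < 1"
    using uniform_limitD[OF unif, of 1] by simp
  then obtain N where N: "\<And>n x. n \<ge> N \<Longrightarrow> x \<in> {0..?X} \<Longrightarrow> dist (sol (l n) x) (sol lam x) < 1"
    unfolding eventually_sequentially by blast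
  have bound: "\<bar>sol (l (n + N)) x\<bar> \<le> B + 1" if "x \<in> {0..?X}" for n x
    using N[of "n + N" x] B(2)[of x] that by (auto simp: dist_real_def)
  have "(\<lambda>n. sol_mass k (l (n + N))) \<longlonglongrightarrow> sol_mass k lam"
    unfolding sol_mass_def
  proof (rule dominated_convergence(2))
    show "(\<lambda>t. (\<bar>sol (l (n + N)) t\<bar> + (sol (l (n + N)) t)\<^sup>2) * m t) integrable_on {0..?X}" for n
      by (intro integrable_on_atLeast_subinterval cont_sol_mass_density) auto
    show "(\<lambda>t. ((B + 1) + (B + 1)\<^sup>2) * m t) integrable_on {0..?X}"
      by (intro integrable_on_atLeast_subinterval continuous_intros cont_facts) auto
    fix n t assume t: "t \<in> {0..?X}"
    have "(sol (l (n + N)) t)\<^sup>2 \<le> (B + 1)\<^sup>2" using bound[OF t, of n] B(1)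
      by (intro abs_le_square_iff[THEN iffD1]) auto
    then have "(\<bar>sol (l (n + N)) t\<bar> + (sol (l (n + N)) t)\<^sup>2) * m t \<le> ((B + 1) + (B + 1)\<^sup>2) * m t"
      using bound[OF t, of n] m_pos[of t] t by (intro mult_right_mono add_mono) auto
    then show "norm ((\<bar>sol (l (n + N)) t\<bar> + (sol (l (n + N)) t)\<^sup>2) * m t) \<le> ((B + 1) + (B + 1)\<^sup>2) * m t"
      using m_pos[of t] t by (simp add: abs_mult)
  next
    fix t assume t: "t \<in> {0..?X}"
    have "(\<lambda>n. sol (l (n + N)) t) \<longlonglongrightarrow> sol lam t"
      by (rule LIMSEQ_ignore_initial_segment[OF tendsto_uniform_limitI[OF unif t]])
    then show "(\<lambda>n. (\<bar>sol (l (n + N)) t\<bar> + (sol (l (n + N)) t)\<^sup>2) * m t)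
        \<longlonglongrightarrow> (\<bar>sol lam t\<bar> + (sol lam t)\<^sup>2) * m t"
      by (intro tendsto_intros)
  qed
  then show ?thesis by (rule LIMSEQ_offset)
qed

lemma bounded_integral_sol_iff:
  "bounded_integral (\<lambda>t. \<bar>sol l t\<bar> * m t) \<and> bounded_integral (\<lambda>t. (sol l t)\<^sup>2 * m t)
    \<longleftrightarrow> (\<exists>K::nat. \<forall>k. sol_mass k l \<le> real K)"
proof -
  have "bounded_integral (\<lambda>t. \<bar>sol l t\<bar> * m t) \<and> bounded_integral (\<lambda>t. (sol l t)\<^sup>2 * m t)
      \<longleftrightarrow> bounded_integral (\<lambda>t. (\<bar>sol l t\<bar> + (sol l t)\<^sup>2) * m t)"
    unfolding distrib_right
    by (rule bounded_integral_add_iff[symmetric])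
      (use m_pos in \<open>auto intro!: continuous_intros cont_facts simp: less_imp_le\<close>)
  also have "\<dots> \<longleftrightarrow> (\<exists>K::nat. \<forall>k. sol_mass k l \<le> real K)"
    unfolding sol_mass_def
    by (rule bounded_integral_nonneg_iff_nat[OF cont_sol_mass_density])
      (use m_pos in \<open>auto simp: less_imp_le\<close>)
  finally show ?thesis .
qed

lemma eigenvalue_less_iff_trace_class:
  assumes trace_class
  shows "(\<exists>l<L. eigenvalue l) \<longleftrightarrow> 0 < L \<and> \<not> slope_positive L"
proof (cases "L > 0")
  case True
  then show ?thesis using slope_positive_iff_le_eigenvalues[OF assms True] by (auto simp: not_le)
next
  case False
  then show ?thesis using eigenvalue_pos by force
qed

lemma eigenvalue_less_iff_not_trace_class:
  assumes "\<not> trace_class"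
  shows "(\<exists>l<L. eigenvalue l) \<longleftrightarrow> (scale_unbounded \<or> \<not> bounded_integral (\<lambda>t. scale_tail t * m t)) \<and>
    (\<exists>n::nat. 1 / real (Suc n) < L - 1 / real (Suc n) \<and>
      (\<exists>K::nat. \<exists>l\<in>{1 / real (Suc n)..L - 1 / real (Suc n)}. \<forall>k. sol_mass k l \<le> real K))"
    (is "?lhs \<longleftrightarrow> ?boundary \<and> ?rhs")
proof -
  have ev_iff: "eigenvalue l \<longleftrightarrow> ?boundary \<and> l > 0 \<and> (\<exists>K::nat. \<forall>k. sol_mass k l \<le> real K)" for l
    unfolding eigenvalue_iff_not_trace_class[OF assms] bounded_integral_sol_iff ..
  show ?thesis
  proof
    assume ?lhs
    then obtain l K where l: "l < L" "l > 0" ?boundary and K: "\<And>k. sol_mass k l \<le> real (K::nat)"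
      unfolding ev_iff by blast
    have "min l (L - l) > 0" using l by simp
    then obtain n where "inverse (real (Suc n)) < min l (L - l)" using reals_Archimedean by blast
    then have "1 / real (Suc n) < l" "l < L - 1 / real (Suc n)" by (auto simp: inverse_eq_divide)
    then show "?boundary \<and> ?rhs" using l(3) K by (intro conjI exI[of _ n] exI[of _ K] bexI[of _ l]) auto
  next
    assume rhs: "?boundary \<and> ?rhs"
    then obtain n K l where l: "l \<in> {1 / real (Suc n)..L - 1 / real (Suc n)}"
      "\<And>k. sol_mass k l \<le> real (K::nat)" by blast
    have "1 / real (Suc n) > 0" by simp
    then have "l > 0" "l < L" using l(1) by (simp_all only: atLeastAtMost_iff, linarith+)
    then show ?lhs using ev_iff l(2) rhs by blast
  qed
qed

end

locale string_process =
  fixes M :: "'a measure" and s m :: "'a \<Rightarrow> real \<Rightarrow> real"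
  assumes process_s: "cont_process M s" and process_m: "cont_process M m"
    and s_pos: "\<And>w x. w \<in> space M \<Longrightarrow> x \<ge> 0 \<Longrightarrow> s w x > 0"
    and m_pos: "\<And>w x. w \<in> space M \<Longrightarrow> x \<ge> 0 \<Longrightarrow> m w x > 0"
begin

lemma string_equation_path: "w \<in> space M \<Longrightarrow> string_equation (s w) (m w)"
  by unfold_locales (use process_s process_m s_pos m_pos in \<open>auto intro: cont_processD(2)\<close>)

lemma cont_process_potential: "cont_process M (\<lambda>w t. lam * m w t)"
  by (intro cont_process_mult cont_process_const process_m) auto

lemma cont_process_scale: "cont_process M (\<lambda>w. string_coefficients.scale (s w))"
  unfolding string_coefficients.scale_def[abs_def] by (rule cont_process_integral[OF process_s])

lemma cont_process_sol: "cont_process M (\<lambda>w. string_coefficients.sol (s w) (m w) lam)"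
  unfolding string_coefficients.sol_def
  by (rule cont_process_string_sol(1)[OF process_s cont_process_potential])

lemma pred_slope_positive: "Measurable.pred M (\<lambda>w. string_coefficients.slope_positive (s w) (m w) lam)"
proof -
  have "string_coefficients.slope_positive (s w) (m w) lam \<longleftrightarrow>
      (\<forall>x>0. string_slope (s w) (\<lambda>t. lam * m w t) x > 0)"
    if "w \<in> space M" for w
  proof -
    interpret string_equation "s w" "m w" by (rule string_equation_path[OF that])
    show ?thesis unfolding slope_positive_def using slope_0[of lam] by (auto simp: slope_def le_less)
  qed
  moreover have "Measurable.pred M (\<lambda>w. \<forall>x>0. string_slope (s w) (\<lambda>t. lam * m w t) x > 0)"
    by (rule pred_all_pos[OF cont_process_string_sol(2)[OF process_s cont_process_potential]])
  ultimately show ?thesis by (subst measurable_cong)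
qed

lemma pred_trace_class: "Measurable.pred M (\<lambda>w. string_coefficients.trace_class (s w) (m w))"
  unfolding string_coefficients.trace_class_def
  by (rule pred_bounded_integral[OF cont_process_mult[OF cont_process_scale process_m]])

lemma pred_scale_unbounded: "Measurable.pred M (\<lambda>w. string_coefficients.scale_unbounded (s w))"
proof -
  have "(\<lambda>w. string_coefficients.scale (s w) (real n)) \<in> borel_measurable M" for n :: nat
    by (rule cont_processD(1)[OF cont_process_scale]) simp
  then show ?thesis unfolding string_coefficients.scale_unbounded_def by measurable
qed

lemma pred_bounded_integral_scale_tail:
  "Measurable.pred M (\<lambda>w. bounded_integral (\<lambda>t. string_coefficients.scale_tail (s w) t * m w t))"
proof (rule pred_bounded_integral, rule cont_process_mult[OF _ process_m])
  have "(\<lambda>w. lim (\<lambda>n. string_coefficients.scale (s w) (real n))) \<in> borel_measurable M"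
    by (rule borel_measurable_lim_metric, rule cont_processD(1)[OF cont_process_scale]) simp
  then show "cont_process M (\<lambda>w. string_coefficients.scale_tail (s w))"
    unfolding string_coefficients.scale_tail_def[abs_def]
    by (intro cont_process_diff cont_process_rv cont_process_scale)
qed

lemma pred_ex_sol_mass_le:
  assumes "c < d"
  shows "Measurable.pred M (\<lambda>w. \<exists>l\<in>{c..d}. \<forall>k. string_coefficients.sol_mass (s w) (m w) k l \<le> K)"
proof (rule pred_ex_Icc_all_le[OF _ assms])
  show "(\<lambda>w. string_coefficients.sol_mass (s w) (m w) k l) \<in> borel_measurable M" for k l
    unfolding string_coefficients.sol_mass_def
    by (rule cont_processD(1)[OF cont_process_integral])
      (auto intro!: cont_process_mult cont_process_add cont_process_abs cont_process_power
          cont_process_sol process_m)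
qed (auto intro: string_equation.sol_mass_tendsto string_equation.sol_mass_mono string_equation_path)

lemma pred_eigenvalue_less: "Measurable.pred M (\<lambda>w. \<exists>l<L. string_coefficients.eigenvalue (s w) (m w) l)"
proof -
  let ?not_trace_class = "\<lambda>w. (string_coefficients.scale_unbounded (s w)
       \<or> \<not> bounded_integral (\<lambda>t. string_coefficients.scale_tail (s w) t * m w t)) \<and>
     (\<exists>n::nat. 1 / real (Suc n) < L - 1 / real (Suc n) \<and>
        (\<exists>K::nat. \<exists>l\<in>{1 / real (Suc n)..L - 1 / real (Suc n)}.
            \<forall>k. string_coefficients.sol_mass (s w) (m w) k l \<le> real K))"
  let ?P = "\<lambda>w. if string_coefficients.trace_class (s w) (m w)
     then 0 < L \<and> \<not> string_coefficients.slope_positive (s w) (m w) L else ?not_trace_class w"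
  have mass: "Measurable.pred M (\<lambda>w. 1 / real (Suc n) < L - 1 / real (Suc n) \<and>
      (\<exists>K::nat. \<exists>l\<in>{1 / real (Suc n)..L - 1 / real (Suc n)}. \<forall>k. string_coefficients.sol_mass (s w)
          (m w) k l \<le> real K))" for n
  proof (cases "1 / real (Suc n) < L - 1 / real (Suc n)")
    case True
    have "Measurable.pred M (\<lambda>w. \<exists>K::nat. \<exists>l\<in>{1 / real (Suc n)..L - 1 / real (Suc n)}.
        \<forall>k. string_coefficients.sol_mass (s w) (m w) k l \<le> real K)"
      by (rule pred_intros_countable, rule pred_ex_sol_mass_le[OF True])
    then show ?thesis using True by (simp only: simp_thms)
  qed simp
  have "Measurable.pred M ?P"
    unfolding if_bool_eq_disj
    by (intro pred_intros_logic pred_intros_countable mass pred_trace_class pred_scale_unbounded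
        pred_bounded_integral_scale_tail pred_slope_positive) simp_all
  moreover have "(\<exists>l<L. string_coefficients.eigenvalue (s w) (m w) l) \<longleftrightarrow> ?P w" if "w \<in> space M" for w
    using string_equation.eigenvalue_less_iff_trace_class[OF string_equation_path[OF that]]
      string_equation.eigenvalue_less_iff_not_trace_class[OF string_equation_path[OF that]] by simp
  ultimately show ?thesis by (subst measurable_cong)
qed

end

text \<open>Without eigenvalues \<open>Lambda0\<close> is the unspecified real \<open>Inf {}\<close>.\<close>

lemma Lambda0_ge_iff:
  assumes cont: "continuous_on {0..} bp"
  shows "L \<le> Lambda0 \<beta> a bp \<longleftrightarrow>
    (if \<exists>n::nat. \<exists>l<real n. string_coefficients.eigenvalue (s_dens \<beta> a bp) (m_dens \<beta> a bp) l
     then \<not> (\<exists>l<L. string_coefficients.eigenvalue (s_dens \<beta> a bp) (m_dens \<beta> a bp) l) else L \<le> Inf {})"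
proof -
  interpret string_equation "s_dens \<beta> a bp" "m_dens \<beta> a bp" by (rule string_equation_dens[OF cont])
  have Lambda0: "Lambda0 \<beta> a bp = Inf {l. eigenvalue l}"
    unfolding Lambda0_def is_G_eigenvalue_iff[OF cont] ..
  have bdd: "bdd_below {l. eigenvalue l}"
    by (rule bdd_belowI[of _ 0]) (use eigenvalue_pos in \<open>auto simp: less_imp_le\<close>)
  show ?thesis
  proof (cases "\<exists>l. eigenvalue l")
    case True
    then have "\<exists>n::nat. \<exists>l<real n. eigenvalue l" using reals_Archimedean2 by blast
    moreover have "L \<le> Inf {l. eigenvalue l} \<longleftrightarrow> \<not> (\<exists>l<L. eigenvalue l)"
      using le_cInf_iff[OF _ bdd, of L] True by (auto simp: not_less)
    ultimately show ?thesis using Lambda0 by simp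
  next
    case False
    then show ?thesis using Lambda0 by simp
  qed
qed

lemma string_process_dens:
  assumes "cont_process M b"
  shows "string_process M (\<lambda>w. s_dens \<beta> a (b w)) (\<lambda>w. m_dens \<beta> a (b w))"
proof
  show "cont_process M (\<lambda>w. s_dens \<beta> a (b w))" "cont_process M (\<lambda>w. m_dens \<beta> a (b w))"
    unfolding s_dens_def[abs_def] m_dens_def[abs_def]
    by (intro cont_process_exp cont_process_add cont_process_diff cont_process_mult assms
        cont_process_const
        continuous_intros)+
qed (auto simp: s_dens_def m_dens_def)

lemma pred_Lambda0_ge:
  assumes b: "cont_process M b"
  shows "Measurable.pred M (\<lambda>w. L \<le> Lambda0 \<beta> a (b w))"
proof -
  interpret string_process M "\<lambda>w. s_dens \<beta> a (b w)" "\<lambda>w. m_dens \<beta> a (b w)"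
    by (rule string_process_dens[OF b])
  have "Measurable.pred M (\<lambda>w. if \<exists>n::nat. \<exists>l<real n. string_coefficients.eigenvalue (s_dens \<beta> a (b w)) (m_dens \<beta> a (b w)) l
     then \<not> (\<exists>l<L. string_coefficients.eigenvalue (s_dens \<beta> a (b w))
         (m_dens \<beta> a (b w)) l) else L \<le> Inf {})"
    unfolding if_bool_eq_disj
    by (intro pred_intros_logic pred_intros_countable pred_eigenvalue_less) simp_all
  then show ?thesis by (subst measurable_cong[OF Lambda0_ge_iff[OF cont_processD(2)[OF b]]])
qed

section \<open>The Riccati equation as a linear system\<close>

definition riccati_scale :: "real \<Rightarrow> (real \<Rightarrow> real) \<Rightarrow> real \<Rightarrow> real" where
  "riccati_scale \<sigma> W t = exp (- 2 * \<sigma> * integral {0..t} W)"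

definition riccati_potential :: "real \<Rightarrow> (real \<Rightarrow> real) \<Rightarrow> real \<Rightarrow> real \<Rightarrow> real" where
  "riccati_potential \<sigma> W \<mu> t = (\<sigma>\<^sup>2 * (W t)\<^sup>2 - t - \<mu>) * exp (2 * \<sigma> * integral {0..t} W)"

definition riccati_sol :: "real \<Rightarrow> (real \<Rightarrow> real) \<Rightarrow> real \<Rightarrow> real \<Rightarrow> real" where
  "riccati_sol \<sigma> W \<mu> = string_sol (riccati_scale \<sigma> W) (riccati_potential \<sigma> W \<mu>)"

definition riccati_slope :: "real \<Rightarrow> (real \<Rightarrow> real) \<Rightarrow> real \<Rightarrow> real \<Rightarrow> real" where
  "riccati_slope \<sigma> W \<mu> = string_slope (riccati_scale \<sigma> W) (riccati_potential \<sigma> W \<mu>)"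

text \<open>The noise is subtracted: \<open>\<sigma> W + riccati_log_deriv \<sigma> W \<mu>\<close> solves the Riccati equation.\<close>

definition riccati_log_deriv :: "real \<Rightarrow> (real \<Rightarrow> real) \<Rightarrow> real \<Rightarrow> real \<Rightarrow> real" where
  "riccati_log_deriv \<sigma> W \<mu> t = riccati_scale \<sigma> W t * riccati_slope \<sigma> W \<mu> t / riccati_sol \<sigma> W \<mu> t"

text \<open>For a solution \<open>z + \<sigma> W\<close> of the Riccati equation the defect \<open>d\<close> satisfies \<open>d' = - (z + 2 \<sigma>
  W) d\<close>, so its positivity propagates to the left, where \<open>d\<close> decreases; but \<open>d\<close> vanishes at \<open>0\<close>,
  and it would be positive at a zero of \<open>riccati_sol\<close> with negative slope.\<close>

definition riccati_defect :: "real \<Rightarrow> (real \<Rightarrow> real) \<Rightarrow> real \<Rightarrow> (real \<Rightarrow> real) \<Rightarrow> real \<Rightarrow> real" where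
  "riccati_defect \<sigma> W \<mu> z t = z t * riccati_sol \<sigma> W \<mu> t - riccati_scale \<sigma> W t * riccati_slope \<sigma> W \<mu> t"

lemma riccati_scale_pos: "riccati_scale \<sigma> W t > 0" by (simp add: riccati_scale_def)

lemma riccati_scale_potential:
  "riccati_scale \<sigma> W t * riccati_potential \<sigma> W \<mu> t = \<sigma>\<^sup>2 * (W t)\<^sup>2 - t - \<mu>"
proof -
  have "exp (- 2 * \<sigma> * integral {0..t} W) * exp (2 * \<sigma> * integral {0..t} W) = 1"
    by (subst exp_add[symmetric]) simp
  then show ?thesis unfolding riccati_scale_def riccati_potential_def by (simp add: algebra_simps)
qed

lemma continuous_on_atLeast_tendsto_at_right:
  fixes f :: "real \<Rightarrow> 'a::topological_space"
  assumes "continuous_on {0..} f"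
  shows "(f \<longlongrightarrow> f 0) (at_right 0)"
proof -
  have "(f \<longlongrightarrow> f 0) (at 0 within {0..})" using assms by (auto simp: continuous_on_def)
  then show ?thesis by (rule tendsto_within_subset) auto
qed

lemma interval_integral_eq_integral_if_continuous:
  fixes f :: "real \<Rightarrow> real"
  assumes "continuous_on {y..x} f" "y \<le> x"
  shows "(LBINT t=y..x. f t) = integral {y..x} f"
  by (rule interval_integral_eq_integral[OF assms(2) borel_integrable_atLeastAtMost'[OF assms(1)]])

lemma linear_ode_pos_backward:
  fixes d k :: "real \<Rightarrow> real"
  assumes "a \<le> c" and cont_k: "continuous_on {a..c} k" and cont_d: "continuous_on {a..c} d"
    and D: "\<And>t. a < t \<Longrightarrow> t < c \<Longrightarrow> DERIV d t :> - k t * d t" and "d c > 0"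
  shows "d a > 0"
proof (cases "a = c")
  case False
  then have "a < c" using \<open>a \<le> c\<close> by simp
  let ?F = "\<lambda>t. d t * exp (integral {a..t} k)"
  have "?F c = ?F a"
  proof (rule DERIV_isconst_end[OF \<open>a < c\<close>])
    show "continuous_on {a..c} ?F"
      by (intro continuous_intros cont_d indefinite_integral_continuous_1
          integrable_continuous_real cont_k)
    fix t assume t: "a < t" "t < c"
    then show "DERIV ?F t :> 0"
      by (auto intro!: derivative_eq_intros D DERIV_integral_interior[OF cont_k] simp: algebra_simps)
  qed
  then have "d a = d c * exp (integral {a..c} k)" by simp
  then show ?thesis using \<open>d c > 0\<close> by simp
qed (use \<open>d c > 0\<close> in simp)

context
  fixes \<sigma> :: real and W :: "real \<Rightarrow> real"
  assumes cont_W: "continuous_on {0..} W"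
begin

lemma cont_riccati_scale: "continuous_on {0..} (riccati_scale \<sigma> W)"
  unfolding riccati_scale_def[abs_def] by (intro continuous_intros continuous_on_integral_upper cont_W)

lemma cont_riccati_potential: "continuous_on {0..} (riccati_potential \<sigma> W \<mu>)"
  unfolding riccati_potential_def[abs_def]
  by (intro continuous_intros continuous_on_integral_upper cont_W)

lemma solves_system_riccati:
  "solves_system (riccati_scale \<sigma> W) (riccati_potential \<sigma> W \<mu>) (riccati_sol \<sigma> W \<mu>)
      (riccati_slope \<sigma> W \<mu>)"
  unfolding riccati_sol_def riccati_slope_def
  by (rule solves_system_string_sol[OF cont_riccati_scale cont_riccati_potential])

lemmas cont_riccati_sol = solves_systemD(1)[OF solves_system_riccati]
  and cont_riccati_slope = solves_systemD(2)[OF solves_system_riccati]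
  and DERIV_riccati_sol = solves_systemD(3)[OF solves_system_riccati]
  and DERIV_riccati_slope = solves_systemD(4)[OF solves_system_riccati]

lemma riccati_sol_0: "riccati_sol \<sigma> W \<mu> 0 = 0" and riccati_slope_0: "riccati_slope \<sigma> W \<mu> 0 = 1"
  unfolding riccati_sol_def riccati_slope_def
  using string_sol_0[OF cont_riccati_scale cont_riccati_potential]
    string_slope_0[OF cont_riccati_scale cont_riccati_potential] by auto

lemma DERIV_riccati_scale: "t > 0 \<Longrightarrow> DERIV (riccati_scale \<sigma> W) t :> - 2 * \<sigma> * W t * riccati_scale \<sigma> W t"
  unfolding riccati_scale_def[abs_def]
  by (auto intro!: derivative_eq_intros DERIV_integral_upper[OF cont_W])

lemma DERIV_riccati_scaled_slope:
  "t > 0 \<Longrightarrow> DERIV (\<lambda>t. riccati_scale \<sigma> W t * riccati_slope \<sigma> W \<mu> t) t :>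
     - 2 * \<sigma> * W t * (riccati_scale \<sigma> W t * riccati_slope \<sigma> W \<mu> t)
         - (\<sigma>\<^sup>2 * (W t)\<^sup>2 - t - \<mu>) * riccati_sol \<sigma> W \<mu> t"
  unfolding riccati_scale_potential[symmetric]
  by (auto intro!: derivative_eq_intros DERIV_riccati_scale DERIV_riccati_slope simp: algebra_simps)

lemma riccati_scaled_slope_tendsto:
  "((\<lambda>t. riccati_scale \<sigma> W t * riccati_slope \<sigma> W \<mu> t) \<longlongrightarrow> 1) (at_right 0)"
  using tendsto_mult[OF continuous_on_atLeast_tendsto_at_right[OF cont_riccati_scale]
      continuous_on_atLeast_tendsto_at_right[OF cont_riccati_slope, of \<mu>]] riccati_slope_0
  by (simp add: riccati_scale_def)

lemma riccati_sol_tendsto: "(riccati_sol \<sigma> W \<mu> \<longlongrightarrow> 0) (at_right 0)"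
  using continuous_on_atLeast_tendsto_at_right[OF cont_riccati_sol, of \<mu>] riccati_sol_0 by simp

lemma DERIV_riccati_log_deriv:
  assumes t: "t > 0" and pos: "riccati_sol \<sigma> W \<mu> t > 0"
  shows "DERIV (riccati_log_deriv \<sigma> W \<mu>) t :> t + \<mu> - (\<sigma> * W t + riccati_log_deriv \<sigma> W \<mu> t)\<^sup>2"
proof -
  let ?y = "riccati_sol \<sigma> W \<mu> t" and ?v = "riccati_scale \<sigma> W t * riccati_slope \<sigma> W \<mu> t"
  have "DERIV (riccati_log_deriv \<sigma> W \<mu>) t :>
      ((- 2 * \<sigma> * W t * ?v - (\<sigma>\<^sup>2 * (W t)\<^sup>2 - t - \<mu>) * ?y) * ?y - ?v * ?v) / (?y * ?y)"
    unfolding riccati_log_deriv_def[abs_def]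
    by (rule DERIV_divide[OF DERIV_riccati_scaled_slope DERIV_riccati_sol]) (use t pos in auto)
  moreover have "((- 2 * \<sigma> * W t * ?v - (\<sigma>\<^sup>2 * (W t)\<^sup>2 - t - \<mu>) * ?y) * ?y - ?v * ?v) / (?y * ?y)
      = t + \<mu> - (\<sigma> * W t + riccati_log_deriv \<sigma> W \<mu> t)\<^sup>2"
    unfolding riccati_log_deriv_def using pos by (simp add: field_simps power2_eq_square)
  ultimately show ?thesis by simp
qed

lemma continuous_on_Ioi_noise: "continuous_on {0<..} W" by (rule continuous_on_subset[OF cont_W]) auto

lemma riccati_if_sol_pos:
  assumes pos: "\<And>t. t > 0 \<Longrightarrow> riccati_sol \<sigma> W \<mu> t > 0" and \<sigma>: "\<sigma> = 2 / sqrt \<beta>"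
  shows "riccati_no_explosion \<beta> \<mu> W"
  unfolding riccati_no_explosion_def \<sigma>[symmetric]
proof (intro exI conjI allI impI)
  let ?z = "riccati_log_deriv \<sigma> W \<mu>"
  let ?q = "\<lambda>t. \<sigma> * W t + ?z t"
  have cont_z: "continuous_on {0<..} ?z"
    by (rule DERIV_continuous_on[OF has_field_derivative_at_within[OF DERIV_riccati_log_deriv]])
      (use pos in auto)
  show cont_q: "continuous_on {0<..} ?q" by (intro continuous_intros cont_z continuous_on_Ioi_noise)
  show "filterlim ?q at_top (at_right 0)"
  proof (rule filterlim_tendsto_add_at_top)
    show "((\<lambda>t. \<sigma> * W t) \<longlongrightarrow> \<sigma> * W 0) (at_right 0)"
      by (intro tendsto_intros continuous_on_atLeast_tendsto_at_right[OF cont_W])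
    have "\<forall>\<^sub>F t in at_right 0. 0 < riccati_sol \<sigma> W \<mu> t"
      using eventually_at_right_less[of 0] by eventually_elim (rule pos)
    then show "filterlim ?z at_top (at_right 0)"
      unfolding riccati_log_deriv_def[abs_def]
      by (rule LIM_at_top_divide[OF riccati_scaled_slope_tendsto zero_less_one riccati_sol_tendsto])
  qed
  fix x y :: real assume xy: "0 < y \<and> y \<le> x"
  have "((\<lambda>t. t + \<mu> - (?q t)\<^sup>2) has_integral (?z x - ?z y)) {y..x}"
  proof (rule fundamental_theorem_of_calculus)
    fix t assume "t \<in> {y..x}"
    then have "DERIV ?z t :> t + \<mu> - (?q t)\<^sup>2" using xy pos by (intro DERIV_riccati_log_deriv) auto
    then show "(?z has_vector_derivative t + \<mu> - (?q t)\<^sup>2) (at t within {y..x})"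
      by (simp add: has_real_derivative_iff_has_vector_derivative has_vector_derivative_at_within)
  qed (use xy in auto)
  then have "integral {y..x} (\<lambda>t. t + \<mu> - (?q t)\<^sup>2) = ?z x - ?z y" by (rule integral_unique)
  moreover have "(LBINT t=y..x. t + \<mu> - (?q t)\<^sup>2) = integral {y..x} (\<lambda>t. t + \<mu> - (?q t)\<^sup>2)"
    by (rule interval_integral_eq_integral_if_continuous)
      (use xy in \<open>auto intro!: continuous_intros continuous_on_subset[OF cont_z] continuous_on_subset[OF cont_W]\<close>)
  ultimately show "?q x - ?q y = \<sigma> * (W x - W y) + (LBINT t=y..x. t + \<mu> - (?q t)\<^sup>2)"
    by (simp add: algebra_simps)
qed

context
  fixes \<mu> :: real and q z :: "real \<Rightarrow> real"
  assumes cont_q: "continuous_on {0<..} q" and q_at_0: "filterlim q at_top (at_right 0)"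
    and q_eq: "\<And>x y. 0 < y \<Longrightarrow> y \<le> x \<Longrightarrow> q x - q y = \<sigma> * (W x - W y) + (LBINT t=y..x. t + \<mu> - (q t)\<^sup>2)"
    and z_eq: "\<And>t. z t = q t - \<sigma> * W t"
begin

lemma DERIV_solution_minus_noise:
  assumes x: "x > 0"
  shows "DERIV z x :> x + \<mu> - (q x)\<^sup>2"
proof -
  let ?f = "\<lambda>t. t + \<mu> - (q t)\<^sup>2"
  have cont_f: "continuous_on {x/2..2*x} ?f"
    by (intro continuous_intros continuous_on_subset[OF cont_q]) (use x in auto)
  have "DERIV (\<lambda>u. integral {x/2..u} ?f) x :> ?f x"
    by (rule DERIV_integral_interior[OF cont_f]) (use x in auto)
  then have "DERIV (\<lambda>u. z (x/2) + integral {x/2..u} ?f) x :> ?f x"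
    by (auto intro!: derivative_eq_intros)
  then show ?thesis
  proof (rule has_field_derivative_transform_within_open[where S="{x/2<..<2*x}"])
    fix u assume u: "u \<in> {x/2<..<2*x}"
    have "q u - q (x/2) = \<sigma> * (W u - W (x/2)) + integral {x/2..u} ?f"
      using q_eq[of "x/2" u] interval_integral_eq_integral_if_continuous[of "x/2" u ?f]
        continuous_on_subset[OF cont_f, of "{x/2..u}"] u x by simp
    then show "z (x/2) + integral {x/2..u} ?f = z u" by (simp add: z_eq algebra_simps)
  qed (use x in auto)
qed

lemma solution_plus_noise_at_0: "filterlim (\<lambda>t. c * W t + z t) at_top (at_right 0)"
proof -
  have "filterlim (\<lambda>t. (c - \<sigma>) * W t + q t) at_top (at_right 0)"
    by (rule filterlim_tendsto_add_at_top[OF _ q_at_0, of _ "(c - \<sigma>) * W 0"])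
      (intro tendsto_intros continuous_on_atLeast_tendsto_at_right[OF cont_W])
  then show ?thesis by (simp add: z_eq algebra_simps)
qed

lemma DERIV_inverse_solution_tendsto: "((\<lambda>t. ((q t)\<^sup>2 - t - \<mu>) / (z t)\<^sup>2) \<longlongrightarrow> 1) (at_right 0)"
proof -
  have z_inf: "filterlim z at_top (at_right 0)" using solution_plus_noise_at_0[of 0] by simp
  then have "((\<lambda>t. inverse (z t)) \<longlongrightarrow> 0) (at_right 0)" by (rule tendsto_inverse_0_at_top)
  then have "((\<lambda>t. (1 + \<sigma> * W t * inverse (z t))\<^sup>2 - (t + \<mu>) * (inverse (z t))\<^sup>2)
      \<longlongrightarrow> (1 + \<sigma> * W 0 * 0)\<^sup>2 - (0 + \<mu>) * 0\<^sup>2) (at_right 0)"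
    by (intro tendsto_intros continuous_on_atLeast_tendsto_at_right[OF cont_W])
  moreover have "\<forall>\<^sub>F t in at_right 0. z t > 0" using z_inf by (simp add: filterlim_at_top_dense)
  then have "\<forall>\<^sub>F t in at_right 0. (1 + \<sigma> * W t * inverse (z t))\<^sup>2 - (t + \<mu>) * (inverse (z t))\<^sup>2
      = ((q t)\<^sup>2 - t - \<mu>) / (z t)\<^sup>2"
  proof eventually_elim
    case (elim t)
    have "q t = z t + \<sigma> * W t" by (simp add: z_eq)
    then show ?case using elim by (simp only:) (simp add: field_simps power2_eq_square)
  qed
  ultimately show ?thesis using Lim_transform_eventually by fastforce
qed

lemma solution_times_sol_tendsto: "((\<lambda>t. z t * riccati_sol \<sigma> W \<mu> t) \<longlongrightarrow> 1) (at_right 0)"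
proof -
  have z_inf: "filterlim z at_top (at_right 0)" using solution_plus_noise_at_0[of 0] by simp
  then have z_pos: "\<forall>\<^sub>F t in at_right 0. z t > 0" by (simp add: filterlim_at_top_dense)
  have pos: "\<forall>\<^sub>F t::real in at_right 0. t > 0" by (rule eventually_at_right_less)
  let ?r = "\<lambda>t. ((q t)\<^sup>2 - t - \<mu>) / (z t)\<^sup>2"
  have "((\<lambda>t. riccati_sol \<sigma> W \<mu> t / inverse (z t)) \<longlongrightarrow> 1) (at_right 0)"
  proof (rule lhopital_right_0[where f'="\<lambda>t. riccati_scale \<sigma> W t * riccati_slope \<sigma> W \<mu> t" and g'="?r"])
    show "((\<lambda>t. inverse (z t)) \<longlongrightarrow> 0) (at_right 0)" using z_inf by (rule tendsto_inverse_0_at_top)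
    show "\<forall>\<^sub>F t in at_right 0. inverse (z t) \<noteq> 0" using z_pos by eventually_elim simp
    have "\<forall>\<^sub>F t in at_right 0. ?r t > 0"
      using order_tendstoD(1)[OF DERIV_inverse_solution_tendsto] by simp
    then show "\<forall>\<^sub>F t in at_right 0. ?r t \<noteq> 0" by eventually_elim (rule less_imp_neq[symmetric])
    show "\<forall>\<^sub>F t in at_right 0. DERIV (riccati_sol \<sigma> W \<mu>) t :>
        riccati_scale \<sigma> W t * riccati_slope \<sigma> W \<mu> t"
      using pos by eventually_elim (rule DERIV_riccati_sol)
    show "\<forall>\<^sub>F t in at_right 0. DERIV (\<lambda>t. inverse (z t)) t :> ?r t"
      using pos z_pos
    proof eventually_elim
      case (elim t)
      then have "DERIV (\<lambda>t. inverse (z t)) t :> - (inverse (z t) * (t + \<mu> - (q t)\<^sup>2) * inverse (z t))"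
        by (intro DERIV_inverse' DERIV_solution_minus_noise) auto
      then show ?case by (rule DERIV_cong) (use elim in \<open>simp add: field_simps power2_eq_square\<close>)
    qed
    show "((\<lambda>t. riccati_scale \<sigma> W t * riccati_slope \<sigma> W \<mu> t / ?r t) \<longlongrightarrow> 1) (at_right 0)"
      using tendsto_divide[OF riccati_scaled_slope_tendsto[of \<mu>] DERIV_inverse_solution_tendsto] by simp
  qed (rule riccati_sol_tendsto)
  then show ?thesis by (simp add: divide_inverse mult.commute)
qed

lemma DERIV_riccati_defect:
  assumes x: "x > 0"
  shows "DERIV (riccati_defect \<sigma> W \<mu> z) x :> - (2 * \<sigma> * W x + z x) * riccati_defect \<sigma> W \<mu> z x"
proof -
  let ?y = "riccati_sol \<sigma> W \<mu> x" and ?v = "riccati_scale \<sigma> W x * riccati_slope \<sigma> W \<mu> x"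
  have "DERIV (riccati_defect \<sigma> W \<mu> z) x :> (x + \<mu> - (q x)\<^sup>2) * ?y + z x * ?v
      - (- 2 * \<sigma> * W x * ?v - (\<sigma>\<^sup>2 * (W x)\<^sup>2 - x - \<mu>) * ?y)"
    unfolding riccati_defect_def[abs_def]
    by (rule DERIV_diff[OF _ DERIV_riccati_scaled_slope[OF x]],
        rule DERIV_cong[OF DERIV_mult[OF DERIV_solution_minus_noise[OF x] DERIV_riccati_sol[OF x]]])
      simp
  moreover have "q x = z x + \<sigma> * W x" by (simp add: z_eq)
  ultimately show ?thesis
    unfolding riccati_defect_def by (elim DERIV_cong) (simp add: algebra_simps power2_eq_square)
qed

lemma no_zero_with_negative_slope:
  assumes c: "c > 0" "riccati_sol \<sigma> W \<mu> c = 0" "riccati_slope \<sigma> W \<mu> c < 0"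
  shows False
proof -
  define d where "d = riccati_defect \<sigma> W \<mu> z"
  note DERIV_d = DERIV_riccati_defect[folded d_def]
  have cont_d: "continuous_on {0<..} d"
    by (rule DERIV_continuous_on[OF has_field_derivative_at_within[OF DERIV_d]]) auto
  have cont_z: "continuous_on {0<..} z"
    by (rule DERIV_continuous_on[OF has_field_derivative_at_within[OF DERIV_solution_minus_noise]]) auto
  have cont_rate: "continuous_on {0<..} (\<lambda>t. 2 * \<sigma> * W t + z t)"
    by (intro continuous_intros continuous_on_Ioi_noise cont_z)
  have "d c > 0" using c riccati_scale_pos[of \<sigma> W c] by (simp add: d_def riccati_defect_def mult_pos_neg)
  then have d_pos: "d x > 0" if "0 < x" "x \<le> c" for x
    using that by (intro linear_ode_pos_backward[OF _ _ _ DERIV_d, of x c]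
        continuous_on_subset[OF cont_d]
        continuous_on_subset[OF cont_rate]) auto
  have "\<forall>\<^sub>F t in at_right 0. 2 * \<sigma> * W t + z t > 0"
    using solution_plus_noise_at_0[of "2 * \<sigma>"] by (simp add: filterlim_at_top_dense)
  then obtain t0 where t0: "t0 > 0" "\<And>t. 0 < t \<Longrightarrow> t < t0 \<Longrightarrow> 2 * \<sigma> * W t + z t > 0"
    unfolding eventually_at_right_field by auto
  define b where "b = min (t0 / 2) c"
  have b: "0 < b" "b < t0" "b \<le> c" using t0 c by (auto simp: b_def)
  have antimono: "d b \<le> d t" if t: "0 < t" "t \<le> b" for t
  proof (rule DERIV_nonpos_imp_ge[OF t(2) continuous_on_subset[OF cont_d] DERIV_d])
    fix x assume x: "t < x" "x < b"
    then have "2 * \<sigma> * W x + z x > 0" "d x > 0" using t0(2)[of x] d_pos[of x] t b by auto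
    then show "- (2 * \<sigma> * W x + z x) * d x \<le> 0" by (intro mult_nonpos_nonneg) auto
  qed (use t in auto)
  have "(d \<longlongrightarrow> 1 - 1) (at_right 0)"
    unfolding d_def riccati_defect_def[abs_def]
    by (intro tendsto_diff solution_times_sol_tendsto riccati_scaled_slope_tendsto)
  then have "d b \<le> 1 - 1"
    by (rule tendsto_lowerbound)
      (use antimono b in \<open>auto simp: eventually_at_right_field intro!: exI[of _ b]\<close>)
  then show False using d_pos[of b] b by simp
qed

end

lemma sol_pos_if_riccati:
  assumes riccati: "riccati_no_explosion \<beta> \<mu> W" and \<sigma>: "\<sigma> = 2 / sqrt \<beta>" and t: "t > 0"
  shows "riccati_sol \<sigma> W \<mu> t > 0"
proof (rule ccontr)
  assume "\<not> riccati_sol \<sigma> W \<mu> t > 0"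
  then have "\<not> (\<forall>x>0. string_sol (riccati_scale \<sigma> W) (riccati_potential \<sigma> W \<mu>) x > 0)" using t
    by (auto simp: riccati_sol_def)
  then obtain c where "c > 0" "riccati_sol \<sigma> W \<mu> c = 0" "riccati_slope \<sigma> W \<mu> c < 0"
    unfolding riccati_sol_def riccati_slope_def
    by (rule string_sol_zero_slope_neg[OF cont_riccati_scale cont_riccati_potential
        riccati_scale_pos]) auto
  moreover obtain q where "continuous_on {0<..} q" "filterlim q at_top (at_right 0)"
    "\<And>x y. 0 < y \<Longrightarrow> y \<le> x \<Longrightarrow> q x - q y = \<sigma> * (W x - W y) + (LBINT t=y..x. t + \<mu> - (q t)\<^sup>2)"
    using riccati unfolding riccati_no_explosion_def \<sigma>[symmetric] by blast
  ultimately show False by (intro no_zero_with_negative_slope[where z="\<lambda>t. q t - \<sigma> * W t"]) auto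
qed

theorem riccati_iff_sol_pos:
  assumes "\<sigma> = 2 / sqrt \<beta>"
  shows "riccati_no_explosion \<beta> \<mu> W \<longleftrightarrow> (\<forall>t>0. riccati_sol \<sigma> W \<mu> t > 0)"
  using riccati_if_sol_pos[OF _ assms] sol_pos_if_riccati[OF _ assms] by blast

end

section \<open>The rescaled string equation\<close>

text \<open>With \<open>W t = b (\<epsilon>\<^sup>2 t) / \<epsilon>\<close>, \<open>\<epsilon> = \<eta> powr (-1/6)\<close> and \<open>h = 2/\<beta>\<close>, the string equation of
  \<open>G_{\<beta>,a}\<close> at \<open>\<eta> - \<mu> \<eta> powr (2/3)\<close> becomes \<open>y' = (G u - y)/\<epsilon>\<close>, \<open>u' = (u - \<kappa> y/G)/\<epsilon>\<close> with \<open>G =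
  noise_factor\<close> and \<open>\<kappa> = spectral_factor\<close>. Writing \<open>u = y + \<epsilon> v\<close> and removing the diagonal part
  with \<open>exp (\<plusminus> noise_integral)\<close> gives a canonical system whose coefficients converge to
  \<open>riccati_scale\<close> and \<open>riccati_potential\<close>.\<close>

definition noise_factor :: "real \<Rightarrow> real \<Rightarrow> real \<Rightarrow> (real \<Rightarrow> real) \<Rightarrow> real \<Rightarrow> real" where
  "noise_factor \<sigma> h \<epsilon> W t = exp (\<epsilon> * (\<sigma> * W t - h * \<epsilon> * t))"

definition noise_rate :: "real \<Rightarrow> real \<Rightarrow> real \<Rightarrow> (real \<Rightarrow> real) \<Rightarrow> real \<Rightarrow> real" where
  "noise_rate \<sigma> h \<epsilon> W t = (noise_factor \<sigma> h \<epsilon> W t - 1) / \<epsilon>"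

definition noise_integral :: "real \<Rightarrow> real \<Rightarrow> real \<Rightarrow> (real \<Rightarrow> real) \<Rightarrow> real \<Rightarrow> real" where
  "noise_integral \<sigma> h \<epsilon> W t = integral {0..t} (noise_rate \<sigma> h \<epsilon> W)"

definition spectral_factor :: "real \<Rightarrow> real \<Rightarrow> real \<Rightarrow> real" where
  "spectral_factor \<epsilon> \<mu> t = (1 - \<mu> * \<epsilon>\<^sup>2) * exp (- (\<epsilon>\<^sup>2 * t))"

definition rescaled_scale :: "real \<Rightarrow> real \<Rightarrow> real \<Rightarrow> (real \<Rightarrow> real) \<Rightarrow> real \<Rightarrow> real" where
  "rescaled_scale \<sigma> h \<epsilon> W t = noise_factor \<sigma> h \<epsilon> W t * exp (- 2 * noise_integral \<sigma> h \<epsilon> W t)"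

definition rescaled_potential :: "real \<Rightarrow> real \<Rightarrow> real \<Rightarrow> (real \<Rightarrow> real) \<Rightarrow> real \<Rightarrow> real \<Rightarrow> real" where
  "rescaled_potential \<sigma> h \<epsilon> W \<mu> t =
     - ((2 - noise_factor \<sigma> h \<epsilon> W t - spectral_factor \<epsilon> \<mu> t / noise_factor \<sigma> h \<epsilon> W t) / \<epsilon>\<^sup>2)
     * exp (2 * noise_integral \<sigma> h \<epsilon> W t)"

definition canonical_sol :: "real \<Rightarrow> real \<Rightarrow> real \<Rightarrow> (real \<Rightarrow> real) \<Rightarrow> real \<Rightarrow> real \<Rightarrow> real" where
  "canonical_sol \<sigma> h \<epsilon> W \<mu> = string_sol (rescaled_scale \<sigma> h \<epsilon> W) (rescaled_potential \<sigma> h \<epsilon> W \<mu>)"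

definition canonical_slope :: "real \<Rightarrow> real \<Rightarrow> real \<Rightarrow> (real \<Rightarrow> real) \<Rightarrow> real \<Rightarrow> real \<Rightarrow> real" where
  "canonical_slope \<sigma> h \<epsilon> W \<mu> = string_slope (rescaled_scale \<sigma> h \<epsilon> W) (rescaled_potential \<sigma> h \<epsilon> W \<mu>)"

definition rescaled_sol :: "real \<Rightarrow> real \<Rightarrow> real \<Rightarrow> (real \<Rightarrow> real) \<Rightarrow> real \<Rightarrow> real \<Rightarrow> real" where
  "rescaled_sol \<sigma> h \<epsilon> W \<mu> t = exp (noise_integral \<sigma> h \<epsilon> W t) * canonical_sol \<sigma> h \<epsilon> W \<mu> t"

definition rescaled_slope :: "real \<Rightarrow> real \<Rightarrow> real \<Rightarrow> (real \<Rightarrow> real) \<Rightarrow> real \<Rightarrow> real \<Rightarrow> real" where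
  "rescaled_slope \<sigma> h \<epsilon> W \<mu> t =
     rescaled_sol \<sigma> h \<epsilon> W \<mu> t + \<epsilon> * (exp (- noise_integral \<sigma> h \<epsilon> W t) * canonical_slope \<sigma> h \<epsilon> W \<mu> t)"

definition rescaled_slope_positive :: "real \<Rightarrow> real \<Rightarrow> real \<Rightarrow> (real \<Rightarrow> real) \<Rightarrow> real \<Rightarrow> bool" where
  "rescaled_slope_positive \<sigma> h \<epsilon> W \<mu> \<longleftrightarrow> (\<forall>t\<ge>0. rescaled_slope \<sigma> h \<epsilon> W \<mu> t > 0)"

lemma noise_factor_pos: "noise_factor \<sigma> h \<epsilon> W t > 0"
  by (simp add: noise_factor_def)

lemma rescaled_scale_pos: "rescaled_scale \<sigma> h \<epsilon> W t > 0"
  by (simp add: rescaled_scale_def noise_factor_pos)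

locale rescaled_string =
  fixes \<sigma> h \<epsilon> :: real and W :: "real \<Rightarrow> real" and \<mu> :: real
  assumes cont_W: "continuous_on {0..} W" and eps_pos: "\<epsilon> > 0"
begin

lemma cont_noise_factor: "continuous_on {0..} (noise_factor \<sigma> h \<epsilon> W)"
  unfolding noise_factor_def[abs_def] by (intro continuous_intros cont_W)

lemma cont_noise_rate: "continuous_on {0..} (noise_rate \<sigma> h \<epsilon> W)"
  unfolding noise_rate_def[abs_def] by (intro continuous_intros cont_noise_factor) (use eps_pos in auto)

lemma cont_noise_integral: "continuous_on {0..} (noise_integral \<sigma> h \<epsilon> W)"
  unfolding noise_integral_def[abs_def] by (rule continuous_on_integral_upper[OF cont_noise_rate])

lemma DERIV_noise_integral: "t > 0 \<Longrightarrow> DERIV (noise_integral \<sigma> h \<epsilon> W) t :> noise_rate \<sigma> h \<epsilon> W t"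
  unfolding noise_integral_def[abs_def] by (rule DERIV_integral_upper[OF cont_noise_rate])

lemma cont_rescaled_scale: "continuous_on {0..} (rescaled_scale \<sigma> h \<epsilon> W)"
  unfolding rescaled_scale_def[abs_def]
  by (intro continuous_intros cont_noise_factor cont_noise_integral)

lemma cont_rescaled_potential: "continuous_on {0..} (rescaled_potential \<sigma> h \<epsilon> W \<mu>)"
  unfolding rescaled_potential_def[abs_def] spectral_factor_def
  by (intro continuous_intros cont_noise_factor cont_noise_integral)
    (use eps_pos noise_factor_pos in \<open>auto simp: less_le\<close>)

lemma solves_system_canonical:
  "solves_system (rescaled_scale \<sigma> h \<epsilon> W) (rescaled_potential \<sigma> h \<epsilon> W \<mu>) (canonical_sol \<sigma> h \<epsilon> W \<mu>)
      (canonical_slope \<sigma> h \<epsilon> W \<mu>)"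
  unfolding canonical_sol_def canonical_slope_def
  by (rule solves_system_string_sol[OF cont_rescaled_scale cont_rescaled_potential])

lemmas cont_canonical_sol = solves_systemD(1)[OF solves_system_canonical]
  and cont_canonical_slope = solves_systemD(2)[OF solves_system_canonical]
  and DERIV_canonical_sol = solves_systemD(3)[OF solves_system_canonical]
  and DERIV_canonical_slope = solves_systemD(4)[OF solves_system_canonical]

lemma canonical_sol_0: "canonical_sol \<sigma> h \<epsilon> W \<mu> 0 = 0"
  and canonical_slope_0: "canonical_slope \<sigma> h \<epsilon> W \<mu> 0 = 1"
  unfolding canonical_sol_def canonical_slope_def
  using string_sol_0[OF cont_rescaled_scale cont_rescaled_potential]
    string_slope_0[OF cont_rescaled_scale cont_rescaled_potential] by auto

lemma rescaled_sol_0: "rescaled_sol \<sigma> h \<epsilon> W \<mu> 0 = 0"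
  by (simp add: rescaled_sol_def canonical_sol_0)

lemma rescaled_slope_0: "rescaled_slope \<sigma> h \<epsilon> W \<mu> 0 = \<epsilon>"
  by (simp add: rescaled_slope_def rescaled_sol_0 canonical_slope_0 noise_integral_def)

lemma cont_rescaled_sol: "continuous_on {0..} (rescaled_sol \<sigma> h \<epsilon> W \<mu>)"
  unfolding rescaled_sol_def[abs_def]
  by (intro continuous_intros cont_noise_integral cont_canonical_sol)

lemma cont_rescaled_slope: "continuous_on {0..} (rescaled_slope \<sigma> h \<epsilon> W \<mu>)"
  unfolding rescaled_slope_def[abs_def]
  by (intro continuous_intros cont_noise_integral cont_rescaled_sol cont_canonical_slope)

lemma DERIV_rescaled_sol:
  assumes t: "t > 0"
  shows "DERIV (rescaled_sol \<sigma> h \<epsilon> W \<mu>) t :>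
    (noise_factor \<sigma> h \<epsilon> W t * rescaled_slope \<sigma> h \<epsilon> W \<mu> t - rescaled_sol \<sigma> h \<epsilon> W \<mu> t) / \<epsilon>"
proof -
  let ?p = "canonical_sol \<sigma> h \<epsilon> W \<mu> t" and ?u = "canonical_slope \<sigma> h \<epsilon> W \<mu> t"
  let ?J = "noise_integral \<sigma> h \<epsilon> W t" and ?G = "noise_factor \<sigma> h \<epsilon> W t"
  have "exp ?J * exp (- 2 * ?J) = exp (- ?J)" by (subst exp_add[symmetric]) simp
  then have "exp ?J * rescaled_scale \<sigma> h \<epsilon> W t = ?G * exp (- ?J)"
    by (simp add: rescaled_scale_def ac_simps)
  then have scale: "exp ?J * (rescaled_scale \<sigma> h \<epsilon> W t * ?u) = ?G * exp (- ?J) * ?u"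
    by (simp only: mult.assoc[symmetric])
  have "DERIV (rescaled_sol \<sigma> h \<epsilon> W \<mu>) t :>
      exp ?J * noise_rate \<sigma> h \<epsilon> W t * ?p + exp ?J * (rescaled_scale \<sigma> h \<epsilon> W t * ?u)"
    unfolding rescaled_sol_def[abs_def]
    by (auto intro!: derivative_eq_intros DERIV_noise_integral DERIV_canonical_sol t)
  then show ?thesis
    by (rule DERIV_cong)
      (use eps_pos in
          \<open>simp only: scale rescaled_slope_def rescaled_sol_def noise_rate_def, simp add: field_simps\<close>)
qed

lemma DERIV_rescaled_slope:
  assumes t: "t > 0"
  shows "DERIV (rescaled_slope \<sigma> h \<epsilon> W \<mu>) t :>
    (rescaled_slope \<sigma> h \<epsilon> W \<mu> t
     - spectral_factor \<epsilon> \<mu> t * rescaled_sol \<sigma> h \<epsilon> W \<mu> t / noise_factor \<sigma> h \<epsilon> W t) / \<epsilon>"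
proof -
  let ?p = "canonical_sol \<sigma> h \<epsilon> W \<mu> t" and ?u = "canonical_slope \<sigma> h \<epsilon> W \<mu> t"
  let ?J = "noise_integral \<sigma> h \<epsilon> W t" and ?G = "noise_factor \<sigma> h \<epsilon> W t" and ?k = "spectral_factor \<epsilon> \<mu> t"
  let ?y = "rescaled_sol \<sigma> h \<epsilon> W \<mu> t" and ?v = "exp (- ?J) * ?u"
  let ?dv = "exp (- ?J) * (- noise_rate \<sigma> h \<epsilon> W t) * ?u
      + exp (- ?J) * (- rescaled_potential \<sigma> h \<epsilon> W \<mu> t * ?p)"
  have "DERIV (\<lambda>t. exp (- noise_integral \<sigma> h \<epsilon> W t) * canonical_slope \<sigma> h \<epsilon> W \<mu> t) t :> ?dv"
    by (auto intro!: derivative_eq_intros DERIV_noise_integral DERIV_canonical_slope t)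
  from DERIV_add[OF DERIV_rescaled_sol[OF t] DERIV_cmult[OF this, of \<epsilon>]]
  have deriv: "DERIV (rescaled_slope \<sigma> h \<epsilon> W \<mu>) t :>
      (?G * rescaled_slope \<sigma> h \<epsilon> W \<mu> t - ?y) / \<epsilon> + \<epsilon> * ?dv"
    unfolding rescaled_slope_def[abs_def] .
  have exp_J: "exp (- ?J) * exp (2 * ?J) = exp ?J" by (subst exp_add[symmetric]) simp
  have "exp (- ?J) * (- rescaled_potential \<sigma> h \<epsilon> W \<mu> t * ?p)
      = ((2 - ?G - ?k / ?G) / \<epsilon>\<^sup>2) * (exp (- ?J) * exp (2 * ?J)) * ?p"
    by (simp add: rescaled_potential_def)
  then have dv: "?dv = - ((?G - 1) / \<epsilon>) * ?v + ((2 - ?G - ?k / ?G) / \<epsilon>\<^sup>2) * ?y"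
    unfolding exp_J by (simp add: rescaled_sol_def noise_rate_def ac_simps)
  have "(G * (y + \<epsilon> * v) - y) / \<epsilon> + \<epsilon> * (- ((G - 1) / \<epsilon>) * v + ((2 - G - k / G) / \<epsilon>\<^sup>2) * y)
      = (y + \<epsilon> * v - k * y / G) / \<epsilon>"
    if "G > 0" for G y v k :: real
    using eps_pos that by (simp add: field_simps power2_eq_square)
  from this[OF noise_factor_pos] show ?thesis
    by (intro DERIV_cong[OF deriv]) (simp only: dv rescaled_slope_def)
qed

definition unscaled_sol :: "real \<Rightarrow> real" where
  "unscaled_sol x = \<epsilon>\<^sup>2 * exp (x / \<epsilon>^3) * rescaled_sol \<sigma> h \<epsilon> W \<mu> (x / \<epsilon>\<^sup>2)"

definition unscaled_slope :: "real \<Rightarrow> real" where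
  "unscaled_slope x = exp (- (x / \<epsilon>^3)) * rescaled_slope \<sigma> h \<epsilon> W \<mu> (x / \<epsilon>\<^sup>2) / \<epsilon>"

lemma DERIV_unscaled_sol:
  assumes "x > 0"
  shows "DERIV unscaled_sol x :> exp (x / \<epsilon>^3) * noise_factor \<sigma> h \<epsilon> W (x / \<epsilon>\<^sup>2)
      * rescaled_slope \<sigma> h \<epsilon> W \<mu> (x / \<epsilon>\<^sup>2) / \<epsilon>"
proof -
  let ?t = "x / \<epsilon>\<^sup>2"
  have t: "?t > 0" using assms eps_pos by simp
  have "DERIV unscaled_sol x :> \<epsilon>\<^sup>2 * (exp (x / \<epsilon>^3) * (1 / \<epsilon>^3)) * rescaled_sol \<sigma> h \<epsilon> W \<mu> ?t
      + ((noise_factor \<sigma> h \<epsilon> W ?t * rescaled_slope \<sigma> h \<epsilon> W \<mu> ?t - rescaled_sol \<sigma> h \<epsilon> W \<mu> ?t) / \<epsilon>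
          * (1 / \<epsilon>\<^sup>2)) * (\<epsilon>\<^sup>2 * exp (x / \<epsilon>^3))"
    unfolding unscaled_sol_def[abs_def]
    by (intro DERIV_mult DERIV_cmult DERIV_chain2[OF DERIV_exp] DERIV_cdivide[OF DERIV_ident]
        DERIV_chain2[OF DERIV_rescaled_sol[OF t] DERIV_cdivide[OF DERIV_ident]])
  then show ?thesis
    by (rule DERIV_cong) (use eps_pos in \<open>simp add: field_simps power2_eq_square power3_eq_cube\<close>)
qed

lemma DERIV_unscaled_slope:
  assumes "x > 0"
  shows "DERIV unscaled_slope x :>
    - (exp (- (x / \<epsilon>^3)) * spectral_factor \<epsilon> \<mu> (x / \<epsilon>\<^sup>2)
        * rescaled_sol \<sigma> h \<epsilon> W \<mu> (x / \<epsilon>\<^sup>2) / noise_factor \<sigma> h \<epsilon> W (x / \<epsilon>\<^sup>2)) / \<epsilon>^4"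
proof -
  let ?t = "x / \<epsilon>\<^sup>2"
  have t: "?t > 0" using assms eps_pos by simp
  have "DERIV unscaled_slope x :> (exp (- (x / \<epsilon>^3)) * - (1 / \<epsilon>^3) * rescaled_slope \<sigma> h \<epsilon> W \<mu> ?t
      + ((rescaled_slope \<sigma> h \<epsilon> W \<mu> ?t
          - spectral_factor \<epsilon> \<mu> ?t * rescaled_sol \<sigma> h \<epsilon> W \<mu> ?t / noise_factor \<sigma> h \<epsilon> W ?t) / \<epsilon>
         * (1 / \<epsilon>\<^sup>2)) * exp (- (x / \<epsilon>^3))) / \<epsilon>"
    unfolding unscaled_slope_def[abs_def]
    by (intro DERIV_cdivide DERIV_mult DERIV_chain2[OF DERIV_exp] DERIV_minus DERIV_ident
        DERIV_chain2[OF DERIV_rescaled_slope[OF t] DERIV_cdivide[OF DERIV_ident]])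
  then show ?thesis
    by (rule DERIV_cong)
      (use eps_pos noise_factor_pos[of \<sigma> h \<epsilon> W ?t] in
        \<open>simp add: field_simps power2_eq_square power3_eq_cube power4_eq_xxxx\<close>)
qed

context
  fixes \<beta> a lam :: real and B :: "real \<Rightarrow> real"
  assumes h: "h = 2 / \<beta>" and \<sigma>: "\<sigma> = 2 / sqrt \<beta>" and a: "a = 2 / \<epsilon>^3 - 2 / \<beta>"
    and lam: "lam = (1 - \<mu> * \<epsilon>\<^sup>2) / \<epsilon>^6"
    and B: "\<And>x. x \<ge> 0 \<Longrightarrow> B x = \<epsilon> * W (x / \<epsilon>\<^sup>2)" and cont_B: "continuous_on {0..} B"
begin

lemma noise_factor_unscaled:
  assumes "x \<ge> 0"
  shows "noise_factor \<sigma> h \<epsilon> W (x / \<epsilon>\<^sup>2) = exp (2 / sqrt \<beta> * B x - h * x)"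
  unfolding noise_factor_def B[OF assms] \<sigma> using eps_pos by (simp add: field_simps power2_eq_square)

lemma s_dens_rescaled:
  assumes "x \<ge> 0"
  shows "s_dens \<beta> a B x = exp (2 * (x / \<epsilon>^3)) * noise_factor \<sigma> h \<epsilon> W (x / \<epsilon>\<^sup>2)"
  unfolding s_dens_def noise_factor_unscaled[OF assms]
  unfolding a h exp_add[symmetric] by (simp add: algebra_simps)

lemma m_dens_rescaled:
  assumes "x \<ge> 0"
  shows "m_dens \<beta> a B x = exp (- (2 * (x / \<epsilon>^3))) * exp (- x) / noise_factor \<sigma> h \<epsilon> W (x / \<epsilon>\<^sup>2)"
  unfolding m_dens_def noise_factor_unscaled[OF assms]
  unfolding a h exp_add[symmetric] exp_diff[symmetric]
  by (simp add: algebra_simps)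

lemma solves_system_unscaled:
  "solves_system (s_dens \<beta> a B) (\<lambda>t. lam * m_dens \<beta> a B t) unscaled_sol unscaled_slope"
  unfolding solves_system_def
proof (intro conjI allI impI)
  have cont: "continuous_on {0..} (\<lambda>x. g (x / \<epsilon>\<^sup>2))" if "continuous_on {0..} g" for g :: "real \<Rightarrow> real"
    by (rule continuous_on_compose2[OF that]) (use eps_pos in \<open>auto intro!: continuous_intros\<close>)
  show "continuous_on {0..} unscaled_sol"
    unfolding unscaled_sol_def[abs_def] using eps_pos
    by (intro continuous_intros cont[OF cont_rescaled_sol]) auto
  show "continuous_on {0..} unscaled_slope"
    unfolding unscaled_slope_def[abs_def] using eps_pos
    by (intro continuous_intros cont[OF cont_rescaled_slope]) auto
  fix x :: real assume x: "x > 0"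
  let ?E = "exp (x / \<epsilon>^3)" and ?F = "exp (- (x / \<epsilon>^3))" and ?t = "x / \<epsilon>\<^sup>2"
  have "exp (2 * (x / \<epsilon>^3)) * ?F = ?E" by (subst exp_add[symmetric]) simp
  then have "s_dens \<beta> a B x * ?F = ?E * noise_factor \<sigma> h \<epsilon> W ?t"
    unfolding s_dens_rescaled[OF less_imp_le[OF x]] by (simp add: ac_simps)
  then show "DERIV unscaled_sol x :> s_dens \<beta> a B x * unscaled_slope x"
    by (intro DERIV_cong[OF DERIV_unscaled_sol[OF x]]) (simp add: unscaled_slope_def)
  have "exp (- (2 * (x / \<epsilon>^3))) * ?E = ?F" by (subst exp_add[symmetric]) simp
  then have m_E: "m_dens \<beta> a B x * ?E = ?F * exp (- x) / noise_factor \<sigma> h \<epsilon> W ?t"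
    unfolding m_dens_rescaled[OF less_imp_le[OF x]] by (simp add: ac_simps)
  have lam_eps: "lam * \<epsilon>\<^sup>2 = (1 - \<mu> * \<epsilon>\<^sup>2) / \<epsilon>^4" unfolding lam using eps_pos by (simp add: field_simps)
  have "lam * m_dens \<beta> a B x * unscaled_sol x = (lam * \<epsilon>\<^sup>2) * (m_dens \<beta> a B x * ?E)
      * rescaled_sol \<sigma> h \<epsilon> W \<mu> ?t"
    by (simp add: unscaled_sol_def)
  also have "\<dots> = ?F * spectral_factor \<epsilon> \<mu> ?t
      * rescaled_sol \<sigma> h \<epsilon> W \<mu> ?t / noise_factor \<sigma> h \<epsilon> W ?t / \<epsilon>^4"
    unfolding lam_eps m_E spectral_factor_def using eps_pos by (simp add: ac_simps)
  finally show "DERIV unscaled_slope x :> - (lam * m_dens \<beta> a B x) * unscaled_sol x"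
    by (intro DERIV_cong[OF DERIV_unscaled_slope[OF x]]) simp
qed

theorem slope_positive_iff_rescaled:
  "string_coefficients.slope_positive (s_dens \<beta> a B) (m_dens \<beta> a B) lam \<longleftrightarrow>
      rescaled_slope_positive \<sigma> h \<epsilon> W \<mu>"
proof -
  interpret string_equation "s_dens \<beta> a B" "m_dens \<beta> a B" by (rule string_equation_dens[OF cont_B])
  have "unscaled_sol 0 = 0" "unscaled_slope 0 = 1"
    using eps_pos by (auto simp: unscaled_sol_def unscaled_slope_def rescaled_sol_0 rescaled_slope_0)
  then have "slope lam x = unscaled_slope x" if "x \<ge> 0" for x
    using solves_system_unique(2)[OF cont_s cont_potential solves_system_unscaled _ that]
    by (simp add: slope_def)
  then have "slope_positive lam \<longleftrightarrow> (\<forall>x\<ge>0. rescaled_slope \<sigma> h \<epsilon> W \<mu> (x / \<epsilon>\<^sup>2) > 0)"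
    unfolding slope_positive_def using eps_pos
    by (auto simp: unscaled_slope_def zero_less_divide_iff zero_less_mult_iff)
  also have "\<dots> \<longleftrightarrow> (\<forall>t\<ge>0. rescaled_slope \<sigma> h \<epsilon> W \<mu> t > 0)"
  proof (intro iffI allI impI)
    fix t :: real assume pos: "\<forall>x\<ge>0. rescaled_slope \<sigma> h \<epsilon> W \<mu> (x / \<epsilon>\<^sup>2) > 0" and "t \<ge> 0"
    then have "rescaled_slope \<sigma> h \<epsilon> W \<mu> ((t * \<epsilon>\<^sup>2) / \<epsilon>\<^sup>2) > 0" using pos[rule_format, of "t * \<epsilon>\<^sup>2"] by simp
    then show "rescaled_slope \<sigma> h \<epsilon> W \<mu> t > 0" using eps_pos by simp
  qed (use eps_pos in simp)
  finally show ?thesis by (simp add: rescaled_slope_positive_def)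
qed

end

lemma rescaled_potential_alt:
  "rescaled_potential \<sigma> h \<epsilon> W \<mu> t =
     ((noise_rate \<sigma> h \<epsilon> W t)\<^sup>2 / noise_factor \<sigma> h \<epsilon> W t
         - ((1 - spectral_factor \<epsilon> \<mu> t) / \<epsilon>\<^sup>2) / noise_factor \<sigma> h \<epsilon> W t)
     * exp (2 * noise_integral \<sigma> h \<epsilon> W t)"
proof -
  have "- ((2 - G - k / G) / \<epsilon>\<^sup>2) = ((G - 1) / \<epsilon>)\<^sup>2 / G - ((1 - k) / \<epsilon>\<^sup>2) / G" if "G > 0" for G k :: real
    using eps_pos that by (simp add: field_simps power2_eq_square)
  from this[OF noise_factor_pos] show ?thesis unfolding rescaled_potential_def noise_rate_def by simp
qed

lemma one_minus_spectral_factor: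
  "(1 - spectral_factor \<epsilon> \<mu> t) / \<epsilon>\<^sup>2 = (1 - exp (- (\<epsilon>\<^sup>2 * t))) / \<epsilon>\<^sup>2 + \<mu> * exp (- (\<epsilon>\<^sup>2 * t))"
  unfolding spectral_factor_def using eps_pos by (simp add: field_simps)

lemma one_minus_spectral_factor_le: "(1 - spectral_factor \<epsilon> \<mu> t) / \<epsilon>\<^sup>2 \<le> t + \<mu> * exp (- (\<epsilon>\<^sup>2 * t))"
proof -
  have "1 - exp (- (\<epsilon>\<^sup>2 * t)) \<le> \<epsilon>\<^sup>2 * t" using exp_ge_add_one_self[of "- (\<epsilon>\<^sup>2 * t)"] by simp
  then have "(1 - exp (- (\<epsilon>\<^sup>2 * t))) / \<epsilon>\<^sup>2 \<le> t" using eps_pos by (simp add: pos_divide_le_eq mult.commute)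
  then show ?thesis unfolding one_minus_spectral_factor by simp
qed

lemma one_minus_spectral_factor_ge:
  assumes "t \<ge> 0"
  shows "t / (1 + \<epsilon>\<^sup>2 * t) + \<mu> * exp (- (\<epsilon>\<^sup>2 * t)) \<le> (1 - spectral_factor \<epsilon> \<mu> t) / \<epsilon>\<^sup>2"
proof -
  let ?\<theta> = "\<epsilon>\<^sup>2 * t"
  have theta: "1 + ?\<theta> > 0" using assms by (simp add: add_pos_nonneg)
  have "exp (- ?\<theta>) \<le> 1 / (1 + ?\<theta>)"
    using exp_ge_add_one_self[of ?\<theta>] theta by (simp add: exp_minus field_simps)
  then have "?\<theta> / (1 + ?\<theta>) \<le> 1 - exp (- ?\<theta>)" using theta by (simp add: field_simps)
  then have "(?\<theta> / (1 + ?\<theta>)) / \<epsilon>\<^sup>2 \<le> (1 - exp (- ?\<theta>)) / \<epsilon>\<^sup>2" using eps_pos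
    by (intro divide_right_mono) auto
  then show ?thesis unfolding one_minus_spectral_factor using eps_pos by simp
qed

lemma abs_one_minus_spectral_factor_le:
  assumes "t \<ge> 0"
  shows "\<bar>(1 - spectral_factor \<epsilon> \<mu> t) / \<epsilon>\<^sup>2\<bar> \<le> t + \<bar>\<mu>\<bar>"
proof -
  have "\<bar>\<mu> * exp (- (\<epsilon>\<^sup>2 * t))\<bar> \<le> \<bar>\<mu>\<bar> * 1" unfolding abs_mult using assms by (intro mult_left_mono) auto
  moreover have "t / (1 + \<epsilon>\<^sup>2 * t) \<ge> 0" using assms by simp
  ultimately show ?thesis
    using one_minus_spectral_factor_ge[OF assms] one_minus_spectral_factor_le[of t]
    unfolding abs_le_iff by linarith
qed

end

lemma abs_exp_minus_one_le: "\<bar>exp z - 1\<bar> \<le> \<bar>z\<bar> * exp \<bar>z\<bar>" for z :: real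
proof (cases "z \<ge> 0")
  case True
  have "(1 - z) * exp z \<le> exp (- z) * exp z"
    using exp_ge_add_one_self[of "- z"] by (intro mult_right_mono) auto
  then have "exp z - 1 \<le> z * exp z" by (simp add: algebra_simps mult_exp_exp)
  then show ?thesis using True by simp
next
  case False
  then have "exp z \<le> 1" by simp
  then have "\<bar>exp z - 1\<bar> \<le> \<bar>z\<bar> * 1" using False exp_ge_add_one_self[of z] unfolding mult_1_right
    by linarith
  also have "\<dots> \<le> \<bar>z\<bar> * exp \<bar>z\<bar>" by (intro mult_left_mono) auto
  finally show ?thesis .
qed

lemma exp_minus_one_le: "exp z - 1 \<le> z / (1 - z)" if "z < 1" for z :: real
proof -
  have "(1 - z) * exp z \<le> exp (- z) * exp z"
    using exp_ge_add_one_self[of "- z"] by (intro mult_right_mono) auto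
  then show ?thesis using that by (simp add: mult_exp_exp field_simps)
qed

section \<open>Convergence of the rescaled system\<close>

locale rescaled_string_limit =
  fixes \<sigma> h :: real and \<epsilon> :: "nat \<Rightarrow> real" and W :: "real \<Rightarrow> real" and \<mu> :: real
  assumes cont_W: "continuous_on {0..} W" and eps_pos: "\<And>n. 0 < \<epsilon> n" and eps_le_1: "\<And>n. \<epsilon> n \<le> 1"
    and eps_tendsto: "\<epsilon> \<longlonglongrightarrow> 0"
begin

sublocale rescaled_string \<sigma> h "\<epsilon> n" W \<mu> for n
  by unfold_locales (rule cont_W eps_pos)+

lemma rescaled_noise_tendsto: "(\<lambda>n. \<sigma> * W t - h * \<epsilon> n * t) \<longlonglongrightarrow> \<sigma> * W t"
proof -
  have "(\<lambda>n. \<sigma> * W t - h * \<epsilon> n * t) \<longlonglongrightarrow> \<sigma> * W t - h * 0 * t" by (intro tendsto_intros eps_tendsto)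
  then show ?thesis by simp
qed

lemma scaled_noise_tendsto_0: "(\<lambda>n. \<epsilon> n * (\<sigma> * W t - h * \<epsilon> n * t)) \<longlonglongrightarrow> 0"
  using tendsto_mult[OF eps_tendsto rescaled_noise_tendsto[of t]] by simp

lemma noise_factor_tendsto: "(\<lambda>n. noise_factor \<sigma> h (\<epsilon> n) W t) \<longlonglongrightarrow> 1"
  using tendsto_exp[OF scaled_noise_tendsto_0[of t]] by (simp add: noise_factor_def)

lemma noise_rate_tendsto: "(\<lambda>n. noise_rate \<sigma> h (\<epsilon> n) W t) \<longlonglongrightarrow> \<sigma> * W t"
proof (rule tendsto_sandwich[OF _ _ rescaled_noise_tendsto])
  let ?N = "\<lambda>n. \<sigma> * W t - h * \<epsilon> n * t"
  have "?N n \<le> noise_rate \<sigma> h (\<epsilon> n) W t" for n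
    using exp_ge_add_one_self[of "\<epsilon> n * ?N n"]
    unfolding noise_rate_def noise_factor_def pos_le_divide_eq[OF eps_pos]
    by (simp only: mult.commute le_diff_eq add.commute)
  then show "\<forall>\<^sub>F n in sequentially. ?N n \<le> noise_rate \<sigma> h (\<epsilon> n) W t" by (intro always_eventually allI)
  have "(\<lambda>n. ?N n / (1 - \<epsilon> n * ?N n)) \<longlonglongrightarrow> \<sigma> * W t / (1 - 0)"
    by (intro tendsto_intros rescaled_noise_tendsto scaled_noise_tendsto_0) simp
  then show "(\<lambda>n. ?N n / (1 - \<epsilon> n * ?N n)) \<longlonglongrightarrow> \<sigma> * W t" by simp
  have "\<forall>\<^sub>F n in sequentially. \<epsilon> n * ?N n < 1"
    by (rule order_tendstoD(2)[OF scaled_noise_tendsto_0]) simp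
  then show "\<forall>\<^sub>F n in sequentially. noise_rate \<sigma> h (\<epsilon> n) W t \<le> ?N n / (1 - \<epsilon> n * ?N n)"
  proof eventually_elim
    case (elim n)
    have "(exp (\<epsilon> n * ?N n) - 1) / \<epsilon> n \<le> (\<epsilon> n * ?N n / (1 - \<epsilon> n * ?N n)) / \<epsilon> n"
      using exp_minus_one_le[OF elim] eps_pos[of n] by (intro divide_right_mono) auto
    then show ?case using eps_pos[of n] by (simp add: noise_rate_def noise_factor_def)
  qed
qed

lemma scaled_noise_bounded:
  obtains b where "b \<ge> 1" "\<And>n t. 0 \<le> t \<Longrightarrow> t \<le> T \<Longrightarrow> \<bar>\<epsilon> n * (\<sigma> * W t - h * \<epsilon> n * t)\<bar> \<le> \<epsilon> n * b"
proof -
  obtain K where K: "K > 0" "\<And>t. 0 \<le> t \<Longrightarrow> t \<le> T \<Longrightarrow> \<bar>W t\<bar> \<le> K"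
    by (rule continuous_on_atLeast_bounded_Icc[OF cont_W]) auto
  show ?thesis
  proof (rule that[of "\<bar>\<sigma>\<bar> * K + \<bar>h\<bar> * \<bar>T\<bar> + 1"])
    fix n and t :: real assume t: "0 \<le> t" "t \<le> T"
    have "\<bar>\<sigma> * W t\<bar> \<le> \<bar>\<sigma>\<bar> * K" using K(2)[OF t] by (simp add: abs_mult mult_left_mono)
    moreover have "\<bar>h * \<epsilon> n * t\<bar> \<le> \<bar>h\<bar> * 1 * \<bar>T\<bar>"
      unfolding abs_mult using eps_pos[of n] eps_le_1[of n] t by (intro mult_mono) auto
    ultimately have "\<bar>\<sigma> * W t - h * \<epsilon> n * t\<bar> \<le> \<bar>\<sigma>\<bar> * K + \<bar>h\<bar> * \<bar>T\<bar> + 1" by linarith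
    then show "\<bar>\<epsilon> n * (\<sigma> * W t - h * \<epsilon> n * t)\<bar> \<le> \<epsilon> n * (\<bar>\<sigma>\<bar> * K + \<bar>h\<bar> * \<bar>T\<bar> + 1)"
      unfolding abs_mult using eps_pos[of n] by (simp add: mult_left_mono)
  qed (use K in simp)
qed

lemma noise_coefficients_bounded:
  obtains B where "B \<ge> 1" "\<And>n t. 0 \<le> t \<Longrightarrow> t \<le> T \<Longrightarrow> \<bar>noise_rate \<sigma> h (\<epsilon> n) W t\<bar> \<le> B"
    "\<And>n t. 0 \<le> t \<Longrightarrow> t \<le> T \<Longrightarrow> noise_factor \<sigma> h (\<epsilon> n) W t \<le> B"
    "\<And>n t. 0 \<le> t \<Longrightarrow> t \<le> T \<Longrightarrow> 1 / noise_factor \<sigma> h (\<epsilon> n) W t \<le> B"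
proof -
  obtain b where b: "b \<ge> 1" "\<And>n t. 0 \<le> t \<Longrightarrow> t \<le> T \<Longrightarrow> \<bar>\<epsilon> n * (\<sigma> * W t - h * \<epsilon> n * t)\<bar> \<le> \<epsilon> n * b"
    by (rule scaled_noise_bounded) auto
  have exp_b: "exp b \<le> b * exp b" using b(1) by simp
  show ?thesis
  proof (rule that[of "b * exp b"])
    show "b * exp b \<ge> 1" using mult_mono[of 1 b 1 "exp b"] b(1) by simp
    fix n and t :: real assume t: "0 \<le> t" "t \<le> T"
    let ?N = "\<epsilon> n * (\<sigma> * W t - h * \<epsilon> n * t)"
    have "\<epsilon> n * b \<le> b" using eps_le_1[of n] b(1) by (simp add: mult_left_le_one_le eps_pos less_imp_le)
    then have N: "\<bar>?N\<bar> \<le> b" using b(2)[OF t, of n] by linarith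
    have "\<bar>exp ?N - 1\<bar> \<le> \<bar>?N\<bar> * exp \<bar>?N\<bar>" by (rule abs_exp_minus_one_le)
    also have "\<dots> \<le> (\<epsilon> n * b) * exp b"
      by (rule mult_mono[OF b(2)[OF t]]) (use N b(1) eps_pos[of n] in \<open>auto simp del: abs_mult\<close>)
    finally have "\<bar>exp ?N - 1\<bar> / \<epsilon> n \<le> (\<epsilon> n * b) * exp b / \<epsilon> n" using eps_pos[of n]
      by (intro divide_right_mono) auto
    then show "\<bar>noise_rate \<sigma> h (\<epsilon> n) W t\<bar> \<le> b * exp b" using eps_pos[of n]
      by (simp add: noise_rate_def noise_factor_def)
    have "exp ?N \<le> exp b" "exp (- ?N) \<le> exp b" using N by (auto simp only: exp_le_cancel_iff)
    then show "noise_factor \<sigma> h (\<epsilon> n) W t \<le> b * exp b" "1 / noise_factor \<sigma> h (\<epsilon> n) W t \<le> b * exp b"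
      using exp_b unfolding noise_factor_def exp_minus inverse_eq_divide by linarith+
  qed
qed

lemma noise_integral_bounded:
  obtains J where "J > 0" "\<And>n t. 0 \<le> t \<Longrightarrow> t \<le> T \<Longrightarrow> \<bar>noise_integral \<sigma> h (\<epsilon> n) W t\<bar> \<le> J"
proof -
  obtain B where B: "B \<ge> 1" "\<And>n t. 0 \<le> t \<Longrightarrow> t \<le> T \<Longrightarrow> \<bar>noise_rate \<sigma> h (\<epsilon> n) W t\<bar> \<le> B"
    by (rule noise_coefficients_bounded) auto
  show ?thesis
  proof (rule that[of "B * \<bar>T\<bar> + 1"])
    show "B * \<bar>T\<bar> + 1 > 0" using B(1) by (simp add: add_nonneg_pos)
    fix n and t :: real assume t: "0 \<le> t" "t \<le> T"
    have "norm (integral {0..t} (noise_rate \<sigma> h (\<epsilon> n) W)) \<le> integral {0..t} (\<lambda>_. B)"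
      by (rule integral_norm_bound_integral)
        (use t B in \<open>auto intro!: integrable_on_atLeast_subinterval cont_noise_rate\<close>)
    also have "\<dots> = B * t" using t by (simp add: mult.commute)
    also have "\<dots> \<le> B * \<bar>T\<bar> + 1" using t B(1) mult_left_mono[of t "\<bar>T\<bar>" B] by linarith
    finally show "\<bar>noise_integral \<sigma> h (\<epsilon> n) W t\<bar> \<le> B * \<bar>T\<bar> + 1" by (simp add: noise_integral_def)
  qed
qed

lemma noise_integral_tendsto:
  assumes "t \<ge> 0"
  shows "(\<lambda>n. noise_integral \<sigma> h (\<epsilon> n) W t) \<longlonglongrightarrow> \<sigma> * integral {0..t} W"
proof -
  obtain B where B: "B \<ge> 1" "\<And>n x. 0 \<le> x \<Longrightarrow> x \<le> t \<Longrightarrow> \<bar>noise_rate \<sigma> h (\<epsilon> n) W x\<bar> \<le> B"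
    by (rule noise_coefficients_bounded) auto
  have "(\<lambda>n. integral {0..t} (noise_rate \<sigma> h (\<epsilon> n) W)) \<longlonglongrightarrow> integral {0..t} (\<lambda>x. \<sigma> * W x)"
    by (rule dominated_convergence(2)[where h="\<lambda>_. B"])
      (use B noise_rate_tendsto in \<open>auto intro!: integrable_on_atLeast_subinterval cont_noise_rate\<close>)
  then show ?thesis by (simp add: noise_integral_def)
qed

lemma spectral_factor_tendsto:
  assumes t: "t \<ge> 0"
  shows "(\<lambda>n. (1 - spectral_factor (\<epsilon> n) \<mu> t) / (\<epsilon> n)\<^sup>2) \<longlonglongrightarrow> t + \<mu>"
proof (rule tendsto_sandwich)
  have "(\<lambda>n. exp (- ((\<epsilon> n)\<^sup>2 * t))) \<longlonglongrightarrow> exp (- (0\<^sup>2 * t))" by (intro tendsto_intros eps_tendsto)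
  then have exp_tendsto: "(\<lambda>n. exp (- ((\<epsilon> n)\<^sup>2 * t))) \<longlonglongrightarrow> 1" by simp
  have "(\<lambda>n. t / (1 + (\<epsilon> n)\<^sup>2 * t) + \<mu> * exp (- ((\<epsilon> n)\<^sup>2 * t))) \<longlonglongrightarrow> t / (1 + 0\<^sup>2 * t) + \<mu> * 1"
    by (intro tendsto_intros eps_tendsto exp_tendsto) simp
  then show "(\<lambda>n. t / (1 + (\<epsilon> n)\<^sup>2 * t) + \<mu> * exp (- ((\<epsilon> n)\<^sup>2 * t))) \<longlonglongrightarrow> t + \<mu>" by simp
  have "(\<lambda>n. t + \<mu> * exp (- ((\<epsilon> n)\<^sup>2 * t))) \<longlonglongrightarrow> t + \<mu> * 1" by (intro tendsto_intros exp_tendsto)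
  then show "(\<lambda>n. t + \<mu> * exp (- ((\<epsilon> n)\<^sup>2 * t))) \<longlonglongrightarrow> t + \<mu>" by simp
qed (use one_minus_spectral_factor_ge[OF t] one_minus_spectral_factor_le in
    \<open>auto intro!: always_eventually\<close>)

lemma rescaled_scale_tendsto:
  assumes "t \<ge> 0"
  shows "(\<lambda>n. rescaled_scale \<sigma> h (\<epsilon> n) W t) \<longlonglongrightarrow> riccati_scale \<sigma> W t"
proof -
  have "(\<lambda>n. rescaled_scale \<sigma> h (\<epsilon> n) W t) \<longlonglongrightarrow> 1 * exp (- 2 * (\<sigma> * integral {0..t} W))"
    unfolding rescaled_scale_def
    by (intro tendsto_intros noise_factor_tendsto noise_integral_tendsto assms)
  then show ?thesis by (simp add: riccati_scale_def mult.assoc)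
qed

lemma rescaled_potential_tendsto:
  assumes "t \<ge> 0"
  shows "(\<lambda>n. rescaled_potential \<sigma> h (\<epsilon> n) W \<mu> t) \<longlonglongrightarrow> riccati_potential \<sigma> W \<mu> t"
proof -
  have "(\<lambda>n. rescaled_potential \<sigma> h (\<epsilon> n) W \<mu> t)
      \<longlonglongrightarrow> ((\<sigma> * W t)\<^sup>2 / 1 - (t + \<mu>) / 1) * exp (2 * (\<sigma> * integral {0..t} W))"
    unfolding rescaled_potential_alt
    by (intro tendsto_intros noise_factor_tendsto noise_integral_tendsto noise_rate_tendsto
        spectral_factor_tendsto assms) auto
  then show ?thesis by (simp add: riccati_potential_def power_mult_distrib algebra_simps)
qed

lemma abs_rescaled_potential_le:
  assumes t: "0 \<le> t" "t \<le> T" and B: "B \<ge> 1" "\<bar>noise_rate \<sigma> h (\<epsilon> n) W t\<bar> \<le> B"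
    "1 / noise_factor \<sigma> h (\<epsilon> n) W t \<le> B"
    and J: "\<bar>noise_integral \<sigma> h (\<epsilon> n) W t\<bar> \<le> J"
  shows "\<bar>rescaled_potential \<sigma> h (\<epsilon> n) W \<mu> t\<bar> \<le> (B\<^sup>2 * B + (T + \<bar>\<mu>\<bar>) * B) * exp (2 * J)"
proof -
  let ?G = "noise_factor \<sigma> h (\<epsilon> n) W t" and ?a = "noise_rate \<sigma> h (\<epsilon> n) W t"
  let ?k = "(1 - spectral_factor (\<epsilon> n) \<mu> t) / (\<epsilon> n)\<^sup>2"
  have "\<bar>?a\<^sup>2 / ?G - ?k / ?G\<bar> \<le> \<bar>?a\<^sup>2 / ?G\<bar> + \<bar>?k / ?G\<bar>" by (rule abs_triangle_ineq4)
  also have "\<dots> = ?a\<^sup>2 * (1 / ?G) + \<bar>?k\<bar> * (1 / ?G)" using noise_factor_pos[of \<sigma> h "\<epsilon> n" W t]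
    by (simp add: abs_divide)
  also have "\<dots> \<le> B\<^sup>2 * B + (T + \<bar>\<mu>\<bar>) * B"
  proof (intro add_mono mult_mono)
    show "?a\<^sup>2 \<le> B\<^sup>2" using B(1,2) by (intro abs_le_square_iff[THEN iffD1]) auto
    show "\<bar>?k\<bar> \<le> T + \<bar>\<mu>\<bar>" using abs_one_minus_spectral_factor_le[OF t(1), of n] t(2) by linarith
  qed (use B t noise_factor_pos[of \<sigma> h "\<epsilon> n" W t] in auto)
  finally show ?thesis
    unfolding rescaled_potential_alt abs_mult using J by (intro mult_mono) auto
qed

lemma rescaled_coefficients_bounded:
  obtains K where "\<And>n t. 0 \<le> t \<Longrightarrow> t \<le> T \<Longrightarrow> \<bar>rescaled_scale \<sigma> h (\<epsilon> n) W t\<bar> \<le> K"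
    "\<And>n t. 0 \<le> t \<Longrightarrow> t \<le> T \<Longrightarrow> \<bar>rescaled_potential \<sigma> h (\<epsilon> n) W \<mu> t\<bar> \<le> K"
proof -
  obtain B where B: "B \<ge> 1" "\<And>n t. 0 \<le> t \<Longrightarrow> t \<le> T \<Longrightarrow> \<bar>noise_rate \<sigma> h (\<epsilon> n) W t\<bar> \<le> B"
    "\<And>n t. 0 \<le> t \<Longrightarrow> t \<le> T \<Longrightarrow> noise_factor \<sigma> h (\<epsilon> n) W t \<le> B"
    "\<And>n t. 0 \<le> t \<Longrightarrow> t \<le> T \<Longrightarrow> 1 / noise_factor \<sigma> h (\<epsilon> n) W t \<le> B"
    by (rule noise_coefficients_bounded) auto
  obtain J where J: "J > 0" "\<And>n t. 0 \<le> t \<Longrightarrow> t \<le> T \<Longrightarrow> \<bar>noise_integral \<sigma> h (\<epsilon> n) W t\<bar> \<le> J"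
    by (rule noise_integral_bounded) auto
  define C where "C = B\<^sup>2 * B + (T + \<bar>\<mu>\<bar>) * B"
  show ?thesis
  proof (rule that[of "max (B * exp (2 * J)) (C * exp (2 * J))"])
    fix n and t :: real assume t: "0 \<le> t" "t \<le> T"
    have "noise_factor \<sigma> h (\<epsilon> n) W t * exp (- 2 * noise_integral \<sigma> h (\<epsilon> n) W t) \<le> B * exp (2 * J)"
      using J(2)[OF t, of n] B(1) by (intro mult_mono B(3) t) auto
    then show "\<bar>rescaled_scale \<sigma> h (\<epsilon> n) W t\<bar> \<le> max (B * exp (2 * J)) (C * exp (2 * J))"
      using rescaled_scale_pos[of \<sigma> h "\<epsilon> n" W t] by (simp add: rescaled_scale_def le_max_iff_disj)
    have "\<bar>rescaled_potential \<sigma> h (\<epsilon> n) W \<mu> t\<bar> \<le> C * exp (2 * J)"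
      unfolding C_def by (rule abs_rescaled_potential_le) (use t B J in auto)
    then show "\<bar>rescaled_potential \<sigma> h (\<epsilon> n) W \<mu> t\<bar> \<le> max (B * exp (2 * J)) (C * exp (2 * J))" by simp
  qed
qed

lemma
  assumes T: "T \<ge> 0"
  shows canonical_sol_uniform_limit:
      "uniform_limit {0..T} (\<lambda>n. canonical_sol \<sigma> h (\<epsilon> n) W \<mu>) (riccati_sol \<sigma> W \<mu>) sequentially"
    and canonical_slope_uniform_limit:
      "uniform_limit {0..T} (\<lambda>n. canonical_slope \<sigma> h (\<epsilon> n) W \<mu>) (riccati_slope \<sigma> W \<mu>) sequentially"
proof -
  obtain K where K: "\<And>n t. 0 \<le> t \<Longrightarrow> t \<le> T \<Longrightarrow> \<bar>rescaled_scale \<sigma> h (\<epsilon> n) W t\<bar> \<le> K"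
    "\<And>n t. 0 \<le> t \<Longrightarrow> t \<le> T \<Longrightarrow> \<bar>rescaled_potential \<sigma> h (\<epsilon> n) W \<mu> t\<bar> \<le> K"
    by (rule rescaled_coefficients_bounded) blast
  note limit = string_sol_uniform_limit[OF cont_riccati_scale[OF cont_W]
      cont_riccati_potential[OF cont_W]
      cont_rescaled_scale cont_rescaled_potential K rescaled_scale_tendsto rescaled_potential_tendsto T]
  show "uniform_limit {0..T} (\<lambda>n. canonical_sol \<sigma> h (\<epsilon> n) W \<mu>) (riccati_sol \<sigma> W \<mu>) sequentially"
    "uniform_limit {0..T} (\<lambda>n. canonical_slope \<sigma> h (\<epsilon> n) W \<mu>) (riccati_slope \<sigma> W \<mu>) sequentially"
    unfolding riccati_sol_def riccati_slope_def canonical_sol_def canonical_slope_def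
    by (rule limit; assumption)+
qed

lemma canonical_sol_tendsto: "t \<ge> 0 \<Longrightarrow> (\<lambda>n. canonical_sol \<sigma> h (\<epsilon> n) W \<mu> t) \<longlonglongrightarrow> riccati_sol \<sigma> W \<mu> t"
  by (rule tendsto_uniform_limitI[OF canonical_sol_uniform_limit]) auto

lemma canonical_slope_tendsto: "t \<ge> 0 \<Longrightarrow> (\<lambda>n. canonical_slope \<sigma> h (\<epsilon> n) W \<mu> t) \<longlonglongrightarrow> riccati_slope \<sigma> W \<mu> t"
  by (rule tendsto_uniform_limitI[OF canonical_slope_uniform_limit]) auto

lemma rescaled_slope_tendsto:
  assumes t: "t \<ge> 0"
  shows "(\<lambda>n. rescaled_slope \<sigma> h (\<epsilon> n) W \<mu> t) \<longlonglongrightarrow> exp (\<sigma> * integral {0..t} W) * riccati_sol \<sigma> W \<mu> t"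
proof -
  have "(\<lambda>n. rescaled_slope \<sigma> h (\<epsilon> n) W \<mu> t) \<longlonglongrightarrow> exp (\<sigma> * integral {0..t} W) * riccati_sol \<sigma> W \<mu> t
      + 0 * (exp (- (\<sigma> * integral {0..t} W)) * riccati_slope \<sigma> W \<mu> t)"
    unfolding rescaled_slope_def rescaled_sol_def
    by (intro tendsto_intros noise_integral_tendsto canonical_sol_tendsto canonical_slope_tendsto
        t eps_tendsto)
  then show ?thesis by simp
qed

theorem eventually_not_rescaled_slope_positive:
  assumes "\<not> (\<forall>t>0. riccati_sol \<sigma> W \<mu> t > 0)"
  shows "\<forall>\<^sub>F n in sequentially. \<not> rescaled_slope_positive \<sigma> h (\<epsilon> n) W \<mu>"
proof -
  obtain t where t: "t > 0" "riccati_sol \<sigma> W \<mu> t < 0"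
    unfolding riccati_sol_def
    by (rule exists_string_sol_neg[OF cont_riccati_scale[OF cont_W]
        cont_riccati_potential[OF cont_W] riccati_scale_pos
          assms[unfolded riccati_sol_def]])
  then have "exp (\<sigma> * integral {0..t} W) * riccati_sol \<sigma> W \<mu> t < 0" by (simp add: mult_pos_neg)
  from order_tendstoD(2)[OF rescaled_slope_tendsto this] t(1)
  have "\<forall>\<^sub>F n in sequentially. rescaled_slope \<sigma> h (\<epsilon> n) W \<mu> t < 0" by simp
  then show ?thesis
  proof eventually_elim
    case (elim n)
    then have "\<not> rescaled_slope \<sigma> h (\<epsilon> n) W \<mu> t > 0" by simp
    then show ?case unfolding rescaled_slope_positive_def using less_imp_le[OF t(1)] by blast
  qed
qed

end

section \<open>The barrier\<close>

definition barrier :: "real \<Rightarrow> real \<Rightarrow> real" where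
  "barrier \<epsilon> t = max (sqrt t) (\<epsilon> * t) / 4"

definition drift_floor :: "real \<Rightarrow> real \<Rightarrow> real" where
  "drift_floor \<epsilon> t = min t (1 / \<epsilon>\<^sup>2)"

definition rescaled_drift :: "real \<Rightarrow> real \<Rightarrow> real \<Rightarrow> real \<Rightarrow> real" where
  "rescaled_drift \<epsilon> \<mu> t q = (2 - exp (\<epsilon> * q) - spectral_factor \<epsilon> \<mu> t * exp (- (\<epsilon> * q))) / \<epsilon>\<^sup>2"

lemma drift_floor_nonneg: "t \<ge> 0 \<Longrightarrow> drift_floor \<epsilon> t \<ge> 0"
  by (simp add: drift_floor_def)

lemma drift_floor_mono: "s \<le> t \<Longrightarrow> drift_floor \<epsilon> s \<le> drift_floor \<epsilon> t"
  by (simp add: drift_floor_def min.coboundedI1)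

lemma exp_neg_le_one_minus_half: "exp (- x) \<le> 1 - x / 2" if "0 \<le> x" "x \<le> 1" for x :: real
proof -
  have "exp (- x) \<le> 1 / (1 + x)" using exp_ge_add_one_self[of x] that(1)
    by (simp add: exp_minus field_simps)
  moreover have "x * x \<le> x" using that by (simp add: mult_left_le)
  then have "1 \<le> (1 - x / 2) * (1 + x)" by (simp add: algebra_simps)
  then have "1 / (1 + x) \<le> 1 - x / 2" using that(1) by (simp add: pos_divide_le_eq)
  ultimately show ?thesis by linarith
qed

lemma exp_neg_le_quadratic: "exp (- x) \<le> 1 - x + x\<^sup>2" if "0 \<le> x" for x :: real
proof -
  have "exp (- x) \<le> 1 / (1 + x)" using exp_ge_add_one_self[of x] that
    by (simp add: exp_minus field_simps)
  moreover have "(1 - x + x\<^sup>2) * (1 + x) = 1 + x^3"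
    by (simp add: algebra_simps power2_eq_square power3_eq_cube)
  then have "1 \<le> (1 - x + x\<^sup>2) * (1 + x)" using that by simp
  then have "1 / (1 + x) \<le> 1 - x + x\<^sup>2" using that by (simp add: pos_divide_le_eq)
  ultimately show ?thesis by linarith
qed

lemma spectral_factor_le: "spectral_factor \<epsilon> \<mu> t \<le> (1 + \<bar>\<mu>\<bar> * \<epsilon>\<^sup>2) * exp (- (\<epsilon>\<^sup>2 * t))"
  unfolding spectral_factor_def
proof (rule mult_right_mono)
  have "- \<mu> * \<epsilon>\<^sup>2 \<le> \<bar>\<mu>\<bar> * \<epsilon>\<^sup>2" by (intro mult_right_mono) auto
  then show "1 - \<mu> * \<epsilon>\<^sup>2 \<le> 1 + \<bar>\<mu>\<bar> * \<epsilon>\<^sup>2" by simp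
qed simp

lemma drift_lower_bound_late:
  fixes \<theta> w \<delta> \<kappa> :: real
  assumes "\<theta> \<ge> 1" and w: "0 \<le> w" "w \<le> \<theta> / 4" and \<delta>: "0 \<le> \<delta>" "\<delta> \<le> 1/10" and \<kappa>: "\<kappa> \<le> (1 + \<delta>) * exp (- \<theta>)"
  shows "1/5 \<le> 2 - exp (- w) - \<kappa> * exp w"
proof -
  have "exp w * exp (- \<theta>) \<le> exp (- (3/4))" unfolding exp_add[symmetric] using w assms(1) by simp
  moreover have "exp (- (3/4)) \<le> (4/7::real)" using exp_ge_add_one_self[of "3/4::real"]
    by (simp add: exp_minus field_simps)
  ultimately have exp_le: "exp w * exp (- \<theta>) \<le> 4/7" by linarith
  have "\<kappa> * exp w \<le> (1 + \<delta>) * exp (- \<theta>) * exp w" using \<kappa> by (intro mult_right_mono) auto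
  also have "\<dots> = (1 + \<delta>) * (exp w * exp (- \<theta>))" by simp
  also have "\<dots> \<le> (1 + 1/10) * (4/7)" using exp_le \<delta> by (intro mult_mono) auto
  finally have "\<kappa> * exp w \<le> 44/70" by simp
  moreover have "exp (- w) \<le> 1" using w by simp
  ultimately show ?thesis by linarith
qed

lemma drift_lower_bound_early:
  fixes \<theta> w \<delta> \<kappa> :: real
  assumes \<theta>: "0 < \<theta>" "\<theta> \<le> 1" and w: "0 \<le> w" "w \<le> sqrt \<theta> / 4" and \<delta>: "0 \<le> \<delta>" "\<delta> \<le> \<theta> / 40"
    and \<kappa>: "\<kappa> \<le> (1 + \<delta>) * exp (- \<theta>)"
  shows "\<theta> / 5 \<le> 2 - exp (- w) - \<kappa> * exp w"
proof -
  have "w\<^sup>2 \<le> (sqrt \<theta> / 4)\<^sup>2" using w by (intro power_mono) auto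
  then have w_sq: "w\<^sup>2 \<le> \<theta> / 16" using \<theta> by (simp add: power_divide)
  have "sqrt \<theta> \<le> 1" using \<theta> by simp
  then have "w \<le> 1" using w by linarith
  then have "exp w \<le> 1 + w + w\<^sup>2" using w by (intro exp_bound) auto
  then have exp_sum: "2 - exp (- w) - exp w \<ge> - (\<theta> / 8)" using exp_neg_le_quadratic[OF w(1)] w_sq
    by linarith
  have "(1 + \<delta>) * exp (- \<theta>) \<le> exp (- \<theta>) + \<delta>"
    using \<theta> \<delta> mult_left_mono[of "exp (- \<theta>)" 1 \<delta>] by (simp add: distrib_right)
  then have "1 - \<kappa> \<ge> \<theta> / 2 - \<theta> / 40" using \<kappa> \<delta> exp_neg_le_one_minus_half[of \<theta>] \<theta> by linarith
  then have "(1 - \<kappa>) * exp w \<ge> (\<theta> / 2 - \<theta> / 40) * 1" using w \<theta> by (intro mult_mono) auto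
  then show ?thesis using exp_sum \<theta> by (simp add: left_diff_distrib)
qed

lemma drift_lower_bound:
  assumes \<epsilon>: "\<epsilon> > 0" and \<mu>: "\<bar>\<mu>\<bar> * \<epsilon>\<^sup>2 \<le> 1/10" and t: "40 * \<bar>\<mu>\<bar> \<le> t" "t > 0"
    and q: "- barrier \<epsilon> t \<le> q" "q \<le> 0"
  shows "drift_floor \<epsilon> t / 5 \<le> rescaled_drift \<epsilon> \<mu> t q"
proof -
  define \<theta> where "\<theta> = \<epsilon>\<^sup>2 * t"
  define w where "w = - (\<epsilon> * q)"
  have \<theta>_pos: "\<theta> > 0" using \<epsilon> t by (simp add: \<theta>_def)
  have w_nonneg: "w \<ge> 0" using q \<epsilon> by (simp add: w_def mult_nonneg_nonpos)
  have "w \<le> \<epsilon> * barrier \<epsilon> t" using q \<epsilon> mult_left_mono[of "- q" "barrier \<epsilon> t" \<epsilon>] by (simp add: w_def)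
  also have "\<dots> = max (\<epsilon> * sqrt t) (\<epsilon> * (\<epsilon> * t)) / 4" using \<epsilon>
    by (simp add: barrier_def max_mult_distrib_left)
  also have "\<epsilon> * sqrt t = sqrt \<theta>" using \<epsilon> by (simp add: \<theta>_def real_sqrt_mult)
  also have "\<epsilon> * (\<epsilon> * t) = \<theta>" by (simp add: \<theta>_def power2_eq_square)
  finally have w_le: "w \<le> max (sqrt \<theta>) \<theta> / 4" .
  note \<kappa> = spectral_factor_le[of \<epsilon> \<mu> t, folded \<theta>_def]
  have "min \<theta> 1 / 5 \<le> 2 - exp (- w) - spectral_factor \<epsilon> \<mu> t * exp w"
  proof (cases "\<theta> \<ge> 1")
    case True
    then have "sqrt \<theta> \<le> \<theta>" by (simp add: real_le_lsqrt power2_eq_square)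
    then have "w \<le> \<theta> / 4" using w_le by simp
    then show ?thesis using drift_lower_bound_late[OF True w_nonneg _ _ \<mu> \<kappa>] True by simp
  next
    case False
    then have "\<theta> \<le> sqrt \<theta>" using \<theta>_pos
      by (intro real_le_rsqrt) (simp add: power2_eq_square mult_left_le)
    then have "w \<le> sqrt \<theta> / 4" using w_le by simp
    moreover have "\<bar>\<mu>\<bar> * \<epsilon>\<^sup>2 \<le> \<theta> / 40"
      using mult_right_mono[OF t(1), of "\<epsilon>\<^sup>2"] by (simp add: \<theta>_def ac_simps)
    ultimately show ?thesis using drift_lower_bound_early[OF \<theta>_pos _ w_nonneg _ _ _ \<kappa>] False by simp
  qed
  then have "(min \<theta> 1 / 5) / \<epsilon>\<^sup>2 \<le> rescaled_drift \<epsilon> \<mu> t q"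
    unfolding rescaled_drift_def w_def using \<epsilon> by (intro divide_right_mono) auto
  moreover have "drift_floor \<epsilon> t = min \<theta> 1 / \<epsilon>\<^sup>2" using \<epsilon>
    by (auto simp: drift_floor_def \<theta>_def min_def field_simps)
  ultimately show ?thesis by simp
qed

lemma drift_gain:
  fixes z Z :: "real \<Rightarrow> real"
  assumes s: "0 < s" "s < t" and cont_z: "continuous_on {s..t} z"
    and D: "\<And>x. s < x \<Longrightarrow> x < t \<Longrightarrow> DERIV z x :> Z x"
    and Z: "\<And>x. s < x \<Longrightarrow> x < t \<Longrightarrow> drift_floor \<epsilon> x / 5 \<le> Z x"
  shows "z s + drift_floor \<epsilon> t / 20 * (t - s) \<le> z t"
proof -
  define s' where "s' = max s (t / 2)"
  have s': "s \<le> s'" "s' \<le> t" "t / 2 \<le> s'" using s by (auto simp: s'_def)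
  have "z s \<le> z s'"
  proof (rule DERIV_nonneg_imp_le[OF s'(1) continuous_on_subset[OF cont_z] D])
    fix x assume "s < x" "x < s'"
    then show "0 \<le> Z x" using Z[of x] drift_floor_nonneg[of x \<epsilon>] s s' by linarith
  qed (use s' in auto)
  moreover have "z s' - drift_floor \<epsilon> s' / 5 * s' \<le> z t - drift_floor \<epsilon> s' / 5 * t"
  proof (rule DERIV_nonneg_imp_le[where F="\<lambda>x. z x - drift_floor \<epsilon> s' / 5 * x", OF s'(2)])
    show "continuous_on {s'..t} (\<lambda>x. z x - drift_floor \<epsilon> s' / 5 * x)"
      by (intro continuous_intros continuous_on_subset[OF cont_z]) (use s' in auto)
    fix x assume x: "s' < x" "x < t"
    then show "DERIV (\<lambda>x. z x - drift_floor \<epsilon> s' / 5 * x) x :> Z x - drift_floor \<epsilon> s' / 5"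
      using D[of x] s' by (auto intro!: derivative_eq_intros)
    show "0 \<le> Z x - drift_floor \<epsilon> s' / 5" using Z[of x] drift_floor_mono[of s' x \<epsilon>] x s' by linarith
  qed
  moreover have "drift_floor \<epsilon> t / 20 * (t - s) \<le> drift_floor \<epsilon> s' / 5 * (t - s')"
  proof -
    have half: "min t c / 2 \<le> min s' c" if "c \<ge> 0" for c using s'(3) that by (auto simp: min_def)
    have "drift_floor \<epsilon> t / 2 \<le> drift_floor \<epsilon> s'" unfolding drift_floor_def by (rule half) simp
    moreover have "(t - s) / 2 \<le> t - s'" using s by (auto simp: s'_def max_def)
    ultimately have "(drift_floor \<epsilon> t / 2) * ((t - s) / 2) \<le> drift_floor \<epsilon> s' * (t - s')"
      using s s' drift_floor_nonneg[of s' \<epsilon>] by (intro mult_mono) auto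
    then show ?thesis by (simp add: field_simps)
  qed
  ultimately show ?thesis by (simp add: right_diff_distrib)
qed

text \<open>As long as the rescaled slope stays positive, \<open>rescaled_log_ratio\<close> solves \<open>dq = \<sigma> dW +
  (rescaled_drift \<epsilon> \<mu> t q - h \<epsilon>) dt\<close>, the rescaled counterpart of the Riccati equation. Between
  its last visit of \<open>-1\<close> and the first visit of the barrier the drift exceeds the oscillation of
  the noise.\<close>

definition rescaled_log_ratio :: "real \<Rightarrow> real \<Rightarrow> real \<Rightarrow> (real \<Rightarrow> real) \<Rightarrow> real \<Rightarrow> real \<Rightarrow> real" where
  "rescaled_log_ratio \<sigma> h \<epsilon> W \<mu> t =
     \<sigma> * W t - h * \<epsilon> * t + ln (rescaled_slope \<sigma> h \<epsilon> W \<mu> t / rescaled_sol \<sigma> h \<epsilon> W \<mu> t) / \<epsilon>"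

context rescaled_string
begin

lemma rescaled_sol_pos_while:
  assumes "0 < T" "T \<le> t" and slope: "\<And>x. T \<le> x \<Longrightarrow> x < t \<Longrightarrow> rescaled_slope \<sigma> h \<epsilon> W \<mu> x > 0"
    and sol_T: "rescaled_sol \<sigma> h \<epsilon> W \<mu> T > 0"
  shows "rescaled_sol \<sigma> h \<epsilon> W \<mu> t > 0"
proof -
  let ?y = "rescaled_sol \<sigma> h \<epsilon> W \<mu>" and ?u = "rescaled_slope \<sigma> h \<epsilon> W \<mu>" and ?G = "noise_factor \<sigma> h \<epsilon> W"
  let ?F' = "\<lambda>x. exp (x / \<epsilon>) * (?G x * ?u x) / \<epsilon>"
  have "exp (T / \<epsilon>) * ?y T \<le> exp (t / \<epsilon>) * ?y t"
  proof (rule DERIV_nonneg_imp_le[where F="\<lambda>t. exp (t / \<epsilon>) * ?y t" and F'="?F'", OF \<open>T \<le> t\<close>])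
    show "continuous_on {T..t} (\<lambda>t. exp (t / \<epsilon>) * ?y t)"
      using eps_pos \<open>0 < T\<close> by (intro continuous_intros continuous_on_subset[OF cont_rescaled_sol]) auto
    fix x assume x: "T < x" "x < t"
    then have "DERIV (\<lambda>t. exp (t / \<epsilon>) * ?y t) x :>
        exp (x / \<epsilon>) * (1 / \<epsilon>) * ?y x + (?G x * ?u x - ?y x) / \<epsilon> * exp (x / \<epsilon>)"
      using \<open>0 < T\<close>
      by (intro DERIV_mult DERIV_rescaled_sol
          DERIV_chain2[OF DERIV_exp DERIV_cdivide[OF DERIV_ident]]) auto
    then show "DERIV (\<lambda>t. exp (t / \<epsilon>) * ?y t) x :> ?F' x"
      by (rule DERIV_cong) (use eps_pos in \<open>simp add: field_simps\<close>)
    show "?F' x \<ge> 0" using slope[of x] x eps_pos noise_factor_pos[of \<sigma> h \<epsilon> W x] by simp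
  qed
  moreover have "exp (T / \<epsilon>) * ?y T > 0" using sol_T by simp
  ultimately have "exp (t / \<epsilon>) * ?y t > 0" by linarith
  then show ?thesis by (simp add: zero_less_mult_iff)
qed

lemma exp_rescaled_log_ratio:
  assumes "rescaled_sol \<sigma> h \<epsilon> W \<mu> t > 0" "rescaled_slope \<sigma> h \<epsilon> W \<mu> t > 0"
  shows "exp (\<epsilon> * rescaled_log_ratio \<sigma> h \<epsilon> W \<mu> t) =
    noise_factor \<sigma> h \<epsilon> W t * (rescaled_slope \<sigma> h \<epsilon> W \<mu> t / rescaled_sol \<sigma> h \<epsilon> W \<mu> t)"
  unfolding rescaled_log_ratio_def noise_factor_def distrib_left exp_add using assms eps_pos by simp

lemma DERIV_ln_rescaled_ratio:
  assumes t: "t > 0" and pos: "rescaled_sol \<sigma> h \<epsilon> W \<mu> t > 0" "rescaled_slope \<sigma> h \<epsilon> W \<mu> t > 0"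
  shows "DERIV (\<lambda>t. ln (rescaled_slope \<sigma> h \<epsilon> W \<mu> t / rescaled_sol \<sigma> h \<epsilon> W \<mu> t) / \<epsilon>) t :>
    rescaled_drift \<epsilon> \<mu> t (rescaled_log_ratio \<sigma> h \<epsilon> W \<mu> t)"
proof -
  let ?y = "rescaled_sol \<sigma> h \<epsilon> W \<mu> t" and ?u = "rescaled_slope \<sigma> h \<epsilon> W \<mu> t"
  let ?G = "noise_factor \<sigma> h \<epsilon> W t" and ?k = "spectral_factor \<epsilon> \<mu> t"
  let ?q = "rescaled_log_ratio \<sigma> h \<epsilon> W \<mu> t"
  have "DERIV (\<lambda>t. ln (rescaled_slope \<sigma> h \<epsilon> W \<mu> t / rescaled_sol \<sigma> h \<epsilon> W \<mu> t) / \<epsilon>) t :>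
    (1 / (?u / ?y) * (((?u - ?k * ?y / ?G) / \<epsilon> * ?y - ?u * ((?G * ?u - ?y) / \<epsilon>)) / (?y * ?y))) / \<epsilon>"
    by (intro DERIV_cdivide DERIV_chain2[OF DERIV_ln_divide] DERIV_divide DERIV_rescaled_slope
        DERIV_rescaled_sol t)
      (use pos in auto)
  moreover have "(1 / (u / y) * (((u - k * y / G) / \<epsilon> * y - u * ((G * u - y) / \<epsilon>)) / (y * y))) / \<epsilon>
      = (2 - G * (u / y) - k * (1 / (G * (u / y)))) / \<epsilon>\<^sup>2" if "u > 0" "y > 0" "G > 0" for u y G k :: real
    using that eps_pos by (simp add: field_simps power2_eq_square)
  from this[OF pos(2,1) noise_factor_pos]
  have "(1 / (?u / ?y) * (((?u - ?k * ?y / ?G) / \<epsilon> * ?y - ?u * ((?G * ?u - ?y) / \<epsilon>)) / (?y * ?y))) / \<epsilon>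
      = rescaled_drift \<epsilon> \<mu> t ?q"
    unfolding rescaled_drift_def exp_minus exp_rescaled_log_ratio[OF pos] inverse_eq_divide .
  ultimately show ?thesis by (simp only:)
qed

text \<open>Has the sign of \<open>rescaled_log_ratio + barrier\<close>, but stays continuous where the slope
  vanishes.\<close>

definition barrier_gap :: "real \<Rightarrow> real" where
  "barrier_gap t = noise_factor \<sigma> h \<epsilon> W t * rescaled_slope \<sigma> h \<epsilon> W \<mu> t
      - rescaled_sol \<sigma> h \<epsilon> W \<mu> t * exp (- (\<epsilon> * barrier \<epsilon> t))"

lemma cont_barrier_gap: "continuous_on {0..} barrier_gap"
  unfolding barrier_gap_def[abs_def] barrier_def
  by (intro continuous_intros cont_noise_factor cont_rescaled_slope cont_rescaled_sol) auto

lemma barrier_gap_sign: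
  assumes pos: "rescaled_sol \<sigma> h \<epsilon> W \<mu> t > 0" "rescaled_slope \<sigma> h \<epsilon> W \<mu> t > 0"
  shows "barrier_gap t > 0 \<longleftrightarrow> - barrier \<epsilon> t < rescaled_log_ratio \<sigma> h \<epsilon> W \<mu> t"
    and "barrier_gap t = 0 \<longleftrightarrow> rescaled_log_ratio \<sigma> h \<epsilon> W \<mu> t = - barrier \<epsilon> t"
proof -
  let ?y = "rescaled_sol \<sigma> h \<epsilon> W \<mu> t" and ?q = "rescaled_log_ratio \<sigma> h \<epsilon> W \<mu> t"
  have "barrier_gap t = ?y * (exp (\<epsilon> * ?q) - exp (\<epsilon> * (- barrier \<epsilon> t)))"
    unfolding exp_rescaled_log_ratio[OF pos] barrier_gap_def using pos by (simp add: field_simps)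
  then have "barrier_gap t > 0 \<longleftrightarrow> \<epsilon> * (- barrier \<epsilon> t) < \<epsilon> * ?q"
    "barrier_gap t = 0 \<longleftrightarrow> \<epsilon> * ?q = \<epsilon> * (- barrier \<epsilon> t)"
    using pos by (simp_all only: zero_less_mult_iff mult_eq_0_iff diff_gt_0_iff_gt right_minus_eq
        exp_less_cancel_iff exp_inj_iff) auto
  then show "barrier_gap t > 0 \<longleftrightarrow> - barrier \<epsilon> t < ?q" "barrier_gap t = 0 \<longleftrightarrow> ?q = - barrier \<epsilon> t"
    using eps_pos by (simp_all only: mult_less_cancel_left_pos mult_cancel_left) auto
qed

context
  fixes T :: real
  assumes T: "T > 16"
    and drift: "\<And>t q. t \<ge> T \<Longrightarrow> - barrier \<epsilon> t \<le> q \<Longrightarrow> q \<le> 0 \<Longrightarrow> drift_floor \<epsilon> t / 5 \<le> rescaled_drift \<epsilon> \<mu> t q"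
    and noise: "\<And>s t. T \<le> s \<Longrightarrow> s \<le> t \<Longrightarrow>
      (\<sigma> * W s - h * \<epsilon> * s) - (\<sigma> * W t - h * \<epsilon> * t) < barrier \<epsilon> t - 1 + drift_floor \<epsilon> t / 20 * (t - s)"
    and log_ratio_T: "rescaled_log_ratio \<sigma> h \<epsilon> W \<mu> T \<ge> -1"
begin

lemma barrier_gt_1:
  assumes "t \<ge> T"
  shows "barrier \<epsilon> t > 1"
proof -
  have "sqrt 16 < sqrt t" using assms T by (subst real_sqrt_less_iff) simp
  then show ?thesis by (simp add: barrier_def)
qed

lemma barrier_not_reached:
  assumes t: "T < t"
    and pos: "\<And>x. T \<le> x \<Longrightarrow> x \<le> t \<Longrightarrow> rescaled_sol \<sigma> h \<epsilon> W \<mu> x > 0 \<and> rescaled_slope \<sigma> h \<epsilon> W \<mu> x > 0"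
    and above: "\<And>x. T \<le> x \<Longrightarrow> x < t \<Longrightarrow> - barrier \<epsilon> x < rescaled_log_ratio \<sigma> h \<epsilon> W \<mu> x"
  shows "rescaled_log_ratio \<sigma> h \<epsilon> W \<mu> t \<noteq> - barrier \<epsilon> t"
proof
  assume reached: "rescaled_log_ratio \<sigma> h \<epsilon> W \<mu> t = - barrier \<epsilon> t"
  let ?q = "rescaled_log_ratio \<sigma> h \<epsilon> W \<mu>"
  define z where "z x = ln (rescaled_slope \<sigma> h \<epsilon> W \<mu> x / rescaled_sol \<sigma> h \<epsilon> W \<mu> x) / \<epsilon>" for x
  have DERIV_z: "DERIV z x :> rescaled_drift \<epsilon> \<mu> x (?q x)" if "T \<le> x" "x \<le> t" for x
    unfolding z_def[abs_def] using pos[OF that] that T by (intro DERIV_ln_rescaled_ratio) auto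
  have cont_z: "continuous_on {T..t} z"
    by (rule DERIV_continuous_on[OF has_field_derivative_at_within[OF DERIV_z]]) auto
  have q: "?q x = \<sigma> * W x - h * \<epsilon> * x + z x" for x by (simp add: rescaled_log_ratio_def z_def)
  have "continuous_on {T..t} ?q"
    unfolding q[abs_def]
    by (intro continuous_intros cont_z continuous_on_subset[OF cont_W]) (use T in auto)
  moreover have "?q t < -1" using reached barrier_gt_1[of t] t by simp
  ultimately obtain s where s: "T \<le> s" "s < t" "?q s = -1" "\<And>x. s < x \<Longrightarrow> x \<le> t \<Longrightarrow> ?q x < -1"
    using last_visit[of T t ?q "-1"] log_ratio_T t by (metis less_imp_le)
  have "z s + drift_floor \<epsilon> t / 20 * (t - s) \<le> z t"
  proof (rule drift_gain)
    show "continuous_on {s..t} z" by (rule continuous_on_subset[OF cont_z]) (use s in auto)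
    fix x assume x: "s < x" "x < t"
    then show "DERIV z x :> rescaled_drift \<epsilon> \<mu> x (?q x)" using s by (intro DERIV_z) auto
    show "drift_floor \<epsilon> x / 5 \<le> rescaled_drift \<epsilon> \<mu> x (?q x)"
      using above[of x] s(1) s(4)[of x] x by (intro drift) auto
  qed (use s T in auto)
  then show False using noise[OF s(1) less_imp_le[OF s(2)]] s(3) reached unfolding q by linarith
qed

theorem rescaled_slope_pos_beyond:
  assumes sol_T: "rescaled_sol \<sigma> h \<epsilon> W \<mu> T > 0" and slope_T: "rescaled_slope \<sigma> h \<epsilon> W \<mu> T > 0"
    and "b \<ge> T"
  shows "rescaled_slope \<sigma> h \<epsilon> W \<mu> b > 0"
proof (rule ccontr)
  assume "\<not> rescaled_slope \<sigma> h \<epsilon> W \<mu> b > 0"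
  then obtain c where c: "T < c" "c \<le> b" "rescaled_slope \<sigma> h \<epsilon> W \<mu> c = 0"
    and slope_pos: "\<And>x. T \<le> x \<Longrightarrow> x < c \<Longrightarrow> rescaled_slope \<sigma> h \<epsilon> W \<mu> x > 0"
    using first_zero[of T b "rescaled_slope \<sigma> h \<epsilon> W \<mu>"] continuous_on_subset[OF cont_rescaled_slope,
        of "{T..b}"]
      slope_T \<open>b \<ge> T\<close> T by auto
  have sol_pos: "rescaled_sol \<sigma> h \<epsilon> W \<mu> x > 0" if "T \<le> x" "x \<le> c" for x
    using that T slope_pos by (intro rescaled_sol_pos_while[OF _ that(1) _ sol_T]) auto
  have "barrier_gap T > 0"
    using barrier_gap_sign(1)[OF sol_T slope_T] log_ratio_T barrier_gt_1[of T] by simp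
  moreover have gap_c: "barrier_gap c < 0" using sol_pos[of c] c by (simp add: barrier_gap_def)
  moreover have "continuous_on {T..c} barrier_gap"
    by (rule continuous_on_subset[OF cont_barrier_gap]) (use T in auto)
  ultimately obtain t where t: "T < t" "t \<le> c" "barrier_gap t = 0"
    and gap_pos: "\<And>x. T \<le> x \<Longrightarrow> x < t \<Longrightarrow> barrier_gap x > 0"
    using first_zero[of T c barrier_gap] c(1) by (metis less_imp_le)
  have "t \<noteq> c" using t(3) gap_c by auto
  then have "t < c" using t(2) by simp
  then have pos: "rescaled_sol \<sigma> h \<epsilon> W \<mu> x > 0 \<and> rescaled_slope \<sigma> h \<epsilon> W \<mu> x > 0"
    if "T \<le> x" "x \<le> t" for x
    using that sol_pos slope_pos by auto
  have "rescaled_log_ratio \<sigma> h \<epsilon> W \<mu> t \<noteq> - barrier \<epsilon> t"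
  proof (rule barrier_not_reached[OF t(1) pos])
    fix x assume x: "T \<le> x" "x < t"
    then show "- barrier \<epsilon> x < rescaled_log_ratio \<sigma> h \<epsilon> W \<mu> x"
      using barrier_gap_sign(1)[of x] pos[of x] gap_pos[of x] by auto
  qed auto
  then show False using barrier_gap_sign(2)[of t] pos[of t] t by auto
qed

end

end

section \<open>Growth of the noise\<close>

definition path_growth :: "real \<Rightarrow> (real \<Rightarrow> real) \<Rightarrow> bool" where
  "path_growth C W \<longleftrightarrow> C \<ge> 0 \<and> (\<forall>t\<ge>0. \<bar>W t\<bar> \<le> C * (1 + t) powr (3/4)) \<and>
     (\<forall>s t. 0 \<le> s \<longrightarrow> s \<le> t \<longrightarrow> \<bar>W t - W s\<bar> \<le> C * (1 + t) powr (1/4) * (t - s + 2))"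

lemma path_growth_mult:
  assumes growth: "path_growth C W" and "c \<ge> 0"
  shows "path_growth (c * C) (\<lambda>t. c * W t)"
proof -
  have "\<bar>c * x\<bar> \<le> c * C * p * r" if "\<bar>x\<bar> \<le> C * p * r" for x p r
    using mult_left_mono[OF that \<open>c \<ge> 0\<close>] \<open>c \<ge> 0\<close> by (simp add: abs_mult mult.assoc)
  from this[of _ _ 1] this show ?thesis
    using growth \<open>c \<ge> 0\<close> unfolding path_growth_def right_diff_distrib[symmetric] by auto
qed

lemma path_growth_increment_le:
  assumes growth: "path_growth C W" and s: "0 \<le> s" "s \<le> t"
  shows "\<bar>W t - W s\<bar> \<le> 2 * C * (1 + t) powr (3/4)"
proof -
  have "C * (1 + s) powr (3/4) \<le> C * (1 + t) powr (3/4)"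
    using growth s by (intro mult_left_mono powr_mono2) (auto simp: path_growth_def)
  moreover have "\<bar>W s\<bar> \<le> C * (1 + s) powr (3/4)" "\<bar>W t\<bar> \<le> C * (1 + t) powr (3/4)"
    using growth s by (auto simp: path_growth_def)
  ultimately show ?thesis by linarith
qed

lemma one_plus_powr_le: "(1 + t) powr p \<le> 2 * t powr p" if "t \<ge> 1" "0 \<le> p" "p \<le> 1" for t p :: real
proof -
  have "(1 + t) powr p \<le> (2 * t) powr p" using that by (intro powr_mono2) auto
  also have "\<dots> = 2 powr p * t powr p" using that by (simp add: powr_mult)
  also have "\<dots> \<le> 2 powr 1 * t powr p" using that by (intro mult_right_mono powr_mono) auto
  finally show ?thesis by simp
qed

lemma barrier_pow4: "barrier \<epsilon> (r ^ 4) = max (r\<^sup>2) (\<epsilon> * r ^ 4) / 4"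
proof -
  have "r ^ 4 = (r\<^sup>2)\<^sup>2" by (simp flip: power_mult)
  then have "sqrt (r ^ 4) = r\<^sup>2" by (simp only: real_sqrt_abs) simp
  then show ?thesis by (simp add: barrier_def)
qed

text \<open>With \<open>t = r\<^sup>4\<close>, for \<open>\<epsilon> r \<ge> 16 C + 8\<close> the barrier alone exceeds the noise; otherwise \<open>r\<close> is
  small enough for the drift to exceed the linear growth of the noise.\<close>

context
  fixes C h \<epsilon> r :: real
  assumes C: "C \<ge> 0" and h: "h \<ge> 0" and \<epsilon>: "0 < \<epsilon>" "\<epsilon> \<le> 1" and r: "r \<ge> 40 * C + 20 * h + 8"
    and small: "2 * C * (16 * C + 8) / \<epsilon> + h * \<epsilon> \<le> 1 / (20 * \<epsilon>\<^sup>2)"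
begin

lemma fourth_root_ge_8: "r \<ge> 8"
  using r C h by linarith

lemma fourth_root_square_ge: "r * r \<ge> 40 * (C * r) + 20 * (h * r) + 8 * r"
  using mult_right_mono[OF r, of r] fourth_root_ge_8 by (simp add: algebra_simps)

lemma linear_noise_le_floor:
  assumes "0 \<le> c" "c \<le> 2 * C * r" "c + h * \<epsilon> \<le> (1 / \<epsilon>\<^sup>2) / 20"
  shows "c + h * \<epsilon> \<le> drift_floor \<epsilon> (r ^ 4) / 20"
proof -
  have "1 * 1 \<le> r * r" using fourth_root_ge_8 by (intro mult_mono) auto
  then have "1 * (r * r) \<le> (r * r) * (r * r)" by (intro mult_right_mono) auto
  then have "r * r \<le> r ^ 4" by (simp add: power4_eq_xxxx mult.assoc)
  moreover have "h * \<epsilon> \<le> h" "h \<le> h * r" using h \<epsilon> fourth_root_ge_8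
    by (simp_all add: mult_left_le mult_le_cancel_left1)
  ultimately have "c + h * \<epsilon> \<le> r ^ 4 / 20" using assms fourth_root_square_ge fourth_root_ge_8 by (simp add: mult.assoc)
  then show ?thesis using assms(3) by (simp add: drift_floor_def min_def)
qed

lemma noise_growth_dominated_steep:
  assumes steep: "\<epsilon> * r \<ge> 16 * C + 8" and D: "D \<le> 4 * C * r ^ 3" and "d \<ge> 0"
  shows "D + h * \<epsilon> * d < barrier \<epsilon> (r ^ 4) - 1 + drift_floor \<epsilon> (r ^ 4) / 20 * d"
proof -
  have "(16 * C + 8) * r ^ 3 \<le> (\<epsilon> * r) * r ^ 3" using steep fourth_root_ge_8 by (intro mult_right_mono) auto
  also have "\<dots> = \<epsilon> * r ^ 4" by (simp add: power4_eq_xxxx power3_eq_cube)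
  also have "\<dots> \<le> 4 * barrier \<epsilon> (r ^ 4)" by (simp add: barrier_pow4)
  finally have "(16 * C + 8) * r ^ 3 \<le> 4 * barrier \<epsilon> (r ^ 4)" .
  moreover have "r ^ 3 \<ge> 1" using fourth_root_ge_8 by (intro one_le_power) auto
  ultimately have "D + 1 < barrier \<epsilon> (r ^ 4)" using D by (simp add: distrib_right)
  moreover have "0 \<le> 2 * C * (16 * C + 8) / \<epsilon>" using C \<epsilon> by simp
  then have "h * \<epsilon> \<le> (1 / \<epsilon>\<^sup>2) / 20" using small by simp
  then have "0 + h * \<epsilon> \<le> drift_floor \<epsilon> (r ^ 4) / 20" using C fourth_root_ge_8
    by (intro linear_noise_le_floor) auto
  then have "h * \<epsilon> * d \<le> drift_floor \<epsilon> (r ^ 4) / 20 * d" using \<open>d \<ge> 0\<close> by (intro mult_right_mono) auto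
  ultimately show ?thesis by linarith
qed

lemma noise_growth_dominated_flat:
  assumes flat: "\<epsilon> * r < 16 * C + 8" and D: "D \<le> C * (2 * r) * (d + 2)" and "d \<ge> 0"
  shows "D + h * \<epsilon> * d < barrier \<epsilon> (r ^ 4) - 1 + drift_floor \<epsilon> (r ^ 4) / 20 * d"
proof -
  have "r \<le> (16 * C + 8) / \<epsilon>" using flat \<epsilon> by (simp add: field_simps)
  then have "2 * C * r \<le> 2 * C * ((16 * C + 8) / \<epsilon>)" using C by (intro mult_left_mono) auto
  then have "2 * C * r + h * \<epsilon> \<le> (1 / \<epsilon>\<^sup>2) / 20" using small by simp
  then have "2 * C * r + h * \<epsilon> \<le> drift_floor \<epsilon> (r ^ 4) / 20" using C fourth_root_ge_8
    by (intro linear_noise_le_floor) auto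
  then have "(2 * C * r + h * \<epsilon>) * d \<le> drift_floor \<epsilon> (r ^ 4) / 20 * d" using \<open>d \<ge> 0\<close>
    by (rule mult_right_mono)
  then have drift: "2 * C * r * d + h * \<epsilon> * d \<le> drift_floor \<epsilon> (r ^ 4) / 20 * d"
    by (simp add: distrib_right)
  have "C * r \<ge> 0" "h * r \<ge> 0" using C h fourth_root_ge_8 by auto
  then have "16 * (C * r) + 8 < r * r" using fourth_root_square_ge fourth_root_ge_8 by linarith
  then have "4 * C * r + 1 < barrier \<epsilon> (r ^ 4)" unfolding barrier_pow4 power2_eq_square by simp
  moreover have "D \<le> 2 * C * r * d + 4 * C * r" using D by (simp add: algebra_simps)
  ultimately show ?thesis using drift by linarith
qed

end

lemma noise_growth_dominated:
  assumes growth: "path_growth C W" and h: "h \<ge> 0" and \<epsilon>: "0 < \<epsilon>" "\<epsilon> \<le> 1"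
    and t: "(40 * C + 20 * h + 8) ^ 4 \<le> t" and s: "0 \<le> s" "s \<le> t"
    and small: "2 * C * (16 * C + 8) / \<epsilon> + h * \<epsilon> \<le> 1 / (20 * \<epsilon>\<^sup>2)"
  shows "(W s - h * \<epsilon> * s) - (W t - h * \<epsilon> * t) < barrier \<epsilon> t - 1 + drift_floor \<epsilon> t / 20 * (t - s)"
proof -
  define r where "r = t powr (1/4)"
  define R where "R = 40 * C + 20 * h + 8"
  have C: "C \<ge> 0" using growth by (simp add: path_growth_def)
  have R: "R \<ge> 8" using C h by (simp add: R_def)
  then have "1 \<le> R ^ 4" by (intro one_le_power) auto
  then have t_ge: "R ^ 4 \<le> t" "t \<ge> 1" using t by (simp_all add: R_def)
  have r_pow: "r ^ n = t powr (real n / 4)" for n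
    unfolding r_def using t_ge by (subst powr_realpow[symmetric]) (auto simp: powr_powr)
  have r4: "r ^ 4 = t" using r_pow[of 4] t_ge by simp
  have "r \<ge> 0" by (simp add: r_def)
  then have "r \<ge> R" using t_ge(1) by (intro power_le_imp_le_base[of R 3 r]) (simp_all add: r4)
  note r = this[unfolded R_def]
  have "W s - W t + h * \<epsilon> * (t - s) < barrier \<epsilon> (r ^ 4) - 1 + drift_floor \<epsilon> (r ^ 4) / 20 * (t - s)"
  proof (cases "\<epsilon> * r \<ge> 16 * C + 8")
    case True
    have "(1 + t) powr (3/4) \<le> 2 * r ^ 3" using one_plus_powr_le[of t "3/4"] t_ge r_pow[of 3] by simp
    then have "2 * C * (1 + t) powr (3/4) \<le> 2 * C * (2 * r ^ 3)" using C by (intro mult_left_mono) auto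
    then have "W s - W t \<le> 4 * C * r ^ 3" using path_growth_increment_le[OF growth s] by linarith
    then show ?thesis by (rule noise_growth_dominated_steep[OF C h \<epsilon> r small True]) (use s in simp)
  next
    case False
    have "(1 + t) powr (1/4) \<le> 2 * r" using one_plus_powr_le[of t "1/4"] t_ge by (simp add: r_def)
    then have "C * (1 + t) powr (1/4) * (t - s + 2) \<le> C * (2 * r) * (t - s + 2)"
      using C s by (intro mult_right_mono mult_left_mono) auto
    moreover have "\<bar>W t - W s\<bar> \<le> C * (1 + t) powr (1/4) * (t - s + 2)" using growth s
      by (simp add: path_growth_def)
    ultimately have "W s - W t \<le> C * (2 * r) * (t - s + 2)" by linarith
    then show ?thesis using False s by (intro noise_growth_dominated_flat[OF C h \<epsilon> r small]) simp_all
  qed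
  then show ?thesis unfolding r4 by (simp add: algebra_simps)
qed

section \<open>Positivity below the limiting threshold\<close>

lemma DERIV_ge_square_blowup:
  fixes f f' :: "real \<Rightarrow> real"
  assumes pos: "\<And>t. t \<ge> a \<Longrightarrow> f t > 0" and D: "\<And>t. t \<ge> a \<Longrightarrow> DERIV f t :> f' t"
    and ge: "\<And>t. t \<ge> a \<Longrightarrow> f' t \<ge> (f t)\<^sup>2"
  shows False
proof -
  define b where "b = a + 1 / f a + 1"
  have ab: "a \<le> b" using pos[of a] by (simp add: b_def)
  have DERIV_inv: "DERIV (\<lambda>t. 1 / f t + t) t :> - f' t / (f t)\<^sup>2 + 1" if "t \<ge> a" for t
  proof -
    have "DERIV (\<lambda>t. 1 / f t + t) t :> (0 * f t - 1 * f' t) / (f t * f t) + 1"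
      by (intro DERIV_add DERIV_divide D DERIV_const DERIV_ident that) (use pos[OF that] in simp)
    then show ?thesis by (simp add: power2_eq_square)
  qed
  have "1 / f b + b \<le> 1 / f a + a"
  proof (rule DERIV_nonpos_imp_ge[where F="\<lambda>t. 1 / f t + t", OF ab _ DERIV_inv])
    show "continuous_on {a..b} (\<lambda>t. 1 / f t + t)"
      by (rule DERIV_continuous_on[OF has_field_derivative_at_within[OF DERIV_inv]]) auto
    fix t assume t: "a < t" "t < b"
    then have "1 \<le> f' t / (f t)\<^sup>2" using ge[of t] pos[of t] by (subst le_divide_eq_1_pos) auto
    then show "- f' t / (f t)\<^sup>2 + 1 \<le> 0" by (simp only: minus_divide_left[symmetric])
  qed auto
  moreover have "1 / f b > 0" using pos[OF ab] by simp
  ultimately show False unfolding b_def by linarith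
qed

context
  fixes \<sigma> \<mu> \<mu>' :: real and W :: "real \<Rightarrow> real"
  assumes cont_W: "continuous_on {0..} W" and less: "\<mu>' < \<mu>"
    and sol'_pos: "\<And>t. t > 0 \<Longrightarrow> riccati_sol \<sigma> W \<mu>' t > 0"
begin

lemma riccati_potential_less: "riccati_potential \<sigma> W \<mu> t < riccati_potential \<sigma> W \<mu>' t"
  using less by (simp add: riccati_potential_def)

lemmas riccati_coefficients_ordered = cont_riccati_scale[OF cont_W] cont_riccati_potential[OF cont_W]
  cont_riccati_potential[OF cont_W] riccati_scale_pos less_imp_le[OF riccati_potential_less]

lemma riccati_sol_pos_mono: "t > 0 \<Longrightarrow> riccati_sol \<sigma> W \<mu> t > 0"
  unfolding riccati_sol_def
  by (rule sturm_sol_pos[OF riccati_coefficients_ordered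
        sol'_pos[unfolded riccati_sol_def] _ order_refl])

lemma riccati_log_deriv_less:
  assumes "t \<ge> 1"
  shows "riccati_log_deriv \<sigma> W \<mu>' t < riccati_log_deriv \<sigma> W \<mu> t"
proof -
  let ?w = "wronskian (riccati_scale \<sigma> W) (riccati_potential \<sigma> W \<mu>) (riccati_potential \<sigma> W \<mu>')"
  obtain w where "w > 0" "\<And>x. x \<ge> 1 \<Longrightarrow> ?w x \<ge> w"
    by (rule wronskian_bounded_below[OF riccati_coefficients_ordered
        sol'_pos[unfolded riccati_sol_def] riccati_potential_less]) auto
  then have "?w t > 0" using assms by force
  have pos: "riccati_sol \<sigma> W \<mu> t > 0" "riccati_sol \<sigma> W \<mu>' t > 0"
    using riccati_sol_pos_mono[of t] sol'_pos[of t] assms by auto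
  have "riccati_log_deriv \<sigma> W \<mu> t - riccati_log_deriv \<sigma> W \<mu>' t
      = riccati_scale \<sigma> W t * ?w t / (riccati_sol \<sigma> W \<mu> t * riccati_sol \<sigma> W \<mu>' t)"
    unfolding riccati_log_deriv_def wronskian_def riccati_sol_def[symmetric]
        riccati_slope_def[symmetric]
    using pos by (simp add: field_simps)
  also have "\<dots> > 0" using \<open>?w t > 0\<close> riccati_scale_pos pos by simp
  finally show ?thesis by simp
qed

text \<open>If the upper of two solutions stayed negative, the difference \<open>d\<close> would satisfy \<open>d' \<ge> d\<^sup>2\<close>.\<close>

lemma riccati_nonneg_again: "\<exists>T\<ge>T0. \<sigma> * W T + riccati_log_deriv \<sigma> W \<mu> T \<ge> 0"
proof (rule ccontr)
  assume "\<not> ?thesis"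
  then have neg: "\<sigma> * W t + riccati_log_deriv \<sigma> W \<mu> t < 0" if "t \<ge> max T0 1" for t using that by force
  define d where "d t = riccati_log_deriv \<sigma> W \<mu> t - riccati_log_deriv \<sigma> W \<mu>' t" for t
  let ?d' = "\<lambda>t. (t + \<mu> - (\<sigma> * W t + riccati_log_deriv \<sigma> W \<mu> t)\<^sup>2)
      - (t + \<mu>' - (\<sigma> * W t + riccati_log_deriv \<sigma> W \<mu>' t)\<^sup>2)"
  have d_pos: "d t > 0" if "t \<ge> max T0 1" for t using riccati_log_deriv_less[of t] that
    by (simp add: d_def)
  show False
  proof (rule DERIV_ge_square_blowup[OF d_pos])
    fix t assume t: "t \<ge> max T0 1"
    then show "DERIV d t :> ?d' t"
      unfolding d_def[abs_def]
      by (intro DERIV_diff DERIV_riccati_log_deriv[OF cont_W] riccati_sol_pos_mono sol'_pos) auto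
    let ?q = "\<sigma> * W t + riccati_log_deriv \<sigma> W \<mu> t"
    have "?q * d t \<le> 0" using neg[OF t] d_pos[OF t] by (simp add: mult_nonpos_nonneg)
    moreover have "?d' t = (\<mu> - \<mu>') - 2 * (?q * d t) + (d t)\<^sup>2" unfolding d_def
      by (simp add: power2_eq_square algebra_simps)
    ultimately show "?d' t \<ge> (d t)\<^sup>2" using less by linarith
  qed
qed

end

context rescaled_string
begin

lemma rescaled_slope_pos_if_canonical_slope_pos:
  assumes "t > 0" and slope: "\<And>x. 0 < x \<Longrightarrow> x \<le> t \<Longrightarrow> canonical_slope \<sigma> h \<epsilon> W \<mu> x > 0"
  shows "rescaled_slope \<sigma> h \<epsilon> W \<mu> t > 0"
proof -
  have "canonical_sol \<sigma> h \<epsilon> W \<mu> 0 < canonical_sol \<sigma> h \<epsilon> W \<mu> t"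
    by (rule solves_system_strict_increasing[OF solves_system_canonical])
      (use assms rescaled_scale_pos in auto)
  then show ?thesis
    unfolding rescaled_slope_def rescaled_sol_def using canonical_sol_0 slope[of t] assms(1) eps_pos
    by (intro add_pos_pos mult_pos_pos) auto
qed

lemma rescaled_slope_pos_if_canonical_sol_large:
  assumes J: "\<bar>noise_integral \<sigma> h \<epsilon> W t\<bar> \<le> J" and sol: "canonical_sol \<sigma> h \<epsilon> W \<mu> t \<ge> c" "c \<ge> 0"
    and slope: "\<bar>canonical_slope \<sigma> h \<epsilon> W \<mu> t\<bar> \<le> M" and small: "\<epsilon> * (exp J * M) < exp (- J) * c"
  shows "rescaled_slope \<sigma> h \<epsilon> W \<mu> t > 0"
proof -
  have "exp (- J) * c \<le> exp (noise_integral \<sigma> h \<epsilon> W t) * canonical_sol \<sigma> h \<epsilon> W \<mu> t"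
    using sol J by (intro mult_mono) auto
  moreover have "\<bar>\<epsilon> * (exp (- noise_integral \<sigma> h \<epsilon> W t) * canonical_slope \<sigma> h \<epsilon> W \<mu> t)\<bar>
      \<le> \<epsilon> * (exp J * M)"
    unfolding abs_mult using eps_pos J slope by (intro mult_mono) auto
  ultimately show ?thesis unfolding rescaled_slope_def rescaled_sol_def using small by linarith
qed

end

context rescaled_string_limit
begin

lemma rescaled_log_ratio_ge:
  assumes pos: "rescaled_sol \<sigma> h (\<epsilon> n) W \<mu> T > 0" "rescaled_slope \<sigma> h (\<epsilon> n) W \<mu> T > 0"
    and r: "r = exp (- 2 * noise_integral \<sigma> h (\<epsilon> n) W T)
        * canonical_slope \<sigma> h (\<epsilon> n) W \<mu> T / canonical_sol \<sigma> h (\<epsilon> n) W \<mu> T"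
  shows "rescaled_log_ratio \<sigma> h (\<epsilon> n) W \<mu> T \<ge> \<sigma> * W T - h * \<epsilon> n * T + r / (1 + \<epsilon> n * r)"
proof -
  let ?J = "noise_integral \<sigma> h (\<epsilon> n) W T" and ?p = "canonical_sol \<sigma> h (\<epsilon> n) W \<mu> T"
  have p_pos: "?p > 0" using pos(1) unfolding rescaled_sol_def by (simp add: zero_less_mult_iff)
  have exp_J: "exp (- ?J) = exp ?J * exp (- 2 * ?J)" by (subst exp_add[symmetric]) simp
  have ratio: "rescaled_slope \<sigma> h (\<epsilon> n) W \<mu> T / rescaled_sol \<sigma> h (\<epsilon> n) W \<mu> T = 1 + \<epsilon> n * r"
    unfolding rescaled_slope_def rescaled_sol_def r exp_J using p_pos by (simp add: field_simps)
  then have ratio_pos: "1 + \<epsilon> n * r > 0" using pos by (metis divide_pos_pos)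
  have "\<epsilon> n * r / (1 + \<epsilon> n * r) = - (1 / (1 + \<epsilon> n * r) - 1)" using ratio_pos by (simp add: field_simps)
  also have "\<dots> \<le> - ln (1 / (1 + \<epsilon> n * r))"
    using ln_le_minus_one[of "1 / (1 + \<epsilon> n * r)"] ratio_pos by simp
  also have "\<dots> = ln (1 + \<epsilon> n * r)" using ratio_pos by (simp add: ln_div)
  finally have "(\<epsilon> n * r / (1 + \<epsilon> n * r)) / \<epsilon> n \<le> ln (1 + \<epsilon> n * r) / \<epsilon> n"
    using eps_pos[of n] by (intro divide_right_mono) auto
  then show ?thesis unfolding rescaled_log_ratio_def ratio using eps_pos[of n] by simp
qed

lemma eventually_canonical_slope_pos_near_0:
  assumes "T > 0"
  obtains d where "0 < d" "d \<le> T"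
    "\<forall>\<^sub>F n in sequentially. \<forall>x. 0 < x \<and> x \<le> d \<longrightarrow> canonical_slope \<sigma> h (\<epsilon> n) W \<mu> x > 0"
proof -
  obtain d0 where d0: "d0 > 0"
    "\<And>x. 0 < x \<Longrightarrow> x \<le> d0 \<Longrightarrow> riccati_sol \<sigma> W \<mu> x > 0 \<and> riccati_slope \<sigma> W \<mu> x > 1/2"
    unfolding riccati_sol_def riccati_slope_def
    by (rule string_sol_slope_pos_near_0[OF cont_riccati_scale[OF cont_W, of \<sigma>]
        cont_riccati_potential[OF cont_W, of \<sigma> \<mu>]
          riccati_scale_pos]) auto
  define d where "d = min d0 T"
  have "\<forall>\<^sub>F n in sequentially. \<forall>t\<in>{0..d}. dist (canonical_slope \<sigma> h (\<epsilon> n) W \<mu> t)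
      (riccati_slope \<sigma> W \<mu> t) < 1/2"
    by (rule uniform_limitD[OF canonical_slope_uniform_limit]) (use d0 \<open>T > 0\<close> in \<open>auto simp: d_def\<close>)
  then have "\<forall>\<^sub>F n in sequentially. \<forall>x. 0 < x \<and> x \<le> d \<longrightarrow> canonical_slope \<sigma> h (\<epsilon> n) W \<mu> x > 0"
  proof eventually_elim
    case (elim n)
    show ?case
    proof (intro allI impI)
      fix x assume x: "0 < x \<and> x \<le> d"
      then have "dist (canonical_slope \<sigma> h (\<epsilon> n) W \<mu> x) (riccati_slope \<sigma> W \<mu> x) < 1/2"
        using elim by auto
      moreover have "riccati_slope \<sigma> W \<mu> x > 1/2" using d0(2)[of x] x by (simp add: d_def)
      ultimately show "canonical_slope \<sigma> h (\<epsilon> n) W \<mu> x > 0" unfolding dist_real_def by linarith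
    qed
  qed
  then show ?thesis by (rule that[rotated 2]) (use d0(1) \<open>T > 0\<close> in \<open>auto simp: d_def\<close>)
qed

context
  assumes sol_pos: "\<And>t. t > 0 \<Longrightarrow> riccati_sol \<sigma> W \<mu> t > 0"
begin

lemma eventually_canonical_bounds:
  assumes "0 < d" "d \<le> T"
  obtains c M where "c > 0" "\<forall>\<^sub>F n in sequentially. \<forall>t\<in>{d..T}. canonical_sol \<sigma> h (\<epsilon> n) W \<mu> t \<ge> c"
    "\<forall>\<^sub>F n in sequentially. \<forall>t\<in>{d..T}. \<bar>canonical_slope \<sigma> h (\<epsilon> n) W \<mu> t\<bar> \<le> M"
proof -
  have "continuous_on {d..T} (riccati_sol \<sigma> W \<mu>)"
    by (rule continuous_on_subset[OF cont_riccati_sol[OF cont_W]]) (use assms in auto)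
  then obtain x0 where x0: "x0 \<in> {d..T}" "\<And>y. y \<in> {d..T} \<Longrightarrow> riccati_sol \<sigma> W \<mu> x0 \<le> riccati_sol \<sigma> W \<mu> y"
    using continuous_attains_inf[of "{d..T}" "riccati_sol \<sigma> W \<mu>"] assms by auto
  define c where "c = riccati_sol \<sigma> W \<mu> x0 / 2"
  have c: "c > 0" using sol_pos[of x0] x0(1) assms by (simp add: c_def)
  obtain M where M: "M > 0" "\<And>t. 0 \<le> t \<Longrightarrow> t \<le> T \<Longrightarrow> \<bar>riccati_slope \<sigma> W \<mu> t\<bar> \<le> M"
    by (rule continuous_on_atLeast_bounded_Icc[OF cont_riccati_slope[OF cont_W]]) auto
  have "\<forall>\<^sub>F n in sequentially. \<forall>t\<in>{0..T}. dist (canonical_sol \<sigma> h (\<epsilon> n) W \<mu> t) (riccati_sol \<sigma> W \<mu> t) < c"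
    by (rule uniform_limitD[OF canonical_sol_uniform_limit c]) (use assms in simp)
  then have "\<forall>\<^sub>F n in sequentially. \<forall>t\<in>{d..T}. canonical_sol \<sigma> h (\<epsilon> n) W \<mu> t \<ge> c"
  proof eventually_elim
    case (elim n)
    show ?case
    proof
      fix t assume t: "t \<in> {d..T}"
      then have "dist (canonical_sol \<sigma> h (\<epsilon> n) W \<mu> t) (riccati_sol \<sigma> W \<mu> t) < c"
        using elim assms by auto
      then show "canonical_sol \<sigma> h (\<epsilon> n) W \<mu> t \<ge> c" using x0(2)[OF t] unfolding dist_real_def c_def
        by linarith
    qed
  qed
  moreover have "\<forall>\<^sub>F n in sequentially. \<forall>t\<in>{0..T}. dist (canonical_slope \<sigma> h (\<epsilon> n) W \<mu> t)
      (riccati_slope \<sigma> W \<mu> t) < 1"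
    by (rule uniform_limitD[OF canonical_slope_uniform_limit]) (use assms in auto)
  then have "\<forall>\<^sub>F n in sequentially. \<forall>t\<in>{d..T}. \<bar>canonical_slope \<sigma> h (\<epsilon> n) W \<mu> t\<bar> \<le> M + 1"
  proof eventually_elim
    case (elim n)
    show ?case
    proof
      fix t assume t: "t \<in> {d..T}"
      then have "dist (canonical_slope \<sigma> h (\<epsilon> n) W \<mu> t) (riccati_slope \<sigma> W \<mu> t) < 1"
        using elim assms by auto
      then show "\<bar>canonical_slope \<sigma> h (\<epsilon> n) W \<mu> t\<bar> \<le> M + 1" using M(2)[of t] t assms
        unfolding dist_real_def by simp
    qed
  qed
  ultimately show ?thesis using that c by blast
qed

lemma eventually_rescaled_slope_pos_on_compact:
  assumes T: "T > 0"
  shows "\<forall>\<^sub>F n in sequentially. (\<forall>t\<in>{0..T}. rescaled_slope \<sigma> h (\<epsilon> n) W \<mu> t > 0)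
      \<and> rescaled_sol \<sigma> h (\<epsilon> n) W \<mu> T > 0"
proof -
  obtain d where d: "0 < d" "d \<le> T"
    and slope_pos: "\<forall>\<^sub>F n in sequentially. \<forall>x. 0 < x \<and> x \<le> d \<longrightarrow> canonical_slope \<sigma> h (\<epsilon> n) W \<mu> x > 0"
    by (rule eventually_canonical_slope_pos_near_0[OF T])
  obtain c M where c: "c > 0"
    and sol_ge: "\<forall>\<^sub>F n in sequentially. \<forall>t\<in>{d..T}. canonical_sol \<sigma> h (\<epsilon> n) W \<mu> t \<ge> c"
    and slope_le: "\<forall>\<^sub>F n in sequentially. \<forall>t\<in>{d..T}. \<bar>canonical_slope \<sigma> h (\<epsilon> n) W \<mu> t\<bar> \<le> M"
    by (rule eventually_canonical_bounds[OF d])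
  obtain J where J: "J > 0" "\<And>n t. 0 \<le> t \<Longrightarrow> t \<le> T \<Longrightarrow> \<bar>noise_integral \<sigma> h (\<epsilon> n) W t\<bar> \<le> J"
    by (rule noise_integral_bounded) auto
  have "(\<lambda>n. \<epsilon> n * (exp J * M)) \<longlonglongrightarrow> 0" by (intro tendsto_mult_left_zero eps_tendsto)
  then have "\<forall>\<^sub>F n in sequentially. \<epsilon> n * (exp J * M) < exp (- J) * c"
    by (rule order_tendstoD) (use c in simp)
  then show ?thesis using slope_pos sol_ge slope_le
  proof eventually_elim
    case (elim n)
    have "rescaled_slope \<sigma> h (\<epsilon> n) W \<mu> t > 0" if t: "t \<in> {0..T}" for t
    proof -
      consider "t = 0" | "0 < t" "t \<le> d" | "d \<le> t" using t by fastforce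
      then show ?thesis
      proof cases
        case 1
        then show ?thesis using rescaled_slope_0 eps_pos by simp
      next
        case 2
        then show ?thesis using elim(2) by (intro rescaled_slope_pos_if_canonical_slope_pos) auto
      next
        case 3
        then show ?thesis
          using elim(1,3,4) t c
          by (intro rescaled_slope_pos_if_canonical_sol_large[OF J(2), where c=c and M=M]) auto
      qed
    qed
    moreover have "canonical_sol \<sigma> h (\<epsilon> n) W \<mu> T > 0" using elim(3) d c by force
    ultimately show ?case by (simp add: rescaled_sol_def)
  qed
qed

lemma eventually_rescaled_log_ratio_ge:
  assumes T: "T > 0" and nonneg: "\<sigma> * W T + riccati_log_deriv \<sigma> W \<mu> T \<ge> 0"
  shows "\<forall>\<^sub>F n in sequentially. rescaled_log_ratio \<sigma> h (\<epsilon> n) W \<mu> T \<ge> -1"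
proof -
  define r where "r n = exp (- 2 * noise_integral \<sigma> h (\<epsilon> n) W T)
      * canonical_slope \<sigma> h (\<epsilon> n) W \<mu> T / canonical_sol \<sigma> h (\<epsilon> n) W \<mu> T" for n
  have "r \<longlonglongrightarrow> exp (- 2 * (\<sigma> * integral {0..T} W)) * riccati_slope \<sigma> W \<mu> T / riccati_sol \<sigma> W \<mu> T"
    unfolding r_def[abs_def] using sol_pos[OF T] T
    by (intro tendsto_intros canonical_sol_tendsto canonical_slope_tendsto noise_integral_tendsto) auto
  then have r: "r \<longlonglongrightarrow> riccati_log_deriv \<sigma> W \<mu> T"
    by (simp add: riccati_log_deriv_def riccati_scale_def mult.assoc)
  have "(\<lambda>n. \<sigma> * W T - h * \<epsilon> n * T + r n / (1 + \<epsilon> n * r n)) \<longlonglongrightarrow>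
      \<sigma> * W T - h * 0 * T + riccati_log_deriv \<sigma> W \<mu> T / (1 + 0 * riccati_log_deriv \<sigma> W \<mu> T)"
    by (intro tendsto_intros eps_tendsto r) auto
  then have "\<forall>\<^sub>F n in sequentially. -1 < \<sigma> * W T - h * \<epsilon> n * T + r n / (1 + \<epsilon> n * r n)"
    by (rule order_tendstoD) (use nonneg in simp)
  then show ?thesis using eventually_rescaled_slope_pos_on_compact[OF T]
  proof eventually_elim
    case (elim n)
    then have "rescaled_slope \<sigma> h (\<epsilon> n) W \<mu> T > 0" using T by auto
    then show ?case using rescaled_log_ratio_ge[OF _ _ r_def[of n]] elim by fastforce
  qed
qed

end

lemma eventually_eps_small:
  shows "\<forall>\<^sub>F n in sequentially. c / \<epsilon> n + h * \<epsilon> n \<le> 1 / (20 * (\<epsilon> n)\<^sup>2)"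
    and "\<forall>\<^sub>F n in sequentially. \<bar>\<mu>\<bar> * (\<epsilon> n)\<^sup>2 \<le> 1/10"
proof -
  have "(\<lambda>n. c * \<epsilon> n + h * (\<epsilon> n)^3) \<longlonglongrightarrow> c * 0 + h * 0^3" by (intro tendsto_intros eps_tendsto)
  then have "\<forall>\<^sub>F n in sequentially. c * \<epsilon> n + h * (\<epsilon> n)^3 < 1/20" by (rule order_tendstoD) simp
  then show "\<forall>\<^sub>F n in sequentially. c / \<epsilon> n + h * \<epsilon> n \<le> 1 / (20 * (\<epsilon> n)\<^sup>2)"
  proof eventually_elim
    case (elim n)
    then have "(c * \<epsilon> n + h * (\<epsilon> n)^3) / (\<epsilon> n)\<^sup>2 \<le> (1/20) / (\<epsilon> n)\<^sup>2" by (intro divide_right_mono) auto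
    then show ?case using eps_pos[of n]
      by (simp add: add_divide_distrib power2_eq_square power3_eq_cube)
  qed
  have "(\<lambda>n. \<bar>\<mu>\<bar> * (\<epsilon> n)\<^sup>2) \<longlonglongrightarrow> \<bar>\<mu>\<bar> * 0\<^sup>2" by (intro tendsto_intros eps_tendsto)
  then have "\<forall>\<^sub>F n in sequentially. \<bar>\<mu>\<bar> * (\<epsilon> n)\<^sup>2 < 1/10" by (rule order_tendstoD) simp
  then show "\<forall>\<^sub>F n in sequentially. \<bar>\<mu>\<bar> * (\<epsilon> n)\<^sup>2 \<le> 1/10" by eventually_elim simp
qed

theorem eventually_rescaled_slope_positive:
  assumes \<sigma>: "\<sigma> \<ge> 0" and h: "h \<ge> 0" and growth: "path_growth C W" and less: "\<mu>' < \<mu>"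
    and sol'_pos: "\<And>t. t > 0 \<Longrightarrow> riccati_sol \<sigma> W \<mu>' t > 0"
  shows "\<forall>\<^sub>F n in sequentially. rescaled_slope_positive \<sigma> h (\<epsilon> n) W \<mu>"
proof -
  define C' where "C' = \<sigma> * C"
  have growth': "path_growth C' (\<lambda>t. \<sigma> * W t)" unfolding C'_def by (rule path_growth_mult[OF growth \<sigma>])
  have sol_pos: "riccati_sol \<sigma> W \<mu> t > 0" if "t > 0" for t
    by (rule riccati_sol_pos_mono[OF cont_W less sol'_pos that])
  obtain T where T_ge: "T \<ge> max ((40 * C' + 20 * h + 8) ^ 4) (40 * \<bar>\<mu>\<bar> + 17)"
    and nonneg: "\<sigma> * W T + riccati_log_deriv \<sigma> W \<mu> T \<ge> 0"
    using riccati_nonneg_again[OF cont_W less sol'_pos] by blast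
  then have T: "T > 0" "T > 16" "40 * \<bar>\<mu>\<bar> \<le> T" "(40 * C' + 20 * h + 8) ^ 4 \<le> T" by auto
  have compact: "\<forall>\<^sub>F n in sequentially. (\<forall>t\<in>{0..T}. rescaled_slope \<sigma> h (\<epsilon> n) W \<mu> t > 0)
      \<and> rescaled_sol \<sigma> h (\<epsilon> n) W \<mu> T > 0"
    by (rule eventually_rescaled_slope_pos_on_compact[OF _ T(1)]) (rule sol_pos)
  have start: "\<forall>\<^sub>F n in sequentially. rescaled_log_ratio \<sigma> h (\<epsilon> n) W \<mu> T \<ge> -1"
    by (rule eventually_rescaled_log_ratio_ge[OF _ T(1) nonneg]) (rule sol_pos)
  show ?thesis
    using eventually_eps_small(1)[of "2 * C' * (16 * C' + 8)"] eventually_eps_small(2) compact start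
  proof eventually_elim
    case (elim n)
    have "rescaled_slope \<sigma> h (\<epsilon> n) W \<mu> t > 0" if "t \<ge> T" for t
    proof (rule rescaled_slope_pos_beyond[OF T(2) _ _ elim(4) _ _ that])
      show "drift_floor (\<epsilon> n) t / 5 \<le> rescaled_drift (\<epsilon> n) \<mu> t q"
        if "t \<ge> T" "- barrier (\<epsilon> n) t \<le> q" "q \<le> 0" for t q
        using that T elim(2) by (intro drift_lower_bound eps_pos) auto
      show "\<sigma> * W s - h * \<epsilon> n * s - (\<sigma> * W t - h * \<epsilon> n * t)
          < barrier (\<epsilon> n) t - 1 + drift_floor (\<epsilon> n) t / 20 * (t - s)"
        if "T \<le> s" "s \<le> t" for s t
        using that T by (intro noise_growth_dominated[OF growth' h eps_pos eps_le_1 _ _ _ elim(1)]) auto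
    qed (use elim(3) T in auto)
    then show ?case unfolding rescaled_slope_positive_def using elim(3)
      by (metis atLeastAtMost_iff linear)
  qed
qed

end

section \<open>Growth of Brownian paths\<close>

lemma
  assumes "is_std_BM M b"
  shows BM_prob_space: "prob_space M"
    and BM_measurable: "t \<ge> 0 \<Longrightarrow> (\<lambda>w. b w t) \<in> borel_measurable M"
    and BM_0: "w \<in> space M \<Longrightarrow> b w 0 = 0"
    and BM_continuous: "w \<in> space M \<Longrightarrow> continuous_on {0..} (b w)"
    and BM_increment_distributed: "0 \<le> s \<Longrightarrow> s < t \<Longrightarrow>
      distributed M lborel (\<lambda>w. b w t - b w s) (\<lambda>x. ennreal (normal_density 0 (sqrt (t - s)) x))"
    and BM_indep_increments: "0 \<le> ts 0 \<Longrightarrow> (\<And>i. i < n \<Longrightarrow> ts i < ts (Suc i)) \<Longrightarrow>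
      prob_space.indep_vars M (\<lambda>_. borel) (\<lambda>i w. b w (ts (Suc i)) - b w (ts i)) {..<n}"
  using assms unfolding is_std_BM_def by simp_all

lemma cont_process_BM:
  assumes "is_std_BM M b"
  shows "cont_process M b"
  unfolding cont_process_def using BM_measurable[OF assms] BM_continuous[OF assms] by auto

lemma BM_increment_moment8:
  assumes b: "is_std_BM M b" and st: "0 \<le> s" "s < t"
  shows "(\<integral>\<^sup>+w. ennreal ((b w t - b w s) ^ 8) \<partial>M) = ennreal (105 * (t - s) ^ 4)"
proof -
  let ?s = "sqrt (t - s)"
  have moment: "has_bochner_integral lborel (\<lambda>x. normal_density 0 ?s x * (x - 0) ^ (2 * 4))
      (fact (2 * 4) / ((2 / ?s\<^sup>2) ^ 4 * fact 4))"
    by (rule normal_moment_even) (use st in simp)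
  have "(\<integral>\<^sup>+w. ennreal ((b w t - b w s) ^ 8) \<partial>M)
      = (\<integral>\<^sup>+x. ennreal (normal_density 0 ?s x) * ennreal (x ^ 8) \<partial>lborel)"
    by (rule distributed_nn_integral[OF BM_increment_distributed[OF b st], symmetric]) measurable
  also have "\<dots> = (\<integral>\<^sup>+x. ennreal (normal_density 0 ?s x * x ^ 8) \<partial>lborel)"
    by (intro nn_integral_cong) (simp add: ennreal_mult)
  also have "\<dots> = ennreal (LINT x|lborel. normal_density 0 ?s x * x ^ 8)"
    by (rule nn_integral_eq_integral) (use integrable.intros[OF moment] in auto)
  also have "(LINT x|lborel. normal_density 0 ?s x * x ^ 8) = fact (2 * 4) / ((2 / ?s\<^sup>2) ^ 4 * fact 4)"
    using has_bochner_integral_integral_eq[OF moment] by simp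
  also have "\<dots> = 105 * (t - s) ^ 4" using st by (simp add: fact_numeral power_divide)
  finally show ?thesis .
qed

definition dyadic_increment :: "(real \<Rightarrow> real) \<Rightarrow> real \<Rightarrow> nat \<Rightarrow> nat \<Rightarrow> real" where
  "dyadic_increment W a k j = W (a + real (Suc j) / 2 ^ k) - W (a + real j / 2 ^ k)"

lemma dyadic_point_increment_le:
  fixes W :: "real \<Rightarrow> real"
  assumes c: "c \<ge> 0" "\<rho> \<ge> 0"
    and inc: "\<And>k j. j < 2 ^ k \<Longrightarrow> \<bar>dyadic_increment W a k j\<bar> \<le> c * \<rho> ^ k"
    and "i \<le> 2 ^ k"
  shows "\<bar>W (a + real i / 2 ^ k) - W a\<bar> \<le> c * (\<Sum>l\<le>k. \<rho> ^ l)"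
  using \<open>i \<le> 2 ^ k\<close>
proof (induction k arbitrary: i)
  case 0
  then consider "i = 0" | "i = 1" by fastforce
  then show ?case using inc[of 0 0] c by cases (auto simp: dyadic_increment_def)
next
  case (Suc k)
  define i' where "i' = i div 2"
  have IH: "\<bar>W (a + real i' / 2 ^ k) - W a\<bar> \<le> c * (\<Sum>l\<le>k. \<rho> ^ l)"
    by (rule Suc.IH) (use Suc.prems in \<open>simp add: i'_def\<close>)
  have half: "real (2 * i') / 2 ^ Suc k = real i' / 2 ^ k" by simp
  have sum: "c * (\<Sum>l\<le>Suc k. \<rho> ^ l) = c * (\<Sum>l\<le>k. \<rho> ^ l) + c * \<rho> ^ Suc k" by (simp add: distrib_left)
  show ?case
  proof (cases "even i")
    case True
    then have "i = 2 * i'" by (simp add: i'_def)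
    moreover have "c * \<rho> ^ Suc k \<ge> 0" using c by simp
    ultimately show ?thesis using IH half sum by simp
  next
    case False
    then have i: "i = Suc (2 * i')" by (simp add: i'_def)
    then have "2 * i' < 2 ^ Suc k" using Suc.prems by simp
    from inc[OF this, unfolded dyadic_increment_def] have "\<bar>W (a + real i / 2 ^ Suc k)
        - W (a + real i' / 2 ^ k)\<bar> \<le> c * \<rho> ^ Suc k"
      unfolding half i .
    then show ?thesis using IH sum by linarith
  qed
qed

lemma dyadic_chaining:
  fixes W :: "real \<Rightarrow> real"
  assumes cont_W: "continuous_on {a..} W" and \<rho>: "0 \<le> \<rho>" "\<rho> < 1" and c: "c \<ge> 0"
    and inc: "\<And>k j. j < 2 ^ k \<Longrightarrow> \<bar>dyadic_increment W a k j\<bar> \<le> c * \<rho> ^ k"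
    and x: "a \<le> x" "x \<le> a + 1"
  shows "\<bar>W x - W a\<bar> \<le> c / (1 - \<rho>)"
proof -
  define i where "i k = nat \<lfloor>2 ^ k * (x - a)\<rfloor>" for k
  have i: "real (i k) = of_int \<lfloor>2 ^ k * (x - a)\<rfloor>" for k using x by (simp add: i_def)
  have "filterlim (\<lambda>k. 2 ^ k :: real) at_top sequentially" by real_asymp
  from tendsto_add[OF tendsto_const floor_mult_div_tendsto[OF this, of "x - a"], of a]
  have "(\<lambda>k. a + real (i k) / 2 ^ k) \<longlonglongrightarrow> x" unfolding i by simp
  then have "(\<lambda>k. W (a + real (i k) / 2 ^ k)) \<longlonglongrightarrow> W x"
    by (rule continuous_on_tendsto_compose[OF cont_W]) (use x in auto)
  then have "(\<lambda>k. \<bar>W (a + real (i k) / 2 ^ k) - W a\<bar>) \<longlonglongrightarrow> \<bar>W x - W a\<bar>" by (intro tendsto_intros)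
  moreover have "\<bar>W (a + real (i k) / 2 ^ k) - W a\<bar> \<le> c / (1 - \<rho>)" for k
  proof -
    have "2 ^ k * (x - a) \<le> 2 ^ k * 1" using x by (intro mult_left_mono) auto
    then have "real (i k) \<le> 2 ^ k" unfolding i by linarith
    then have "real (i k) \<le> real (2 ^ k)" by simp
    then have "i k \<le> 2 ^ k" by (simp only: of_nat_le_iff)
    then have "\<bar>W (a + real (i k) / 2 ^ k) - W a\<bar> \<le> c * (\<Sum>l\<le>k. \<rho> ^ l)"
      by (intro dyadic_point_increment_le c \<rho>(1) inc)
    also have "(\<Sum>l\<le>k. \<rho> ^ l) \<le> (\<Sum>l. \<rho> ^ l)"
      by (rule sum_le_suminf) (use \<rho> in \<open>auto intro!: summable_geometric\<close>)
    then have "c * (\<Sum>l\<le>k. \<rho> ^ l) \<le> c * (\<Sum>l. \<rho> ^ l)" using c by (rule mult_left_mono)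
    also have "\<dots> = c / (1 - \<rho>)" using \<rho> by (simp add: suminf_geometric)
    finally show ?thesis .
  qed
  ultimately show ?thesis by (intro LIMSEQ_le_const2) auto
qed

lemma increment_le_if_unit_oscillation:
  fixes W :: "real \<Rightarrow> real"
  assumes osc: "\<And>n x. real n \<le> x \<Longrightarrow> x \<le> real n + 1 \<Longrightarrow> real n \<le> t \<Longrightarrow> \<bar>W x - W (real n)\<bar> \<le> K"
    and "0 \<le> s" "s \<le> t"
  shows "\<bar>W t - W s\<bar> \<le> (t - s + 3) * K"
proof -
  define n m where "n = nat \<lfloor>s\<rfloor>" and "m = nat \<lfloor>t\<rfloor>"
  have n: "real n \<le> s" "s \<le> real n + 1" and m: "real m \<le> t" "t \<le> real m + 1" using assms
    unfolding n_def m_def by linarith+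
  have "n \<le> m" unfolding n_def m_def using assms by (intro nat_mono floor_mono)
  have K: "K \<ge> 0" using osc[of 0 0] assms by simp
  have "W (real m) - W (real n) = (\<Sum>k=n..<m. W (real (Suc k)) - W (real k))"
    using sum_Suc_diff'[OF \<open>n \<le> m\<close>, of "\<lambda>k. W (real k)"] by simp
  then have "\<bar>W (real m) - W (real n)\<bar> \<le> (\<Sum>k=n..<m. \<bar>W (real (Suc k)) - W (real k)\<bar>)"
    by (simp only: sum_abs)
  also have "\<dots> \<le> real (card {n..<m}) * K"
    by (rule sum_bounded_above) (use m(1) in \<open>auto intro!: osc\<close>)
  finally have "\<bar>W (real m) - W (real n)\<bar> \<le> real (m - n) * K" by simp
  moreover have "\<bar>W t - W (real m)\<bar> \<le> K" by (rule osc[OF m m(1)])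
  moreover have "\<bar>W s - W (real n)\<bar> \<le> K" by (rule osc[OF n]) (use n assms in simp)
  ultimately have "\<bar>W t - W s\<bar> \<le> (real (m - n) + 2) * K" by (simp add: distrib_right)
  also have "\<dots> \<le> (t - s + 3) * K"
    using n m \<open>n \<le> m\<close> by (intro mult_right_mono[OF _ K]) (simp add: of_nat_diff)
  finally show ?thesis .
qed

lemma path_growth_if_unit_oscillation:
  fixes W :: "real \<Rightarrow> real"
  assumes c: "c \<ge> 0" and r: "r \<ge> 0"
    and osc: "\<And>n x. real n \<le> x \<Longrightarrow> x \<le> real n + 1 \<Longrightarrow> \<bar>W x - W (real n)\<bar> \<le> c * (real n + 1) powr (1/4)"
    and at_nat: "\<And>n. \<bar>W (real n)\<bar> \<le> r * (real n + 1) powr (3/4)"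
  shows "path_growth (r + 2 * c) W"
  unfolding path_growth_def
proof (intro conjI allI impI)
  show "0 \<le> r + 2 * c" using c r by simp
  fix t :: real assume t: "0 \<le> t"
  define n where "n = nat \<lfloor>t\<rfloor>"
  have n: "real n \<le> t" "t \<le> real n + 1" using t unfolding n_def by linarith+
  have "(real n + 1) powr (1/4) \<le> (real n + 1) powr (3/4)" by (intro powr_mono) auto
  moreover have "(real n + 1) powr (3/4) \<le> (1 + t) powr (3/4)" using n by (intro powr_mono2) auto
  ultimately have "c * (real n + 1) powr (1/4) + r * (real n + 1) powr (3/4)
      \<le> c * (1 + t) powr (3/4) + r * (1 + t) powr (3/4)"
    using c r by (intro add_mono mult_left_mono) auto
  then have "\<bar>W t\<bar> \<le> c * (1 + t) powr (3/4) + r * (1 + t) powr (3/4)" using osc[OF n] at_nat[of n]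
    by linarith
  also have "\<dots> \<le> (r + 2 * c) * (1 + t) powr (3/4)" using c by (simp add: distrib_right)
  finally show "\<bar>W t\<bar> \<le> (r + 2 * c) * (1 + t) powr (3/4)" .
next
  fix s t :: real assume s: "0 \<le> s" "s \<le> t"
  have "c * (real n + 1) powr (1/4) \<le> c * (1 + t) powr (1/4)" if "real n \<le> t" for n
    using that c by (intro mult_left_mono powr_mono2) auto
  then have "\<bar>W t - W s\<bar> \<le> (t - s + 3) * (c * (1 + t) powr (1/4))"
    using osc by (intro increment_le_if_unit_oscillation[OF _ s]) (meson order_trans)
  also have "\<dots> \<le> (2 * (t - s + 2)) * (c * (1 + t) powr (1/4))" using s c by (intro mult_right_mono) auto
  also have "\<dots> = (2 * c) * ((1 + t) powr (1/4) * (t - s + 2))" by simp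
  also have "\<dots> \<le> (r + 2 * c) * ((1 + t) powr (1/4) * (t - s + 2))" using r s
    by (intro mult_right_mono) auto
  finally show "\<bar>W t - W s\<bar> \<le> (r + 2 * c) * (1 + t) powr (1/4) * (t - s + 2)" by (simp only: mult.assoc)
qed

lemma abs_le_root_mult:
  fixes x y R :: real
  assumes "x ^ n \<le> R * y ^ n" "even n" "n > 0" "R \<ge> 0" "y \<ge> 0"
  shows "\<bar>x\<bar> \<le> root n R * y"
proof -
  have "\<bar>x\<bar> ^ n \<le> (root n R * y) ^ n"
    using assms by (simp add: power_even_abs power_mult_distrib real_root_pow_pos2)
  then have "\<bar>x\<bar> ^ Suc (n - 1) \<le> (root n R * y) ^ Suc (n - 1)" using assms by simp
  then show ?thesis by (rule power_le_imp_le_base) (use assms in simp)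
qed

lemma AE_ennreal_sequence_bounded:
  fixes F :: "nat \<Rightarrow> 'a \<Rightarrow> ennreal"
  assumes F: "\<And>n. F n \<in> borel_measurable M" and le: "\<And>n. (\<integral>\<^sup>+w. F n w \<partial>M) \<le> ennreal (c n)"
    and c: "\<And>n. c n \<ge> 0" "summable c"
  shows "AE w in M. \<exists>R\<ge>0. \<forall>n. F n w \<le> ennreal R"
proof -
  have "(\<integral>\<^sup>+w. (\<Sum>n. F n w) \<partial>M) = (\<Sum>n. \<integral>\<^sup>+w. F n w \<partial>M)" by (intro nn_integral_suminf F)
  also have "\<dots> \<le> (\<Sum>n. ennreal (c n))" by (intro suminf_le le summableI)
  also have "\<dots> < \<infinity>" unfolding infinity_ennreal_def less_top[symmetric]
    by (rule ennreal_suminf_neq_top[OF c(2,1)])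
  finally have "AE w in M. (\<Sum>n. F n w) \<noteq> \<infinity>"
    by (intro nn_integral_PInf_AE borel_measurable_suminf_order F) auto
  then show ?thesis
  proof eventually_elim
    case (elim w)
    have "F n w \<le> ennreal (enn2real (\<Sum>n. F n w))" for n
      using sum_le_suminf[of "\<lambda>n. F n w" "{n}"] elim by (simp add: less_top)
    then show ?case by (intro exI[of _ "enn2real (\<Sum>n. F n w)"]) simp
  qed
qed

lemma summable_inverse_square_Suc: "summable (\<lambda>n. c * (1 / (real n + 1)\<^sup>2))"
proof -
  have "summable (\<lambda>n. inverse (real (Suc n) ^ 2))"
    using inverse_power_summable[of 2, where 'a=real] by (subst summable_Suc_iff) simp
  then show ?thesis by (intro summable_mult) (simp add: inverse_eq_divide add.commute)
qed

context
  fixes M :: "'a measure" and b :: "'a \<Rightarrow> real \<Rightarrow> real"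
  assumes b: "is_std_BM M b"
begin

lemma BM_integer_measurable [measurable]: "(\<lambda>w. b w (real n)) \<in> borel_measurable M"
  by (rule BM_measurable[OF b]) simp

lemma BM_integer_moment8: "(\<integral>\<^sup>+w. ennreal (b w (real n) ^ 8) \<partial>M) = ennreal (105 * real n ^ 4)"
proof -
  have "(\<integral>\<^sup>+w. ennreal (b w (real n) ^ 8) \<partial>M) = (\<integral>\<^sup>+w. ennreal ((b w (real n) - b w 0) ^ 8) \<partial>M)"
    by (rule nn_integral_cong) (simp add: BM_0[OF b])
  then show ?thesis using BM_increment_moment8[OF b, of 0 "real n"] by (cases "n = 0") simp_all
qed

lemma BM_integer_weighted_moment8_le:
  "(\<integral>\<^sup>+w. ennreal (1 / (real n + 1) ^ 6) * ennreal (b w (real n) ^ 8) \<partial>M)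
      \<le> ennreal (105 * (1 / (real n + 1)\<^sup>2))"
proof -
  have "real n ^ 4 \<le> (real n + 1) ^ 4" by (intro power_mono) auto
  then have "real n ^ 4 / (real n + 1) ^ 6 \<le> (real n + 1) ^ 4 / (real n + 1) ^ 6"
    by (intro divide_right_mono) auto
  also have "\<dots> = 1 / (real n + 1)\<^sup>2" by (simp add: divide_simps)
  finally have "1 / (real n + 1) ^ 6 * (105 * real n ^ 4) \<le> 105 * (1 / (real n + 1)\<^sup>2)" by simp
  then have "ennreal (1 / (real n + 1) ^ 6) * ennreal (105 * real n ^ 4)
      \<le> ennreal (105 * (1 / (real n + 1)\<^sup>2))"
    by (subst ennreal_mult[symmetric]) (auto intro: ennreal_leI)
  moreover have "(\<integral>\<^sup>+w. ennreal (1 / (real n + 1) ^ 6) * ennreal (b w (real n) ^ 8) \<partial>M)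
      = ennreal (1 / (real n + 1) ^ 6) * ennreal (105 * real n ^ 4)"
    unfolding BM_integer_moment8[symmetric] by (rule nn_integral_cmult) measurable
  ultimately show ?thesis by simp
qed

lemma AE_BM_integer_growth: "AE w in M. \<exists>r\<ge>0. \<forall>n. \<bar>b w (real n)\<bar> \<le> r * (real n + 1) powr (3/4)"
proof -
  have meas: "(\<lambda>w. ennreal (1 / (real n + 1) ^ 6) * ennreal (b w (real n) ^ 8))
      \<in> borel_measurable M" for n
    by measurable
  have "AE w in M. \<exists>R\<ge>0. \<forall>n. ennreal (1 / (real n + 1) ^ 6) * ennreal (b w (real n) ^ 8) \<le> ennreal R"
    by (rule AE_ennreal_sequence_bounded[OF meas BM_integer_weighted_moment8_le _
          summable_inverse_square_Suc]) simp
  then show ?thesis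
  proof eventually_elim
    case (elim w)
    then obtain R where R: "R \<ge> 0"
      "\<And>n. ennreal (1 / (real n + 1) ^ 6) * ennreal (b w (real n) ^ 8) \<le> ennreal R" by blast
    have "b w (real n) ^ 8 \<le> R * ((real n + 1) powr (3/4)) ^ 8" for n
    proof -
      have "1 / (real n + 1) ^ 6 * b w (real n) ^ 8 \<le> R" using R(2)[of n] R(1)
        by (simp add: ennreal_mult[symmetric])
      then have "b w (real n) ^ 8 \<le> R * (real n + 1) ^ 6" by (simp add: field_simps)
      then show ?thesis by (simp add: powr_power)
    qed
    then have "\<bar>b w (real n)\<bar> \<le> root 8 R * (real n + 1) powr (3/4)" for n
      by (rule abs_le_root_mult) (use R in auto)
    then show ?case using R(1) by (intro exI[of _ "root 8 R"]) simp
  qed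
qed

lemma dyadic_increment_measurable [measurable]:
  "(\<lambda>w. dyadic_increment (b w) (real n) k j) \<in> borel_measurable M"
  unfolding dyadic_increment_def[abs_def] by (intro borel_measurable_diff BM_measurable[OF b]) auto

lemma nn_integral_dyadic_increment:
  "(\<integral>\<^sup>+w. ennreal (4 ^ k * dyadic_increment (b w) (real n) k j ^ 8) \<partial>M) = ennreal (105 * (1 / 4) ^ k)"
proof -
  have step: "real n + real (Suc j) / 2 ^ k - (real n + real j / 2 ^ k) = 1 / 2 ^ k"
    by (simp add: add_divide_distrib)
  have "(\<integral>\<^sup>+w. ennreal (4 ^ k * dyadic_increment (b w) (real n) k j ^ 8) \<partial>M)
      = ennreal (4 ^ k) * (\<integral>\<^sup>+w. ennreal (dyadic_increment (b w) (real n) k j ^ 8) \<partial>M)"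
    by (subst nn_integral_cmult[symmetric]) (measurable, simp add: ennreal_mult)
  also have "(\<integral>\<^sup>+w. ennreal (dyadic_increment (b w) (real n) k j ^ 8) \<partial>M)
      = ennreal (105 * (1 / 2 ^ k) ^ 4)"
    unfolding dyadic_increment_def step[symmetric]
    by (rule BM_increment_moment8[OF b]) (auto simp: divide_strict_right_mono)
  also have "ennreal (4 ^ k) * ennreal (105 * (1 / 2 ^ k) ^ 4)
      = ennreal (4 ^ k * (105 * (1 / 2 ^ k) ^ 4))"
    by (rule ennreal_mult[symmetric]) auto
  also have "(4::real) ^ k * (105 * (1 / 2 ^ k) ^ 4) = 105 * (1 / 4) ^ k"
  proof -
    have "(1 / 2 ^ k) ^ 4 = ((1 / 2 :: real) ^ 4) ^ k"
      by (simp only: power_one_over[symmetric] power_mult[symmetric] mult.commute)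
    also have "(1 / 2 :: real) ^ 4 = 1 / 16" by (simp add: power4_eq_xxxx)
    finally have "(4::real) ^ k * (1 / 2 ^ k) ^ 4 = (4 * (1 / 16)) ^ k"
      by (simp only: power_mult_distrib)
    then show ?thesis by simp
  qed
  finally show ?thesis .
qed

lemma nn_integral_dyadic_increments:
  "(\<integral>\<^sup>+w. (\<Sum>k. \<Sum>j<(2::nat)^k. ennreal (4 ^ k * dyadic_increment (b w) (real n) k j ^ 8)) \<partial>M)
      = ennreal 210"
proof -
  have "(\<integral>\<^sup>+w. (\<Sum>k. \<Sum>j<(2::nat)^k. ennreal (4 ^ k * dyadic_increment (b w) (real n) k j ^ 8)) \<partial>M)
      = (\<Sum>k. \<Sum>j<(2::nat)^k. ennreal (105 * (1 / 4) ^ k))"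
    by (simp add: nn_integral_suminf nn_integral_sum nn_integral_dyadic_increment
        del: sum_ennreal sum_constant)
  also have "\<dots> = (\<Sum>k. ennreal (105 * (1 / 2) ^ k))"
  proof (rule suminf_cong)
    fix k :: nat
    have "(2::real) ^ k * (1 / 4) ^ k = (1 / 2) ^ k" unfolding power_mult_distrib[symmetric] by simp
    then have "(\<Sum>j<(2::nat)^k. 105 * (1 / 4 :: real) ^ k) = 105 * (1 / 2) ^ k" by simp
    then show "(\<Sum>j<(2::nat)^k. ennreal (105 * (1 / 4) ^ k)) = ennreal (105 * (1 / 2) ^ k)"
      by (subst sum_ennreal) auto
  qed
  also have "\<dots> = ennreal 210"
  proof (rule suminf_ennreal_eq)
    have "(\<lambda>k. (1/2::real) ^ k) sums (1 / (1 - 1/2))" by (rule geometric_sums) simp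
    from sums_mult[OF this, of 105] show "(\<lambda>k. 105 * (1/2::real) ^ k) sums 210" by simp
  qed simp
  finally show ?thesis .
qed

lemma AE_BM_dyadic_growth:
  "AE w in M. \<exists>r\<ge>0. \<forall>n k. \<forall>j<2 ^ k. \<bar>dyadic_increment (b w) (real n) k j\<bar>
      \<le> r * (real n + 1) powr (1/4) * (2 powr (-1/4)) ^ k"
proof -
  let ?E = "\<lambda>n w. \<Sum>k. \<Sum>j<(2::nat)^k. ennreal (4 ^ k * dyadic_increment (b w) (real n) k j ^ 8)"
  have meas: "(\<lambda>w. ennreal (1 / (real n + 1)\<^sup>2) * ?E n w) \<in> borel_measurable M" for n by measurable
  have bound: "(\<integral>\<^sup>+w. ennreal (1 / (real n + 1)\<^sup>2) * ?E n w \<partial>M) \<le> ennreal (210 * (1 / (real n + 1)\<^sup>2))"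
    for n
    by (subst nn_integral_cmult) (measurable, simp only: nn_integral_dyadic_increments, subst
        ennreal_mult[symmetric], auto)
  have "AE w in M. \<exists>R\<ge>0. \<forall>n. ennreal (1 / (real n + 1)\<^sup>2) * ?E n w \<le> ennreal R"
    by (rule AE_ennreal_sequence_bounded[OF meas bound _ summable_inverse_square_Suc]) simp
  then show ?thesis
  proof eventually_elim
    case (elim w)
    then obtain R where R: "R \<ge> 0" "\<And>n. ennreal (1 / (real n + 1)\<^sup>2) * ?E n w \<le> ennreal R" by blast
    have "\<bar>dyadic_increment (b w) (real n) k j\<bar>
        \<le> root 8 R * ((real n + 1) powr (1/4) * (2 powr (-1/4)) ^ k)" if j: "j < 2 ^ k" for n k j
    proof (rule abs_le_root_mult)
      have "ennreal (4 ^ k * dyadic_increment (b w) (real n) k j ^ 8)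
          \<le> (\<Sum>j<(2::nat)^k. ennreal (4 ^ k * dyadic_increment (b w) (real n) k j ^ 8))"
        by (rule member_le_sum) (use j in auto)
      also have "\<dots> \<le> ?E n w"
        using sum_le_suminf[of "\<lambda>k. \<Sum>j<(2::nat)^k. ennreal (4 ^ k * dyadic_increment (b w)
          (real n) k j ^ 8)" "{k}"] by simp
      finally have "ennreal (1 / (real n + 1)\<^sup>2)
          * ennreal (4 ^ k * dyadic_increment (b w) (real n) k j ^ 8) \<le> ennreal R"
        by (rule order_trans[OF mult_left_mono R(2)]) simp
      then have "1 / (real n + 1)\<^sup>2 * (4 ^ k * dyadic_increment (b w) (real n) k j ^ 8) \<le> R"
        using R(1) by (simp add: ennreal_mult[symmetric])
      then have "dyadic_increment (b w) (real n) k j ^ 8 \<le> R * ((real n + 1)\<^sup>2 * (1 / 4) ^ k)"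
        by (simp add: field_simps power_divide)
      moreover have "((2::real) powr (-1/4)) ^ 8 = 1 / 4"
        by (subst powr_power) (simp_all add: powr_minus)
      then have "(((2::real) powr (-1/4)) ^ k) ^ 8 = (1 / 4) ^ k" by (metis power_mult mult.commute)
      ultimately show "dyadic_increment (b w) (real n) k j ^ 8
          \<le> R * ((real n + 1) powr (1/4) * (2 powr (-1/4)) ^ k) ^ 8"
        by (simp add: power_mult_distrib powr_power)
    qed (use R(1) in auto)
    then show ?case using R(1) by (intro exI[of _ "root 8 R"]) (simp add: mult.assoc)
  qed
qed

theorem AE_BM_path_growth: "AE w in M. \<exists>C. path_growth C (b w)"
  using AE_BM_integer_growth AE_BM_dyadic_growth AE_space
proof eventually_elim
  case (elim w)
  define \<rho> :: real where "\<rho> = 2 powr (-1/4)"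
  have \<rho>: "0 \<le> \<rho>" "\<rho> < 1" unfolding \<rho>_def using powr_less_mono[of "-1/4" 0 2] by auto
  obtain r where r: "r \<ge> 0" "\<And>n. \<bar>b w (real n)\<bar> \<le> r * (real n + 1) powr (3/4)" using elim(1) by blast
  obtain c where c: "c \<ge> 0" "\<And>n k j. j < 2 ^ k \<Longrightarrow> \<bar>dyadic_increment (b w) (real n) k j\<bar>
      \<le> c * (real n + 1) powr (1/4) * \<rho> ^ k"
    using elim(2) unfolding \<rho>_def by blast
  have "\<bar>b w x - b w (real n)\<bar> \<le> c / (1 - \<rho>) * (real n + 1) powr (1/4)"
    if "real n \<le> x" "x \<le> real n + 1" for n x
  proof -
    have "\<bar>b w x - b w (real n)\<bar> \<le> (c * (real n + 1) powr (1/4)) / (1 - \<rho>)"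
    proof (rule dyadic_chaining[OF _ \<rho> _ _ that])
      show "continuous_on {real n..} (b w)"
        by (rule continuous_on_subset[OF BM_continuous[OF b elim(3)]]) auto
    qed (use c in auto)
    then show ?thesis by simp
  qed
  then have "path_growth (r + 2 * (c / (1 - \<rho>))) (b w)"
    using r c(1) \<rho> by (intro path_growth_if_unit_oscillation) auto
  then show ?case by (rule exI)
qed

end

section \<open>The law of Brownian paths\<close>

theorem BM_scaling:
  assumes b: "is_std_BM M b" and k: "k > 0"
  shows "is_std_BM M (\<lambda>w t. k * b w (t / k\<^sup>2))"
proof -
  interpret prob_space M by (rule BM_prob_space[OF b])
  have less: "s / k\<^sup>2 < t / k\<^sup>2" if "s < t" for s t using that k by (simp add: divide_strict_right_mono)
  show ?thesis
    unfolding is_std_BM_def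
  proof (intro conjI allI impI ballI)
    show "prob_space M" by unfold_locales
    show "(\<lambda>w. k * b w (t / k\<^sup>2)) \<in> borel_measurable M" if "0 \<le> t" for t
      by (intro borel_measurable_times borel_measurable_const BM_measurable[OF b]) (use that k in simp)
    show "k * b w (0 / k\<^sup>2) = 0" if "w \<in> space M" for w using BM_0[OF b that] by simp
    show "continuous_on {0..} (\<lambda>t. k * b w (t / k\<^sup>2))" if "w \<in> space M" for w
      by (intro continuous_intros continuous_on_compose2[OF BM_continuous[OF b that]]) (use k in auto)
    fix s t :: real assume st: "0 \<le> s \<and> s < t"
    have "distributed M lborel (\<lambda>w. b w (t / k\<^sup>2) - b w (s / k\<^sup>2))
        (\<lambda>x. ennreal (normal_density 0 (sqrt (t / k\<^sup>2 - s / k\<^sup>2)) x))"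
      by (rule BM_increment_distributed[OF b]) (use st less k in auto)
    then have "distributed M lborel (\<lambda>w. 0 + k * (b w (t / k\<^sup>2) - b w (s / k\<^sup>2)))
        (\<lambda>x. ennreal (normal_density (0 + k * 0) (\<bar>k\<bar> * sqrt (t / k\<^sup>2 - s / k\<^sup>2)) x))"
      by (rule normal_density_affine) (use st k less[of s t] in auto)
    moreover have "\<bar>k\<bar> * sqrt (t / k\<^sup>2 - s / k\<^sup>2) = sqrt (t - s)"
      using k by (simp add: diff_divide_distrib[symmetric] real_sqrt_divide)
    ultimately show "distributed M lborel (\<lambda>w. k * b w (t / k\<^sup>2) - k * b w (s / k\<^sup>2))
        (\<lambda>x. ennreal (normal_density 0 (sqrt (t - s)) x))"
      by (simp add: right_diff_distrib)
  next
    fix ts :: "nat \<Rightarrow> real" and n :: nat assume ts: "0 \<le> ts 0 \<and> (\<forall>i<n. ts i < ts (Suc i))"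
    have "indep_vars (\<lambda>_. borel) (\<lambda>i w. b w (ts (Suc i) / k\<^sup>2) - b w (ts i / k\<^sup>2)) {..<n}"
      by (rule BM_indep_increments[OF b, of "\<lambda>i. ts i / k\<^sup>2"]) (use ts less in auto)
    then have "indep_vars (\<lambda>_. borel) (\<lambda>i w. k * (b w (ts (Suc i) / k\<^sup>2) - b w (ts i / k\<^sup>2))) {..<n}"
      by (rule indep_vars_compose2[where Y="\<lambda>_ x. k * x"]) simp
    then show "indep_vars (\<lambda>_. borel) (\<lambda>i w. k * b w (ts (Suc i) / k\<^sup>2) - k * b w (ts i / k\<^sup>2)) {..<n}"
      by (simp add: right_diff_distrib)
  qed
qed

definition gaussian_increments :: "(nat \<Rightarrow> real) \<Rightarrow> nat \<Rightarrow> (nat \<Rightarrow> real) measure" where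
  "gaussian_increments ts n =
     (\<Pi>\<^sub>M i\<in>{..<n}. density lborel (\<lambda>x. ennreal (normal_density 0 (sqrt (ts (Suc i) - ts i)) x)))"

context
  fixes ts :: "nat \<Rightarrow> real" and n :: nat
  assumes ts_0: "ts 0 = 0" and ts_less: "\<And>i. i < n \<Longrightarrow> ts i < ts (Suc i)" and n: "n > 0"
begin

lemma time_grid_nonneg: "i \<le> n \<Longrightarrow> 0 \<le> ts i"
proof (induction i)
  case (Suc i)
  then show ?case using ts_less[of i] by simp
qed (simp add: ts_0)

lemma BM_increments_measurable:
  assumes b: "is_std_BM M b"
  shows "(\<lambda>w. \<lambda>i\<in>{..<n}. b w (ts (Suc i)) - b w (ts i)) \<in> measurable M (\<Pi>\<^sub>M i\<in>{..<n}. borel)"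
  by (intro measurable_restrict borel_measurable_diff BM_measurable[OF b] time_grid_nonneg) auto

lemma distr_BM_increments:
  assumes b: "is_std_BM M b"
  shows "distr M (\<Pi>\<^sub>M i\<in>{..<n}. borel) (\<lambda>w. \<lambda>i\<in>{..<n}. b w (ts (Suc i)) - b w (ts i))
    = gaussian_increments ts n"
proof -
  interpret prob_space M by (rule BM_prob_space[OF b])
  have "indep_vars (\<lambda>_. borel) (\<lambda>i w. b w (ts (Suc i)) - b w (ts i)) {..<n}"
    by (rule BM_indep_increments[OF b]) (use ts_0 ts_less in auto)
  moreover have "(\<lambda>w. b w (ts (Suc i)) - b w (ts i)) \<in> borel_measurable M" if "i \<in> {..<n}" for i
    by (intro borel_measurable_diff BM_measurable[OF b] time_grid_nonneg) (use that in auto)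
  ultimately have "distr M (\<Pi>\<^sub>M i\<in>{..<n}. borel) (\<lambda>w. \<lambda>i\<in>{..<n}. b w (ts (Suc i)) - b w (ts i))
     = (\<Pi>\<^sub>M i\<in>{..<n}. distr M borel (\<lambda>w. b w (ts (Suc i)) - b w (ts i)))"
    using n by (subst (asm) indep_vars_iff_distr_eq_PiM') auto
  also have "\<dots> = gaussian_increments ts n"
    unfolding gaussian_increments_def
  proof (rule PiM_cong[OF refl])
    fix i assume "i \<in> {..<n}"
    then have "distributed M lborel (\<lambda>w. b w (ts (Suc i)) - b w (ts i))
        (\<lambda>x. ennreal (normal_density 0 (sqrt (ts (Suc i) - ts i)) x))"
      using time_grid_nonneg[of i] ts_less[of i] by (intro BM_increment_distributed[OF b]) auto
    from distributed_distr_eq_density[OF this]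
    show "distr M borel (\<lambda>w. b w (ts (Suc i)) - b w (ts i))
        = density lborel (\<lambda>x. ennreal (normal_density 0 (sqrt (ts (Suc i) - ts i)) x))"
      by (subst distr_cong[OF refl _ refl, of _ lborel]) auto
  qed
  finally show ?thesis .
qed

lemma BM_finite_dimensional_law:
  assumes b: "is_std_BM M b" and "finite J" and A: "\<And>t. t \<in> J \<Longrightarrow> A t \<in> sets borel"
    and idx: "\<And>t. t \<in> J \<Longrightarrow> idx t \<le> n \<and> ts (idx t) = t"
  shows "emeasure M {w \<in> space M. \<forall>t\<in>J. b w t \<in> A t}
    = emeasure (gaussian_increments ts n)
        {x \<in> space (\<Pi>\<^sub>M i\<in>{..<n}. borel). \<forall>t\<in>J. (\<Sum>i<idx t. x i) \<in> A t}"
proof -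
  let ?D = "\<lambda>w. \<lambda>i\<in>{..<n}. b w (ts (Suc i)) - b w (ts i)"
  let ?P = "\<Pi>\<^sub>M i\<in>{..<n}. (borel :: real measure)"
  let ?B = "{x \<in> space ?P. \<forall>t\<in>J. (\<Sum>i<idx t. x i) \<in> A t}"
  have "Measurable.pred ?P (\<lambda>x. \<forall>t\<in>J. (\<Sum>i<idx t. x i) \<in> A t)"
  proof (rule pred_intros_finite[OF \<open>finite J\<close>])
    fix t assume t: "t \<in> J"
    have "(\<lambda>x. \<Sum>i<idx t. x i) \<in> borel_measurable ?P"
      by (intro borel_measurable_sum measurable_component_singleton) (use idx[OF t] in auto)
    then show "Measurable.pred ?P (\<lambda>x. (\<Sum>i<idx t. x i) \<in> A t)" by (rule pred_sets2[OF A[OF t]])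
  qed
  then have B: "?B \<in> sets ?P" by (simp add: pred_def)
  have "b w t = (\<Sum>i<idx t. ?D w i)" if w: "w \<in> space M" and t: "t \<in> J" for w t
  proof -
    have "(\<Sum>i<idx t. ?D w i) = (\<Sum>i<idx t. b w (ts (Suc i)) - b w (ts i))"
      by (rule sum.cong) (use idx[OF t] in auto)
    also have "\<dots> = b w (ts (idx t)) - b w (ts 0)" by (rule sum_lessThan_telescope)
    finally show ?thesis using idx[OF t] ts_0 BM_0[OF b w] by simp
  qed
  then have "{w \<in> space M. \<forall>t\<in>J. b w t \<in> A t} = ?D -` ?B \<inter> space M"
    using measurable_space[OF BM_increments_measurable[OF b]] by auto
  then show ?thesis
    using emeasure_distr[OF BM_increments_measurable[OF b] B] unfolding distr_BM_increments[OF b] by simp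
qed

end

lemma finite_time_grid:
  fixes J :: "real set"
  assumes "finite J" "J \<subseteq> {0..}"
  obtains ts n where "ts 0 = 0" "\<And>i. i < n \<Longrightarrow> ts i < ts (Suc i)" "n > 0" "\<And>t. t \<in> J \<Longrightarrow> \<exists>m\<le>n. ts m = t"
proof -
  let ?J = "insert 0 (insert 1 J)"
  define xs where "xs = sorted_list_of_set ?J"
  have set_xs: "set xs = ?J" unfolding xs_def using assms by (intro set_sorted_list_of_set) auto
  have "card {0::real, 1} \<le> card ?J" by (rule card_mono) (use assms in auto)
  then have len: "length xs \<ge> 2" by (simp add: xs_def)
  have sorted: "sorted_wrt (<) xs" unfolding xs_def by (rule strict_sorted_list_of_set)
  show ?thesis
  proof (rule that[of "(!) xs" "length xs - 1"])
    have "Min ?J = 0" by (rule Min_eqI) (use assms in auto)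
    then show "xs ! 0 = 0" unfolding xs_def using assms by (subst sorted_list_of_set_nonempty) auto
    show "xs ! i < xs ! Suc i" if "i < length xs - 1" for i
      by (rule sorted_wrt_nth_less[OF sorted]) (use that in auto)
    fix t assume "t \<in> J"
    then have "t \<in> set xs" using set_xs by simp
    then obtain m where "m < length xs" "xs ! m = t" by (auto simp: in_set_conv_nth)
    then show "\<exists>m\<le>length xs - 1. xs ! m = t" by (intro exI[of _ m]) auto
  qed (use len in simp)
qed

lemma BM_path_measurable:
  assumes b: "is_std_BM M b"
  shows "(\<lambda>w. restrict (b w) {0..}) \<in> measurable M (\<Pi>\<^sub>M t\<in>{0..}. borel)"
  by (intro measurable_restrict BM_measurable[OF b]) auto

theorem BM_law_unique:
  assumes b: "is_std_BM M b" and b': "is_std_BM M b'"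
  shows "distr M (\<Pi>\<^sub>M t\<in>{0..}. borel) (\<lambda>w. restrict (b w) {0..}) = distr M (\<Pi>\<^sub>M t\<in>{0..}. borel)
      (\<lambda>w. restrict (b' w) {0..})"
proof (rule measure_eqI_PiM_infinite)
  interpret prob_space M by (rule BM_prob_space[OF b])
  show "finite_measure (distr M (\<Pi>\<^sub>M t\<in>{0..}. borel) (\<lambda>w. restrict (b w) {0..}))"
    using prob_space_distr[OF BM_path_measurable[OF b]] by (simp add: prob_space_def)
  fix A :: "real \<Rightarrow> real set" and J assume J: "finite J" "J \<subseteq> {0..}"
    and A: "\<And>i. i \<in> J \<Longrightarrow> A i \<in> sets borel"
  let ?C = "prod_emb {0..} (\<lambda>_. borel) J (Pi\<^sub>E J A)"
  have C: "?C \<in> sets (\<Pi>\<^sub>M t\<in>{0..}. (borel :: real measure))" by (rule sets_PiM_I) (use J A in auto)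
  have cylinder: "emeasure (distr M (\<Pi>\<^sub>M t\<in>{0..}. borel) (\<lambda>w. restrict (c w) {0..})) ?C
      = emeasure M {w \<in> space M. \<forall>t\<in>J. c w t \<in> A t}" if c: "is_std_BM M c" for c
  proof -
    have "(\<lambda>w. restrict (c w) {0..}) -` ?C \<inter> space M = {w \<in> space M. \<forall>t\<in>J. c w t \<in> A t}"
      using J(2) by (auto simp: prod_emb_def PiE_iff restrict_def extensional_def subset_eq)
    then show ?thesis using emeasure_distr[OF BM_path_measurable[OF c] C] by simp
  qed
  obtain ts n where ts: "ts 0 = 0" "\<And>i. i < n \<Longrightarrow> ts i < ts (Suc i)" "n > 0" "\<And>t. t \<in> J \<Longrightarrow> \<exists>m\<le>n. ts m = t"
    by (rule finite_time_grid[OF J]) blast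
  from ts(4) obtain idx where idx: "\<And>t. t \<in> J \<Longrightarrow> idx t \<le> n \<and> ts (idx t) = t" by metis
  show "emeasure (distr M (\<Pi>\<^sub>M t\<in>{0..}. borel) (\<lambda>w. restrict (b w) {0..})) ?C
    = emeasure (distr M (\<Pi>\<^sub>M t\<in>{0..}. borel) (\<lambda>w. restrict (b' w) {0..})) ?C"
    unfolding cylinder[OF b] cylinder[OF b']
    by (rule trans[OF BM_finite_dimensional_law[OF ts(1-3) b J(1) A idx]
          BM_finite_dimensional_law[OF ts(1-3) b' J(1) A idx, symmetric]])
qed simp_all

definition path_space :: "(real \<Rightarrow> real) measure" where
  "path_space = restrict_space (\<Pi>\<^sub>M t\<in>{0..}. borel) {f. continuous_on {0..} f}"

lemma cont_process_path_space: "cont_process path_space (\<lambda>f. f)"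
  unfolding cont_process_def
proof (intro conjI allI impI ballI)
  fix t :: real assume "0 \<le> t"
  then have "(\<lambda>f. f t) \<in> borel_measurable (\<Pi>\<^sub>M t\<in>{0..}. (borel :: real measure))"
    by (intro measurable_component_singleton) simp
  then show "(\<lambda>f. f t) \<in> borel_measurable path_space" unfolding path_space_def
    by (rule measurable_restrict_space1)
next
  fix f assume "f \<in> space path_space"
  then show "continuous_on {0..} f" by (simp add: path_space_def space_restrict_space)
qed

theorem BM_path_functional:
  assumes b: "is_std_BM M b" and b': "is_std_BM M b'"
    and cong: "\<And>f g. (\<And>t. t \<ge> 0 \<Longrightarrow> f t = g t) \<Longrightarrow> Q f \<longleftrightarrow> Q g" and Q: "Measurable.pred path_space Q"
  shows "measure M {w \<in> space M. Q (b w)} = measure M {w \<in> space M. Q (b' w)}"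
proof -
  have "{f \<in> space path_space. Q f} \<in> sets path_space" using Q by (simp add: pred_def)
  then obtain A where A: "A \<in> sets (\<Pi>\<^sub>M t\<in>{0..}. (borel :: real measure))"
    and Q_eq: "{f \<in> space path_space. Q f} = {f. continuous_on {0..} f} \<inter> A"
    unfolding path_space_def sets_restrict_space by auto
  have "measure M {w \<in> space M. Q (c w)}
      = measure (distr M (\<Pi>\<^sub>M t\<in>{0..}. borel) (\<lambda>w. restrict (c w) {0..})) A"
    if c: "is_std_BM M c" for c
  proof -
    have "Q (c w) \<longleftrightarrow> restrict (c w) {0..} \<in> A" if w: "w \<in> space M" for w
    proof -
      have cont: "continuous_on {0..} (restrict (c w) {0..})"
        using BM_continuous[OF c w] by (subst continuous_on_cong[OF refl, of _ _ "c w"]) auto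
      then have space: "restrict (c w) {0..} \<in> space path_space"
        using measurable_space[OF BM_path_measurable[OF c] w]
        by (simp add: path_space_def space_restrict_space)
      have "Q (c w) \<longleftrightarrow> Q (restrict (c w) {0..})" by (rule cong) simp
      also have "\<dots> \<longleftrightarrow> restrict (c w) {0..} \<in> {f \<in> space path_space. Q f}" using space by simp
      also have "\<dots> \<longleftrightarrow> restrict (c w) {0..} \<in> A" unfolding Q_eq using cont by simp
      finally show ?thesis .
    qed
    then have "{w \<in> space M. Q (c w)} = (\<lambda>w. restrict (c w) {0..}) -` A \<inter> space M" by auto
    then show ?thesis using measure_distr[OF BM_path_measurable[OF c] A] by simp
  qed
  from this[OF b] this[OF b'] show ?thesis unfolding BM_law_unique[OF b b'] by simp
qed

section \<open>Trace class almost surely\<close>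

lemma twice_powr_three_quarters_le:
  fixes \<kappa> t :: real
  assumes "\<kappa> \<ge> 0" and t: "t \<ge> (4 * \<kappa>) ^ 4"
  shows "2 * (\<kappa> * (1 + t) powr (3/4)) \<le> (1 + t) / 2"
proof -
  have "t \<ge> 0" by (rule order_trans[OF zero_le_power t]) (use assms(1) in simp)
  have "(4 * \<kappa>) ^ 4 \<le> ((1 + t) powr (1/4)) ^ 4" using t \<open>t \<ge> 0\<close> by (simp add: powr_power)
  then have "4 * \<kappa> \<le> (1 + t) powr (1/4)" by (intro power_le_imp_le_base[of "4 * \<kappa>" 3]) simp_all
  then have "4 * \<kappa> * (1 + t) powr (3/4) \<le> (1 + t) powr (1/4) * (1 + t) powr (3/4)"
    by (intro mult_right_mono) auto
  also have "\<dots> = 1 + t" using \<open>t \<ge> 0\<close> by (simp add: powr_add[symmetric])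
  finally show ?thesis by simp
qed

lemma bounded_integral_exp_neg:
  fixes c :: real
  assumes "c > 0"
  shows "bounded_integral (\<lambda>t. exp (- (c * t)))"
  unfolding bounded_integral_def
proof (intro exI allI impI)
  fix x :: real assume x: "x \<ge> 0"
  have "integral {0..x} (\<lambda>t. exp (- (c * t))) = (- exp (- (c * x)) / c) - (- exp (- (c * 0)) / c)"
    by (rule integral_of_DERIV) (use x assms in \<open>auto intro!: continuous_intros derivative_eq_intros\<close>)
  also have "\<dots> \<le> 1 / c" using assms by (simp add: field_simps)
  finally show "integral {0..x} (\<lambda>t. exp (- (c * t))) \<le> 1 / c" .
qed

context
  fixes \<beta> a \<kappa> :: real and bp :: "real \<Rightarrow> real"
  assumes cont: "continuous_on {0..} bp" and a: "a > 0" and \<kappa>: "\<kappa> \<ge> 0"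
    and noise: "\<And>t. t \<ge> 0 \<Longrightarrow> \<bar>2 / sqrt \<beta> * bp t\<bar> \<le> \<kappa> * (1 + t) powr (3/4)"
begin

lemma scale_dens_le:
  assumes t: "t \<ge> 0"
  shows "string_coefficients.scale (s_dens \<beta> a bp) t \<le> exp (\<kappa> * (1 + t) powr (3/4)) * (exp (a * t) / a)"
proof -
  interpret string_equation "s_dens \<beta> a bp" "m_dens \<beta> a bp" by (rule string_equation_dens[OF cont])
  let ?E = "exp (\<kappa> * (1 + t) powr (3/4))"
  have "scale t \<le> integral {0..t} (\<lambda>z. ?E * exp (a * z))"
    unfolding scale_def
  proof (rule integral_le)
    fix z assume z: "z \<in> {0..t}"
    have "\<kappa> * (1 + z) powr (3/4) \<le> \<kappa> * (1 + t) powr (3/4)" using z \<kappa>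
      by (intro mult_left_mono powr_mono2) auto
    moreover have "2 / sqrt \<beta> * bp z \<le> \<kappa> * (1 + z) powr (3/4)"
      by (rule order_trans[OF abs_ge_self noise]) (use z in simp)
    ultimately have "a * z + 2 / sqrt \<beta> * bp z \<le> \<kappa> * (1 + t) powr (3/4) + a * z" by linarith
    then show "s_dens \<beta> a bp z \<le> ?E * exp (a * z)" unfolding s_dens_def exp_add[symmetric]
      by (subst exp_le_cancel_iff)
  qed (auto intro!: integrable_on_atLeast_subinterval continuous_intros cont_s)
  also have "\<dots> = ?E * integral {0..t} (\<lambda>z. exp (a * z))" by simp
  also have "integral {0..t} (\<lambda>z. exp (a * z)) = exp (a * t) / a - exp (a * 0) / a"
    by (rule integral_of_DERIV) (use t a in \<open>auto intro!: continuous_intros derivative_eq_intros\<close>)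
  also have "?E * \<dots> \<le> ?E * (exp (a * t) / a)" using a by (intro mult_left_mono) auto
  finally show ?thesis .
qed

lemma m_dens_le:
  assumes "t \<ge> 0"
  shows "m_dens \<beta> a bp t \<le> exp (- (a + 1) * t + \<kappa> * (1 + t) powr (3/4))"
proof -
  have "- (a + 1) * t - 2 / sqrt \<beta> * bp t \<le> - (a + 1) * t + \<kappa> * (1 + t) powr (3/4)"
    using noise[OF assms] by linarith
  then show ?thesis unfolding m_dens_def by (subst exp_le_cancel_iff)
qed

lemma trace_class_dens: "string_coefficients.trace_class (s_dens \<beta> a bp) (m_dens \<beta> a bp)"
proof -
  interpret string_equation "s_dens \<beta> a bp" "m_dens \<beta> a bp" by (rule string_equation_dens[OF cont])
  show ?thesis
    unfolding trace_class_def
  proof (rule bounded_integral_comparison[where g="\<lambda>t. exp (- (1/2 * t))" and c="exp (1/2) / a" and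
      X="(4 * \<kappa>) ^ 4"])
    fix t assume t: "t \<ge> (4 * \<kappa>) ^ 4"
    have t_nonneg: "t \<ge> 0" by (rule order_trans[OF zero_le_power t]) (use \<kappa> in simp)
    let ?n = "\<kappa> * (1 + t) powr (3/4)"
    have "scale t * m_dens \<beta> a bp t \<le> (exp ?n * (exp (a * t) / a)) * exp (- (a + 1) * t + ?n)"
      by (intro mult_mono scale_dens_le m_dens_le t_nonneg)
        (use a m_pos[OF t_nonneg] in \<open>auto simp: less_imp_le\<close>)
    also have "\<dots> = exp (?n + a * t + (- (a + 1) * t + ?n)) / a" by (simp only: exp_add) simp
    also have "?n + a * t + (- (a + 1) * t + ?n) = 2 * ?n - t" by (simp add: algebra_simps)
    also have "exp (2 * ?n - t) / a \<le> exp (1/2 + - (1/2 * t)) / a"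
      using twice_powr_three_quarters_le[OF \<kappa> t] a by (intro divide_right_mono) (auto simp: field_simps)
    also have "\<dots> = exp (1/2) / a * exp (- (1/2 * t))" by (simp only: exp_add) simp
    finally show "scale t * m_dens \<beta> a bp t \<le> exp (1/2) / a * exp (- (1/2 * t))" .
  next
    show "bounded_integral (\<lambda>t. exp (- (1/2 * t)))" by (rule bounded_integral_exp_neg) simp
  qed (use a in \<open>auto intro!: cont_scale_m continuous_intros\<close>)
qed

end

lemma trace_class_if_path_growth:
  assumes cont: "continuous_on {0..} bp" and growth: "path_growth C bp" and \<beta>: "\<beta> > 0" and a: "a > 0"
  shows "string_coefficients.trace_class (s_dens \<beta> a bp) (m_dens \<beta> a bp)"
proof (rule trace_class_dens[OF cont a])
  have growth': "path_growth (2 / sqrt \<beta> * C) (\<lambda>t. 2 / sqrt \<beta> * bp t)" using \<beta>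
    by (intro path_growth_mult[OF growth]) simp
  then show "2 / sqrt \<beta> * C \<ge> 0" unfolding path_growth_def by (rule conjunct1)
  show "\<bar>2 / sqrt \<beta> * bp t\<bar> \<le> 2 / sqrt \<beta> * C * (1 + t) powr (3/4)" if "t \<ge> 0" for t
    using growth' that unfolding path_growth_def by blast
qed

lemma Lambda0_ge_iff_slope_positive:
  assumes cont: "continuous_on {0..} bp"
    and trace: "string_coefficients.trace_class (s_dens \<beta> a bp) (m_dens \<beta> a bp)"
    and lam: "lam > 0"
  shows "lam \<le> Lambda0 \<beta> a bp \<longleftrightarrow> string_coefficients.slope_positive (s_dens \<beta> a bp) (m_dens \<beta> a bp) lam"
proof -
  interpret string_equation "s_dens \<beta> a bp" "m_dens \<beta> a bp" by (rule string_equation_dens[OF cont])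
  obtain l where "eigenvalue l" by (rule exists_eigenvalue[OF trace])
  moreover obtain n :: nat where "l < real n" using reals_Archimedean2 by blast
  ultimately have "\<exists>n::nat. \<exists>l<real n. eigenvalue l" by blast
  then show ?thesis
    unfolding Lambda0_ge_iff[OF cont] slope_positive_iff_le_eigenvalues[OF trace lam]
    by (auto simp: not_less)
qed

section \<open>Convergence in law\<close>

lemma prob_Lambda0_ge_eq_slope_positive:
  assumes b: "is_std_BM M b" and \<beta>: "\<beta> > 0" and a: "a > 0" and lam: "lam > 0"
  shows "measure M {w \<in> space M. lam \<le> Lambda0 \<beta> a (b w)}
    = measure M {w \<in> space M. string_coefficients.slope_positive (s_dens \<beta> a (b w))
        (m_dens \<beta> a (b w)) lam}"
proof -
  interpret prob_space M by (rule BM_prob_space[OF b])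
  interpret string_process M "\<lambda>w. s_dens \<beta> a (b w)" "\<lambda>w. m_dens \<beta> a (b w)"
    by (rule string_process_dens[OF cont_process_BM[OF b]])
  show ?thesis
  proof (rule finite_measure_eq_AE)
    show "AE w in M. (w \<in> {w \<in> space M. lam \<le> Lambda0 \<beta> a (b w)})
      = (w \<in> {w \<in> space M. string_coefficients.slope_positive (s_dens \<beta> a (b w))
          (m_dens \<beta> a (b w)) lam})"
      using AE_BM_path_growth[OF b] AE_space
    proof eventually_elim
      case (elim w)
      then obtain C where "path_growth C (b w)" by blast
      note trace_class = trace_class_if_path_growth[OF BM_continuous[OF b elim(2)] this \<beta> a]
      show ?case using Lambda0_ge_iff_slope_positive[OF BM_continuous[OF b elim(2)] trace_class lam]
        by simp
    qed
    show "{w \<in> space M. lam \<le> Lambda0 \<beta> a (b w)} \<in> sets M"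
      using pred_Lambda0_ge[OF cont_process_BM[OF b]] by (simp only: pred_def)
    show "{w \<in> space M. string_coefficients.slope_positive (s_dens \<beta> a (b w))
        (m_dens \<beta> a (b w)) lam} \<in> sets M"
      using pred_slope_positive by (simp only: pred_def)
  qed
qed

lemma prob_slope_positive_law:
  assumes b: "is_std_BM M b" and b': "is_std_BM M b'"
  shows "measure M {w \<in> space M. string_coefficients.slope_positive (s_dens \<beta> a (b w))
      (m_dens \<beta> a (b w)) lam}
    = measure M {w \<in> space M. string_coefficients.slope_positive (s_dens \<beta> a (b' w))
        (m_dens \<beta> a (b' w)) lam}"
proof (rule BM_path_functional[OF b b'])
  interpret string_process path_space "\<lambda>f. s_dens \<beta> a f" "\<lambda>f. m_dens \<beta> a f"
    by (rule string_process_dens[OF cont_process_path_space])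
  show "Measurable.pred path_space (\<lambda>f. string_coefficients.slope_positive (s_dens \<beta> a f)
      (m_dens \<beta> a f) lam)"
    by (rule pred_slope_positive)
  fix f g :: "real \<Rightarrow> real" assume eq: "\<And>t. t \<ge> 0 \<Longrightarrow> f t = g t"
  have "string_slope (s_dens \<beta> a f) (\<lambda>t. lam * m_dens \<beta> a f t) x = string_slope (s_dens \<beta> a g)
      (\<lambda>t. lam * m_dens \<beta> a g t) x"
    if "x \<ge> 0" for x
    by (rule string_slope_cong[OF _ _ that]) (simp_all add: s_dens_def m_dens_def eq)
  then show "string_coefficients.slope_positive (s_dens \<beta> a f) (m_dens \<beta> a f) lam \<longleftrightarrow>
      string_coefficients.slope_positive (s_dens \<beta> a g) (m_dens \<beta> a g) lam"
    unfolding string_coefficients.slope_positive_def string_coefficients.slope_def by simp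
qed

context
  fixes M :: "'a measure" and b :: "'a \<Rightarrow> real \<Rightarrow> real" and \<beta> h \<sigma> :: real
  assumes b: "is_std_BM M b" and \<beta>: "\<beta> > 0" and h: "h = 2 / \<beta>" and \<sigma>: "\<sigma> = 2 / sqrt \<beta>"
begin

interpretation prob_space M
  by (rule BM_prob_space[OF b])

context
  fixes \<epsilon> a lam \<mu> :: real
  assumes \<epsilon>: "\<epsilon> > 0" and a: "a = 2 / \<epsilon>^3 - 2 / \<beta>" and lam: "lam = (1 - \<mu> * \<epsilon>\<^sup>2) / \<epsilon>^6"
begin

lemma slope_positive_BM_iff_rescaled:
  assumes w: "w \<in> space M"
  shows "string_coefficients.slope_positive (s_dens \<beta> a (\<lambda>t. \<epsilon> * b w (t / \<epsilon>\<^sup>2)))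
      (m_dens \<beta> a (\<lambda>t. \<epsilon> * b w (t / \<epsilon>\<^sup>2))) lam
    \<longleftrightarrow> rescaled_slope_positive \<sigma> h \<epsilon> (b w) \<mu>"
proof -
  interpret rescaled_string \<sigma> h \<epsilon> "b w" \<mu> by unfold_locales (rule BM_continuous[OF b w] \<epsilon>)+
  show ?thesis
    by (rule slope_positive_iff_rescaled[OF h \<sigma> a lam refl BM_continuous[OF BM_scaling[OF b \<epsilon>] w]])
qed

lemma prob_Lambda0_ge_eq_rescaled:
  assumes "a > 0" "lam > 0"
  shows "prob {w \<in> space M. lam \<le> Lambda0 \<beta> a (b w)}
      = prob {w \<in> space M. rescaled_slope_positive \<sigma> h \<epsilon> (b w) \<mu>}"
proof -
  let ?b = "\<lambda>w t. \<epsilon> * b w (t / \<epsilon>\<^sup>2)"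
  have "prob {w \<in> space M. lam \<le> Lambda0 \<beta> a (b w)}
    = prob {w \<in> space M. string_coefficients.slope_positive (s_dens \<beta> a (?b w))
        (m_dens \<beta> a (?b w)) lam}"
    by (rule trans[OF prob_Lambda0_ge_eq_slope_positive[OF b \<beta> assms]
        prob_slope_positive_law[OF b BM_scaling[OF b \<epsilon>]]])
  also have "{w \<in> space M. string_coefficients.slope_positive (s_dens \<beta> a (?b w))
      (m_dens \<beta> a (?b w)) lam}
    = {w \<in> space M. rescaled_slope_positive \<sigma> h \<epsilon> (b w) \<mu>}"
    using slope_positive_BM_iff_rescaled by auto
  finally show ?thesis .
qed

end

lemma pred_rescaled_slope_positive:
  assumes \<epsilon>: "\<epsilon> > 0"
  shows "Measurable.pred M (\<lambda>w. rescaled_slope_positive \<sigma> h \<epsilon> (b w) \<mu>)"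
proof -
  interpret string_process M "\<lambda>w. s_dens \<beta> (2 / \<epsilon>^3 - 2 / \<beta>) (\<lambda>t. \<epsilon> * b w (t / \<epsilon>\<^sup>2))"
      "\<lambda>w. m_dens \<beta> (2 / \<epsilon>^3 - 2 / \<beta>) (\<lambda>t. \<epsilon> * b w (t / \<epsilon>\<^sup>2))"
    by (rule string_process_dens[OF cont_process_BM[OF BM_scaling[OF b \<epsilon>]]])
  show ?thesis
    using pred_slope_positive[of "(1 - \<mu> * \<epsilon>\<^sup>2) / \<epsilon>^6"]
    by (subst measurable_cong[OF slope_positive_BM_iff_rescaled[OF \<epsilon> refl refl, symmetric]])
qed

lemma prob_Lambda0_eq_rescaled:
  assumes \<eta>: "\<eta> > 0" and a: "2 * sqrt \<eta> - 2 / \<beta> > 0" and lam: "\<eta> - \<mu> * \<eta> powr (2/3) > 0"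
  shows "prob {w \<in> space M. (\<eta> - Lambda0 \<beta> (2 * sqrt \<eta> - 2 / \<beta>) (b w)) / \<eta> powr (2/3) \<le> \<mu>}
    = prob {w \<in> space M. rescaled_slope_positive \<sigma> h (\<eta> powr (-1/6)) (b w) \<mu>}"
proof -
  define \<epsilon> where "\<epsilon> = \<eta> powr (-1/6)"
  have \<epsilon>: "\<epsilon> > 0" using \<eta> by (simp add: \<epsilon>_def)
  have eps_pow: "\<epsilon> ^ k = \<eta> powr (- (real k / 6))" for k using \<eta> by (simp add: \<epsilon>_def powr_power)
  have a_eq: "2 * sqrt \<eta> - 2 / \<beta> = 2 / \<epsilon> ^ 3 - 2 / \<beta>"
    using \<eta> by (simp add: eps_pow powr_half_sqrt[symmetric] powr_minus_divide)
  have "(1 - \<mu> * \<epsilon>\<^sup>2) / \<epsilon> ^ 6 = 1 / \<eta> powr (-1) - \<mu> * (\<eta> powr (-1/3) / \<eta> powr (-1))"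
    by (simp add: eps_pow diff_divide_distrib left_diff_distrib)
  also have "\<eta> powr (-1/3) / \<eta> powr (-1) = \<eta> powr (2/3)" unfolding powr_diff[symmetric] by simp
  also have "1 / \<eta> powr (-1) = \<eta>" using \<eta> by (simp add: powr_minus_divide)
  finally have lam_eq: "\<eta> - \<mu> * \<eta> powr (2/3) = (1 - \<mu> * \<epsilon>\<^sup>2) / \<epsilon> ^ 6" by (rule sym)
  have "(\<eta> - L) / \<eta> powr (2/3) \<le> \<mu> \<longleftrightarrow> \<eta> - \<mu> * \<eta> powr (2/3) \<le> L" for L
    using \<eta> by (simp add: pos_divide_le_eq algebra_simps)
  then show ?thesis
    using prob_Lambda0_ge_eq_rescaled[OF \<epsilon> a_eq lam_eq a lam] by (simp add: \<epsilon>_def)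
qed

end

lemma TW_cdf_left_eq:
  assumes b: "is_std_BM M b" and \<sigma>: "\<sigma> = 2 / sqrt \<beta>"
  shows "TW_cdf_left M b \<beta> \<nu> = measure M {w \<in> space M. \<forall>t>0. riccati_sol \<sigma> (b w) \<nu> t > 0}"
proof -
  have "{w \<in> space M. riccati_no_explosion \<beta> \<nu> (b w)}
      = {w \<in> space M. \<forall>t>0. riccati_sol \<sigma> (b w) \<nu> t > 0}"
    using riccati_iff_sol_pos[OF BM_continuous[OF b] \<sigma>] by auto
  then show ?thesis by (simp add: TW_cdf_left_def)
qed

lemma pred_riccati_sol_pos:
  assumes "cont_process M b"
  shows "Measurable.pred M (\<lambda>w. \<forall>t>0. riccati_sol \<sigma> (b w) \<nu> t > 0)"
  unfolding riccati_sol_def riccati_scale_def[abs_def] riccati_potential_def[abs_def]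
  by (intro pred_all_pos cont_process_string_sol(1) cont_process_exp cont_process_mult
      cont_process_diff cont_process_power
      cont_process_const cont_process_integral assms continuous_intros)

lemma (in finite_measure) tendsto_measure_if_eventually_eq:
  assumes A: "\<And>n. A n \<in> sets M" and B: "B \<in> sets M"
    and eq: "AE w in M. \<forall>\<^sub>F n in sequentially. w \<in> A n \<longleftrightarrow> w \<in> B"
  shows "(\<lambda>n. measure M (A n)) \<longlonglongrightarrow> measure M B"
proof -
  have "(\<lambda>n. LINT w|M. indicat_real (A n) w) \<longlonglongrightarrow> (LINT w|M. indicat_real B w)"
  proof (rule integral_dominated_convergence[where w="\<lambda>_. 1"])
    show "AE w in M. (\<lambda>n. indicat_real (A n) w) \<longlonglongrightarrow> indicat_real B w"
      using eq
    proof eventually_elim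
      case (elim w)
      show ?case by (rule tendsto_eventually) (use elim in \<open>eventually_elim, simp add: indicator_def\<close>)
    qed
  qed (use A B in \<open>auto simp: indicator_def\<close>)
  then show ?thesis using A B by simp
qed

lemma (in finite_measure) eventually_measure_less:
  assumes A: "\<And>n. A n \<in> sets M" and B: "B \<in> sets M"
    and notin: "AE w in M. w \<notin> B \<longrightarrow> (\<forall>\<^sub>F n in sequentially. w \<notin> A n)" and y: "measure M B < y"
  shows "\<forall>\<^sub>F n in sequentially. measure M (A n) < y"
proof -
  have "AE w in M. \<forall>\<^sub>F n in sequentially. w \<in> A n \<union> B \<longleftrightarrow> w \<in> B"
    using notin
  proof eventually_elim
    case (elim w)
    then show ?case by (cases "w \<in> B") (auto elim: eventually_mono)
  qed
  then have "(\<lambda>n. measure M (A n \<union> B)) \<longlonglongrightarrow> measure M B"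
    by (intro tendsto_measure_if_eventually_eq) (use A B in auto)
  from order_tendstoD(2)[OF this y] show ?thesis
  proof eventually_elim
    case (elim n)
    have "measure M (A n) \<le> measure M (A n \<union> B)" by (rule finite_measure_mono) (use A B in auto)
    then show ?case using elim by simp
  qed
qed

lemma (in finite_measure) eventually_measure_greater:
  assumes A: "\<And>n. A n \<in> sets M" and B: "B \<in> sets M"
    and "in": "AE w in M. w \<in> B \<longrightarrow> (\<forall>\<^sub>F n in sequentially. w \<in> A n)" and y: "y < measure M B"
  shows "\<forall>\<^sub>F n in sequentially. y < measure M (A n)"
proof -
  have "AE w in M. \<forall>\<^sub>F n in sequentially. w \<in> A n \<inter> B \<longleftrightarrow> w \<in> B"
    using "in"
  proof eventually_elim
    case (elim w)
    then show ?case by (cases "w \<in> B") (auto elim: eventually_mono)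
  qed
  then have "(\<lambda>n. measure M (A n \<inter> B)) \<longlonglongrightarrow> measure M B"
    by (intro tendsto_measure_if_eventually_eq) (use A B in auto)
  from order_tendstoD(1)[OF this y] show ?thesis
  proof eventually_elim
    case (elim n)
    have "measure M (A n \<inter> B) \<le> measure M (A n)" by (rule finite_measure_mono) (use A B in auto)
    then show ?case using elim by simp
  qed
qed

context
  fixes M :: "'a measure" and b :: "'a \<Rightarrow> real \<Rightarrow> real" and \<beta> h \<sigma> \<mu> :: real and \<epsilon> :: "nat \<Rightarrow> real"
  assumes b: "is_std_BM M b" and \<beta>: "\<beta> > 0" and h: "h = 2 / \<beta>" and \<sigma>: "\<sigma> = 2 / sqrt \<beta>"
    and \<epsilon>: "\<And>n. 0 < \<epsilon> n" "\<And>n. \<epsilon> n \<le> 1" "\<epsilon> \<longlonglongrightarrow> 0"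
begin

interpretation prob_space M
  by (rule BM_prob_space[OF b])

lemma rescaled_string_limit_BM: "w \<in> space M \<Longrightarrow> rescaled_string_limit \<epsilon> (b w)"
  by unfold_locales (use \<epsilon> BM_continuous[OF b] in auto)

lemma rescaled_slope_positive_sets: "{w \<in> space M. rescaled_slope_positive \<sigma> h (\<epsilon> n) (b w) \<mu>} \<in> sets M"
  using pred_rescaled_slope_positive[OF b \<beta> h \<sigma> \<epsilon>(1)] by (simp only: pred_def)

lemma riccati_sol_pos_sets: "{w \<in> space M. \<forall>t>0. riccati_sol \<sigma> (b w) \<nu> t > 0} \<in> sets M"
  using pred_riccati_sol_pos[OF cont_process_BM[OF b]] by (simp only: pred_def)

lemma eventually_prob_rescaled_less:
  assumes "TW_cdf_left M b \<beta> \<mu> < y"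
  shows "\<forall>\<^sub>F n in sequentially. prob {w \<in> space M. rescaled_slope_positive \<sigma> h (\<epsilon> n) (b w) \<mu>} < y"
proof (rule eventually_measure_less[OF rescaled_slope_positive_sets riccati_sol_pos_sets[of \<mu>]])
  show "prob {w \<in> space M. \<forall>t>0. riccati_sol \<sigma> (b w) \<mu> t > 0} < y" using assms
    unfolding TW_cdf_left_eq[OF b \<sigma>] .
  show "AE w in M. w \<notin> {w \<in> space M. \<forall>t>0. riccati_sol \<sigma> (b w) \<mu> t > 0} \<longrightarrow>
      (\<forall>\<^sub>F n in sequentially. w \<notin> {w \<in> space M. rescaled_slope_positive \<sigma> h (\<epsilon> n) (b w) \<mu>})"
  proof (rule AE_I2, rule impI)
    fix w assume w: "w \<in> space M" "w \<notin> {w \<in> space M. \<forall>t>0. riccati_sol \<sigma> (b w) \<mu> t > 0}"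
    then have "\<not> (\<forall>t>0. riccati_sol \<sigma> (b w) \<mu> t > 0)" by simp
    from rescaled_string_limit.eventually_not_rescaled_slope_positive[OF rescaled_string_limit_BM[OF w(1)] this, of h]
    show "\<forall>\<^sub>F n in sequentially. w \<notin> {w \<in> space M. rescaled_slope_positive \<sigma> h (\<epsilon> n) (b w) \<mu>}"
      by eventually_elim simp
  qed
qed

lemma eventually_prob_rescaled_greater:
  assumes "\<nu> < \<mu>" and "y < TW_cdf_left M b \<beta> \<nu>"
  shows "\<forall>\<^sub>F n in sequentially. y < prob {w \<in> space M. rescaled_slope_positive \<sigma> h (\<epsilon> n) (b w) \<mu>}"
proof (rule eventually_measure_greater[OF rescaled_slope_positive_sets riccati_sol_pos_sets[of \<nu>]])
  show "y < prob {w \<in> space M. \<forall>t>0. riccati_sol \<sigma> (b w) \<nu> t > 0}" using assms(2)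
    unfolding TW_cdf_left_eq[OF b \<sigma>] .
  show "AE w in M. w \<in> {w \<in> space M. \<forall>t>0. riccati_sol \<sigma> (b w) \<nu> t > 0} \<longrightarrow>
      (\<forall>\<^sub>F n in sequentially. w \<in> {w \<in> space M. rescaled_slope_positive \<sigma> h (\<epsilon> n) (b w) \<mu>})"
    using AE_BM_path_growth[OF b] AE_space
  proof (eventually_elim, intro impI)
    fix w assume "\<exists>C. path_growth C (b w)" and w: "w \<in> space M"
      and pos: "w \<in> {w \<in> space M. \<forall>t>0. riccati_sol \<sigma> (b w) \<nu> t > 0}"
    then obtain C where "path_growth C (b w)" by blast
    from rescaled_string_limit.eventually_rescaled_slope_positive[OF rescaled_string_limit_BM[OF w]
        _ _ this assms(1), of \<sigma> h]
    have "\<forall>\<^sub>F n in sequentially. rescaled_slope_positive \<sigma> h (\<epsilon> n) (b w) \<mu>" using pos \<beta> h \<sigma> by simp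
    then show "\<forall>\<^sub>F n in sequentially. w \<in> {w \<in> space M. rescaled_slope_positive \<sigma> h (\<epsilon> n) (b w) \<mu>}"
      by eventually_elim (simp add: w)
  qed
qed

lemma prob_rescaled_tendsto:
  assumes cont: "isCont (TW_cdf_left M b \<beta>) \<mu>"
  shows "(\<lambda>n. prob {w \<in> space M. rescaled_slope_positive \<sigma> h (\<epsilon> n) (b w) \<mu>}) \<longlonglongrightarrow> TW_cdf_left M b \<beta> \<mu>"
proof (rule order_tendstoI)
  fix y assume "y < TW_cdf_left M b \<beta> \<mu>"
  moreover have "(TW_cdf_left M b \<beta> \<longlongrightarrow> TW_cdf_left M b \<beta> \<mu>) (at_left \<mu>)"
    by (rule filterlim_mono[OF cont[unfolded isCont_def] order_refl]) (simp add: at_le)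
  ultimately have "\<forall>\<^sub>F \<nu> in at_left \<mu>. \<nu> < \<mu> \<and> y < TW_cdf_left M b \<beta> \<nu>"
    by (intro eventually_conj order_tendstoD(1)) (simp_all add: eventually_at_filter)
  then have "\<exists>\<nu>. \<nu> < \<mu> \<and> y < TW_cdf_left M b \<beta> \<nu>" by (rule eventually_happens'[rotated]) simp
  then show "\<forall>\<^sub>F n in sequentially. y < prob {w \<in> space M. rescaled_slope_positive \<sigma> h (\<epsilon> n) (b w) \<mu>}"
    using eventually_prob_rescaled_greater by blast
qed (rule eventually_prob_rescaled_less)

end

lemma prob_rescaled_tendsto_at_right:
  assumes "is_std_BM M b" "\<beta> > 0" "isCont (TW_cdf_left M b \<beta>) \<mu>"
  shows "((\<lambda>\<epsilon>. measure M {w \<in> space M. rescaled_slope_positive (2 / sqrt \<beta>) (2 / \<beta>) \<epsilon> (b w) \<mu>})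
      \<longlongrightarrow> TW_cdf_left M b \<beta> \<mu>) (at_right 0)"
  by (rule tendsto_at_right_sequentially[OF zero_less_one])
    (rule prob_rescaled_tendsto[OF assms(1,2) refl refl _ _ _ assms(3)], auto intro: less_imp_le)

theorem theorem3:
  fixes M :: "'a measure" and b :: "'a \<Rightarrow> real \<Rightarrow> real" and \<beta> :: real
  assumes "\<beta> > 0" and "is_std_BM M b"
  shows "\<forall>\<mu>. isCont (TW_cdf_left M b \<beta>) \<mu> \<longrightarrow>
           ((\<lambda>\<eta>::real. measure M {w \<in> space M.
               (\<eta> - Lambda0 \<beta> (2 * sqrt \<eta> - 2 / \<beta>) (b w)) / \<eta> powr (2/3) \<le> \<mu>})
            \<longlongrightarrow> TW_cdf_left M b \<beta> \<mu>) at_top"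
proof (intro allI impI)
  fix \<mu> :: real assume cont: "isCont (TW_cdf_left M b \<beta>) \<mu>"
  have "filterlim (\<lambda>\<eta>::real. \<eta> powr (-1/6)) (at_right 0) at_top" by real_asymp
  from filterlim_compose[OF prob_rescaled_tendsto_at_right[OF assms(2,1) cont] this]
  have rescaled:
    "((\<lambda>\<eta>. measure M {w \<in> space M. rescaled_slope_positive (2 / sqrt \<beta>) (2 / \<beta>)
      (\<eta> powr (-1/6)) (b w) \<mu>})
      \<longlongrightarrow> TW_cdf_left M b \<beta> \<mu>) at_top" .
  have "\<forall>\<^sub>F \<eta>::real in at_top. \<eta> > 0" "\<forall>\<^sub>F \<eta>::real in at_top. 2 * sqrt \<eta> - 2 / \<beta> > 0"
    "\<forall>\<^sub>F \<eta>::real in at_top. \<eta> - \<mu> * \<eta> powr (2/3) > 0" by real_asymp+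
  then have "\<forall>\<^sub>F \<eta> in at_top.
      measure M {w \<in> space M. rescaled_slope_positive (2 / sqrt \<beta>) (2 / \<beta>) (\<eta> powr (-1/6)) (b w) \<mu>} =
      measure M {w \<in> space M. (\<eta> - Lambda0 \<beta> (2 * sqrt \<eta> - 2 / \<beta>) (b w)) / \<eta> powr (2/3) \<le> \<mu>}"
    by eventually_elim (rule prob_Lambda0_eq_rescaled[OF assms(2,1) refl refl, symmetric])
  then show "((\<lambda>\<eta>. measure M {w \<in> space M.
      (\<eta> - Lambda0 \<beta> (2 * sqrt \<eta> - 2 / \<beta>) (b w)) / \<eta> powr (2/3) \<le> \<mu>}) \<longlongrightarrow> TW_cdf_left M b \<beta> \<mu>) at_top"
    by (rule Lim_transform_eventually[OF rescaled])
qed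

end
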